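(* Let $S$ be a Gorenstein local ring and $I\subset J$ perfect ideals of $S$ of codimensions $r$ and $r+1$ respectively. Let $\mathbf L\to S/I$ and $\mathbf M\to S/J$ be minimal free resolutions over $S$, let $\psi\colon \mathbf L\to\mathbf M$ be a map of complexes induced by the natural map $S/I\to S/J$, and let $l=\operatorname{rank} M_{r+1}$. Let $T\subset S^l$, $s_i\colon J\to T$ and the induced homomorphism $\psi^*\colon T\to\omega_{S/I}$ be as defined in the context, and set $k_i=\psi^*\circ s_i\in\operatorname{Hom}_S(J,\omega_{S/I})$ for $1\le i\le l$. Then the $S$-module $\operatorname{Hom}_S(J,\omega_{S/I})$ is generated by $\omega_{S/I}$ together with $k_1,\dots,k_l$.
   Context: Notation: $N^*=\operatorname{Hom}_S(N,S)$. Here $\omega$ denotes the canonical module. Since $S/I$ and $S/J$ are Cohen--Macaulay, the dual complexes give minimal resolutions $\mathbf L^*\to\omega_{S/I}$ and $\mathbf M^*\to\omega_{S/J}$; that is, $\omega_{S/I}=\operatorname{coker}(L_{r-1}^*\to L_r^* )$, and there is an exact sequence $M_{r-1}^*\to M_r^*\xrightarrow{b} M_{r+1}^*\xrightarrow{c}\omega_{S/J}\to 0$. $\omega_{S/I}$ is identified with a submodule of $\operatorname{Hom}_S(J,\omega_{S/I})=\operatorname{Hom}_{S/I}(J/I,\omega_{S/I})$ via the injective map $a(x)(t)=tx$ for $x\in\omega_{S/I}$, $t\in J$. Definition of $T$: identify $M_{r+1}^*$ with $S^l$ and set $T=\ker c\subset S^l$. Since $J$ annihilates $\omega_{S/J}$,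 there is for $1\le i\le l$ a map $s_i\colon J\to T$, $s_i(t)=(0,\dots,0,t,0,\dots,0)$ with $t$ in the $i$th coordinate. Definition of $\psi^*\colon T\to\omega_{S/I}$: the dual chain map has components $M_{r-1}^*\to L_{r-1}^*$ and $M_r^*\to L_r^*$. Since $T=\operatorname{im} b\cong M_r^*/\operatorname{im}(M_{r-1}^*\to M_r^* )$ and $\omega_{S/I}=L_r^*/\operatorname{im}(L_{r-1}^*\to L_r^* )$, the component $M_r^*\to L_r^*$ induces a homomorphism $\psi^*\colon T\to\omega_{S/I}$. *)

theory Defs
  imports "HOL-Algebra.Algebra" "HOL-Library.Extended_Nat"
begin

section \<open>Modules over a commutative ring\<close>

text \<open>The record type \<^typ>\<open>('a, 'b) module\<close> extends that of rings; the fields for the multiplication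
  and the unit of a module play no role and are left undefined where no natural value exists.\<close>

definition reg_module :: "('a, 'm) ring_scheme \<Rightarrow> ('a, 'a) module" where
  "reg_module R = \<lparr>carrier = carrier R, monoid.mult = monoid.mult R, one = one R,
     ring.zero = \<zero>\<^bsub>R\<^esub>, add = add R, smult = monoid.mult R\<rparr>"

definition std_free_module :: "('a, 'm) ring_scheme \<Rightarrow> nat \<Rightarrow> ('a, nat \<Rightarrow> 'a) module" where
  "std_free_module R n = \<lparr>carrier = {..<n} \<rightarrow>\<^sub>E carrier R, monoid.mult = undefined, one = undefined,
     ring.zero = (\<lambda>i\<in>{..<n}. \<zero>\<^bsub>R\<^esub>),
     add = (\<lambda>u v. \<lambda>i\<in>{..<n}. u i \<oplus>\<^bsub>R\<^esub> v i),
     smult = (\<lambda>a u. \<lambda>i\<in>{..<n}. a \<otimes>\<^bsub>R\<^esub> u i)\<rparr>"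

definition module_hom ::
    "('a, 'm) ring_scheme \<Rightarrow> ('a, 'b) module \<Rightarrow> ('a, 'c) module \<Rightarrow> ('b \<Rightarrow> 'c) set" where
  "module_hom R N P = {h \<in> carrier N \<rightarrow> carrier P.
     (\<forall>x\<in>carrier N. \<forall>y\<in>carrier N. h (x \<oplus>\<^bsub>N\<^esub> y) = h x \<oplus>\<^bsub>P\<^esub> h y) \<and>
     (\<forall>a\<in>carrier R. \<forall>x\<in>carrier N. h (a \<odot>\<^bsub>N\<^esub> x) = a \<odot>\<^bsub>P\<^esub> h x)}"

definition module_iso ::
    "('a, 'm) ring_scheme \<Rightarrow> ('a, 'b) module \<Rightarrow> ('a, 'c) module \<Rightarrow> ('b \<Rightarrow> 'c) set" where
  "module_iso R N P = {h \<in> module_hom R N P. bij_betw h (carrier N) (carrier P)}"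

text \<open>The module of homomorphisms; its elements are taken extensional on the carrier of the source,
  so that equality of elements is equality of homomorphisms.\<close>

definition hom_module ::
    "('a, 'm) ring_scheme \<Rightarrow> ('a, 'b) module \<Rightarrow> ('a, 'c) module \<Rightarrow> ('a, 'b \<Rightarrow> 'c) module" where
  "hom_module R N P = \<lparr>carrier = module_hom R N P \<inter> extensional (carrier N),
     monoid.mult = undefined, one = undefined,
     ring.zero = (\<lambda>x\<in>carrier N. \<zero>\<^bsub>P\<^esub>),
     add = (\<lambda>f g. \<lambda>x\<in>carrier N. f x \<oplus>\<^bsub>P\<^esub> g x),
     smult = (\<lambda>a f. \<lambda>x\<in>carrier N. a \<odot>\<^bsub>P\<^esub> f x)\<rparr>"

definition dual :: "('a, 'm) ring_scheme \<Rightarrow> ('a, 'b) module \<Rightarrow> ('a, 'b \<Rightarrow> 'a) module" where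
  "dual R N = hom_module R N (reg_module R)"

text \<open>The transpose \<open>P\<^sup>* \<rightarrow> N\<^sup>*\<close> of a homomorphism \<open>f : N \<rightarrow> P\<close>; only the source \<open>N\<close> is needed
  as an argument.\<close>

definition dual_map :: "('a, 'b) module \<Rightarrow> ('b \<Rightarrow> 'c) \<Rightarrow> ('c \<Rightarrow> 'a) \<Rightarrow> ('b \<Rightarrow> 'a)" where
  "dual_map N f g = (\<lambda>x\<in>carrier N. g (f x))"

definition quot_module :: "('a, 'b) module \<Rightarrow> 'b set \<Rightarrow> ('a, 'b set) module" where
  "quot_module N K = \<lparr>carrier = a_rcosets\<^bsub>N\<^esub> K, monoid.mult = undefined, one = undefined,
     ring.zero = K, add = set_add N,
     smult = (\<lambda>a A. \<Union>x\<in>A. K +>\<^bsub>N\<^esub> (a \<odot>\<^bsub>N\<^esub> x))\<rparr>"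

definition gen_submodule ::
    "('a, 'm) ring_scheme \<Rightarrow> ('a, 'b) module \<Rightarrow> 'b set \<Rightarrow> 'b set" where
  "gen_submodule R N A = \<Inter>{K. submodule K R N \<and> A \<subseteq> K}"

definition free_of_rank :: "('a, 'm) ring_scheme \<Rightarrow> ('a, 'b) module \<Rightarrow> nat \<Rightarrow> bool" where
  "free_of_rank R N n \<longleftrightarrow> module R N \<and> module_iso R (std_free_module R n) N \<noteq> {}"

text \<open>\<open>P\<close> is projective if every epimorphism onto \<open>P\<close> splits. The epimorphisms range over
  sources in the type \<^typ>\<open>'b \<Rightarrow> 'a\<close>, which contains the free module on the elements of \<open>P\<close>
  (finitely supported families of coefficients); splitting of that one epimorphism already implies
  that \<open>P\<close> is projective with respect to modules in all types.\<close>

definition projective_module :: "('a, 'm) ring_scheme \<Rightarrow> ('a, 'b) module \<Rightarrow> bool" where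
  "projective_module R P \<longleftrightarrow> module R P \<and>
     (\<forall>(N :: ('a, 'b \<Rightarrow> 'a) module) g.
        module R N \<and> g \<in> module_hom R N P \<and> g ` carrier N = carrier P \<longrightarrow>
        (\<exists>s\<in>module_hom R P N. \<forall>x\<in>carrier P. g (s x) = x))"

text \<open>Extension of homomorphisms from submodules. Test modules in the carrier type of the ring include
  the ring as a module over itself, so by Baer's criterion they suffice for injectivity with respect
  to modules in all types.\<close>

definition injective_module :: "('a, 'm) ring_scheme \<Rightarrow> ('a, 'b) module \<Rightarrow> bool" where
  "injective_module R E \<longleftrightarrow> module R E \<and>
     (\<forall>(N :: ('a, 'a) module) K h.
        module R N \<and> submodule K R N \<and> h \<in> module_hom R (N\<lparr>carrier := K\<rparr>) E \<longrightarrow>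
        (\<exists>h'\<in>module_hom R N E. \<forall>x\<in>K. h' x = h x))"


section \<open>Resolutions\<close>

text \<open>In a left resolution \<open>d i\<close> is the map \<open>F (i + 1) \<rightarrow> F i\<close> and \<open>\<epsilon> : F 0 \<rightarrow> N\<close> is the augmentation;
  in a right resolution \<open>d i\<close> is the map \<open>E i \<rightarrow> E (i + 1)\<close> and \<open>\<iota> : N \<rightarrow> E 0\<close>.\<close>

definition left_resolution ::
    "('a, 'm) ring_scheme \<Rightarrow> (nat \<Rightarrow> ('a, 'b) module) \<Rightarrow> (nat \<Rightarrow> 'b \<Rightarrow> 'b) \<Rightarrow> ('b \<Rightarrow> 'c) \<Rightarrow>
     ('a, 'c) module \<Rightarrow> bool" where
  "left_resolution R F d \<epsilon> N \<longleftrightarrow>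
     (\<forall>i. module R (F i)) \<and>
     (\<forall>i. d i \<in> module_hom R (F (Suc i)) (F i)) \<and>
     \<epsilon> \<in> module_hom R (F 0) N \<and>
     \<epsilon> ` carrier (F 0) = carrier N \<and>
     d 0 ` carrier (F 1) = {x \<in> carrier (F 0). \<epsilon> x = \<zero>\<^bsub>N\<^esub>} \<and>
     (\<forall>i. d (Suc i) ` carrier (F (Suc (Suc i))) = {x \<in> carrier (F (Suc i)). d i x = \<zero>\<^bsub>F i\<^esub>})"

definition right_resolution ::
    "('a, 'm) ring_scheme \<Rightarrow> ('a, 'c) module \<Rightarrow> ('c \<Rightarrow> 'b) \<Rightarrow> (nat \<Rightarrow> ('a, 'b) module) \<Rightarrow>
     (nat \<Rightarrow> 'b \<Rightarrow> 'b) \<Rightarrow> bool" where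
  "right_resolution R N \<iota> E d \<longleftrightarrow>
     (\<forall>i. module R (E i)) \<and>
     (\<forall>i. d i \<in> module_hom R (E i) (E (Suc i))) \<and>
     \<iota> \<in> module_hom R N (E 0) \<and>
     inj_on \<iota> (carrier N) \<and>
     \<iota> ` carrier N = {x \<in> carrier (E 0). d 0 x = \<zero>\<^bsub>E 1\<^esub>} \<and>
     (\<forall>i. d i ` carrier (E i) = {x \<in> carrier (E (Suc i)). d (Suc i) x = \<zero>\<^bsub>E (Suc (Suc i))\<^esub>})"

definition minimal_free_resolution ::
    "('a, 'm) ring_scheme \<Rightarrow> (nat \<Rightarrow> ('a, 'b) module) \<Rightarrow> (nat \<Rightarrow> 'b \<Rightarrow> 'b) \<Rightarrow> ('b \<Rightarrow> 'c) \<Rightarrow>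
     ('a, 'c) module \<Rightarrow> bool" where
  "minimal_free_resolution R F d \<epsilon> N \<longleftrightarrow>
     left_resolution R F d \<epsilon> N \<and>
     (\<forall>i. \<exists>n. free_of_rank R (F i) n) \<and>
     (\<forall>i m. maximalideal m R \<longrightarrow> d i ` carrier (F (Suc i)) \<subseteq>
        gen_submodule R (F i) {a \<odot>\<^bsub>F i\<^esub> x | a x. a \<in> m \<and> x \<in> carrier (F i)})"

text \<open>Projective resolutions are sought in the type \<^typ>\<open>nat \<Rightarrow> 'a\<close>, which contains the standard free
  modules and their submodules. A finitely generated module \<open>N\<close> over a Noetherian ring has a resolution
  by standard free modules of finite rank, which can be truncated at a projective syzygy, so for such
  \<open>N\<close> this is the usual projective dimension.\<close>

definition proj_dim :: "('a, 'm) ring_scheme \<Rightarrow> ('a, 'c) module \<Rightarrow> enat" where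
  "proj_dim R N = Inf {enat n | n. \<exists>(P :: nat \<Rightarrow> ('a, nat \<Rightarrow> 'a) module) d \<epsilon>.
     left_resolution R P d \<epsilon> N \<and> (\<forall>i. projective_module R (P i)) \<and>
     (\<forall>i>n. carrier (P i) = {\<zero>\<^bsub>P i\<^esub>})}"


section \<open>Local rings, grade, codimension, perfect ideals\<close>

definition noetherian_local_ring :: "('a, 'm) ring_scheme \<Rightarrow> bool" where
  "noetherian_local_ring R \<longleftrightarrow> cring R \<and> noetherian_ring R \<and> (\<exists>!m. maximalideal m R)"

text \<open>Gorenstein: Noetherian local of finite injective dimension over itself. HOL cannot quantify
  over the type \<^typ>\<open>'e\<close> in which the injective resolution lives, so it is a parameter; a theorem that
  assumes \<^term>\<open>gorenstein_local_ring TYPE('e) R\<close> for a type variable \<^typ>\<open>'e\<close> covers resolutions in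
  every type.\<close>

definition gorenstein_local_ring :: "'e itself \<Rightarrow> ('a, 'm) ring_scheme \<Rightarrow> bool" where
  "gorenstein_local_ring _ R \<longleftrightarrow> noetherian_local_ring R \<and>
     (\<exists>(E :: nat \<Rightarrow> ('a, 'e) module) d \<iota> n.
        right_resolution R (reg_module R) \<iota> E d \<and> (\<forall>i. injective_module R (E i)) \<and>
        (\<forall>i>n. carrier (E i) = {\<zero>\<^bsub>E i\<^esub>}))"

definition regular_sequence :: "('a, 'm) ring_scheme \<Rightarrow> 'a list \<Rightarrow> bool" where
  "regular_sequence R xs \<longleftrightarrow> set xs \<subseteq> carrier R \<and> Idl\<^bsub>R\<^esub> (set xs) \<noteq> carrier R \<and>
     (\<forall>i<length xs. \<forall>a\<in>carrier R.
        xs ! i \<otimes>\<^bsub>R\<^esub> a \<in> Idl\<^bsub>R\<^esub> (set (take i xs)) \<longrightarrow> a \<in> Idl\<^bsub>R\<^esub> (set (take i xs)))"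

definition grade :: "('a, 'm) ring_scheme \<Rightarrow> 'a set \<Rightarrow> enat" where
  "grade R I = Sup {enat (length xs) | xs. set xs \<subseteq> I \<and> regular_sequence R xs}"

definition prime_height :: "('a, 'm) ring_scheme \<Rightarrow> 'a set \<Rightarrow> enat" where
  "prime_height R P = Sup {enat n | n. \<exists>C :: nat \<Rightarrow> 'a set.
     (\<forall>i\<le>n. primeideal (C i) R) \<and> (\<forall>i<n. C i \<subset> C (Suc i)) \<and> C n = P}"

definition codim :: "('a, 'm) ring_scheme \<Rightarrow> 'a set \<Rightarrow> enat" where
  "codim R I = Inf {prime_height R P | P. primeideal P R \<and> I \<subseteq> P}"

definition perfect_ideal :: "('a, 'm) ring_scheme \<Rightarrow> 'a set \<Rightarrow> bool" where
  "perfect_ideal R I \<longleftrightarrow> ideal I R \<and> I \<noteq> carrier R \<and>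
     proj_dim R (quot_module (reg_module R) I) = grade R I"


section \<open>Comparison maps and canonical modules\<close>

text \<open>The map \<open>S/I \<rightarrow> S/J\<close>, \<open>I + x \<mapsto> J + x\<close>, for \<open>I \<subseteq> J\<close>.\<close>

definition quot_proj :: "('a, 'm) ring_scheme \<Rightarrow> 'a set \<Rightarrow> 'a set \<Rightarrow> 'a set" where
  "quot_proj R J A = (\<Union>x\<in>A. J +>\<^bsub>R\<^esub> x)"

definition chain_map_over ::
    "('a, 'm) ring_scheme \<Rightarrow>
     (nat \<Rightarrow> ('a, 'b) module) \<Rightarrow> (nat \<Rightarrow> 'b \<Rightarrow> 'b) \<Rightarrow> ('b \<Rightarrow> 'd) \<Rightarrow>
     (nat \<Rightarrow> ('a, 'c) module) \<Rightarrow> (nat \<Rightarrow> 'c \<Rightarrow> 'c) \<Rightarrow> ('c \<Rightarrow> 'e) \<Rightarrow>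
     ('d \<Rightarrow> 'e) \<Rightarrow> (nat \<Rightarrow> 'b \<Rightarrow> 'c) \<Rightarrow> bool" where
  "chain_map_over R L dL \<epsilon>L M dM \<epsilon>M q \<psi> \<longleftrightarrow>
     (\<forall>i. \<psi> i \<in> module_hom R (L i) (M i)) \<and>
     (\<forall>i. \<forall>x\<in>carrier (L (Suc i)). \<psi> i (dL i x) = dM i (\<psi> (Suc i) x)) \<and>
     (\<forall>x\<in>carrier (L 0). \<epsilon>M (\<psi> 0 x) = q (\<epsilon>L x))"

text \<open>The image of \<open>F\<^sub>i\<^sub>-\<^sub>1\<^sup>* \<rightarrow> F\<^sub>i\<^sup>*\<close>, with \<open>F\<^sub>-\<^sub>1 = 0\<close>.\<close>

definition dual_boundaries ::
    "('a, 'm) ring_scheme \<Rightarrow> (nat \<Rightarrow> ('a, 'b) module) \<Rightarrow> (nat \<Rightarrow> 'b \<Rightarrow> 'b) \<Rightarrow> nat \<Rightarrow> ('b \<Rightarrow> 'a) set" where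
  "dual_boundaries R F d i = (case i of
      0 \<Rightarrow> {\<zero>\<^bsub>dual R (F 0)\<^esub>}
    | Suc j \<Rightarrow> dual_map (F (Suc j)) (d j) ` carrier (dual R (F j)))"

text \<open>\<open>coker (F\<^sub>i\<^sub>-\<^sub>1\<^sup>* \<rightarrow> F\<^sub>i\<^sup>*)\<close> and the projection of \<open>F\<^sub>i\<^sup>*\<close> onto it. For the minimal free resolution of a
  perfect quotient of codimension \<open>i\<close> this is its canonical module.\<close>

definition omega ::
    "('a, 'm) ring_scheme \<Rightarrow> (nat \<Rightarrow> ('a, 'b) module) \<Rightarrow> (nat \<Rightarrow> 'b \<Rightarrow> 'b) \<Rightarrow> nat \<Rightarrow>
     ('a, ('b \<Rightarrow> 'a) set) module" where
  "omega R F d i = quot_module (dual R (F i)) (dual_boundaries R F d i)"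

definition omega_proj ::
    "('a, 'm) ring_scheme \<Rightarrow> (nat \<Rightarrow> ('a, 'b) module) \<Rightarrow> (nat \<Rightarrow> 'b \<Rightarrow> 'b) \<Rightarrow> nat \<Rightarrow>
     ('b \<Rightarrow> 'a) \<Rightarrow> ('b \<Rightarrow> 'a) set" where
  "omega_proj R F d i f = dual_boundaries R F d i +>\<^bsub>dual R (F i)\<^esub> f"


section \<open>The generators of \<open>Hom(J, \<omega>)\<close>\<close>

text \<open>Throughout \<open>\<tau> : M\<^sub>r\<^sub>+\<^sub>1\<^sup>* \<rightarrow> S\<^sup>l\<close> is the chosen identification, and coordinates are numbered
  from \<open>0\<close> to \<open>l - 1\<close>.\<close>

definition T_module ::
    "('a, 'm) ring_scheme \<Rightarrow> (nat \<Rightarrow> ('a, 'c) module) \<Rightarrow> (nat \<Rightarrow> 'c \<Rightarrow> 'c) \<Rightarrow> nat \<Rightarrow>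
     (('c \<Rightarrow> 'a) \<Rightarrow> (nat \<Rightarrow> 'a)) \<Rightarrow> (nat \<Rightarrow> 'a) set" where
  "T_module R M dM r \<tau> = \<tau> ` {f \<in> carrier (dual R (M (Suc r))).
     omega_proj R M dM (Suc r) f = \<zero>\<^bsub>omega R M dM (Suc r)\<^esub>}"

definition s_map :: "('a, 'm) ring_scheme \<Rightarrow> nat \<Rightarrow> nat \<Rightarrow> 'a \<Rightarrow> (nat \<Rightarrow> 'a)" where
  "s_map R l i t = (\<lambda>j\<in>{..<l}. if j = i then t else \<zero>\<^bsub>R\<^esub>)"

text \<open>The map on \<open>T = im b\<close> induced by \<open>\<psi>\<^sub>r\<^sup>* : M\<^sub>r\<^sup>* \<rightarrow> L\<^sub>r\<^sup>*\<close>: it sends \<open>\<tau> (b g)\<close> to the class of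
  \<open>\<psi>\<^sub>r\<^sup>* g\<close>, where \<open>b : M\<^sub>r\<^sup>* \<rightarrow> M\<^sub>r\<^sub>+\<^sub>1\<^sup>*\<close> is the transpose of the differential. The class
  does not depend on the choice of \<open>g\<close>.\<close>

definition psi_star ::
    "('a, 'm) ring_scheme \<Rightarrow> (nat \<Rightarrow> ('a, 'b) module) \<Rightarrow> (nat \<Rightarrow> 'b \<Rightarrow> 'b) \<Rightarrow>
     (nat \<Rightarrow> ('a, 'c) module) \<Rightarrow> (nat \<Rightarrow> 'c \<Rightarrow> 'c) \<Rightarrow> (nat \<Rightarrow> 'b \<Rightarrow> 'c) \<Rightarrow> nat \<Rightarrow>
     (('c \<Rightarrow> 'a) \<Rightarrow> (nat \<Rightarrow> 'a)) \<Rightarrow> (nat \<Rightarrow> 'a) \<Rightarrow> ('b \<Rightarrow> 'a) set" where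
  "psi_star R L dL M dM \<psi> r \<tau> = (\<lambda>t\<in>T_module R M dM r \<tau>.
     THE w. \<exists>g\<in>carrier (dual R (M r)).
       t = \<tau> (dual_map (M (Suc r)) (dM r) g) \<and>
       w = omega_proj R L dL r (dual_map (L r) (\<psi> r) g))"

definition k_map ::
    "('a, 'm) ring_scheme \<Rightarrow> 'a set \<Rightarrow> (nat \<Rightarrow> ('a, 'b) module) \<Rightarrow> (nat \<Rightarrow> 'b \<Rightarrow> 'b) \<Rightarrow>
     (nat \<Rightarrow> ('a, 'c) module) \<Rightarrow> (nat \<Rightarrow> 'c \<Rightarrow> 'c) \<Rightarrow> (nat \<Rightarrow> 'b \<Rightarrow> 'c) \<Rightarrow> nat \<Rightarrow>
     (('c \<Rightarrow> 'a) \<Rightarrow> (nat \<Rightarrow> 'a)) \<Rightarrow> nat \<Rightarrow> nat \<Rightarrow> 'a \<Rightarrow> ('b \<Rightarrow> 'a) set" where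
  "k_map R J L dL M dM \<psi> r \<tau> l i = (\<lambda>t\<in>J. psi_star R L dL M dM \<psi> r \<tau> (s_map R l i t))"

definition ideal_module :: "('a, 'm) ring_scheme \<Rightarrow> 'a set \<Rightarrow> ('a, 'a) module" where
  "ideal_module R J = (reg_module R)\<lparr>carrier := J\<rparr>"

text \<open>The embedding \<open>a : W \<rightarrow> Hom(J, W)\<close>, \<open>a(x)(t) = tx\<close>.\<close>

definition a_map :: "'a set \<Rightarrow> ('a, 'w) module \<Rightarrow> 'w \<Rightarrow> 'a \<Rightarrow> 'w" where
  "a_map J W x = (\<lambda>t\<in>J. t \<odot>\<^bsub>W\<^esub> x)"

end

theory Submission
  imports Defs
begin

text \<open>Write \<open>\<omega>\<close> for the canonical module of \<open>S/I\<close>. A homomorphism \<open>J \<rightarrow> \<omega>\<close> lifts to a chain map from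
  the shifted resolution \<open>M\<close> to the resolution \<open>L\<^sup>*\<close> of \<open>\<omega>\<close>, and this chain map ends in a map
  \<open>M\<^sub>r\<^sub>+\<^sub>1 \<rightarrow> L\<^sub>0\<^sup>* = M\<^sub>0\<^sup>*\<close>. Starting from that end one builds a chain map from the shifted \<open>M\<close> to \<open>M\<^sup>*\<close>
  with the same last component; the first step uses that \<open>J\<close> annihilates the cokernel of
  \<open>M\<^sub>r\<^sup>* \<rightarrow> M\<^sub>r\<^sub>+\<^sub>1\<^sup>*\<close>, the others that \<open>M\<^sup>*\<close> is exact below degree \<open>r + 1\<close>. Composed with
  \<open>\<psi>\<^sup>* : M\<^sup>* \<rightarrow> L\<^sup>*\<close> it agrees with the given chain map up to homotopy. At the other end the chain map
  to \<open>M\<^sup>*\<close> is multiplication by an element \<open>c\<close> of \<open>M\<^sub>r\<^sub>+\<^sub>1\<^sup>* = S\<^sup>l\<close>, so the given homomorphism is the sum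
  of the \<open>c\<^sub>i k\<^sub>i\<close>, up to an element of \<open>\<omega>\<close>.

  The exactness of \<open>L\<^sup>*\<close> and \<open>M\<^sup>*\<close> rests on the equality of grade and codimension for perfect ideals
  of \<open>S\<close>. One inequality holds in every Noetherian ring. For the other one, compute \<open>Ext\<^sup>i(S/K, S)\<close>
  from the injective resolution of \<open>S\<close>: by Nakayama's lemma, nonvanishing of \<open>Ext\<^sup>i(S/P, S)\<close>
  localized at \<open>P\<close> propagates up chains of primes, \<open>i\<close> increasing at each step, so that
  \<open>Ext\<^sup>m(S/K, S)\<close> is nonzero for some \<open>m\<close> not below the codimension of \<open>K\<close>; but it vanishes above
  the projective dimension of \<open>S/K\<close>.\<close>

section \<open>Homomorphisms and modules of homomorphisms\<close>

text \<open>Over S/I the quotient Hom(J, \<omega>)/\<omega> is Ext^1(S/J, \<omega>), which duality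
  identifies with Ext^(r+1)(S/J, S) = S^l / T; the k_i lift the unit vectors of S^l, hence l of
  them. Working on the resolutions themselves shows that the prescribed maps generate, not just some
  l elements. Two devices shape the proof. A map into a dual complex is a bilinear form, for
  instance on \<open>M (i + 1)\<close> and \<open>L k\<close>; it can be lifted in either argument,
  and one induction along i + k = r builds the factored chain map together with the homotopy, since
  the homotopy in one degree is what produces the next. Localization is expressed by multipliers: an
  element vanishes at Q if some s outside Q sends it into the submodule in question, so Nakayama's
  lemma and the long exact sequences of Ext become element chases in one fixed injective resolution.
  Grade and codimension have to be matched because perfection bounds the length of the resolution by
  the grade, whereas \<open>r\<close> is given as a codimension.\<close>

lemma module_homI:
  assumes "\<And>x. x \<in> carrier N \<Longrightarrow> h x \<in> carrier P"
    and "\<And>x y. x \<in> carrier N \<Longrightarrow> y \<in> carrier N \<Longrightarrow> h (x \<oplus>\<^bsub>N\<^esub> y) = h x \<oplus>\<^bsub>P\<^esub> h y"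
    and "\<And>a x. a \<in> carrier R \<Longrightarrow> x \<in> carrier N \<Longrightarrow> h (a \<odot>\<^bsub>N\<^esub> x) = a \<odot>\<^bsub>P\<^esub> h x"
  shows "h \<in> module_hom R N P"
  using assms by (auto simp: module_hom_def)

lemma module_homD:
  assumes "h \<in> module_hom R N P"
  shows "x \<in> carrier N \<Longrightarrow> h x \<in> carrier P"
    and "x \<in> carrier N \<Longrightarrow> y \<in> carrier N \<Longrightarrow> h (x \<oplus>\<^bsub>N\<^esub> y) = h x \<oplus>\<^bsub>P\<^esub> h y"
    and "a \<in> carrier R \<Longrightarrow> x \<in> carrier N \<Longrightarrow> h (a \<odot>\<^bsub>N\<^esub> x) = a \<odot>\<^bsub>P\<^esub> h x"
  using assms by (auto simp: module_hom_def)

lemma module_hom_zero: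
  assumes "module R N" "module R P" "h \<in> module_hom R N P"
  shows "h \<zero>\<^bsub>N\<^esub> = \<zero>\<^bsub>P\<^esub>"
proof -
  interpret N: module R N by fact
  interpret P: module R P by fact
  have "h (\<zero>\<^bsub>R\<^esub> \<odot>\<^bsub>N\<^esub> \<zero>\<^bsub>N\<^esub>) = \<zero>\<^bsub>R\<^esub> \<odot>\<^bsub>P\<^esub> h \<zero>\<^bsub>N\<^esub>"
    using module_homD(3)[OF assms(3)] by blast
  then show ?thesis using module_homD(1)[OF assms(3)] by simp
qed

text \<open>Homomorphisms are required to respect addition and scalars only; writing the negative as
  a multiple by -1 reduces its preservation to linearity.\<close>

lemma (in module) uminus_eq_smult:
  "x \<in> carrier M \<Longrightarrow> \<ominus>\<^bsub>M\<^esub> x = (\<ominus> \<one>) \<odot>\<^bsub>M\<^esub> x"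
  by (simp add: smult_l_minus)

lemma module_hom_minus:
  assumes "module R N" "module R P" "h \<in> module_hom R N P" "x \<in> carrier N" "y \<in> carrier N"
  shows "h (x \<ominus>\<^bsub>N\<^esub> y) = h x \<ominus>\<^bsub>P\<^esub> h y"
proof -
  interpret N: module R N by fact
  interpret P: module R P by fact
  show ?thesis
    using assms(3-5) module_homD[OF assms(3)]
    by (simp add: a_minus_def N.uminus_eq_smult P.uminus_eq_smult)
qed

lemma module_hom_comp:
  assumes "f \<in> module_hom R N P" "g \<in> module_hom R P Q"
  shows "(\<lambda>x. g (f x)) \<in> module_hom R N Q"
  using module_homD[OF assms(1)] module_homD[OF assms(2)] by (intro module_homI) auto

lemma module_hom_add:
  assumes "module R N" "module R P" "f \<in> module_hom R N P" "g \<in> module_hom R N P"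
  shows "(\<lambda>x. f x \<oplus>\<^bsub>P\<^esub> g x) \<in> module_hom R N P"
proof -
  interpret N: module R N by fact
  interpret P: module R P by fact
  show ?thesis
    using module_homD[OF assms(3)] module_homD[OF assms(4)]
    by (intro module_homI) (auto simp: P.smult_r_distr P.a_ac)
qed

lemma module_hom_smult:
  assumes "module R N" "module R P" "f \<in> module_hom R N P" "a \<in> carrier R"
  shows "(\<lambda>x. a \<odot>\<^bsub>P\<^esub> f x) \<in> module_hom R N P"
proof -
  interpret N: module R N by fact
  interpret P: module R P by fact
  show ?thesis
    using module_homD[OF assms(3)] assms(4)
    by (intro module_homI) (auto simp: P.smult_r_distr P.smult_assoc1[symmetric] N.R.m_comm)
qed

lemma module_hom_diff:
  assumes "module R N" "module R P" "f \<in> module_hom R N P" "g \<in> module_hom R N P"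
  shows "(\<lambda>x. f x \<ominus>\<^bsub>P\<^esub> g x) \<in> module_hom R N P"
proof -
  interpret N: module R N by fact
  interpret P: module R P by fact
  show ?thesis
  proof (intro module_homI)
    fix x assume x: "x \<in> carrier N"
    note cl = module_homD(1)[OF assms(3)] module_homD(1)[OF assms(4)]
    show "f x \<ominus>\<^bsub>P\<^esub> g x \<in> carrier P" using x cl by simp
    show "f (a \<odot>\<^bsub>N\<^esub> x) \<ominus>\<^bsub>P\<^esub> g (a \<odot>\<^bsub>N\<^esub> x) = a \<odot>\<^bsub>P\<^esub> (f x \<ominus>\<^bsub>P\<^esub> g x)" if "a \<in> carrier R" for a
      using that x cl module_homD(3)[OF assms(3)] module_homD(3)[OF assms(4)]
      by (simp add: a_minus_def P.smult_r_distr P.smult_r_minus)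
    fix y assume y: "y \<in> carrier N"
    show "f (x \<oplus>\<^bsub>N\<^esub> y) \<ominus>\<^bsub>P\<^esub> g (x \<oplus>\<^bsub>N\<^esub> y) = (f x \<ominus>\<^bsub>P\<^esub> g x) \<oplus>\<^bsub>P\<^esub> (f y \<ominus>\<^bsub>P\<^esub> g y)"
      using x y cl module_homD(2)[OF assms(3)] module_homD(2)[OF assms(4)]
      by (simp add: a_minus_def P.minus_add P.a_ac)
  qed
qed

lemma module_hom_const_zero:
  assumes "module R N" "module R P"
  shows "(\<lambda>x. \<zero>\<^bsub>P\<^esub>) \<in> module_hom R N P"
proof -
  interpret P: module R P by fact
  show ?thesis by (intro module_homI) auto
qed

lemma module_hom_id: "(\<lambda>x. x) \<in> module_hom R N N"
  by (intro module_homI) auto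

lemma module_hom_cong:
  assumes "module R N" "f \<in> module_hom R N P" "\<And>x. x \<in> carrier N \<Longrightarrow> g x = f x"
  shows "g \<in> module_hom R N P"
proof -
  interpret N: module R N by fact
  show ?thesis
    using module_homD[OF assms(2)] assms(3) by (intro module_homI) auto
qed

lemma module_hom_eqI_diff:
  assumes "module R P" "x \<in> carrier P" "y \<in> carrier P" "x \<ominus>\<^bsub>P\<^esub> y = \<zero>\<^bsub>P\<^esub>"
  shows "x = y"
proof -
  interpret P: module R P by fact
  show ?thesis
    using P.M.minus_equality[of x "\<ominus>\<^bsub>P\<^esub> y"] assms(2-4) by (simp add: a_minus_def)
qed

text \<open>All module axioms are inherited along a surjection compatible with the operations, so
  \<open>P\<close> is not assumed to be a module; this is how sets of cosets become modules.\<close>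

lemma module_surj_image:
  assumes N: "module R N"
    and im: "h ` carrier N = carrier P"
    and add: "\<And>x y. x \<in> carrier N \<Longrightarrow> y \<in> carrier N \<Longrightarrow> h (x \<oplus>\<^bsub>N\<^esub> y) = h x \<oplus>\<^bsub>P\<^esub> h y"
    and smult: "\<And>a x. a \<in> carrier R \<Longrightarrow> x \<in> carrier N \<Longrightarrow> h (a \<odot>\<^bsub>N\<^esub> x) = a \<odot>\<^bsub>P\<^esub> h x"
    and zero: "h \<zero>\<^bsub>N\<^esub> = \<zero>\<^bsub>P\<^esub>"
  shows "module R P"
proof -
  interpret N: module R N by fact
  have ex: "\<exists>y\<in>carrier N. x = h y" if "x \<in> carrier P" for x
    using that im by blast
  have cl: "h y \<in> carrier P" if "y \<in> carrier N" for y
    using that im by blast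
  show ?thesis
  proof (intro moduleI abelian_groupI)
    show "cring R" by (rule N.R.is_cring)
    show "\<zero>\<^bsub>P\<^esub> \<in> carrier P" using cl zero[symmetric] by auto
    fix x assume x: "x \<in> carrier P"
    then obtain x' where x': "x' \<in> carrier N" "x = h x'" using ex by blast
    show "\<zero>\<^bsub>P\<^esub> \<oplus>\<^bsub>P\<^esub> x = x"
      using x' add[OF N.zero_closed x'(1)] zero by simp
    have "h (\<ominus>\<^bsub>N\<^esub> x') \<oplus>\<^bsub>P\<^esub> x = \<zero>\<^bsub>P\<^esub>"
      using x' add[of "\<ominus>\<^bsub>N\<^esub> x'" x'] zero by (simp add: N.M.l_neg)
    then show "\<exists>y\<in>carrier P. y \<oplus>\<^bsub>P\<^esub> x = \<zero>\<^bsub>P\<^esub>" using cl x'(1) by blast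
    show "\<one>\<^bsub>R\<^esub> \<odot>\<^bsub>P\<^esub> x = x" using smult[of "\<one>\<^bsub>R\<^esub>" x'] x' by simp
    fix a assume a: "a \<in> carrier R"
    show "a \<odot>\<^bsub>P\<^esub> x \<in> carrier P" using smult[of a x'] x' a cl[of "a \<odot>\<^bsub>N\<^esub> x'"] by simp
    {
      fix b assume b: "b \<in> carrier R"
      show "(a \<oplus>\<^bsub>R\<^esub> b) \<odot>\<^bsub>P\<^esub> x = a \<odot>\<^bsub>P\<^esub> x \<oplus>\<^bsub>P\<^esub> b \<odot>\<^bsub>P\<^esub> x"
        using a b x' by (simp add: smult[symmetric] add[symmetric] N.smult_l_distr)
      show "(a \<otimes>\<^bsub>R\<^esub> b) \<odot>\<^bsub>P\<^esub> x = a \<odot>\<^bsub>P\<^esub> (b \<odot>\<^bsub>P\<^esub> x)"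
        using a b x' by (simp add: smult[symmetric] N.smult_assoc1)
    }
    fix y assume y: "y \<in> carrier P"
    then obtain y' where y': "y' \<in> carrier N" "y = h y'" using ex by blast
    show "a \<odot>\<^bsub>P\<^esub> (x \<oplus>\<^bsub>P\<^esub> y) = a \<odot>\<^bsub>P\<^esub> x \<oplus>\<^bsub>P\<^esub> a \<odot>\<^bsub>P\<^esub> y"
      using a x' y' by (simp add: smult[symmetric] add[symmetric] N.smult_r_distr)
  next
    fix x y assume x: "x \<in> carrier P" and y: "y \<in> carrier P"
    obtain x' where x': "x' \<in> carrier N" "x = h x'" using ex x by blast
    obtain y' where y': "y' \<in> carrier N" "y = h y'" using ex y by blast
    show "x \<oplus>\<^bsub>P\<^esub> y \<in> carrier P" using x' y' cl[of "x' \<oplus>\<^bsub>N\<^esub> y'"] add by simp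
    show "x \<oplus>\<^bsub>P\<^esub> y = y \<oplus>\<^bsub>P\<^esub> x" using x' y' by (simp add: add[symmetric] N.a_comm)
    fix z assume z: "z \<in> carrier P"
    obtain z' where z': "z' \<in> carrier N" "z = h z'" using ex z by blast
    show "x \<oplus>\<^bsub>P\<^esub> y \<oplus>\<^bsub>P\<^esub> z = x \<oplus>\<^bsub>P\<^esub> (y \<oplus>\<^bsub>P\<^esub> z)"
      using x' y' z' by (simp add: add[symmetric] N.a_assoc)
  qed
qed

section \<open>The ring as a module, modules of homomorphisms and duals\<close>

lemma reg_module_simps [simp]:
  "carrier (reg_module R) = carrier R"
  "add (reg_module R) = add R"
  "smult (reg_module R) = monoid.mult R"
  "ring.zero (reg_module R) = \<zero>\<^bsub>R\<^esub>"
  by (simp_all add: reg_module_def)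

lemma (in cring) reg_module_module: "module R (reg_module R)"
proof (intro moduleI abelian_groupI)
  show "cring R" by (rule is_cring)
  fix x assume "x \<in> carrier (reg_module R)"
  then show "\<exists>y\<in>carrier (reg_module R). y \<oplus>\<^bsub>reg_module R\<^esub> x = \<zero>\<^bsub>reg_module R\<^esub>"
    by (intro bexI[of _ "\<ominus> x"]) (auto simp: l_neg)
qed (simp_all add: a_ac l_distr r_distr m_assoc)

lemma (in cring) reg_module_minus [simp]:
  "a \<in> carrier R \<Longrightarrow> b \<in> carrier R \<Longrightarrow> a \<ominus>\<^bsub>reg_module R\<^esub> b = a \<ominus> b"
proof -
  assume a: "a \<in> carrier R" "b \<in> carrier R"
  interpret S: module R "reg_module R" by (rule reg_module_module)
  show ?thesis using a S.uminus_eq_smult[of b] by (simp add: a_minus_def l_minus)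
qed

lemma hom_module_simps:
  "carrier (hom_module R N P) = module_hom R N P \<inter> extensional (carrier N)"
  "f \<oplus>\<^bsub>hom_module R N P\<^esub> g = (\<lambda>x\<in>carrier N. f x \<oplus>\<^bsub>P\<^esub> g x)"
  "a \<odot>\<^bsub>hom_module R N P\<^esub> f = (\<lambda>x\<in>carrier N. a \<odot>\<^bsub>P\<^esub> f x)"
  "\<zero>\<^bsub>hom_module R N P\<^esub> = (\<lambda>x\<in>carrier N. \<zero>\<^bsub>P\<^esub>)"
  by (simp_all add: hom_module_def)

lemma hom_module_restrict:
  assumes "module R N" "f \<in> module_hom R N P"
  shows "restrict f (carrier N) \<in> carrier (hom_module R N P)"
  using module_hom_cong[OF assms(1,2), of "restrict f (carrier N)"]
  by (simp add: hom_module_simps)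

lemma hom_module_eqI:
  assumes "f \<in> carrier (hom_module R N P)" "g \<in> carrier (hom_module R N P)"
    and "\<And>x. x \<in> carrier N \<Longrightarrow> f x = g x"
  shows "f = g"
  using assms by (auto simp: hom_module_simps intro: extensionalityI)

lemma hom_module_module:
  assumes N: "module R N" and P: "module R P"
  shows "module R (hom_module R N P)"
proof -
  interpret N: module R N by fact
  interpret P: module R P by fact
  let ?H = "hom_module R N P"
  have hom: "f \<in> module_hom R N P" and ext: "f \<in> extensional (carrier N)"
    if "f \<in> carrier ?H" for f
    using that by (auto simp: hom_module_simps)
  have val: "f x \<in> carrier P" if "f \<in> carrier ?H" "x \<in> carrier N" for f x
    using module_homD(1)[OF hom[OF that(1)] that(2)] .
  have cl_add: "f \<oplus>\<^bsub>?H\<^esub> g \<in> carrier ?H" if "f \<in> carrier ?H" "g \<in> carrier ?H" for f g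
    using hom_module_restrict[OF N module_hom_add[OF N P hom[OF that(1)] hom[OF that(2)]]]
    by (simp add: hom_module_simps)
  have cl_smult: "a \<odot>\<^bsub>?H\<^esub> f \<in> carrier ?H" if "f \<in> carrier ?H" "a \<in> carrier R" for f a
    using hom_module_restrict[OF N module_hom_smult[OF N P hom[OF that(1)] that(2)]]
    by (simp add: hom_module_simps)
  have cl_zero: "\<zero>\<^bsub>?H\<^esub> \<in> carrier ?H"
    using hom_module_restrict[OF N module_hom_const_zero[OF N P]] by (simp add: hom_module_simps)
  show ?thesis
  proof (intro moduleI abelian_groupI)
    show "cring R" by (rule N.R.is_cring)
    show "\<zero>\<^bsub>?H\<^esub> \<in> carrier ?H" by (rule cl_zero)
    fix f assume f: "f \<in> carrier ?H"
    show "\<zero>\<^bsub>?H\<^esub> \<oplus>\<^bsub>?H\<^esub> f = f"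
      using f val by (intro hom_module_eqI[OF cl_add[OF cl_zero]]) (auto simp: hom_module_simps)
    have "((\<ominus>\<^bsub>R\<^esub> \<one>\<^bsub>R\<^esub>) \<odot>\<^bsub>?H\<^esub> f) \<oplus>\<^bsub>?H\<^esub> f = \<zero>\<^bsub>?H\<^esub>"
      using f val
      by (intro hom_module_eqI[OF cl_add[OF cl_smult] cl_zero])
        (auto simp: hom_module_simps P.uminus_eq_smult[symmetric] P.M.l_neg)
    then show "\<exists>g\<in>carrier ?H. g \<oplus>\<^bsub>?H\<^esub> f = \<zero>\<^bsub>?H\<^esub>" using cl_smult[OF f] by blast
    show "\<one>\<^bsub>R\<^esub> \<odot>\<^bsub>?H\<^esub> f = f"
      using f val by (intro hom_module_eqI[OF cl_smult]) (auto simp: hom_module_simps)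
    fix a assume a: "a \<in> carrier R"
    show "a \<odot>\<^bsub>?H\<^esub> f \<in> carrier ?H" using f a by (rule cl_smult)
    {
      fix b assume b: "b \<in> carrier R"
      show "(a \<oplus>\<^bsub>R\<^esub> b) \<odot>\<^bsub>?H\<^esub> f = a \<odot>\<^bsub>?H\<^esub> f \<oplus>\<^bsub>?H\<^esub> b \<odot>\<^bsub>?H\<^esub> f"
        using a b f val
        by (intro hom_module_eqI[OF cl_smult cl_add[OF cl_smult cl_smult]])
          (auto simp: hom_module_simps P.smult_l_distr)
      show "(a \<otimes>\<^bsub>R\<^esub> b) \<odot>\<^bsub>?H\<^esub> f = a \<odot>\<^bsub>?H\<^esub> (b \<odot>\<^bsub>?H\<^esub> f)"
        using a b f val
        by (intro hom_module_eqI[OF cl_smult cl_smult[OF cl_smult]])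
          (auto simp: hom_module_simps P.smult_assoc1)
    }
    fix g assume g: "g \<in> carrier ?H"
    show "a \<odot>\<^bsub>?H\<^esub> (f \<oplus>\<^bsub>?H\<^esub> g) = a \<odot>\<^bsub>?H\<^esub> f \<oplus>\<^bsub>?H\<^esub> a \<odot>\<^bsub>?H\<^esub> g"
      using a f g val
      by (intro hom_module_eqI[OF cl_smult[OF cl_add] cl_add[OF cl_smult cl_smult]])
        (auto simp: hom_module_simps P.smult_r_distr)
  next
    fix f g assume f: "f \<in> carrier ?H" and g: "g \<in> carrier ?H"
    show "f \<oplus>\<^bsub>?H\<^esub> g \<in> carrier ?H" by (rule cl_add[OF f g])
    show "f \<oplus>\<^bsub>?H\<^esub> g = g \<oplus>\<^bsub>?H\<^esub> f"
      using f g val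
      by (intro hom_module_eqI[OF cl_add cl_add]) (auto simp: hom_module_simps P.a_comm)
    fix h assume h: "h \<in> carrier ?H"
    show "f \<oplus>\<^bsub>?H\<^esub> g \<oplus>\<^bsub>?H\<^esub> h = f \<oplus>\<^bsub>?H\<^esub> (g \<oplus>\<^bsub>?H\<^esub> h)"
      using f g h val
      by (intro hom_module_eqI[OF cl_add[OF cl_add] cl_add[OF _ cl_add]])
        (auto simp: hom_module_simps P.a_assoc)
  qed
qed

lemma dual_module: "cring R \<Longrightarrow> module R N \<Longrightarrow> module R (dual R N)"
  unfolding dual_def by (intro hom_module_module cring.reg_module_module)

lemma dual_simps:
  "carrier (dual R N) = module_hom R N (reg_module R) \<inter> extensional (carrier N)"
  "f \<oplus>\<^bsub>dual R N\<^esub> g = (\<lambda>x\<in>carrier N. f x \<oplus>\<^bsub>R\<^esub> g x)"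
  "a \<odot>\<^bsub>dual R N\<^esub> f = (\<lambda>x\<in>carrier N. a \<otimes>\<^bsub>R\<^esub> f x)"
  "\<zero>\<^bsub>dual R N\<^esub> = (\<lambda>x\<in>carrier N. \<zero>\<^bsub>R\<^esub>)"
  by (simp_all add: dual_def hom_module_def)

lemma dual_map_hom:
  assumes "module R N" "f \<in> module_hom R N P"
  shows "dual_map N f \<in> module_hom R (dual R P) (dual R N)"
proof (intro module_homI)
  interpret N: module R N by fact
  fix g assume g: "g \<in> carrier (dual R P)"
  then have g': "g \<in> module_hom R P (reg_module R)" by (simp add: dual_simps)
  show "dual_map N f g \<in> carrier (dual R N)"
    using hom_module_restrict[OF assms(1) module_hom_comp[OF assms(2) g']]
    by (simp add: dual_def dual_map_def)
  {
    fix h assume h: "h \<in> carrier (dual R P)"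
    show "dual_map N f (g \<oplus>\<^bsub>dual R P\<^esub> h) = dual_map N f g \<oplus>\<^bsub>dual R N\<^esub> dual_map N f h"
      using module_homD(1)[OF assms(2)] by (auto simp: dual_map_def dual_simps)
  }
  fix a assume "a \<in> carrier R"
  show "dual_map N f (a \<odot>\<^bsub>dual R P\<^esub> g) = a \<odot>\<^bsub>dual R N\<^esub> dual_map N f g"
    using module_homD(1)[OF assms(2)] by (auto simp: dual_map_def dual_simps)
qed

lemma dual_restrict:
  "module R N \<Longrightarrow> f \<in> module_hom R N (reg_module R) \<Longrightarrow> restrict f (carrier N) \<in> carrier (dual R N)"
  unfolding dual_def by (rule hom_module_restrict)

section \<open>Ideals and Noetherian induction\<close>

lemma (in cring) idealI_simple:
  assumes "U \<subseteq> carrier R" "\<zero> \<in> U"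
    and "\<And>a b. a \<in> U \<Longrightarrow> b \<in> U \<Longrightarrow> a \<oplus> b \<in> U"
    and "\<And>a x. a \<in> U \<Longrightarrow> x \<in> carrier R \<Longrightarrow> x \<otimes> a \<in> U"
  shows "ideal U R"
proof (rule idealI)
  show "ring R" by (rule ring_axioms)
  have "\<ominus> a \<in> U" if "a \<in> U" for a
    using assms(4)[OF that, of "\<ominus> \<one>"] that assms(1) by (auto simp: l_minus)
  then show "subgroup U (add_monoid R)"
    using assms by (intro add.subgroupI) (auto simp: a_inv_def)
  fix a x assume a: "a \<in> U" "x \<in> carrier R"
  show "x \<otimes> a \<in> U" using a by (rule assms(4))
  then show "a \<otimes> x \<in> U" using a assms(1) m_comm by (metis subsetD)
qed

lemma idealD:
  assumes "ideal K R"
  shows "K \<subseteq> carrier R" "\<zero>\<^bsub>R\<^esub> \<in> K"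
    and "a \<in> K \<Longrightarrow> b \<in> K \<Longrightarrow> a \<oplus>\<^bsub>R\<^esub> b \<in> K"
    and "a \<in> K \<Longrightarrow> b \<in> K \<Longrightarrow> a \<ominus>\<^bsub>R\<^esub> b \<in> K"
    and "a \<in> K \<Longrightarrow> \<ominus>\<^bsub>R\<^esub> a \<in> K"
    and "a \<in> K \<Longrightarrow> x \<in> carrier R \<Longrightarrow> x \<otimes>\<^bsub>R\<^esub> a \<in> K"
    and "a \<in> K \<Longrightarrow> x \<in> carrier R \<Longrightarrow> a \<otimes>\<^bsub>R\<^esub> x \<in> K"
proof -
  interpret ideal K R by fact
  show "K \<subseteq> carrier R" "\<zero>\<^bsub>R\<^esub> \<in> K" using a_subset by auto
  show "a \<in> K \<Longrightarrow> b \<in> K \<Longrightarrow> a \<oplus>\<^bsub>R\<^esub> b \<in> K" "a \<in> K \<Longrightarrow> b \<in> K \<Longrightarrow> a \<ominus>\<^bsub>R\<^esub> b \<in> K"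
    "a \<in> K \<Longrightarrow> \<ominus>\<^bsub>R\<^esub> a \<in> K"
    by (auto simp: a_minus_def)
  show "a \<in> K \<Longrightarrow> x \<in> carrier R \<Longrightarrow> x \<otimes>\<^bsub>R\<^esub> a \<in> K" by (rule I_l_closed)
  show "a \<in> K \<Longrightarrow> x \<in> carrier R \<Longrightarrow> a \<otimes>\<^bsub>R\<^esub> x \<in> K" by (rule I_r_closed)
qed

text \<open>The colon ideal (K : x), that is, the annihilator of the class of x in R/K.\<close>

definition ideal_quotient :: "('a, 'm) ring_scheme \<Rightarrow> 'a set \<Rightarrow> 'a \<Rightarrow> 'a set" where
  "ideal_quotient R K x = {a \<in> carrier R. a \<otimes>\<^bsub>R\<^esub> x \<in> K}"

lemma (in cring) ideal_ideal_quotient: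
  assumes "ideal K R" "x \<in> carrier R"
  shows "ideal (ideal_quotient R K x) R" "K \<subseteq> ideal_quotient R K x"
  using assms(2) idealD[OF assms(1)]
  by (auto intro!: idealI_simple simp: ideal_quotient_def l_distr m_assoc)

lemma (in cring) Idl_insert_ideal:
  assumes "ideal K R" "x \<in> carrier R"
  shows "Idl (insert x K) = {k \<oplus> a \<otimes> x | k a. k \<in> K \<and> a \<in> carrier R}" (is "_ = ?U")
proof
  have K: "K \<subseteq> carrier R" using idealD(1)[OF assms(1)] .
  have "ideal ?U R"
  proof (rule idealI_simple)
    show "?U \<subseteq> carrier R" using K assms(2) by auto
    show "\<zero> \<in> ?U" using idealD(2)[OF assms(1)] assms(2)
      by (intro CollectI exI[of _ \<zero>]) auto
    fix u v assume "u \<in> ?U"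
    then obtain k a where u: "k \<in> K" "a \<in> carrier R" "u = k \<oplus> a \<otimes> x" by blast
    {
      assume "v \<in> ?U"
      then obtain k' a' where v: "k' \<in> K" "a' \<in> carrier R" "v = k' \<oplus> a' \<otimes> x" by blast
      have "u \<oplus> v = (k \<oplus> k') \<oplus> (a \<oplus> a') \<otimes> x"
        using u v K assms(2) by (auto simp: l_distr subset_iff a_ac)
      then show "u \<oplus> v \<in> ?U" using u v idealD(3)[OF assms(1)] by blast
    }
    assume v: "v \<in> carrier R"
    have "v \<otimes> u = v \<otimes> k \<oplus> (v \<otimes> a) \<otimes> x"
      using u v K assms(2) by (auto simp: r_distr m_assoc subset_iff)
    then show "v \<otimes> u \<in> ?U" using u v idealD(6)[OF assms(1)] by blast
  qed
  moreover have "insert x K \<subseteq> ?U"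
  proof -
    have "x = \<zero> \<oplus> \<one> \<otimes> x" using assms(2) by simp
    then have "x \<in> ?U" using idealD(2)[OF assms(1)] by blast
    moreover have "k = k \<oplus> \<zero> \<otimes> x" if "k \<in> K" for k using that K assms(2) by auto
    then have "K \<subseteq> ?U" by blast
    ultimately show ?thesis by blast
  qed
  ultimately show "Idl (insert x K) \<subseteq> ?U" by (rule genideal_minimal)
  have I: "ideal (Idl (insert x K)) R" "insert x K \<subseteq> Idl (insert x K)"
    by (rule genideal_ideal, use K assms(2) in blast) (rule genideal_self, use K assms(2) in blast)
  show "?U \<subseteq> Idl (insert x K)"
    using idealD(3,6)[OF I(1)] I(2) by (auto simp: subset_iff)
qed

text \<open>In a Noetherian ring a nonempty chain of ideals contains its union, so Zorn's lemma
  applies to an arbitrary property \<open>P\<close> of ideals.\<close>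

lemma (in noetherian_ring) ideal_maximal_element:
  assumes "ideal K R" "P K"
  obtains N where "ideal N R" "P N" "K \<subseteq> N" "\<And>N'. ideal N' R \<Longrightarrow> P N' \<Longrightarrow> N \<subseteq> N' \<Longrightarrow> N' = N"
proof -
  define A where "A = {N. ideal N R \<and> P N \<and> K \<subseteq> N}"
  have "\<exists>N\<in>A. (\<forall>N'\<in>A. N \<subseteq> N' \<longrightarrow> N' = N)"
  proof (rule subset_Zorn_nonempty)
    show "A \<noteq> {}" using assms by (auto simp: A_def)
    fix C assume C: "C \<noteq> {}" "subset.chain A C"
    then have "subset.chain {I. ideal I R} C"
      by (auto simp: subset.chain_def A_def)
    then have "\<Union>C \<in> C" using C(1) ideal_chain_is_trivial by blast
    then show "\<Union>C \<in> A" using C(2) by (auto simp: subset.chain_def)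
  qed
  then obtain N where N: "N \<in> A" "\<forall>N'\<in>A. N \<subseteq> N' \<longrightarrow> N' = N" by blast
  show ?thesis
  proof (rule that)
    show "ideal N R" "P N" "K \<subseteq> N" using N(1) by (auto simp: A_def)
    show "N' = N" if "ideal N' R" "P N'" "N \<subseteq> N'" for N'
      using N that by (auto simp: A_def)
  qed
qed

lemma (in noetherian_ring) noetherian_induct [consumes 1, case_names step]:
  assumes "ideal K R"
    and "\<And>K. ideal K R \<Longrightarrow> (\<And>K'. ideal K' R \<Longrightarrow> K \<subset> K' \<Longrightarrow> P K') \<Longrightarrow> P K"
  shows "P K"
proof (rule ccontr)
  assume "\<not> P K"
  then obtain N where "ideal N R" "\<not> P N"
    "\<And>N'. ideal N' R \<Longrightarrow> \<not> P N' \<Longrightarrow> N \<subseteq> N' \<Longrightarrow> N' = N"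
    using ideal_maximal_element[of K "\<lambda>N. \<not> P N"] assms(1) by metis
  then show False using assms(2)[of N] by blast
qed

section \<open>Submodules annihilated by an ideal\<close>

definition annihilated :: "('a, 'b) module \<Rightarrow> 'a set \<Rightarrow> 'b set" where
  "annihilated M K = {e \<in> carrier M. \<forall>k\<in>K. k \<odot>\<^bsub>M\<^esub> e = \<zero>\<^bsub>M\<^esub>}"

text \<open>The definitions apply to modules without record extensions only, whereas \<^locale>\<open>module\<close>
  admits them.\<close>

locale plain_module = module R M for R :: "('a, 'm) ring_scheme" (structure) and M :: "('a, 'b) module" (structure)

lemma (in plain_module) smult_lcomm:
  "a \<in> carrier R \<Longrightarrow> b \<in> carrier R \<Longrightarrow> x \<in> carrier M \<Longrightarrow>
    a \<odot>\<^bsub>M\<^esub> (b \<odot>\<^bsub>M\<^esub> x) = b \<odot>\<^bsub>M\<^esub> (a \<odot>\<^bsub>M\<^esub> x)"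
  by (simp add: smult_assoc1[symmetric] R.m_comm)

lemma (in plain_module) ideal_annihilator:
  assumes "e \<in> carrier M"
  shows "ideal {a \<in> carrier R. a \<odot>\<^bsub>M\<^esub> e = \<zero>\<^bsub>M\<^esub>} R"
  using assms by (intro R.idealI_simple) (auto simp: smult_l_distr smult_assoc1)

text \<open>The ring elements killing a fixed \<open>e\<close> form an ideal. Cohomology can thus be
  computed from generators of an ideal, and a generator is adjoined by
  \<open>insert\<close>.\<close>

lemma (in plain_module) annihilated_Idl:
  assumes "A \<subseteq> carrier R"
  shows "annihilated M (Idl A) = annihilated M A"
proof -
  have "annihilated M (Idl A) \<subseteq> annihilated M A"
    using R.genideal_self[OF assms] by (auto simp: annihilated_def)
  moreover have "Idl A \<subseteq> {a \<in> carrier R. a \<odot>\<^bsub>M\<^esub> e = \<zero>\<^bsub>M\<^esub>}" if "e \<in> annihilated M A" for e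
    using that assms by (intro R.genideal_minimal ideal_annihilator) (auto simp: annihilated_def)
  then have "annihilated M A \<subseteq> annihilated M (Idl A)"
    by (auto simp: annihilated_def)
  ultimately show ?thesis by blast
qed

lemma (in plain_module) submodule_annihilated:
  assumes "K \<subseteq> carrier R"
  shows "submodule (annihilated M K) R M"
proof -
  have *: "k \<odot>\<^bsub>M\<^esub> (a \<odot>\<^bsub>M\<^esub> x) = \<zero>\<^bsub>M\<^esub>"
    if "k \<in> K" "a \<in> carrier R" "x \<in> carrier M" "k \<odot>\<^bsub>M\<^esub> x = \<zero>\<^bsub>M\<^esub>" for k a x
    using that assms by (metis R.m_comm smult_assoc1 smult_r_null subsetD)
  show ?thesis
    using assms by (intro submoduleI) (auto simp: annihilated_def smult_r_distr smult_r_minus subset_iff *)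
qed

text \<open>The regular module is one of the test modules of \<open>injective_module\<close>, and a
  map extended to the whole ring is determined by its value at 1, the element
  \<open>e\<close>.\<close>

lemma (in cring) injective_extend_ideal:
  assumes E: "injective_module R E" and U: "ideal U R"
    and "\<And>u. u \<in> U \<Longrightarrow> h u \<in> carrier E"
    and "\<And>u v. u \<in> U \<Longrightarrow> v \<in> U \<Longrightarrow> h (u \<oplus> v) = h u \<oplus>\<^bsub>E\<^esub> h v"
    and "\<And>a u. a \<in> carrier R \<Longrightarrow> u \<in> U \<Longrightarrow> h (a \<otimes> u) = a \<odot>\<^bsub>E\<^esub> h u"
  shows "\<exists>e\<in>carrier E. \<forall>u\<in>U. h u = u \<odot>\<^bsub>E\<^esub> e"
proof -
  interpret S: plain_module R "reg_module R" by (rule plain_module.intro[OF reg_module_module])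
  note idl = idealD[OF U]
  have uminus: "\<ominus>\<^bsub>reg_module R\<^esub> a = \<ominus> a" if "a \<in> carrier R" for a
    using that S.uminus_eq_smult[of a] by (simp add: l_minus)
  have "submodule U R (reg_module R)"
    using idl by (intro S.submoduleI) (auto simp: uminus subset_iff)
  moreover have "h \<in> module_hom R ((reg_module R)\<lparr>carrier := U\<rparr>) E"
    using assms(3-5) by (intro module_homI) auto
  ultimately obtain h' where h': "h' \<in> module_hom R (reg_module R) E" "\<forall>u\<in>U. h' u = h u"
    using E S.module_axioms unfolding injective_module_def by blast
  have "h u = u \<odot>\<^bsub>E\<^esub> h' \<one>" if "u \<in> U" for u
    using h' that idl(1) module_homD(3)[OF h'(1), of u \<one>] by (auto simp: subset_iff)
  then show ?thesis using module_homD(1)[OF h'(1), of \<one>] by auto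
qed

text \<open>Multiplication by \<open>x\<close> embeds \<open>R/(K:x)\<close> into \<open>R/K\<close>, and \<open>annihilated E K\<close> is \<open>Hom(R/K, E)\<close>.\<close>

lemma (in cring) injective_divisible:
  assumes E: "injective_module R E" and K: "ideal K R" and x: "x \<in> carrier R"
    and e: "e \<in> annihilated E (ideal_quotient R K x)"
  obtains e' where "e' \<in> annihilated E K" "x \<odot>\<^bsub>E\<^esub> e' = e"
proof -
  interpret E: plain_module R E using E by (simp add: plain_module_def injective_module_def)
  define U where "U = Idl (insert x K)"
  note idl = idealD[OF K]
  have ec: "e \<in> carrier E" using e by (simp add: annihilated_def)
  have U: "ideal U R" unfolding U_def using x idl(1) by (intro genideal_ideal) auto
  have Ueq: "U = {k \<oplus> a \<otimes> x | k a. k \<in> K \<and> a \<in> carrier R}"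
    unfolding U_def by (rule Idl_insert_ideal[OF K x])
  \<comment> \<open>The map on K + Rx that sends k + a x to a e. Two coefficients of the same
    element differ by an element of (K : x), which kills \<open>e\<close>. The map vanishes on
    \<open>K\<close> and sends \<open>x\<close> to \<open>e\<close>, so an element \<open>e'\<close>
    that represents it has both required properties.\<close>
  define h where "h u = (SOME w. \<exists>k a. k \<in> K \<and> a \<in> carrier R \<and> u = k \<oplus> a \<otimes> x \<and> w = a \<odot>\<^bsub>E\<^esub> e)" for u
  have wd: "a \<odot>\<^bsub>E\<^esub> e = b \<odot>\<^bsub>E\<^esub> e"
    if "k \<in> K" "a \<in> carrier R" "k' \<in> K" "b \<in> carrier R" "k \<oplus> a \<otimes> x = k' \<oplus> b \<otimes> x" for k a k' b
  proof -
    have c: "k \<in> carrier R" "k' \<in> carrier R" using that idl(1) by auto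
    have "(a \<ominus> b) \<otimes> x = k' \<ominus> k"
    proof -
      have "a \<otimes> x = \<ominus> k \<oplus> (k \<oplus> a \<otimes> x)"
        using c that(2) x by (simp add: a_assoc[symmetric] l_neg)
      also have "\<dots> = \<ominus> k \<oplus> (k' \<oplus> b \<otimes> x)" using that(5) by simp
      finally have *: "a \<otimes> x = \<ominus> k \<oplus> (k' \<oplus> b \<otimes> x)" .
      have "(a \<ominus> b) \<otimes> x = a \<otimes> x \<ominus> b \<otimes> x" using that(2,4) x by algebra
      then show ?thesis unfolding * using c that(4) x by algebra
    qed
    then have "a \<ominus> b \<in> ideal_quotient R K x"
      using that idl(4) by (simp add: ideal_quotient_def)
    then have "(a \<ominus> b) \<odot>\<^bsub>E\<^esub> e = \<zero>\<^bsub>E\<^esub>" using e by (auto simp: annihilated_def)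
    then have "a \<odot>\<^bsub>E\<^esub> e \<ominus>\<^bsub>E\<^esub> b \<odot>\<^bsub>E\<^esub> e = \<zero>\<^bsub>E\<^esub>"
      using that(2,4) ec by (simp add: a_minus_def E.smult_l_distr E.smult_l_minus)
    then show ?thesis
      by (rule module_hom_eqI_diff[OF E.module_axioms, rotated 2]) (use that(2,4) ec in simp_all)
  qed
  have h_eq: "h (k \<oplus> a \<otimes> x) = a \<odot>\<^bsub>E\<^esub> e" if "k \<in> K" "a \<in> carrier R" for k a
    unfolding h_def
  proof (rule someI2)
    show "\<exists>k' a'. k' \<in> K \<and> a' \<in> carrier R \<and> k \<oplus> a \<otimes> x = k' \<oplus> a' \<otimes> x \<and> a \<odot>\<^bsub>E\<^esub> e = a' \<odot>\<^bsub>E\<^esub> e"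
      using that by blast
  next
    fix w assume "\<exists>k' a'. k' \<in> K \<and> a' \<in> carrier R \<and> k \<oplus> a \<otimes> x = k' \<oplus> a' \<otimes> x \<and> w = a' \<odot>\<^bsub>E\<^esub> e"
    then show "w = a \<odot>\<^bsub>E\<^esub> e" using wd that by metis
  qed
  have "\<exists>e'\<in>carrier E. \<forall>u\<in>U. h u = u \<odot>\<^bsub>E\<^esub> e'"
  proof (rule injective_extend_ideal[OF E U])
    fix u assume "u \<in> U"
    then obtain k a where u: "k \<in> K" "a \<in> carrier R" "u = k \<oplus> a \<otimes> x" unfolding Ueq by blast
    show "h u \<in> carrier E" using u h_eq ec by simp
    {
      fix b assume b: "b \<in> carrier R"
      have "b \<otimes> u = b \<otimes> k \<oplus> (b \<otimes> a) \<otimes> x"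
        using u b x idl(1) by (auto simp: r_distr m_assoc subset_iff)
      then show "h (b \<otimes> u) = b \<odot>\<^bsub>E\<^esub> h u"
        using u b h_eq idl(6) ec by (simp add: E.smult_assoc1)
    }
    fix v assume "v \<in> U"
    then obtain k' a' where v: "k' \<in> K" "a' \<in> carrier R" "v = k' \<oplus> a' \<otimes> x" unfolding Ueq by blast
    have "u \<oplus> v = (k \<oplus> k') \<oplus> (a \<oplus> a') \<otimes> x"
      using u v x idl(1) by (auto simp: l_distr a_ac subset_iff)
    then show "h (u \<oplus> v) = h u \<oplus>\<^bsub>E\<^esub> h v"
      using u v h_eq idl(3) ec by (simp add: E.smult_l_distr)
  qed
  then obtain e' where e': "e' \<in> carrier E" "\<forall>u\<in>U. h u = u \<odot>\<^bsub>E\<^esub> e'" by blast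
  show ?thesis
  proof (rule that)
    have "k \<odot>\<^bsub>E\<^esub> e' = \<zero>\<^bsub>E\<^esub>" if k: "k \<in> K" for k
    proof -
      have keq: "k = k \<oplus> \<zero> \<otimes> x" using k x idl(1) by auto
      then have "k \<in> U" unfolding Ueq using k by blast
      then have "k \<odot>\<^bsub>E\<^esub> e' = h k" using e' by simp
      also have "\<dots> = \<zero> \<odot>\<^bsub>E\<^esub> e" by (subst keq) (rule h_eq[OF k zero_closed])
      finally show ?thesis using ec by simp
    qed
    then show "e' \<in> annihilated E K" using e' by (simp add: annihilated_def)
    have xeq: "x = \<zero> \<oplus> \<one> \<otimes> x" using x by simp
    then have "x \<in> U" unfolding Ueq using idl(2) by blast
    then have "x \<odot>\<^bsub>E\<^esub> e' = h x" using e' by simp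
    also have "\<dots> = \<one> \<odot>\<^bsub>E\<^esub> e" by (subst xeq) (rule h_eq[OF idl(2) one_closed])
    finally show "x \<odot>\<^bsub>E\<^esub> e' = e" using ec by simp
  qed
qed

section \<open>Generated submodules and Nakayama's lemma\<close>

context plain_module
begin

lemma submodule_gen_submodule:
  assumes "A \<subseteq> carrier M"
  shows "submodule (gen_submodule R M A) R M" "A \<subseteq> gen_submodule R M A"
proof -
  have c: "carrier M \<in> {K. submodule K R M \<and> A \<subseteq> K}"
    using assms carrier_is_submodule by blast
  show "submodule (gen_submodule R M A) R M"
    unfolding gen_submodule_def
  proof (rule submoduleI)
    show "\<Inter>{K. submodule K R M \<and> A \<subseteq> K} \<subseteq> carrier M" using c by blast
    show "\<zero>\<^bsub>M\<^esub> \<in> \<Inter>{K. submodule K R M \<and> A \<subseteq> K}"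
      using subgroup.one_closed[OF submodule.axioms(1)] by fastforce
  qed (auto simp: submoduleE)
  show "A \<subseteq> gen_submodule R M A" by (auto simp: gen_submodule_def)
qed

lemma gen_submodule_minimal:
  "submodule K R M \<Longrightarrow> A \<subseteq> K \<Longrightarrow> gen_submodule R M A \<subseteq> K"
  by (auto simp: gen_submodule_def)

lemma submodule_zero: "submodule K R M \<Longrightarrow> \<zero>\<^bsub>M\<^esub> \<in> K"
  using subgroup.one_closed[OF submodule.axioms(1)] by fastforce

lemma submoduleD:
  assumes "submodule K R M"
  shows "K \<subseteq> carrier M" "\<zero>\<^bsub>M\<^esub> \<in> K"
    and "x \<in> K \<Longrightarrow> y \<in> K \<Longrightarrow> x \<oplus>\<^bsub>M\<^esub> y \<in> K"
    and "x \<in> K \<Longrightarrow> y \<in> K \<Longrightarrow> x \<ominus>\<^bsub>M\<^esub> y \<in> K"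
    and "a \<in> carrier R \<Longrightarrow> x \<in> K \<Longrightarrow> a \<odot>\<^bsub>M\<^esub> x \<in> K"
  using submoduleE[OF assms] submodule_zero[OF assms] by (auto simp: a_minus_def)

lemma submoduleI_smult:
  assumes "K \<subseteq> carrier M" "\<zero>\<^bsub>M\<^esub> \<in> K"
    and "\<And>x y. x \<in> K \<Longrightarrow> y \<in> K \<Longrightarrow> x \<oplus>\<^bsub>M\<^esub> y \<in> K"
    and "\<And>a x. a \<in> carrier R \<Longrightarrow> x \<in> K \<Longrightarrow> a \<odot>\<^bsub>M\<^esub> x \<in> K"
  shows "submodule K R M"
proof (rule submoduleI)
  show "\<ominus>\<^bsub>M\<^esub> x \<in> K" if "x \<in> K" for x
    using assms(4)[of "\<ominus> \<one>" x] that uminus_eq_smult[OF subsetD[OF assms(1) that]] by simp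
qed (use assms in auto)

lemma submodule_insert:
  assumes K: "submodule K R M" and x: "x \<in> carrier M"
  shows "submodule {k \<oplus>\<^bsub>M\<^esub> a \<odot>\<^bsub>M\<^esub> x | k a. k \<in> K \<and> a \<in> carrier R} R M" (is "submodule ?U R M")
proof -
  note sub = submoduleD[OF K]
  have add: "u \<oplus>\<^bsub>M\<^esub> v \<in> ?U" if uv: "u \<in> ?U" "v \<in> ?U" for u v
  proof -
    obtain k a where u: "k \<in> K" "a \<in> carrier R" "u = k \<oplus>\<^bsub>M\<^esub> a \<odot>\<^bsub>M\<^esub> x" using uv by blast
    obtain k' a' where v: "k' \<in> K" "a' \<in> carrier R" "v = k' \<oplus>\<^bsub>M\<^esub> a' \<odot>\<^bsub>M\<^esub> x" using uv by blast
    have "u \<oplus>\<^bsub>M\<^esub> v = (k \<oplus>\<^bsub>M\<^esub> k') \<oplus>\<^bsub>M\<^esub> (a \<oplus> a') \<odot>\<^bsub>M\<^esub> x"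
      using u v x sub(1) by (auto simp: smult_l_distr M.a_ac subset_iff)
    then show ?thesis using u v sub(3) by blast
  qed
  have smult: "b \<odot>\<^bsub>M\<^esub> u \<in> ?U" if uv: "u \<in> ?U" "b \<in> carrier R" for u b
  proof -
    obtain k a where u: "k \<in> K" "a \<in> carrier R" "u = k \<oplus>\<^bsub>M\<^esub> a \<odot>\<^bsub>M\<^esub> x" using uv by blast
    have "b \<odot>\<^bsub>M\<^esub> u = b \<odot>\<^bsub>M\<^esub> k \<oplus>\<^bsub>M\<^esub> (b \<otimes> a) \<odot>\<^bsub>M\<^esub> x"
      using u x uv(2) sub(1) by (auto simp: smult_r_distr smult_assoc1 subset_iff)
    then show ?thesis using u uv(2) sub(5) by blast
  qed
  have sub': "?U \<subseteq> carrier M" using x sub(1) by auto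
  show ?thesis
  proof (rule submoduleI_smult[OF sub'])
    have "\<zero>\<^bsub>M\<^esub> = \<zero>\<^bsub>M\<^esub> \<oplus>\<^bsub>M\<^esub> \<zero> \<odot>\<^bsub>M\<^esub> x" using x by simp
    then show "\<zero>\<^bsub>M\<^esub> \<in> ?U" using sub(2) by blast
  qed (rule add smult, assumption+)+
qed

lemma gen_submodule_insert:
  assumes A: "A \<subseteq> carrier M" and x: "x \<in> carrier M"
  shows "gen_submodule R M (insert x A) =
    {k \<oplus>\<^bsub>M\<^esub> a \<odot>\<^bsub>M\<^esub> x | k a. k \<in> gen_submodule R M A \<and> a \<in> carrier R}" (is "_ = ?U")
proof
  let ?K = "gen_submodule R M A"
  note K = submodule_gen_submodule[OF A]
  note sub = submoduleD[OF K(1)]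
  show "gen_submodule R M (insert x A) \<subseteq> ?U"
  proof (rule gen_submodule_minimal)
    show "submodule ?U R M" by (rule submodule_insert[OF K(1) x])
    have "x = \<zero>\<^bsub>M\<^esub> \<oplus>\<^bsub>M\<^esub> \<one> \<odot>\<^bsub>M\<^esub> x" using x by simp
    then have "x \<in> ?U" using sub(2) by blast
    moreover have "y = y \<oplus>\<^bsub>M\<^esub> \<zero> \<odot>\<^bsub>M\<^esub> x" if "y \<in> A" for y using that A x by auto
    then have "A \<subseteq> ?U" using K(2) by blast
    ultimately show "insert x A \<subseteq> ?U" by blast
  qed
  have c: "insert x A \<subseteq> carrier M" using A x by auto
  note L = submodule_gen_submodule[OF c]
  have "?K \<subseteq> gen_submodule R M (insert x A)"
    by (rule gen_submodule_minimal[OF L(1)]) (use L(2) in auto)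
  then show "?U \<subseteq> gen_submodule R M (insert x A)"
    using submoduleD(3,5)[OF L(1)] L(2) by blast
qed

lemma gen_submodule_of_submodule: "submodule K R M \<Longrightarrow> gen_submodule R M K = K"
  using gen_submodule_minimal[of K K] by (auto simp: gen_submodule_def)

text \<open>Nakayama's lemma for W/K localized at \<open>Q\<close>, with denominators cleared: a
  class is zero at \<open>Q\<close> if some s outside \<open>Q\<close> kills it. Absorbing one
  generator e into \<open>K\<close>, the induction puts W inside K + Re up to such factors, hence QW
  inside K + Qe up to such factors. Then s e = k + q e, and s - q is outside \<open>Q\<close> and
  carries e into \<open>K\<close>.\<close>

lemma nakayama_local:
  assumes Q: "primeideal Q R"
    and "finite A" "A \<subseteq> carrier M" "submodule K R M" "W = gen_submodule R M (K \<union> A)"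
    and gen: "\<And>w. w \<in> W \<Longrightarrow> \<exists>s\<in>carrier R - Q.
      s \<odot>\<^bsub>M\<^esub> w \<in> gen_submodule R M (K \<union> {q \<odot>\<^bsub>M\<^esub> v | q v. q \<in> Q \<and> v \<in> W})"
    and "w \<in> W"
  shows "\<exists>s\<in>carrier R - Q. s \<odot>\<^bsub>M\<^esub> w \<in> K"
  using assms(2-5,7) gen
proof (induction A arbitrary: K w rule: finite_induct)
  case empty
  then have "w \<in> K" using gen_submodule_of_submodule by simp
  moreover have "\<one> \<notin> Q"
    using Q primeideal.I_notcarr ideal.one_imp_carrier[OF primeideal.axioms(1)[OF Q]] by blast
  ultimately show ?case
    using submoduleD(1)[OF empty.prems(2)] by (intro bexI[of _ \<one>]) auto
next
  case (insert e A)
  interpret Q: primeideal Q R by fact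
  note idlQ = idealD[OF Q.ideal_axioms]
  have prim: "s \<otimes> t \<in> carrier R - Q" if "s \<in> carrier R - Q" "t \<in> carrier R - Q" for s t
    using that Q.I_prime[of s t] by auto
  have oneQ: "\<one> \<in> carrier R - Q"
    using Q primeideal.I_notcarr ideal.one_imp_carrier[OF primeideal.axioms(1)[OF Q]] by blast
  note K = submoduleD[OF insert.prems(2)]
  have e: "e \<in> carrier M" and A: "A \<subseteq> carrier M" using insert.prems(1) by auto
  have KA: "K \<union> insert e A \<subseteq> carrier M" using insert.prems(1) K by auto
  note Wsub = submodule_gen_submodule[OF KA, folded insert.prems(3)]
  note W = submoduleD[OF Wsub(1)]
  define K1 where "K1 = gen_submodule R M (insert e K)"
  have c1: "insert e K \<subseteq> carrier M" using e K by auto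
  note K1 = submodule_gen_submodule[OF c1, folded K1_def]
  have K1eq: "K1 = {k \<oplus>\<^bsub>M\<^esub> a \<odot>\<^bsub>M\<^esub> e | k a. k \<in> K \<and> a \<in> carrier R}"
    unfolding K1_def using gen_submodule_insert[OF K(1) e] gen_submodule_of_submodule[OF insert.prems(2)]
    by simp
  have W1: "W = gen_submodule R M (K1 \<union> A)"
  proof
    have c: "K1 \<union> A \<subseteq> carrier M" using submoduleD(1)[OF K1(1)] A by auto
    note L = submodule_gen_submodule[OF c]
    show "W \<subseteq> gen_submodule R M (K1 \<union> A)"
      unfolding insert.prems(3) by (rule gen_submodule_minimal[OF L(1)]) (use L(2) K1(2) in blast)
    have "K1 \<subseteq> W" unfolding K1_def by (rule gen_submodule_minimal[OF Wsub(1)]) (use Wsub(2) in blast)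
    then show "gen_submodule R M (K1 \<union> A) \<subseteq> W"
      using Wsub(2) by (intro gen_submodule_minimal[OF Wsub(1)]) blast
  qed
  have qW: "q \<odot>\<^bsub>M\<^esub> v \<in> carrier M" if "q \<in> Q" "v \<in> W" for q v
    using that idlQ(1) W(1) by auto
  \<comment> \<open>With e absorbed into \<open>K1\<close> one generator fewer remains, and the
    hypothesis on W is inherited because \<open>K\<close> lies in \<open>K1\<close>.\<close>
  have IH: "\<exists>s\<in>carrier R - Q. s \<odot>\<^bsub>M\<^esub> w \<in> K1" if w: "w \<in> W" for w
  proof (rule insert.IH[OF A K1(1) W1 w])
    fix w assume w: "w \<in> W"
    obtain s where s: "s \<in> carrier R - Q"
      "s \<odot>\<^bsub>M\<^esub> w \<in> gen_submodule R M (K \<union> {q \<odot>\<^bsub>M\<^esub> v | q v. q \<in> Q \<and> v \<in> W})"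
      using insert.prems(5)[OF w] by blast
    have c: "K1 \<union> {q \<odot>\<^bsub>M\<^esub> v | q v. q \<in> Q \<and> v \<in> W} \<subseteq> carrier M"
      using submoduleD(1)[OF K1(1)] qW by auto
    note L = submodule_gen_submodule[OF c]
    have "gen_submodule R M (K \<union> {q \<odot>\<^bsub>M\<^esub> v | q v. q \<in> Q \<and> v \<in> W})
        \<subseteq> gen_submodule R M (K1 \<union> {q \<odot>\<^bsub>M\<^esub> v | q v. q \<in> Q \<and> v \<in> W})"
      by (rule gen_submodule_minimal[OF L(1)]) (use L(2) K1(2) in blast)
    then show "\<exists>s\<in>carrier R - Q. s \<odot>\<^bsub>M\<^esub> w \<in>
        gen_submodule R M (K1 \<union> {q \<odot>\<^bsub>M\<^esub> v | q v. q \<in> Q \<and> v \<in> W})"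
      using s by blast
  qed
  \<comment> \<open>The elements that lie in K + Qe after localization at \<open>Q\<close>. It
    contains QW because \<open>IH\<close> puts W inside K + Re up to a factor.\<close>
  define U where "U = {w \<in> carrier M. \<exists>s\<in>carrier R - Q. \<exists>q\<in>Q. \<exists>k\<in>K. s \<odot>\<^bsub>M\<^esub> w = k \<oplus>\<^bsub>M\<^esub> q \<odot>\<^bsub>M\<^esub> e}"
  have U_smult: "b \<odot>\<^bsub>M\<^esub> u \<in> U" if uU: "u \<in> U" and b: "b \<in> carrier R" for b u
  proof -
    obtain s q k where u: "u \<in> carrier M" "s \<in> carrier R - Q" "q \<in> Q" "k \<in> K" "s \<odot>\<^bsub>M\<^esub> u = k \<oplus>\<^bsub>M\<^esub> q \<odot>\<^bsub>M\<^esub> e"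
      using uU unfolding U_def by blast
    have c: "q \<in> carrier R" "k \<in> carrier M" using u idlQ(1) K(1) by auto
    have "s \<odot>\<^bsub>M\<^esub> (b \<odot>\<^bsub>M\<^esub> u) = b \<odot>\<^bsub>M\<^esub> (s \<odot>\<^bsub>M\<^esub> u)"
      using u(1,2) b by (intro smult_lcomm) auto
    also have "\<dots> = b \<odot>\<^bsub>M\<^esub> k \<oplus>\<^bsub>M\<^esub> (b \<otimes> q) \<odot>\<^bsub>M\<^esub> e"
      using u(5) c e b by (simp add: smult_r_distr smult_assoc1)
    finally show ?thesis using u b K(5) idlQ(6) unfolding U_def by blast
  qed
  have U_add: "u \<oplus>\<^bsub>M\<^esub> v \<in> U" if uU: "u \<in> U" and vU: "v \<in> U" for u v
  proof -
    obtain s q k where u: "u \<in> carrier M" "s \<in> carrier R - Q" "q \<in> Q" "k \<in> K" "s \<odot>\<^bsub>M\<^esub> u = k \<oplus>\<^bsub>M\<^esub> q \<odot>\<^bsub>M\<^esub> e"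
      using uU unfolding U_def by blast
    obtain s' q' k' where v: "v \<in> carrier M" "s' \<in> carrier R - Q" "q' \<in> Q" "k' \<in> K" "s' \<odot>\<^bsub>M\<^esub> v = k' \<oplus>\<^bsub>M\<^esub> q' \<odot>\<^bsub>M\<^esub> e"
      using vU unfolding U_def by blast
    have c: "q \<in> carrier R" "k \<in> carrier M" "q' \<in> carrier R" "k' \<in> carrier M" "s \<in> carrier R" "s' \<in> carrier R"
      using u v idlQ(1) K(1) by auto
    have "(s \<otimes> s') \<odot>\<^bsub>M\<^esub> (u \<oplus>\<^bsub>M\<^esub> v) = s' \<odot>\<^bsub>M\<^esub> (s \<odot>\<^bsub>M\<^esub> u) \<oplus>\<^bsub>M\<^esub> s \<odot>\<^bsub>M\<^esub> (s' \<odot>\<^bsub>M\<^esub> v)"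
      using u(1) v(1) c by (simp add: smult_r_distr smult_assoc1[symmetric] R.m_comm)
    also have "\<dots> = (s' \<odot>\<^bsub>M\<^esub> k \<oplus>\<^bsub>M\<^esub> s \<odot>\<^bsub>M\<^esub> k') \<oplus>\<^bsub>M\<^esub> (s' \<otimes> q \<oplus> s \<otimes> q') \<odot>\<^bsub>M\<^esub> e"
      using u(5) v(5) c e by (simp add: smult_r_distr smult_l_distr smult_assoc1 M.a_ac)
    finally have eq: "(s \<otimes> s') \<odot>\<^bsub>M\<^esub> (u \<oplus>\<^bsub>M\<^esub> v) =
      (s' \<odot>\<^bsub>M\<^esub> k \<oplus>\<^bsub>M\<^esub> s \<odot>\<^bsub>M\<^esub> k') \<oplus>\<^bsub>M\<^esub> (s' \<otimes> q \<oplus> s \<otimes> q') \<odot>\<^bsub>M\<^esub> e" .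
    have "u \<oplus>\<^bsub>M\<^esub> v \<in> carrier M" using u(1) v(1) by simp
    moreover have "s' \<otimes> q \<oplus> s \<otimes> q' \<in> Q" by (intro idlQ(3,6) u v c)
    moreover have "s' \<odot>\<^bsub>M\<^esub> k \<oplus>\<^bsub>M\<^esub> s \<odot>\<^bsub>M\<^esub> k' \<in> K" by (intro K(3,5) u v c)
    ultimately show ?thesis
      unfolding U_def using eq prim[OF u(2) v(2)] by blast
  qed
  have U_sub: "U \<subseteq> carrier M" by (auto simp: U_def)
  have "submodule U R M"
  proof (rule submoduleI_smult[OF U_sub])
    have "\<one> \<odot>\<^bsub>M\<^esub> \<zero>\<^bsub>M\<^esub> = \<zero>\<^bsub>M\<^esub> \<oplus>\<^bsub>M\<^esub> \<zero> \<odot>\<^bsub>M\<^esub> e" using e by simp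
    then show "\<zero>\<^bsub>M\<^esub> \<in> U" unfolding U_def using oneQ idlQ(2) K(2) by blast
  qed (rule U_add U_smult, assumption+)+
  moreover have "K \<subseteq> U"
  proof
    fix k assume k: "k \<in> K"
    then have "\<one> \<odot>\<^bsub>M\<^esub> k = k \<oplus>\<^bsub>M\<^esub> \<zero> \<odot>\<^bsub>M\<^esub> e" using e K(1) by auto
    then show "k \<in> U" unfolding U_def using oneQ idlQ(2) K(1) k by blast
  qed
  moreover have "q \<odot>\<^bsub>M\<^esub> v \<in> U" if q: "q \<in> Q" and v: "v \<in> W" for q v
  proof -
    obtain s k a where s: "s \<in> carrier R - Q" "k \<in> K" "a \<in> carrier R" "s \<odot>\<^bsub>M\<^esub> v = k \<oplus>\<^bsub>M\<^esub> a \<odot>\<^bsub>M\<^esub> e"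
      using IH[OF v] unfolding K1eq by blast
    have c: "q \<in> carrier R" "k \<in> carrier M" "v \<in> carrier M" using s q v idlQ(1) K(1) W(1) by auto
    have "s \<odot>\<^bsub>M\<^esub> (q \<odot>\<^bsub>M\<^esub> v) = q \<odot>\<^bsub>M\<^esub> (s \<odot>\<^bsub>M\<^esub> v)"
      using s(1) c by (intro smult_lcomm) auto
    also have "\<dots> = q \<odot>\<^bsub>M\<^esub> k \<oplus>\<^bsub>M\<^esub> (q \<otimes> a) \<odot>\<^bsub>M\<^esub> e"
      using s(3,4) c e by (simp add: smult_r_distr smult_assoc1)
    finally show ?thesis unfolding U_def using s c K(5) idlQ(7)[OF q s(3)] by blast
  qed
  ultimately have gU: "gen_submodule R M (K \<union> {q \<odot>\<^bsub>M\<^esub> v | q v. q \<in> Q \<and> v \<in> W}) \<subseteq> U"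
    by (intro gen_submodule_minimal) blast+
  have "e \<in> W" using Wsub(2) by blast
  then obtain s where s: "s \<in> carrier R - Q" "s \<odot>\<^bsub>M\<^esub> e \<in> U"
    using insert.prems(5) gU by blast
  then obtain s' q k where s': "s' \<in> carrier R - Q" "q \<in> Q" "k \<in> K"
    "s' \<odot>\<^bsub>M\<^esub> (s \<odot>\<^bsub>M\<^esub> e) = k \<oplus>\<^bsub>M\<^esub> q \<odot>\<^bsub>M\<^esub> e"
    unfolding U_def by blast
  \<comment> \<open>The equation s' s e = k + q e rearranged; \<open>t\<close> avoids
    \<open>Q\<close> because s' s does and q lies in \<open>Q\<close>.\<close>
  define t where "t = s' \<otimes> s \<ominus> q"
  have c: "s \<in> carrier R" "s' \<in> carrier R" "q \<in> carrier R" "k \<in> carrier M"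
    using s s' idlQ(1) K(1) by auto
  have t: "t \<in> carrier R - Q"
  proof
    show "t \<in> carrier R" using c by (simp add: t_def)
    show "t \<notin> Q"
    proof
      assume "t \<in> Q"
      then have "t \<oplus> q \<in> Q" using s'(2) idlQ(3) by blast
      moreover have "t \<oplus> q = s' \<otimes> s" unfolding t_def using c by algebra
      ultimately show False using prim[OF s'(1) s(1)] by simp
    qed
  qed
  have "t \<odot>\<^bsub>M\<^esub> e = s' \<odot>\<^bsub>M\<^esub> (s \<odot>\<^bsub>M\<^esub> e) \<ominus>\<^bsub>M\<^esub> q \<odot>\<^bsub>M\<^esub> e"
    using c e by (simp add: t_def a_minus_def smult_l_distr smult_l_minus smult_assoc1)
  also have "\<dots> = k" using s'(4) c e by (simp add: a_minus_def M.a_assoc M.r_neg)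
  finally have te: "t \<odot>\<^bsub>M\<^esub> e \<in> K" using s'(3) by simp
  obtain s1 k1 a1 where s1: "s1 \<in> carrier R - Q" "k1 \<in> K" "a1 \<in> carrier R" "s1 \<odot>\<^bsub>M\<^esub> w = k1 \<oplus>\<^bsub>M\<^esub> a1 \<odot>\<^bsub>M\<^esub> e"
    using IH[OF insert.prems(4)] unfolding K1eq by blast
  have c1: "s1 \<in> carrier R" "k1 \<in> carrier M" "w \<in> carrier M" "t \<in> carrier R"
    using s1 K(1) W(1) insert.prems(4) t by auto
  have "(t \<otimes> s1) \<odot>\<^bsub>M\<^esub> w = t \<odot>\<^bsub>M\<^esub> (s1 \<odot>\<^bsub>M\<^esub> w)" using c1 by (simp add: smult_assoc1)
  also have "\<dots> = t \<odot>\<^bsub>M\<^esub> k1 \<oplus>\<^bsub>M\<^esub> a1 \<odot>\<^bsub>M\<^esub> (t \<odot>\<^bsub>M\<^esub> e)"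
    using s1(3,4) c1 e by (simp add: smult_r_distr smult_assoc1[symmetric] R.m_comm)
  also have "\<dots> \<in> K" using te s1 c1 K(3,5) by blast
  finally show ?case using prim[OF t s1(1)] by blast
qed

end

section \<open>Sums, images and preimages of submodules\<close>

context plain_module
begin

lemma submodule_sum:
  assumes K: "submodule K R M" and L: "submodule L R M"
  shows "submodule {k \<oplus>\<^bsub>M\<^esub> l | k l. k \<in> K \<and> l \<in> L} R M" (is "submodule ?U R M")
proof -
  note K' = submoduleD[OF K] and L' = submoduleD[OF L]
  have sub: "?U \<subseteq> carrier M" using K'(1) L'(1) by auto
  have add: "u \<oplus>\<^bsub>M\<^esub> v \<in> ?U" if uU: "u \<in> ?U" and vU: "v \<in> ?U" for u v
  proof -
    obtain k l where u: "k \<in> K" "l \<in> L" "u = k \<oplus>\<^bsub>M\<^esub> l" using uU by blast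
    obtain k' l' where v: "k' \<in> K" "l' \<in> L" "v = k' \<oplus>\<^bsub>M\<^esub> l'" using vU by blast
    have "u \<oplus>\<^bsub>M\<^esub> v = (k \<oplus>\<^bsub>M\<^esub> k') \<oplus>\<^bsub>M\<^esub> (l \<oplus>\<^bsub>M\<^esub> l')"
      using u v K'(1) L'(1) by (auto simp: M.a_ac subset_iff)
    then show ?thesis using u v K'(3) L'(3) by blast
  qed
  have smult: "b \<odot>\<^bsub>M\<^esub> u \<in> ?U" if uU: "u \<in> ?U" and b: "b \<in> carrier R" for u b
  proof -
    obtain k l where u: "k \<in> K" "l \<in> L" "u = k \<oplus>\<^bsub>M\<^esub> l" using uU by blast
    have "b \<odot>\<^bsub>M\<^esub> u = b \<odot>\<^bsub>M\<^esub> k \<oplus>\<^bsub>M\<^esub> b \<odot>\<^bsub>M\<^esub> l"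
      using u K'(1) L'(1) b by (auto simp: smult_r_distr subset_iff)
    then show ?thesis using u b K'(5) L'(5) by blast
  qed
  show ?thesis
  proof (rule submoduleI_smult[OF sub])
    have "\<zero>\<^bsub>M\<^esub> = \<zero>\<^bsub>M\<^esub> \<oplus>\<^bsub>M\<^esub> \<zero>\<^bsub>M\<^esub>" by simp
    then show "\<zero>\<^bsub>M\<^esub> \<in> ?U" using K'(2) L'(2) by blast
  qed (rule add smult, assumption+)+
qed

lemma gen_submodule_Un:
  assumes K: "submodule K R M" and A: "A \<subseteq> carrier M"
  shows "gen_submodule R M (K \<union> A) = {k \<oplus>\<^bsub>M\<^esub> g | k g. k \<in> K \<and> g \<in> gen_submodule R M A}"
    (is "_ = ?U")
proof
  note G = submodule_gen_submodule[OF A]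
  note K' = submoduleD[OF K] and G' = submoduleD[OF G(1)]
  have "k = k \<oplus>\<^bsub>M\<^esub> \<zero>\<^bsub>M\<^esub>" if "k \<in> K" for k using that K'(1) by auto
  then have "K \<subseteq> ?U" using G'(2) by blast
  moreover have "g = \<zero>\<^bsub>M\<^esub> \<oplus>\<^bsub>M\<^esub> g" if "g \<in> A" for g using that A by auto
  then have "A \<subseteq> ?U" using G(2) K'(2) by blast
  ultimately show "gen_submodule R M (K \<union> A) \<subseteq> ?U"
    by (intro gen_submodule_minimal submodule_sum K G) blast
  have c: "K \<union> A \<subseteq> carrier M" using K'(1) A by blast
  note L = submodule_gen_submodule[OF c]
  have "gen_submodule R M A \<subseteq> gen_submodule R M (K \<union> A)"
    using L(2) by (intro gen_submodule_minimal[OF L(1)]) blast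
  then show "?U \<subseteq> gen_submodule R M (K \<union> A)"
    using L(2) submoduleD(3)[OF L(1)] by (auto simp: subset_iff)
qed

end

lemma submodule_hom_image:
  assumes N: "module R N" and P: "module R P" and h: "h \<in> module_hom R N P"
    and K: "submodule K R N"
  shows "submodule (h ` K) R P"
proof -
  interpret N: plain_module R N using N by (rule plain_module.intro)
  interpret P: plain_module R P using P by (rule plain_module.intro)
  note K' = N.submoduleD[OF K] and h' = module_homD[OF h]
  have c: "k \<in> carrier N" if "k \<in> K" for k using K'(1) that by blast
  have smult: "a \<odot>\<^bsub>P\<^esub> h k \<in> h ` K" if "k \<in> K" "a \<in> carrier R" for a k
    using that K'(5) h'(3)[of a k] c by (metis imageI)
  show ?thesis
  proof (rule P.submoduleI_smult)
    show "h ` K \<subseteq> carrier P" using K'(1) h'(1) by auto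
    show "\<zero>\<^bsub>P\<^esub> \<in> h ` K" using module_hom_zero[OF N P h] K'(2) by (metis imageI)
    show "u \<oplus>\<^bsub>P\<^esub> v \<in> h ` K" if "u \<in> h ` K" "v \<in> h ` K" for u v
      using that K'(3) h'(2) c by (auto simp: image_iff) metis
    show "a \<odot>\<^bsub>P\<^esub> u \<in> h ` K" if "a \<in> carrier R" "u \<in> h ` K" for a u
      using that smult by auto
  qed
qed

lemma submodule_hom_vimage:
  assumes N: "module R N" and P: "module R P" and h: "h \<in> module_hom R N P"
    and K: "submodule K R P"
  shows "submodule {x \<in> carrier N. h x \<in> K} R N"
proof -
  interpret N: plain_module R N using N by (rule plain_module.intro)
  interpret P: plain_module R P using P by (rule plain_module.intro)
  note K' = P.submoduleD[OF K] and h' = module_homD[OF h]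
  show ?thesis
    using K' h' module_hom_zero[OF N P h]
    by (intro N.submoduleI_smult) auto
qed

lemma submodule_inter:
  fixes N :: "('a, 'b) module"
  assumes "module R N" "submodule K R N" "submodule L R N"
  shows "submodule (K \<inter> L) R N"
proof -
  interpret N: plain_module R N using assms(1) by (rule plain_module.intro)
  show ?thesis
    using N.submoduleD[OF assms(2)] N.submoduleD[OF assms(3)]
    by (intro N.submoduleI_smult) auto
qed

lemma gen_submodule_hom_image:
  assumes N: "module R N" and P: "module R P" and h: "h \<in> module_hom R N P"
    and A: "A \<subseteq> carrier N"
  shows "gen_submodule R P (h ` A) = h ` gen_submodule R N A"
proof
  interpret N: plain_module R N using N by (rule plain_module.intro)
  interpret P: plain_module R P using P by (rule plain_module.intro)
  note G = N.submodule_gen_submodule[OF A]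
  show "gen_submodule R P (h ` A) \<subseteq> h ` gen_submodule R N A"
    using G(2) by (intro P.gen_submodule_minimal submodule_hom_image[OF N P h G(1)]) blast
  have c: "h ` A \<subseteq> carrier P" using A module_homD(1)[OF h] by auto
  note L = P.submodule_gen_submodule[OF c]
  have "gen_submodule R N A \<subseteq> {x \<in> carrier N. h x \<in> gen_submodule R P (h ` A)}"
    using L(2) A by (intro N.gen_submodule_minimal submodule_hom_vimage[OF N P h L(1)]) blast
  then show "h ` gen_submodule R N A \<subseteq> gen_submodule R P (h ` A)" by blast
qed

lemma (in plain_module) smult_hom: "a \<in> carrier R \<Longrightarrow> (\<lambda>x. a \<odot>\<^bsub>M\<^esub> x) \<in> module_hom R M M"
  by (intro module_homI) (auto simp: smult_r_distr smult_lcomm)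

lemma (in plain_module) minus_add_cancel:
  "x \<in> carrier M \<Longrightarrow> y \<in> carrier M \<Longrightarrow> (x \<ominus>\<^bsub>M\<^esub> y) \<oplus>\<^bsub>M\<^esub> y = x"
  by (simp add: a_minus_def M.a_assoc M.l_neg)

section \<open>Cohomology of an injective resolution\<close>

locale injective_resolution = noetherian_ring R + cring R for R :: "('a, 'm) ring_scheme" (structure) +
  fixes E :: "nat \<Rightarrow> ('a, 'e) module" and d :: "nat \<Rightarrow> 'e \<Rightarrow> 'e" and \<iota> :: "'a \<Rightarrow> 'e"
  assumes resolution: "right_resolution R (reg_module R) \<iota> E d"
    and injective: "injective_module R (E i)"
begin

lemma E_module: "module R (E i)"
  using resolution by (simp add: right_resolution_def)

sublocale E: plain_module R "E i" for i
  by (rule plain_module.intro[OF E_module])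

lemma d_hom: "d i \<in> module_hom R (E i) (E (Suc i))"
  using resolution by (simp add: right_resolution_def)

lemma d_closed: "x \<in> carrier (E i) \<Longrightarrow> d i x \<in> carrier (E (Suc i))"
  using module_homD(1)[OF d_hom] .

lemma d_smult: "a \<in> carrier R \<Longrightarrow> x \<in> carrier (E i) \<Longrightarrow> d i (a \<odot>\<^bsub>E i\<^esub> x) = a \<odot>\<^bsub>E (Suc i)\<^esub> d i x"
  using module_homD(3)[OF d_hom] .

lemma d_minus: "x \<in> carrier (E i) \<Longrightarrow> y \<in> carrier (E i) \<Longrightarrow>
    d i (x \<ominus>\<^bsub>E i\<^esub> y) = d i x \<ominus>\<^bsub>E (Suc i)\<^esub> d i y"
  using module_hom_minus[OF E_module E_module d_hom] .

lemma d_zero: "d i \<zero>\<^bsub>E i\<^esub> = \<zero>\<^bsub>E (Suc i)\<^esub>"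
  using module_hom_zero[OF E_module E_module d_hom] .

lemma d_exact: "d i ` carrier (E i) = {x \<in> carrier (E (Suc i)). d (Suc i) x = \<zero>\<^bsub>E (Suc (Suc i))\<^esub>}"
  using resolution by (simp add: right_resolution_def)

lemma d_d: "x \<in> carrier (E i) \<Longrightarrow> d (Suc i) (d i x) = \<zero>\<^bsub>E (Suc (Suc i))\<^esub>"
  using d_exact[of i] by blast

lemma \<iota>_hom: "\<iota> \<in> module_hom R (reg_module R) (E 0)"
  using resolution by (simp add: right_resolution_def)

lemma \<iota>_exact: "\<iota> ` carrier R = {x \<in> carrier (E 0). d 0 x = \<zero>\<^bsub>E 1\<^esub>}"
  using resolution by (simp add: right_resolution_def)

text \<open>\<open>cocycles i K / coboundaries i K\<close> is \<open>Ext\<^sup>i(R/K, R)\<close>.\<close>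

definition cocycles :: "nat \<Rightarrow> 'a set \<Rightarrow> 'e set" where
  "cocycles i K = {e \<in> annihilated (E i) K. d i e = \<zero>\<^bsub>E (Suc i)\<^esub>}"

definition coboundaries :: "nat \<Rightarrow> 'a set \<Rightarrow> 'e set" where
  "coboundaries i K = (case i of 0 \<Rightarrow> {\<zero>\<^bsub>E 0\<^esub>} | Suc j \<Rightarrow> d j ` annihilated (E j) K)"

text \<open>The localization of \<open>Ext\<^sup>i(R/K, R)\<close> at \<open>Q\<close> does not vanish.\<close>

definition ext_nonzero_at :: "nat \<Rightarrow> 'a set \<Rightarrow> 'a set \<Rightarrow> bool" where
  "ext_nonzero_at i K Q \<longleftrightarrow>
    (\<exists>z\<in>cocycles i K. \<forall>s\<in>carrier R - Q. s \<odot>\<^bsub>E i\<^esub> z \<notin> coboundaries i K)"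

text \<open>Exhibits zero as an annihilated part, so that the kernel of \<open>d\<close> and the
  coboundaries in degree 0 are covered by \<open>submodule_annihilated\<close>.\<close>

lemma zero_eq_annihilated: "{\<zero>\<^bsub>E i\<^esub>} = annihilated (E i) (carrier R)"
proof -
  have "x = \<zero>\<^bsub>E i\<^esub>" if "x \<in> annihilated (E i) (carrier R)" for x
  proof -
    have "\<one> \<odot>\<^bsub>E i\<^esub> x = \<zero>\<^bsub>E i\<^esub>" "x \<in> carrier (E i)"
      using that by (auto simp: annihilated_def simp del: E.smult_one)
    then show ?thesis by simp
  qed
  then show ?thesis by (auto simp: annihilated_def)
qed

lemma annihilated_mono: "K \<subseteq> K' \<Longrightarrow> annihilated (E i) K' \<subseteq> annihilated (E i) K"
  by (auto simp: annihilated_def)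

lemma annihilated_carrier: "annihilated (E i) K \<subseteq> carrier (E i)"
  by (auto simp: annihilated_def)

lemma cocycles_mono: "K \<subseteq> K' \<Longrightarrow> cocycles i K' \<subseteq> cocycles i K"
  using annihilated_mono[of K K' i] by (auto simp: cocycles_def)

lemma coboundaries_mono: "K \<subseteq> K' \<Longrightarrow> coboundaries i K' \<subseteq> coboundaries i K"
  by (auto simp: coboundaries_def split: nat.split dest: subsetD[OF annihilated_mono])

lemma d_annihilated:
  assumes "K \<subseteq> carrier R" "e \<in> annihilated (E i) K"
  shows "d i e \<in> annihilated (E (Suc i)) K"
proof -
  have "k \<odot>\<^bsub>E (Suc i)\<^esub> d i e = \<zero>\<^bsub>E (Suc i)\<^esub>" if "k \<in> K" for k
    using assms that d_smult[of k e i] by (auto simp: annihilated_def d_zero subset_iff)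
  then show ?thesis using assms d_closed by (auto simp: annihilated_def)
qed

lemma submodule_cocycles:
  assumes "K \<subseteq> carrier R"
  shows "submodule (cocycles i K) R (E i)"
proof -
  have "submodule {\<zero>\<^bsub>E (Suc i)\<^esub>} R (E (Suc i))"
    unfolding zero_eq_annihilated by (rule E.submodule_annihilated) simp
  then have "submodule (annihilated (E i) K \<inter> {x \<in> carrier (E i). d i x \<in> {\<zero>\<^bsub>E (Suc i)\<^esub>}}) R (E i)"
    by (intro submodule_inter[OF E_module] submodule_hom_vimage[OF E_module E_module d_hom]
        E.submodule_annihilated assms)
  moreover have "annihilated (E i) K \<inter> {x \<in> carrier (E i). d i x \<in> {\<zero>\<^bsub>E (Suc i)\<^esub>}} = cocycles i K"
    by (auto simp: cocycles_def annihilated_def)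
  ultimately show ?thesis by simp
qed

lemma submodule_coboundaries:
  assumes "K \<subseteq> carrier R"
  shows "submodule (coboundaries i K) R (E i)"
proof (cases i)
  case 0
  then show ?thesis
    using E.submodule_annihilated[of "carrier R" 0] zero_eq_annihilated[of 0]
    by (simp add: coboundaries_def)
next
  case (Suc j)
  then show ?thesis
    using submodule_hom_image[OF E_module E_module d_hom E.submodule_annihilated[OF assms]]
    by (simp add: coboundaries_def)
qed

lemma coboundaries_cocycles:
  assumes "K \<subseteq> carrier R"
  shows "coboundaries i K \<subseteq> cocycles i K"
proof (cases i)
  case 0
  then show ?thesis
    using E.submoduleD(2)[OF submodule_cocycles[OF assms]] by (simp add: coboundaries_def)
next
  case (Suc j)
  then show ?thesis
    using d_annihilated[OF assms] d_d annihilated_carrier[of j K]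
    by (auto simp: coboundaries_def cocycles_def)
qed

lemma coboundaries_Idl: "A \<subseteq> carrier R \<Longrightarrow> coboundaries i (Idl A) = coboundaries i A"
  by (auto simp: coboundaries_def E.annihilated_Idl split: nat.split)

lemma cocycles_Idl: "A \<subseteq> carrier R \<Longrightarrow> cocycles i (Idl A) = cocycles i A"
  by (auto simp: cocycles_def E.annihilated_Idl)

lemma ext_nonzero_at_Idl:
  "A \<subseteq> carrier R \<Longrightarrow> ext_nonzero_at i (Idl A) Q \<longleftrightarrow> ext_nonzero_at i A Q"
  by (simp add: ext_nonzero_at_def cocycles_Idl coboundaries_Idl)

section \<open>Exact sequences for R/(K : x), R/K and R/(K + Rx)\<close>

lemma smult_annihilated:
  assumes "ideal K R" "x \<in> carrier R" "e \<in> annihilated (E i) K"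
  shows "x \<odot>\<^bsub>E i\<^esub> e \<in> annihilated (E i) (ideal_quotient R K x)"
  using assms by (auto simp: annihilated_def ideal_quotient_def E.smult_assoc1[symmetric])

text \<open>By injectivity, multiplication by \<open>x\<close> maps Hom(R/K, E_j) onto Hom(R/(K :
  x), E_j), and it commutes with the differential.\<close>

lemma coboundaries_divisible:
  assumes K: "ideal K R" and x: "x \<in> carrier R" and b: "b \<in> coboundaries i (ideal_quotient R K x)"
  obtains b' where "b' \<in> coboundaries i K" "x \<odot>\<^bsub>E i\<^esub> b' = b"
proof (cases i)
  case 0
  then show ?thesis using b that[of "\<zero>\<^bsub>E 0\<^esub>"] x by (auto simp: coboundaries_def)
next
  case (Suc j)
  then obtain e where e: "e \<in> annihilated (E j) (ideal_quotient R K x)" "b = d j e"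
    using b by (auto simp: coboundaries_def)
  obtain e' where e': "e' \<in> annihilated (E j) K" "x \<odot>\<^bsub>E j\<^esub> e' = e"
    using injective_divisible[OF injective K x e(1)] .
  have "x \<odot>\<^bsub>E i\<^esub> d j e' = b"
    using d_smult[OF x, of e' j] e' e(2) Suc annihilated_carrier[of j K] by auto
  then show ?thesis using that[of "d j e'"] e'(1) Suc by (simp add: coboundaries_def)
qed

text \<open>The embedding of R/(K : x) into R/K has cokernel R/(K + Rx); the claim comes from
  exactness of the long Ext sequence at Ext^i(R/K, R), localized at \<open>Q\<close> and chased on
  elements.\<close>

lemma ext_nonzero_at_dichotomy:
  assumes K: "ideal K R" and x: "x \<in> carrier R" and Q: "primeideal Q R"
    and nz: "ext_nonzero_at i K Q"
  shows "ext_nonzero_at i (ideal_quotient R K x) Q \<or> ext_nonzero_at i (Idl (insert x K)) Q"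
proof (rule ccontr)
  note Kc = idealD(1)[OF K]
  have xK: "insert x K \<subseteq> carrier R" using Kc x by blast
  assume neg: "\<not> (ext_nonzero_at i (ideal_quotient R K x) Q \<or> ext_nonzero_at i (Idl (insert x K)) Q)"
  obtain z where z: "z \<in> cocycles i K" "\<And>s. s \<in> carrier R - Q \<Longrightarrow> s \<odot>\<^bsub>E i\<^esub> z \<notin> coboundaries i K"
    using nz by (auto simp: ext_nonzero_at_def)
  note Zs = E.submoduleD[OF submodule_cocycles[OF Kc, of i]]
  note Bs = E.submoduleD[OF submodule_coboundaries[OF Kc, of i]]
  have zc: "z \<in> carrier (E i)" using z(1) Zs(1) by blast
  have "x \<odot>\<^bsub>E i\<^esub> z \<in> cocycles i (ideal_quotient R K x)"
    using z(1) smult_annihilated[OF K x, of z i] Zs(5)[OF x z(1)] by (auto simp: cocycles_def)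
  then obtain s where s: "s \<in> carrier R - Q"
      "s \<odot>\<^bsub>E i\<^esub> (x \<odot>\<^bsub>E i\<^esub> z) \<in> coboundaries i (ideal_quotient R K x)"
    using neg by (auto simp: ext_nonzero_at_def)
  then obtain b where b: "b \<in> coboundaries i K" "x \<odot>\<^bsub>E i\<^esub> b = s \<odot>\<^bsub>E i\<^esub> (x \<odot>\<^bsub>E i\<^esub> z)"
    using coboundaries_divisible[OF K x] by blast
  have bZ: "b \<in> cocycles i K" and bc: "b \<in> carrier (E i)"
    using b(1) Bs(1) coboundaries_cocycles[OF Kc] by auto
  have sc: "s \<in> carrier R" using s by blast
  \<comment> \<open>Subtracting the coboundary \<open>b\<close> from s z gives an element killed by
    \<open>x\<close>, so \<open>y\<close> is a cocycle for K + Rx whose class over R/K is that of s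
    z.\<close>
  define y where "y = s \<odot>\<^bsub>E i\<^esub> z \<ominus>\<^bsub>E i\<^esub> b"
  have yZ: "y \<in> cocycles i K" unfolding y_def using Zs(4,5) z(1) bZ sc by blast
  have "x \<odot>\<^bsub>E i\<^esub> y = x \<odot>\<^bsub>E i\<^esub> (s \<odot>\<^bsub>E i\<^esub> z) \<ominus>\<^bsub>E i\<^esub> x \<odot>\<^bsub>E i\<^esub> b"
    unfolding y_def using module_hom_minus[OF E_module E_module E.smult_hom[OF x]] zc bc sc by simp
  also have "x \<odot>\<^bsub>E i\<^esub> (s \<odot>\<^bsub>E i\<^esub> z) = x \<odot>\<^bsub>E i\<^esub> b"
    unfolding b(2) using E.smult_lcomm[OF x sc zc] .
  finally have "x \<odot>\<^bsub>E i\<^esub> y = \<zero>\<^bsub>E i\<^esub>" using x bc by (simp add: a_minus_def E.M.r_neg)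
  then have "y \<in> cocycles i (insert x K)"
    using yZ by (auto simp: cocycles_def annihilated_def)
  then obtain t where t: "t \<in> carrier R - Q" "t \<odot>\<^bsub>E i\<^esub> y \<in> coboundaries i (insert x K)"
    using neg unfolding ext_nonzero_at_Idl[OF xK] by (auto simp: ext_nonzero_at_def)
  have tc: "t \<in> carrier R" using t by blast
  have "t \<odot>\<^bsub>E i\<^esub> y \<in> coboundaries i K" using t(2) coboundaries_mono[of K "insert x K"] by blast
  then have "t \<odot>\<^bsub>E i\<^esub> y \<oplus>\<^bsub>E i\<^esub> t \<odot>\<^bsub>E i\<^esub> b \<in> coboundaries i K"
    using Bs(3,5) b(1) tc by blast
  also have "t \<odot>\<^bsub>E i\<^esub> y \<oplus>\<^bsub>E i\<^esub> t \<odot>\<^bsub>E i\<^esub> b = t \<odot>\<^bsub>E i\<^esub> (y \<oplus>\<^bsub>E i\<^esub> b)"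
    using tc bc zc sc by (simp add: E.smult_r_distr y_def)
  also have "y \<oplus>\<^bsub>E i\<^esub> b = s \<odot>\<^bsub>E i\<^esub> z"
    unfolding y_def using sc zc bc by (intro E.minus_add_cancel) auto
  also have "t \<odot>\<^bsub>E i\<^esub> (s \<odot>\<^bsub>E i\<^esub> z) = (t \<otimes> s) \<odot>\<^bsub>E i\<^esub> z"
    using tc sc zc by (simp add: E.smult_assoc1)
  finally have "(t \<otimes> s) \<odot>\<^bsub>E i\<^esub> z \<in> coboundaries i K" .
  moreover have "t \<otimes> s \<in> carrier R - Q"
    using primeideal.I_prime[OF Q tc sc] s(1) t(1) by auto
  ultimately show False using z(2) by blast
qed

text \<open>\<open>K\<close> annihilates Ext^i(R/K, R), so no element of it can become a unit at
  \<open>Q\<close>.\<close>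

lemma ext_nonzero_at_subset:
  assumes K: "K \<subseteq> carrier R" and nz: "ext_nonzero_at i K Q"
  shows "K \<subseteq> Q"
proof
  fix k assume k: "k \<in> K"
  obtain z where z: "z \<in> cocycles i K" "\<And>s. s \<in> carrier R - Q \<Longrightarrow> s \<odot>\<^bsub>E i\<^esub> z \<notin> coboundaries i K"
    using nz by (auto simp: ext_nonzero_at_def)
  have "k \<odot>\<^bsub>E i\<^esub> z = \<zero>\<^bsub>E i\<^esub>" using z(1) k by (auto simp: cocycles_def annihilated_def)
  then have "k \<odot>\<^bsub>E i\<^esub> z \<in> coboundaries i K"
    using E.submoduleD(2)[OF submodule_coboundaries[OF K]] by simp
  then show "k \<in> Q" using z(2) k K by blast
qed

text \<open>Noetherian induction in place of a prime filtration: if a proper \<open>K\<close> is not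
  prime, some x and y outside it have their product inside, both (K : x) and K + Rx are strictly
  larger, and one of them inherits the nonvanishing.\<close>

lemma ext_nonzero_at_prime:
  assumes K: "ideal K R" and Q: "primeideal Q R" and "ext_nonzero_at i K Q"
  shows "\<exists>P. primeideal P R \<and> K \<subseteq> P \<and> P \<subseteq> Q \<and> ext_nonzero_at i P Q"
  using assms(1,3)
proof (induction K rule: noetherian_induct)
  case (step K)
  note Kc = idealD(1)[OF step.hyps]
  have KQ: "K \<subseteq> Q" using ext_nonzero_at_subset[OF Kc step.prems] .
  show ?case
  proof (cases "primeideal K R")
    case True
    then show ?thesis using KQ step.prems by blast
  next
    case False
    have "K \<noteq> carrier R"
      using KQ primeideal.I_notcarr[OF Q] idealD(1)[OF primeideal.axioms(1)[OF Q]] by blast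
    have "\<exists>x y. x \<in> carrier R \<and> y \<in> carrier R \<and> x \<otimes> y \<in> K \<and> x \<notin> K \<and> y \<notin> K"
    proof (rule ccontr)
      assume "\<not> ?thesis"
      with \<open>K \<noteq> carrier R\<close> have "primeideal K R"
        by (intro primeidealI[OF step.hyps is_cring]) auto
      with False show False ..
    qed
    then obtain x y where xy: "x \<in> carrier R" "y \<in> carrier R" "x \<otimes> y \<in> K" "x \<notin> K" "y \<notin> K"
      by blast
    have "y \<in> ideal_quotient R K x"
      unfolding ideal_quotient_def using xy(2,3) m_comm[OF xy(2,1)] by simp
    then have sub: "K \<subset> ideal_quotient R K x" "ideal (ideal_quotient R K x) R"
      using ideal_ideal_quotient[OF step.hyps xy(1)] xy(5) by blast+
    have xK: "insert x K \<subseteq> carrier R" using xy Kc by blast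
    have sub': "K \<subset> Idl (insert x K)" "ideal (Idl (insert x K)) R"
      using genideal_self[OF xK] genideal_ideal[OF xK] xy(4) by blast+
    from ext_nonzero_at_dichotomy[OF step.hyps xy(1) Q step.prems]
    obtain K' where "K \<subset> K'" "ideal K' R" "ext_nonzero_at i K' Q"
      using sub sub' by blast
    then show ?thesis using step.IH[of K'] by blast
  qed
qed

section \<open>Finite generation of the Ext modules\<close>

text \<open>The exact sequence
  \<open>Ext\<^sup>i\<^sup>-\<^sup>1(R/(K:x), R) \<rightarrow> Ext\<^sup>i(R/(K + Rx), R) \<rightarrow> Ext\<^sup>i(R/K, R)\<close>, started at
  \<open>K = 0\<close>, shows that these modules are Noetherian.\<close>

definition ext_noetherian :: "nat \<Rightarrow> 'a set \<Rightarrow> bool" where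
  "ext_noetherian i K \<longleftrightarrow> (\<forall>W. submodule W R (E i) \<and> coboundaries i K \<subseteq> W \<and> W \<subseteq> cocycles i K \<longrightarrow>
    (\<exists>A\<subseteq>W. finite A \<and> W = gen_submodule R (E i) (coboundaries i K \<union> A)))"

text \<open>The empty set stands for the zero ideal. Exactness of the resolution makes Ext^i(R, R)
  zero for i > 0; for i = 0 the cocycles are the image of R under \<iota>, and \<open>W\<close>
  comes from a finitely generated ideal.\<close>

lemma ext_noetherian_empty: "ext_noetherian i {}"
  unfolding ext_noetherian_def
proof (intro allI impI, elim conjE)
  fix W assume W: "submodule W R (E i)" "coboundaries i {} \<subseteq> W" "W \<subseteq> cocycles i {}"
  note Ws = E.submoduleD[OF W(1)]
  show "\<exists>A\<subseteq>W. finite A \<and> W = gen_submodule R (E i) (coboundaries i {} \<union> A)"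
  proof (cases i)
    case (Suc j)
    have "cocycles i {} \<subseteq> coboundaries i {}"
      using Suc d_exact[of j] by (auto simp: cocycles_def coboundaries_def annihilated_def)
    then have "W = coboundaries i {}" using W by blast
    then show ?thesis using E.gen_submodule_of_submodule[OF W(1)] by (intro exI[of _ "{}"]) auto
  next
    case 0
    interpret S: plain_module R "reg_module R" by (rule plain_module.intro[OF reg_module_module])
    note W0 = W[unfolded 0] and Ws0 = Ws[unfolded 0]
    define U where "U = {a \<in> carrier R. \<iota> a \<in> W}"
    have U: "ideal U R"
      unfolding U_def
      using Ws0 module_homD[OF \<iota>_hom] module_hom_zero[OF S.module_axioms E_module \<iota>_hom]
      by (intro idealI_simple) auto
    then obtain A where A: "A \<subseteq> carrier R" "finite A" "U = Idl A"
      using finetely_gen by blast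
    have AU: "A \<subseteq> U" unfolding A(3) by (rule genideal_self[OF A(1)])
    then have AW: "\<iota> ` A \<subseteq> W" by (auto simp: U_def)
    have c: "coboundaries 0 {} \<union> \<iota> ` A \<subseteq> carrier (E 0)" using W0(2) AW Ws0(1) by blast
    note G = E.submodule_gen_submodule[OF c]
    note Gs = E.submoduleD[OF G(1)]
    have "ideal {a \<in> carrier R. \<iota> a \<in> gen_submodule R (E 0) (coboundaries 0 {} \<union> \<iota> ` A)} R"
      using Gs module_homD[OF \<iota>_hom] module_hom_zero[OF S.module_axioms E_module \<iota>_hom]
      by (intro idealI_simple) auto
    moreover have "A \<subseteq> {a \<in> carrier R. \<iota> a \<in> gen_submodule R (E 0) (coboundaries 0 {} \<union> \<iota> ` A)}"
      using G(2) A(1) by blast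
    ultimately have UG: "U \<subseteq> {a \<in> carrier R. \<iota> a \<in> gen_submodule R (E 0) (coboundaries 0 {} \<union> \<iota> ` A)}"
      unfolding A(3) by (rule genideal_minimal)
    have "W = gen_submodule R (E 0) (coboundaries 0 {} \<union> \<iota> ` A)"
    proof
      show "W \<subseteq> gen_submodule R (E 0) (coboundaries 0 {} \<union> \<iota> ` A)"
      proof
        fix w assume w: "w \<in> W"
        then have "w \<in> \<iota> ` carrier R"
          using W0(3) \<iota>_exact by (auto simp: cocycles_def annihilated_def)
        then show "w \<in> gen_submodule R (E 0) (coboundaries 0 {} \<union> \<iota> ` A)"
          using UG w by (auto simp: U_def)
      qed
      show "gen_submodule R (E 0) (coboundaries 0 {} \<union> \<iota> ` A) \<subseteq> W"
        using W0 AW by (intro E.gen_submodule_minimal) auto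
    qed
    then show ?thesis using AW A(2) 0 by (intro exI[of _ "\<iota> ` A"]) simp
  qed
qed

text \<open>With K generated by \<open>A\<close>, the image of \<open>W\<close> in Ext^i(R/K, R) is
  finitely generated by \<open>fA\<close>; the part of \<open>W\<close> that dies there comes from
  Ext^(i-1)(R/(K : x), R) and is handled by \<open>prev\<close>.\<close>

lemma ext_noetherian_insert:
  assumes A: "A \<subseteq> carrier R" and x: "x \<in> carrier R" and fA: "ext_noetherian i A"
    and prev: "\<And>j. i = Suc j \<Longrightarrow> ext_noetherian j (ideal_quotient R (Idl A) x)"
  shows "ext_noetherian i (insert x A)"
  unfolding ext_noetherian_def
proof (intro allI impI, elim conjE)
  fix W assume W: "submodule W R (E i)" "coboundaries i (insert x A) \<subseteq> W" "W \<subseteq> cocycles i (insert x A)"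
  note Ws = E.submoduleD[OF W(1)]
  note Bsub = submodule_coboundaries[OF A, of i]
  note Bs = E.submoduleD[OF Bsub]
  note Zs = E.submoduleD[OF submodule_cocycles[OF A, of i]]
  have xA: "insert x A \<subseteq> carrier R" using x A by blast
  note B1sub = submodule_coboundaries[OF xA, of i]
  \<comment> \<open>The image of \<open>W\<close> in Ext^i(R/K, R), kept as a submodule of
    \<open>E i\<close> that contains the coboundaries.\<close>
  define V where "V = {w \<oplus>\<^bsub>E i\<^esub> b | w b. w \<in> W \<and> b \<in> coboundaries i A}"
  have V: "submodule V R (E i)" unfolding V_def by (rule E.submodule_sum[OF W(1) Bsub])
  have BV: "coboundaries i A \<subseteq> V"
  proof
    fix b assume b: "b \<in> coboundaries i A"
    then have "b = \<zero>\<^bsub>E i\<^esub> \<oplus>\<^bsub>E i\<^esub> b" using Bs(1) by auto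
    then show "b \<in> V" unfolding V_def using b Ws(2) by blast
  qed
  have WZ: "W \<subseteq> cocycles i A" using W(3) cocycles_mono[of A "insert x A" i] by blast
  have VZ: "V \<subseteq> cocycles i A"
    unfolding V_def using WZ Zs(3) coboundaries_cocycles[OF A, of i] by blast
  obtain F where F: "F \<subseteq> V" "finite F" "V = gen_submodule R (E i) (coboundaries i A \<union> F)"
    using fA V BV VZ unfolding ext_noetherian_def by blast
  have "\<forall>f\<in>F. \<exists>w\<in>W. \<exists>b\<in>coboundaries i A. f = w \<oplus>\<^bsub>E i\<^esub> b" using F(1) unfolding V_def by blast
  then obtain g where g: "\<And>f. f \<in> F \<Longrightarrow> g f \<in> W \<and> (\<exists>b\<in>coboundaries i A. f = g f \<oplus>\<^bsub>E i\<^esub> b)"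
    by metis
  define F' where "F' = g ` F"
  have F': "F' \<subseteq> W" "finite F'" using g F(2) by (auto simp: F'_def)
  have F'c: "F' \<subseteq> carrier (E i)" using F'(1) Ws(1) by blast
  have decomp: "\<exists>b\<in>coboundaries i A \<inter> W. \<exists>v\<in>gen_submodule R (E i) F'. w = b \<oplus>\<^bsub>E i\<^esub> v" if w: "w \<in> W" for w
  proof -
    have c: "coboundaries i A \<union> F' \<subseteq> carrier (E i)" using Bs(1) F'c by blast
    note G = E.submodule_gen_submodule[OF c]
    have "F \<subseteq> gen_submodule R (E i) (coboundaries i A \<union> F')"
    proof
      fix f assume f: "f \<in> F"
      obtain b where b: "b \<in> coboundaries i A" "f = g f \<oplus>\<^bsub>E i\<^esub> b" using g[OF f] by blast
      have "g f \<in> gen_submodule R (E i) (coboundaries i A \<union> F')" using f G(2) by (auto simp: F'_def)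
      moreover have "b \<in> gen_submodule R (E i) (coboundaries i A \<union> F')" using b(1) G(2) by blast
      ultimately show "f \<in> gen_submodule R (E i) (coboundaries i A \<union> F')"
        by (subst b(2)) (rule E.submoduleD(3)[OF G(1)])
    qed
    then have "V \<subseteq> gen_submodule R (E i) (coboundaries i A \<union> F')"
      unfolding F(3) using G by (intro E.gen_submodule_minimal) blast+
    moreover have "w \<in> V"
    proof -
      have "w = w \<oplus>\<^bsub>E i\<^esub> \<zero>\<^bsub>E i\<^esub>" using w Ws(1) by auto
      then show ?thesis unfolding V_def using w Bs(2) by blast
    qed
    ultimately obtain b v where bv: "b \<in> coboundaries i A" "v \<in> gen_submodule R (E i) F'" "w = b \<oplus>\<^bsub>E i\<^esub> v"
      unfolding E.gen_submodule_Un[OF Bsub F'c] by blast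
    have vW: "v \<in> W" using bv(2) E.gen_submodule_minimal[OF W(1) F'(1)] by blast
    have bc: "b \<in> carrier (E i)" "v \<in> carrier (E i)" using bv(1) Bs(1) vW Ws(1) by auto
    have "b = w \<ominus>\<^bsub>E i\<^esub> v" unfolding bv(3) using bc by (simp add: a_minus_def E.M.a_assoc E.M.r_neg)
    then have "b \<in> W" using w vW Ws(4) by blast
    then show ?thesis using bv by blast
  qed
  have "\<exists>G\<subseteq>W. finite G \<and> coboundaries i A \<inter> W \<subseteq> gen_submodule R (E i) (coboundaries i (insert x A) \<union> G)"
  proof (cases i)
    case 0
    have "coboundaries i A \<inter> W \<subseteq> coboundaries i (insert x A) \<union> {}" by (simp add: 0 coboundaries_def)
    also have "\<dots> \<subseteq> gen_submodule R (E i) (coboundaries i (insert x A) \<union> {})"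
      by (rule E.submodule_gen_submodule(2)) (use E.submoduleD(1)[OF B1sub] in simp)
    finally show ?thesis by blast
  next
    case (Suc j)
    let ?I = "Idl A"
    let ?Q = "ideal_quotient R ?I x"
    have I: "ideal ?I R" by (rule genideal_ideal[OF A])
    have Qc: "?Q \<subseteq> carrier R" by (auto simp: ideal_quotient_def)
    have annI: "annihilated (E k) ?I = annihilated (E k) A" for k by (rule E.annihilated_Idl[OF A])
    \<comment> \<open>Preimage of \<open>W\<close> under the connecting map: a cocycle for (K : x)
      has the form x e with e in Hom(R/K, E_j), and the connecting map sends it to d e.
      \<open>W'\<close> collects these x e.\<close>
    define D where "D = annihilated (E j) A \<inter> {e \<in> carrier (E j). d j e \<in> W}"
    have D: "submodule D R (E j)"
      unfolding D_def using W(1) Suc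
      by (intro submodule_inter[OF E_module] E.submodule_annihilated A
          submodule_hom_vimage[OF E_module E_module d_hom]) simp
    note Ds = E.submoduleD[OF D]
    define W' where "W' = (\<lambda>e. x \<odot>\<^bsub>E j\<^esub> e) ` D"
    have W'1: "submodule W' R (E j)"
      unfolding W'_def by (rule submodule_hom_image[OF E_module E_module E.smult_hom[OF x] D])
    have W'2: "coboundaries j ?Q \<subseteq> W'"
    proof
      fix b assume "b \<in> coboundaries j ?Q"
      then obtain b' where b': "b' \<in> coboundaries j ?I" "x \<odot>\<^bsub>E j\<^esub> b' = b"
        using coboundaries_divisible[OF I x] by blast
      have "b' \<in> cocycles j ?I" using b'(1) coboundaries_cocycles[OF idealD(1)[OF I]] by blast
      then have "b' \<in> D" using Ws(2) Suc annihilated_carrier[of j A] by (auto simp: D_def cocycles_def annI)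
      then show "b \<in> W'" using b'(2) by (auto simp: W'_def)
    qed
    have W'3: "W' \<subseteq> cocycles j ?Q"
    proof
      fix w assume "w \<in> W'"
      then obtain e where e: "e \<in> D" "w = x \<odot>\<^bsub>E j\<^esub> e" by (auto simp: W'_def)
      have ec: "e \<in> carrier (E j)" using e(1) Ds(1) by blast
      have "w \<in> annihilated (E j) ?Q"
        unfolding e(2) using e(1) smult_annihilated[OF I x, of e j] by (simp add: D_def annI)
      moreover have "d j w = x \<odot>\<^bsub>E i\<^esub> d j e" unfolding e(2) Suc by (rule d_smult[OF x ec])
      moreover have "x \<odot>\<^bsub>E i\<^esub> d j e = \<zero>\<^bsub>E i\<^esub>"
        using e(1) W(3) by (auto simp: D_def cocycles_def annihilated_def)
      ultimately show "w \<in> cocycles j ?Q" using Suc by (simp add: cocycles_def)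
    qed
    obtain G where G: "G \<subseteq> W'" "finite G" "W' = gen_submodule R (E j) (coboundaries j ?Q \<union> G)"
      using prev[OF Suc] W'1 W'2 W'3 unfolding ext_noetherian_def by blast
    have Gc: "G \<subseteq> carrier (E j)" using G(1) E.submoduleD(1)[OF W'1] by blast
    obtain H where H: "H \<subseteq> D" "finite H" "G = (\<lambda>e. x \<odot>\<^bsub>E j\<^esub> e) ` H"
      using finite_subset_image[OF G(2) G(1)[unfolded W'_def]] by blast
    have Hc: "H \<subseteq> carrier (E j)" using H(1) Ds(1) by blast
    define G' where "G' = d j ` H"
    have G'W: "G' \<subseteq> W" using H(1) by (auto simp: G'_def D_def)
    have c: "coboundaries i (insert x A) \<union> G' \<subseteq> carrier (E i)" using W(2) G'W Ws(1) by blast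
    have G'c: "G' \<subseteq> carrier (E i)" using c by blast
    have "u \<in> gen_submodule R (E i) (coboundaries i (insert x A) \<union> G')"
      if u: "u \<in> coboundaries i A" "u \<in> W" for u
    proof -
      obtain e where e: "e \<in> annihilated (E j) A" "u = d j e"
        using u(1) Suc by (auto simp: coboundaries_def)
      have eD: "e \<in> D" using e u(2) annihilated_carrier by (auto simp: D_def)
      then have "x \<odot>\<^bsub>E j\<^esub> e \<in> gen_submodule R (E j) (coboundaries j ?Q \<union> G)"
        unfolding G(3)[symmetric] by (auto simp: W'_def)
      then obtain b v where bv: "b \<in> coboundaries j ?Q" "v \<in> gen_submodule R (E j) G"
        "x \<odot>\<^bsub>E j\<^esub> e = b \<oplus>\<^bsub>E j\<^esub> v"
        unfolding E.gen_submodule_Un[OF submodule_coboundaries[OF Qc] Gc] by blast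
      obtain b' where b': "b' \<in> coboundaries j ?I" "x \<odot>\<^bsub>E j\<^esub> b' = b"
        using coboundaries_divisible[OF I x bv(1)] by blast
      obtain v' where v': "v' \<in> gen_submodule R (E j) H" "v = x \<odot>\<^bsub>E j\<^esub> v'"
        using bv(2) unfolding H(3) gen_submodule_hom_image[OF E_module E_module E.smult_hom[OF x] Hc] by blast
      have b'Z: "b' \<in> cocycles j A"
        using b'(1) coboundaries_cocycles[OF idealD(1)[OF I], of j] cocycles_Idl[OF A, of j] by blast
      have v'D: "v' \<in> D" using v'(1) E.gen_submodule_minimal[OF D H(1)] by blast
      have cc: "e \<in> carrier (E j)" "b' \<in> carrier (E j)" "v' \<in> carrier (E j)"
        using e(1) b'Z v'D Ds(1) by (auto simp: cocycles_def annihilated_def)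
      \<comment> \<open>The equation x e = x (b' + v') makes \<open>x\<close> kill \<open>y\<close>,
        so d y is a coboundary for K + Rx. As d b' = 0, what remains of u = d e is d v', which is
        generated by the finitely many elements of \<open>G'\<close>.\<close>
      define y where "y = e \<ominus>\<^bsub>E j\<^esub> (b' \<oplus>\<^bsub>E j\<^esub> v')"
      have yc: "y \<in> carrier (E j)" unfolding y_def using cc by simp
      note As = E.submoduleD[OF E.submodule_annihilated[OF A, of j]]
      have "y \<in> annihilated (E j) A"
        unfolding y_def using As(3,4) e(1) b'Z v'D by (simp add: cocycles_def D_def)
      moreover have "x \<odot>\<^bsub>E j\<^esub> y = \<zero>\<^bsub>E j\<^esub>"
      proof -
        have "x \<odot>\<^bsub>E j\<^esub> y = x \<odot>\<^bsub>E j\<^esub> e \<ominus>\<^bsub>E j\<^esub> x \<odot>\<^bsub>E j\<^esub> (b' \<oplus>\<^bsub>E j\<^esub> v')"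
          unfolding y_def using module_hom_minus[OF E_module E_module E.smult_hom[OF x]] cc by simp
        also have "x \<odot>\<^bsub>E j\<^esub> (b' \<oplus>\<^bsub>E j\<^esub> v') = x \<odot>\<^bsub>E j\<^esub> e"
          unfolding bv(3) b'(2)[symmetric] v'(2) using x cc by (simp add: E.smult_r_distr)
        finally show ?thesis using x cc by (simp add: a_minus_def E.M.r_neg)
      qed
      ultimately have "y \<in> annihilated (E j) (insert x A)" by (auto simp: annihilated_def)
      then have dy: "d j y \<in> coboundaries i (insert x A)" using Suc by (auto simp: coboundaries_def)
      have dv': "d j v' \<in> gen_submodule R (E i) G'"
        unfolding G'_def Suc gen_submodule_hom_image[OF E_module E_module d_hom Hc] using v'(1) by blast
      have "d j b' = \<zero>\<^bsub>E i\<^esub>" using b'Z Suc by (simp add: cocycles_def)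
      then have "d j (b' \<oplus>\<^bsub>E j\<^esub> v') = d j v'"
        using module_homD(2)[OF d_hom cc(2,3)] Suc d_closed[OF cc(3)] by simp
      then have "d j y = d j e \<ominus>\<^bsub>E i\<^esub> d j v'"
        unfolding y_def using d_minus[of e j "b' \<oplus>\<^bsub>E j\<^esub> v'"] cc Suc by simp
      then have "u = d j y \<oplus>\<^bsub>E i\<^esub> d j v'"
        unfolding e(2) using E.minus_add_cancel[of "d j e" i "d j v'"] d_closed[OF cc(1)] d_closed[OF cc(3)] Suc
        by simp
      then show ?thesis
        unfolding E.gen_submodule_Un[OF B1sub G'c] using dy dv' by blast
    qed
    then show ?thesis using G'W H(2) by (intro exI[of _ G']) (auto simp: G'_def)
  qed
  then obtain G where G: "G \<subseteq> W" "finite G"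
    "coboundaries i A \<inter> W \<subseteq> gen_submodule R (E i) (coboundaries i (insert x A) \<union> G)" by blast
  have c: "coboundaries i (insert x A) \<union> (F' \<union> G) \<subseteq> carrier (E i)" "coboundaries i (insert x A) \<union> G \<subseteq> carrier (E i)"
    using W(2) F'(1) G(1) Ws(1) by blast+
  note L = E.submodule_gen_submodule[OF c(1)] and L2 = E.submodule_gen_submodule[OF c(2)]
  have "gen_submodule R (E i) (coboundaries i (insert x A) \<union> G)
      \<subseteq> gen_submodule R (E i) (coboundaries i (insert x A) \<union> (F' \<union> G))"
    using L(2) by (intro E.gen_submodule_minimal[OF L(1)]) blast
  moreover have "gen_submodule R (E i) F' \<subseteq> gen_submodule R (E i) (coboundaries i (insert x A) \<union> (F' \<union> G))"
    using L(2) by (intro E.gen_submodule_minimal[OF L(1)]) blast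
  ultimately have "W \<subseteq> gen_submodule R (E i) (coboundaries i (insert x A) \<union> (F' \<union> G))"
    using decomp G(3) E.submoduleD(3)[OF L(1)] by blast
  moreover have "gen_submodule R (E i) (coboundaries i (insert x A) \<union> (F' \<union> G)) \<subseteq> W"
    using W(2) F'(1) G(1) by (intro E.gen_submodule_minimal[OF W(1)]) blast
  ultimately show "\<exists>A'\<subseteq>W. finite A' \<and> W = gen_submodule R (E i) (coboundaries i (insert x A) \<union> A')"
    using F' G(1,2) by (intro exI[of _ "F' \<union> G"]) auto
qed

text \<open>Colon ideals occur in the step from degree j to j + 1, hence the induction on the degree
  over all ideals at once, with an inner induction over generators.\<close>

lemma ext_noetherian: "ideal K R \<Longrightarrow> ext_noetherian i K"
proof (induction i arbitrary: K)
  case (0 K)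
  then obtain A where A: "A \<subseteq> carrier R" "finite A" "K = Idl A" using finetely_gen by blast
  from A(2,1) have "ext_noetherian 0 A"
    by (induction A) (auto intro: ext_noetherian_empty ext_noetherian_insert)
  then show ?case using A by (simp add: ext_noetherian_def cocycles_Idl coboundaries_Idl)
next
  case (Suc j K)
  then obtain A where A: "A \<subseteq> carrier R" "finite A" "K = Idl A" using finetely_gen by blast
  from A(2,1) have "ext_noetherian (Suc j) A"
    by (induction A) (auto intro!: ext_noetherian_empty ext_noetherian_insert Suc.IH ideal_ideal_quotient genideal_ideal)
  then show ?case using A by (simp add: ext_noetherian_def cocycles_Idl coboundaries_Idl)
qed

end

section \<open>Nonvanishing of localized Ext along primes\<close>

context injective_resolution
begin

text \<open>The connecting map sends z = x e to d e. If its target vanishes at \<open>Q\<close>,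
  then s d e = d e' for some \<open>e'\<close> killed by \<open>x\<close>, and s e - e' is a cocycle
  that lifts s z.\<close>

lemma ext_lift_quotient:
  assumes K: "ideal K R" and x: "x \<in> carrier R" and Q: "primeideal Q R"
    and z: "z \<in> cocycles i (ideal_quotient R K x)"
    and vanish: "\<not> ext_nonzero_at (Suc i) (Idl (insert x K)) Q"
  shows "\<exists>s\<in>carrier R - Q. \<exists>y\<in>cocycles i K. x \<odot>\<^bsub>E i\<^esub> y = s \<odot>\<^bsub>E i\<^esub> z"
proof -
  note Kc = idealD(1)[OF K]
  have xK: "insert x K \<subseteq> carrier R" using Kc x by blast
  have "z \<in> annihilated (E i) (ideal_quotient R K x)" using z by (simp add: cocycles_def)
  then obtain e where e: "e \<in> annihilated (E i) K" "x \<odot>\<^bsub>E i\<^esub> e = z"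
    using injective_divisible[OF injective K x] by blast
  have ec: "e \<in> carrier (E i)" using e(1) annihilated_carrier[of i K] by blast
  have "x \<odot>\<^bsub>E (Suc i)\<^esub> d i e = \<zero>\<^bsub>E (Suc i)\<^esub>"
    using z e(2) d_smult[OF x ec] by (simp add: cocycles_def)
  then have "d i e \<in> cocycles (Suc i) (insert x K)"
    using d_annihilated[OF Kc e(1)] d_d[OF ec] by (auto simp: cocycles_def annihilated_def)
  then obtain s where s: "s \<in> carrier R - Q" "s \<odot>\<^bsub>E (Suc i)\<^esub> d i e \<in> coboundaries (Suc i) (insert x K)"
    using vanish unfolding ext_nonzero_at_Idl[OF xK] by (auto simp: ext_nonzero_at_def)
  then obtain e' where e': "e' \<in> annihilated (E i) (insert x K)" "s \<odot>\<^bsub>E (Suc i)\<^esub> d i e = d i e'"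
    by (auto simp: coboundaries_def)
  have e'c: "e' \<in> carrier (E i)" using e'(1) annihilated_carrier[of i "insert x K"] by blast
  have e'K: "e' \<in> annihilated (E i) K" using e'(1) by (simp add: annihilated_def)
  have sc: "s \<in> carrier R" using s by blast
  note As = E.submoduleD[OF E.submodule_annihilated[OF Kc, of i]]
  define y where "y = s \<odot>\<^bsub>E i\<^esub> e \<ominus>\<^bsub>E i\<^esub> e'"
  have "y \<in> annihilated (E i) K" unfolding y_def using As(4,5) e(1) e'K sc by blast
  moreover have "d i y = \<zero>\<^bsub>E (Suc i)\<^esub>"
    unfolding y_def using d_minus[of "s \<odot>\<^bsub>E i\<^esub> e" i e'] d_smult[OF sc ec] e'(2) sc ec e'c
    by (simp add: d_closed a_minus_def E.M.r_neg)
  ultimately have "y \<in> cocycles i K" by (simp add: cocycles_def)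
  moreover have "x \<odot>\<^bsub>E i\<^esub> y = s \<odot>\<^bsub>E i\<^esub> z"
  proof -
    have "x \<odot>\<^bsub>E i\<^esub> y = x \<odot>\<^bsub>E i\<^esub> (s \<odot>\<^bsub>E i\<^esub> e) \<ominus>\<^bsub>E i\<^esub> x \<odot>\<^bsub>E i\<^esub> e'"
      unfolding y_def using module_hom_minus[OF E_module E_module E.smult_hom[OF x]] ec e'c sc by simp
    also have "x \<odot>\<^bsub>E i\<^esub> e' = \<zero>\<^bsub>E i\<^esub>" using e'(1) by (simp add: annihilated_def)
    also have "x \<odot>\<^bsub>E i\<^esub> (s \<odot>\<^bsub>E i\<^esub> e) = s \<odot>\<^bsub>E i\<^esub> z"
      unfolding e(2)[symmetric] using E.smult_lcomm[OF x sc ec] .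
    finally show ?thesis using sc x ec unfolding e(2)[symmetric] by (simp add: a_minus_def)
  qed
  ultimately show ?thesis using s(1) by blast
qed

text \<open>Exactness of the localized sequence at Ext^i(R/(K : x), R): if the Ext module in degree
  i + 1 vanishes at \<open>Q\<close>, a class lifts to Ext^i(R/K, R), and if that vanishes too, so
  does the class.\<close>

lemma ext_nonzero_at_quotient:
  assumes K: "ideal K R" and x: "x \<in> carrier R" and Q: "primeideal Q R"
    and nz: "ext_nonzero_at i (ideal_quotient R K x) Q"
  shows "ext_nonzero_at i K Q \<or> ext_nonzero_at (Suc i) (Idl (insert x K)) Q"
proof (rule ccontr)
  assume neg: "\<not> ?thesis"
  note Kc = idealD(1)[OF K]
  note Bs = E.submoduleD[OF submodule_coboundaries[of "ideal_quotient R K x" i]]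
  have Qc: "ideal_quotient R K x \<subseteq> carrier R" by (auto simp: ideal_quotient_def)
  obtain z where z: "z \<in> cocycles i (ideal_quotient R K x)"
    "\<And>s. s \<in> carrier R - Q \<Longrightarrow> s \<odot>\<^bsub>E i\<^esub> z \<notin> coboundaries i (ideal_quotient R K x)"
    using nz by (auto simp: ext_nonzero_at_def)
  have zc: "z \<in> carrier (E i)" using z(1) E.submoduleD(1)[OF submodule_cocycles[OF Qc]] by blast
  obtain s y where s: "s \<in> carrier R - Q" "y \<in> cocycles i K" "x \<odot>\<^bsub>E i\<^esub> y = s \<odot>\<^bsub>E i\<^esub> z"
    using ext_lift_quotient[OF K x Q z(1)] neg by blast
  obtain t where t: "t \<in> carrier R - Q" "t \<odot>\<^bsub>E i\<^esub> y \<in> coboundaries i K"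
    using neg s(2) by (auto simp: ext_nonzero_at_def)
  have c: "s \<in> carrier R" "t \<in> carrier R" "y \<in> carrier (E i)"
    using s t E.submoduleD(1)[OF submodule_cocycles[OF Kc]] by blast+
  have "x \<odot>\<^bsub>E i\<^esub> (t \<odot>\<^bsub>E i\<^esub> y) \<in> coboundaries i (ideal_quotient R K x)"
  proof (cases i)
    case 0
    then show ?thesis using t(2) x by (simp add: coboundaries_def)
  next
    case (Suc j)
    then obtain e where e: "e \<in> annihilated (E j) K" "t \<odot>\<^bsub>E i\<^esub> y = d j e"
      using t(2) by (auto simp: coboundaries_def)
    have "x \<odot>\<^bsub>E i\<^esub> d j e = d j (x \<odot>\<^bsub>E j\<^esub> e)"
      using d_smult[OF x, of e j] e(1) Suc annihilated_carrier[of j K] by auto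
    then show ?thesis
      using smult_annihilated[OF K x e(1)] Suc e(2) by (auto simp: coboundaries_def)
  qed
  also have "x \<odot>\<^bsub>E i\<^esub> (t \<odot>\<^bsub>E i\<^esub> y) = t \<odot>\<^bsub>E i\<^esub> (s \<odot>\<^bsub>E i\<^esub> z)"
    unfolding s(3)[symmetric] using E.smult_lcomm[OF x c(2,3)] .
  also have "\<dots> = (t \<otimes> s) \<odot>\<^bsub>E i\<^esub> z" using E.smult_assoc1[OF c(2,1) zc] by simp
  finally have "(t \<otimes> s) \<odot>\<^bsub>E i\<^esub> z \<in> coboundaries i (ideal_quotient R K x)" .
  moreover have "t \<otimes> s \<in> carrier R - Q"
    using primeideal.I_prime[OF Q c(2,1)] s(1) t(1) c by auto
  ultimately show False using z(2) by blast
qed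

text \<open>If this localization vanished, multiplication by \<open>x\<close> would be surjective on the finitely
  generated module \<open>Ext\<^sup>i(R/P, R)\<close> localized at \<open>Q\<close>, contradicting Nakayama's lemma.\<close>

lemma ext_nonzero_at_Suc:
  assumes P: "primeideal P R" and Q: "primeideal Q R" and x: "x \<in> Q - P"
    and nz: "ext_nonzero_at i P Q"
  shows "ext_nonzero_at (Suc i) (Idl (insert x P)) Q"
proof (rule ccontr)
  assume neg: "\<not> ?thesis"
  have PI: "ideal P R" by (rule primeideal.axioms(1)[OF P])
  note Pc = idealD(1)[OF PI]
  have xc: "x \<in> carrier R" using x idealD(1)[OF primeideal.axioms(1)[OF Q]] by blast
  \<comment> \<open>As \<open>P\<close> is prime and \<open>x\<close> lies outside it, (P : x) = P,
    and lifting along multiplication by \<open>x\<close> becomes divisibility by \<open>x\<close>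
    inside Ext^i(R/P, R) localized at \<open>Q\<close>.\<close>
  have quot: "ideal_quotient R P x = P"
    using primeideal.I_prime[OF P _ xc] x ideal_ideal_quotient(2)[OF PI xc]
    by (auto simp: ideal_quotient_def)
  let ?B = "coboundaries i P" and ?Z = "cocycles i P"
  have B: "submodule ?B R (E i)" by (rule submodule_coboundaries[OF Pc])
  have Z: "submodule ?Z R (E i)" by (rule submodule_cocycles[OF Pc])
  obtain A where A: "A \<subseteq> ?Z" "finite A" "?Z = gen_submodule R (E i) (?B \<union> A)"
    using ext_noetherian[OF PI, of i] Z coboundaries_cocycles[OF Pc, of i]
    unfolding ext_noetherian_def by blast
  have Ac: "A \<subseteq> carrier (E i)" using A(1) E.submoduleD(1)[OF Z] by blast
  obtain z where z: "z \<in> ?Z" "\<And>s. s \<in> carrier R - Q \<Longrightarrow> s \<odot>\<^bsub>E i\<^esub> z \<notin> ?B"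
    using nz by (auto simp: ext_nonzero_at_def)
  have "\<exists>s\<in>carrier R - Q. s \<odot>\<^bsub>E i\<^esub> z \<in> ?B"
  proof (rule E.nakayama_local[OF Q A(2) Ac B A(3) _ z(1)])
    fix w assume w: "w \<in> ?Z"
    have "w \<in> cocycles i (ideal_quotient R P x)" using w quot by simp
    then obtain s y where s: "s \<in> carrier R - Q" "y \<in> ?Z" "x \<odot>\<^bsub>E i\<^esub> y = s \<odot>\<^bsub>E i\<^esub> w"
      using ext_lift_quotient[OF PI xc Q _ neg] by blast
    have c: "?B \<union> {q \<odot>\<^bsub>E i\<^esub> v |q v. q \<in> Q \<and> v \<in> ?Z} \<subseteq> carrier (E i)"
      using E.submoduleD(1)[OF B] E.submoduleD(1)[OF Z] idealD(1)[OF primeideal.axioms(1)[OF Q]]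
      by (auto simp: subset_iff)
    have "x \<odot>\<^bsub>E i\<^esub> y \<in> {q \<odot>\<^bsub>E i\<^esub> v |q v. q \<in> Q \<and> v \<in> ?Z}" using x s(2) by blast
    then show "\<exists>s\<in>carrier R - Q. s \<odot>\<^bsub>E i\<^esub> w \<in>
        gen_submodule R (E i) (?B \<union> {q \<odot>\<^bsub>E i\<^esub> v |q v. q \<in> Q \<and> v \<in> ?Z})"
      using s(1,3) E.submodule_gen_submodule(2)[OF c] by (intro bexI[of _ s]) auto
  qed
  then show False using z(2) by blast
qed

text \<open>As long as a prime P differs from \<open>Q\<close>, adjoining some x in Q - P and
  passing to a prime above moves the nonvanishing to a larger prime inside \<open>Q\<close>, one
  degree higher. By the ascending chain condition this stops, and it can stop only at
  \<open>Q\<close>.\<close>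

lemma ext_nonzero_at_self:
  assumes K: "ideal K R" and Q: "primeideal Q R" and nz: "ext_nonzero_at i K Q"
  shows "\<exists>k\<ge>i. ext_nonzero_at k Q Q"
proof -
  have *: "\<exists>k\<ge>i. ext_nonzero_at k Q Q" if "ideal P R" "primeideal P R" "ext_nonzero_at i P Q" for P i
    using that
  proof (induction P arbitrary: i rule: noetherian_induct)
    case (step P)
    have PQ: "P \<subseteq> Q" using ext_nonzero_at_subset[OF idealD(1)[OF step.hyps] step.prems(2)] .
    show ?case
    proof (cases "P = Q")
      case True
      then show ?thesis using step.prems by blast
    next
      case False
      then obtain x where x: "x \<in> Q - P" using PQ by blast
      have xP: "insert x P \<subseteq> carrier R"
        using x PQ idealD(1)[OF primeideal.axioms(1)[OF Q]] by blast
      have sub: "P \<subset> Idl (insert x P)" using genideal_self[OF xP] x by blast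
      obtain P' where P': "primeideal P' R" "Idl (insert x P) \<subseteq> P'" "ext_nonzero_at (Suc i) P' Q"
        using ext_nonzero_at_prime[OF genideal_ideal[OF xP] Q]
          ext_nonzero_at_Suc[OF step.prems(1) Q x step.prems(2)] by blast
      obtain k where "k \<ge> Suc i" "ext_nonzero_at k Q Q"
        using step.IH[OF primeideal.axioms(1)[OF P'(1)] _ P'(1,3)] P'(2) sub by blast
      then show ?thesis using Suc_leD by blast
    qed
  qed
  obtain P where "primeideal P R" "ext_nonzero_at i P Q"
    using ext_nonzero_at_prime[OF assms] by blast
  then show ?thesis using *[of P] primeideal.axioms(1) by blast
qed

text \<open>Ext^0(R, R) = R contains the class of 1, which s kills only if s = 0, an element of
  \<open>Q\<close>.\<close>

lemma ext_nonzero_at_0: "primeideal Q R \<Longrightarrow> ext_nonzero_at 0 {\<zero>} Q"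
proof -
  assume Q: "primeideal Q R"
  interpret S: plain_module R "reg_module R" by (rule plain_module.intro[OF reg_module_module])
  have inj: "inj_on \<iota> (carrier R)" using resolution by (simp add: right_resolution_def)
  have zero: "\<iota> \<zero> = \<zero>\<^bsub>E 0\<^esub>"
    using module_hom_zero[OF S.module_axioms E_module \<iota>_hom] by simp
  have c: "\<iota> \<one> \<in> carrier (E 0)" using module_homD(1)[OF \<iota>_hom] by simp
  have "\<iota> \<one> \<in> cocycles 0 {\<zero>}"
    using c \<iota>_exact by (auto simp: cocycles_def annihilated_def)
  moreover have "s \<odot>\<^bsub>E 0\<^esub> \<iota> \<one> \<notin> coboundaries 0 {\<zero>}" if s: "s \<in> carrier R - Q" for s
  proof
    assume "s \<odot>\<^bsub>E 0\<^esub> \<iota> \<one> \<in> coboundaries 0 {\<zero>}"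
    then have "\<iota> s = \<iota> \<zero>"
      using module_homD(3)[OF \<iota>_hom, of s \<one>] s zero by (simp add: coboundaries_def)
    then have "s = \<zero>" using inj s by (auto dest: inj_onD)
    then show False using s idealD(2)[OF primeideal.axioms(1)[OF Q]] by blast
  qed
  ultimately show ?thesis by (auto simp: ext_nonzero_at_def)
qed

lemma ext_nonzero_at_chain:
  assumes "\<And>i. i \<le> n \<Longrightarrow> primeideal (C i) R" "\<And>i. i < n \<Longrightarrow> C i \<subset> C (Suc i)"
  shows "\<exists>k\<ge>n. ext_nonzero_at k (C n) (C n)"
  using assms
proof (induction n)
  case 0
  then show ?case
    using ext_nonzero_at_self[OF zeroideal _ ext_nonzero_at_0] by blast
next
  case (Suc n)
  obtain k where k: "k \<ge> n" "ext_nonzero_at k (C n) (C n)"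
    using Suc.IH Suc.prems by auto
  have sub: "C n \<subset> C (Suc n)" using Suc.prems(2) by simp
  have P: "primeideal (C n) R" "primeideal (C (Suc n)) R" using Suc.prems(1) by auto
  \<comment> \<open>A larger prime leaves fewer multipliers, so nonvanishing at \<open>C n\<close>
    gives nonvanishing at \<open>C (Suc n)\<close>; adjoining x then raises the degree.\<close>
  have nz: "ext_nonzero_at k (C n) (C (Suc n))" using k(2) sub by (auto simp: ext_nonzero_at_def)
  obtain x where x: "x \<in> C (Suc n) - C n" using sub by blast
  have xP: "insert x (C n) \<subseteq> carrier R"
    using x sub idealD(1)[OF primeideal.axioms(1)[OF P(2)]] by blast
  obtain k' where "k' \<ge> Suc k" "ext_nonzero_at k' (C (Suc n)) (C (Suc n))"
    using ext_nonzero_at_self[OF genideal_ideal[OF xP] P(2) ext_nonzero_at_Suc[OF P x nz]] by blast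
  then show ?case using k(1) by (meson Suc_le_mono le_trans)
qed

text \<open>The largest \<open>m\<close> with \<open>Ext\<^sup>m(R/P, R)\<^sub>P \<noteq> 0\<close> for an associated prime \<open>P = (I:y)\<close> of \<open>R/I\<close> also has
  \<open>Ext\<^sup>m(R/I, R)\<^sub>P \<noteq> 0\<close>: otherwise \<open>Ext\<^sup>m\<^sup>+\<^sup>1(R/(I + Ry), R)\<^sub>P\<close> would not vanish.\<close>

lemma ext_nonzero_above_codim:
  assumes I: "ideal I R" "I \<noteq> carrier R"
    and bound: "\<And>i. i > n \<Longrightarrow> carrier (E i) = {\<zero>\<^bsub>E i\<^esub>}"
    and chain: "\<And>P. primeideal P R \<Longrightarrow> I \<subseteq> P \<Longrightarrow> \<exists>h\<ge>r. \<exists>C. (\<forall>i\<le>h. primeideal (C i) R) \<and>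
      (\<forall>i<h. C i \<subset> C (Suc i)) \<and> C h = P"
  shows "\<exists>m\<ge>r. \<not> cocycles m I \<subseteq> coboundaries m I"
proof -
  have oneI: "\<one> \<notin> I" using I ideal.one_imp_carrier by blast
  have IQ: "I = ideal_quotient R I \<one>" using idealD(1)[OF I(1)] by (auto simp: ideal_quotient_def)
  \<comment> \<open>A colon ideal (I : y) with y outside \<open>I\<close>, maximal among these, is
    prime; localization takes place at this associated prime. The search starts from (I : 1) =
    I.\<close>
  obtain P where P: "ideal P R" "\<exists>y\<in>carrier R - I. P = ideal_quotient R I y" "I \<subseteq> P"
    "\<And>N'. ideal N' R \<Longrightarrow> \<exists>y\<in>carrier R - I. N' = ideal_quotient R I y \<Longrightarrow> P \<subseteq> N' \<Longrightarrow> N' = P"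
    by (rule ideal_maximal_element[OF I(1), of "\<lambda>N. \<exists>y\<in>carrier R - I. N = ideal_quotient R I y"])
      (use oneI IQ in blast)+
  then obtain y where y: "y \<in> carrier R" "y \<notin> I" "P = ideal_quotient R I y" by blast
  have prime: "primeideal P R"
  proof (rule primeidealI[OF P(1) is_cring])
    show "carrier R \<noteq> P"
    proof
      assume "carrier R = P"
      then have "\<one> \<in> P" by blast
      then show False using y by (simp add: ideal_quotient_def)
    qed
    fix a b assume ab: "a \<in> carrier R" "b \<in> carrier R" "a \<otimes> b \<in> P"
    show "a \<in> P \<or> b \<in> P"
    proof (rule disjCI)
      assume b: "b \<notin> P"
      have by': "b \<otimes> y \<in> carrier R - I" using b y ab by (simp add: ideal_quotient_def)
      have "P \<subseteq> ideal_quotient R I (b \<otimes> y)"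
      proof
        fix c assume c: "c \<in> P"
        then have cc: "c \<in> carrier R" "c \<otimes> y \<in> I" using y(3) by (auto simp: ideal_quotient_def)
        have "c \<otimes> (b \<otimes> y) = b \<otimes> (c \<otimes> y)" using cc ab y(1) by (simp add: m_lcomm)
        then show "c \<in> ideal_quotient R I (b \<otimes> y)"
          using idealD(6)[OF I(1) cc(2) ab(2)] cc by (simp add: ideal_quotient_def)
      qed
      moreover have "ideal (ideal_quotient R I (b \<otimes> y)) R"
        using by' by (intro ideal_ideal_quotient I) auto
      ultimately have eq: "ideal_quotient R I (b \<otimes> y) = P" using P(4) by' by blast
      have "a \<otimes> (b \<otimes> y) \<in> I" using ab y by (simp add: ideal_quotient_def m_assoc)
      then have "a \<in> ideal_quotient R I (b \<otimes> y)" using ab(1) by (simp add: ideal_quotient_def)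
      then show "a \<in> P" using eq by simp
    qed
  qed
  obtain h C where C: "h \<ge> r" "\<forall>i\<le>h. primeideal (C i) R" "\<forall>i<h. C i \<subset> C (Suc i)" "C h = P"
    using chain[OF prime P(3)] by blast
  obtain k where k: "k \<ge> h" "ext_nonzero_at k P P"
    using ext_nonzero_at_chain[of h C] C by auto
  \<comment> \<open>Past degree \<open>n\<close> the modules of the resolution are zero and so is
    every Ext; this bound makes the maximum \<open>m\<close> below exist.\<close>
  have le: "i \<le> n" if "ext_nonzero_at i K P" "ideal K R" for i K
  proof (rule ccontr)
    assume "\<not> i \<le> n"
    then have "i > n" by simp
    then have E0: "carrier (E i) = {\<zero>\<^bsub>E i\<^esub>}" by (rule bound)
    obtain z where z: "z \<in> cocycles i K" "\<And>s. s \<in> carrier R - P \<Longrightarrow> s \<odot>\<^bsub>E i\<^esub> z \<notin> coboundaries i K"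
      using \<open>ext_nonzero_at i K P\<close> by (auto simp: ext_nonzero_at_def)
    note Kc = idealD(1)[OF that(2)]
    have "\<one> \<in> carrier R - P"
      using primeideal.I_notcarr[OF prime] ideal.one_imp_carrier[OF P(1)] by blast
    moreover have "\<one> \<odot>\<^bsub>E i\<^esub> z \<in> coboundaries i K"
      using z(1) E0 annihilated_carrier[of i K] E.submoduleD(2)[OF submodule_coboundaries[OF Kc]]
      by (auto simp: cocycles_def)
    ultimately show False using z(2) by blast
  qed
  define m where "m = Max {i. ext_nonzero_at i P P}"
  have fin: "finite {i. ext_nonzero_at i P P}"
  proof (rule finite_subset)
    show "{i. ext_nonzero_at i P P} \<subseteq> {..n}"
    proof
      fix i assume "i \<in> {i. ext_nonzero_at i P P}"
      then have "ext_nonzero_at i P P" by simp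
      then show "i \<in> {..n}" using le[OF _ P(1), of i] by simp
    qed
  qed simp
  have "m \<in> {i. ext_nonzero_at i P P}" unfolding m_def using k(2) by (intro Max_in fin) blast
  then have m: "ext_nonzero_at m P P" by simp
  have max: "i \<le> m" if "ext_nonzero_at i P P" for i using Max_ge[OF fin] that by (simp add: m_def)
  have "m \<ge> r" using max[OF k(2)] k(1) C(1) by simp
  moreover have "ext_nonzero_at m I P"
  proof (rule ccontr)
    assume "\<not> ext_nonzero_at m I P"
    then have nz: "ext_nonzero_at (Suc m) (Idl (insert y I)) P"
      using ext_nonzero_at_quotient[OF I(1) y(1) prime, of m] m y(3) by simp
    have "ideal (Idl (insert y I)) R" using y idealD(1)[OF I(1)] by (intro genideal_ideal) auto
    then obtain k where "k \<ge> Suc m" "ext_nonzero_at k P P"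
      using ext_nonzero_at_self[OF _ prime nz] by blast
    then show False using max[of k] by simp
  qed
  then have "\<not> cocycles m I \<subseteq> coboundaries m I"
  proof (rule contrapos_pn)
    assume sub: "cocycles m I \<subseteq> coboundaries m I"
    have "\<one> \<in> carrier R - P"
      using primeideal.I_notcarr[OF prime] ideal.one_imp_carrier[OF P(1)] by blast
    then show "\<not> ext_nonzero_at m I P"
      using sub annihilated_carrier[of m I] by (force simp: ext_nonzero_at_def cocycles_def)
  qed
  ultimately show ?thesis by blast
qed

end

section \<open>Grade and codimension\<close>

text \<open>An ideal maximal among those disjoint from the multiplicative set \<open>T\<close> is
  prime: two elements outside it with product inside would each yield a member of \<open>T\<close>,
  and the product of these members would lie in the ideal.\<close>

lemma (in noetherian_ring) prime_disjoint_exists: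
  assumes "cring R" and K: "ideal K R" and T: "T \<subseteq> carrier R" "\<one> \<in> T" "\<And>s t. s \<in> T \<Longrightarrow> t \<in> T \<Longrightarrow> s \<otimes> t \<in> T"
    and KT: "K \<inter> T = {}"
  shows "\<exists>P. primeideal P R \<and> K \<subseteq> P \<and> P \<inter> T = {}"
proof -
  interpret cring R by fact
  obtain P where P: "ideal P R" "P \<inter> T = {}" "K \<subseteq> P"
    "\<And>N'. ideal N' R \<Longrightarrow> N' \<inter> T = {} \<Longrightarrow> P \<subseteq> N' \<Longrightarrow> N' = P"
    using ideal_maximal_element[OF K, of "\<lambda>N. N \<inter> T = {}"] KT by metis
  note Pi = idealD[OF P(1)]
  have meet: "\<exists>p\<in>P. \<exists>r\<in>carrier R. p \<oplus> r \<otimes> a \<in> T" if a: "a \<in> carrier R" "a \<notin> P" for a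
  proof -
    have aP: "insert a P \<subseteq> carrier R" using a Pi(1) by blast
    have "Idl (insert a P) \<inter> T \<noteq> {}"
      using P(4)[OF genideal_ideal[OF aP]] genideal_self[OF aP] a(2) by blast
    then obtain t where "t \<in> Idl (insert a P)" "t \<in> T" by blast
    then show ?thesis unfolding Idl_insert_ideal[OF P(1) a(1)] by blast
  qed
  have "primeideal P R"
  proof (rule primeidealI[OF P(1) is_cring])
    show "carrier R \<noteq> P" using P(2) T(2) by blast
    fix a b assume ab: "a \<in> carrier R" "b \<in> carrier R" "a \<otimes> b \<in> P"
    show "a \<in> P \<or> b \<in> P"
    proof (rule ccontr)
      assume "\<not> ?thesis"
      then obtain p r q s where *: "p \<in> P" "r \<in> carrier R" "p \<oplus> r \<otimes> a \<in> T"
        "q \<in> P" "s \<in> carrier R" "q \<oplus> s \<otimes> b \<in> T"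
        using meet[OF ab(1)] meet[OF ab(2)] by blast
      have c: "p \<in> carrier R" "q \<in> carrier R" using * Pi(1) by auto
      have "(p \<oplus> r \<otimes> a) \<otimes> (q \<oplus> s \<otimes> b) = p \<otimes> (q \<oplus> s \<otimes> b) \<oplus> ((r \<otimes> a) \<otimes> q \<oplus> (r \<otimes> s) \<otimes> (a \<otimes> b))"
        using c *(2,5) ab(1,2) by algebra
      also have "\<dots> \<in> P"
      proof (intro Pi(3))
        show "p \<otimes> (q \<oplus> s \<otimes> b) \<in> P" using * c ab by (intro Pi(7)) auto
        show "(r \<otimes> a) \<otimes> q \<in> P" using * c ab by (intro Pi(6)) auto
        show "(r \<otimes> s) \<otimes> (a \<otimes> b) \<in> P" using * ab by (intro Pi(6)[OF ab(3)]) auto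
      qed
      finally show False using T(3)[OF *(3,6)] P(2) by blast
    qed
  qed
  then show ?thesis using P by blast
qed

text \<open>The last element x is a nonzerodivisor modulo the ideal K of the earlier ones, so K
  avoids all products s x^m with s outside \<open>P\<close>. A prime above K that avoids them is
  contained in \<open>P\<close> and misses x, and the induction continues from it.\<close>

lemma (in noetherian_ring) regular_sequence_chain:
  assumes "cring R" "set xs \<subseteq> carrier R"
    and "\<And>i a. i < length xs \<Longrightarrow> a \<in> carrier R \<Longrightarrow>
        xs ! i \<otimes> a \<in> Idl (set (take i xs)) \<Longrightarrow> a \<in> Idl (set (take i xs))"
    and "primeideal P R" "set xs \<subseteq> P"
  shows "\<exists>C. (\<forall>i\<le>length xs. primeideal (C i) R) \<and> (\<forall>i<length xs. C i \<subset> C (Suc i)) \<and> C (length xs) = P"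
  using assms(2-)
proof (induction xs arbitrary: P rule: rev_induct)
  case Nil
  then show ?case by (intro exI[of _ "\<lambda>_. P"]) auto
next
  case (snoc x xs)
  interpret cring R by fact
  let ?K = "Idl (set xs)"
  have xsc: "set xs \<subseteq> carrier R" and x: "x \<in> carrier R" using snoc.prems(1) by auto
  have K: "ideal ?K R" by (rule genideal_ideal[OF xsc])
  note PI = primeideal.axioms(1)[OF snoc.prems(3)]
  have KP: "?K \<subseteq> P" using snoc.prems(4) by (intro genideal_minimal[OF PI]) auto
  have nzd: "a \<in> ?K" if "a \<in> carrier R" "x \<otimes> a \<in> ?K" for a
    using snoc.prems(2)[of "length xs" a] that by simp
  have nzd_pow: "s \<in> ?K" if "s \<in> carrier R" "s \<otimes> x [^] (m::nat) \<in> ?K" for s m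
    using that(2)
  proof (induction m)
    case 0
    then show ?case using that(1) by simp
  next
    case (Suc m)
    have "s \<otimes> x [^] Suc m = x \<otimes> (s \<otimes> x [^] m)"
      using that(1) x by (simp add: m_ac)
    then show ?case using Suc nzd[of "s \<otimes> x [^] m"] that(1) x by simp
  qed
  have oneP: "\<one> \<in> carrier R - P"
    using primeideal.I_notcarr[OF snoc.prems(3)] ideal.one_imp_carrier[OF PI] by blast
  define T where "T = {s \<otimes> x [^] (m::nat) | s m. s \<in> carrier R - P}"
  have "\<exists>P'. primeideal P' R \<and> ?K \<subseteq> P' \<and> P' \<inter> T = {}"
  proof (rule prime_disjoint_exists[OF is_cring K])
    show "T \<subseteq> carrier R" using x by (auto simp: T_def)
    have "\<one> = \<one> \<otimes> x [^] (0::nat)" by simp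
    then show "\<one> \<in> T" unfolding T_def using oneP by blast
    fix s t assume "s \<in> T" "t \<in> T"
    then obtain a m b k where *: "a \<in> carrier R - P" "b \<in> carrier R - P"
      "s = a \<otimes> x [^] (m::nat)" "t = b \<otimes> x [^] (k::nat)" unfolding T_def by blast
    have "s \<otimes> t = (a \<otimes> b) \<otimes> x [^] (m + k)"
      using * x by (simp add: nat_pow_mult[symmetric] m_ac)
    moreover have "a \<otimes> b \<in> carrier R - P"
      using *(1,2) primeideal.I_prime[OF snoc.prems(3), of a b] by auto
    ultimately show "s \<otimes> t \<in> T" unfolding T_def by blast
  next
    show "?K \<inter> T = {}" using nzd_pow KP unfolding T_def by blast
  qed
  then obtain P' where P': "primeideal P' R" "?K \<subseteq> P'" "P' \<inter> T = {}" by blast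
  have "P' \<subseteq> P"
  proof
    fix p assume p: "p \<in> P'"
    then have pc: "p \<in> carrier R" using idealD(1)[OF primeideal.axioms(1)[OF P'(1)]] by blast
    then have "p = p \<otimes> x [^] (0::nat)" by simp
    then show "p \<in> P" using p P'(3) pc unfolding T_def by blast
  qed
  moreover have "x \<in> P" using snoc.prems(4) by simp
  moreover have "x \<notin> P'"
  proof -
    have "x = \<one> \<otimes> x [^] (1::nat)" using x by simp
    then have "x \<in> T" unfolding T_def using oneP by blast
    then show ?thesis using P'(3) by blast
  qed
  ultimately have sub: "P' \<subset> P" by blast
  have "set xs \<subseteq> P'" using P'(2) genideal_self[OF xsc] by blast
  moreover have "a \<in> Idl (set (take i xs))"
    if "i < length xs" "a \<in> carrier R" "xs ! i \<otimes> a \<in> Idl (set (take i xs))" for i a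
    using snoc.prems(2)[of i a] that by (simp add: nth_append)
  ultimately obtain C where C: "\<forall>i\<le>length xs. primeideal (C i) R" "\<forall>i<length xs. C i \<subset> C (Suc i)"
      "C (length xs) = P'"
    using snoc.IH[OF xsc _ P'(1)] by blast
  show ?case
    using C sub snoc.prems(3) by (intro exI[of _ "C(Suc (length xs) := P)"]) (auto simp: less_Suc_eq)
qed

lemma (in noetherian_ring) grade_le_codim:
  assumes "cring R"
  shows "grade R I \<le> codim R I"
  unfolding grade_def codim_def
proof (intro Sup_least Inf_greatest, clarify)
  fix P xs assume P: "primeideal P R" "I \<subseteq> P" and xs: "set xs \<subseteq> I" "regular_sequence R xs"
  have "\<exists>C. (\<forall>i\<le>length xs. primeideal (C i) R) \<and> (\<forall>i<length xs. C i \<subset> C (Suc i)) \<and> C (length xs) = P"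
    using xs P by (intro regular_sequence_chain[OF assms]) (auto simp: regular_sequence_def)
  then show "enat (length xs) \<le> prime_height R P"
    unfolding prime_height_def by (intro Sup_upper) blast
qed

text \<open>The height can be infinite, and then no chain attains it; but strictly below a supremum
  there is always a member beyond, so r is written as \<open>Suc r'\<close> and a chain longer than
  \<open>r'\<close> is taken.\<close>

lemma prime_height_chain:
  assumes P: "primeideal P R" and h: "enat r \<le> prime_height R P"
  shows "\<exists>h\<ge>r. \<exists>C. (\<forall>i\<le>h. primeideal (C i) R) \<and> (\<forall>i<h. C i \<subset> C (Suc i)) \<and> C h = P"
proof (cases r)
  case 0
  then show ?thesis using P by (intro exI[of _ 0]) (auto intro!: exI[of _ "\<lambda>_. P"])
next
  case (Suc r')
  have "enat r' < prime_height R P" using h Suc by (metis Suc_ile_eq)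
  then obtain n where "enat r' < enat n" "\<exists>C. (\<forall>i\<le>n. primeideal (C i) R) \<and> (\<forall>i<n. C i \<subset> C (Suc i)) \<and> C n = P"
    unfolding prime_height_def less_Sup_iff by blast
  then show ?thesis using Suc by (intro exI[of _ n]) auto
qed

section \<open>Dual bases and lifting\<close>

text \<open>The index set may be infinite, for instance all elements of a projective module, so the
  sum runs over the support, which is finite wherever the value matters.\<close>

definition lincomb ::
    "('a, 'm) ring_scheme \<Rightarrow> ('a, 'b) module \<Rightarrow> 'i set \<Rightarrow> ('i \<Rightarrow> 'a) \<Rightarrow> ('i \<Rightarrow> 'b) \<Rightarrow> 'b" where
  "lincomb R N A w y = finsum N (\<lambda>i. w i \<odot>\<^bsub>N\<^esub> y i) {i \<in> A. w i \<noteq> \<zero>\<^bsub>R\<^esub>}"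

lemma module_hom_finsum:
  assumes "module R N" "module R P" "h \<in> module_hom R N P" "finite B" "u \<in> B \<rightarrow> carrier N"
  shows "h (finsum N u B) = finsum P (\<lambda>i. h (u i)) B"
proof -
  interpret N: plain_module R N using assms(1) by (rule plain_module.intro)
  interpret P: plain_module R P using assms(2) by (rule plain_module.intro)
  show ?thesis
    using assms(4,5)
  proof (induction B)
    case empty
    then show ?case using module_hom_zero[OF assms(1-3)] by simp
  next
    case (insert b B)
    have u: "u \<in> B \<rightarrow> carrier N" "u b \<in> carrier N" using insert.prems by auto
    have hu: "(\<lambda>i. h (u i)) \<in> B \<rightarrow> carrier P" "h (u b) \<in> carrier P"
      using u module_homD(1)[OF assms(3)] by auto
    show ?case
      using insert.hyps insert.IH[OF u(1)] u hu N.finsum_closed[OF u(1)]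
      by (simp add: module_homD(2)[OF assms(3)])
  qed
qed

context plain_module
begin

lemma lincomb_eq:
  assumes "finite B" "B \<subseteq> A" "{i \<in> A. w i \<noteq> \<zero>} \<subseteq> B"
    and "\<And>i. i \<in> A \<Longrightarrow> w i \<in> carrier R" "\<And>i. i \<in> A \<Longrightarrow> y i \<in> carrier M"
  shows "lincomb R M A w y = finsum M (\<lambda>i. w i \<odot>\<^bsub>M\<^esub> y i) B"
  unfolding lincomb_def
proof (rule M.add.finprod_mono_neutral_cong_left)
  show "finite B" "{i \<in> A. w i \<noteq> \<zero>} \<subseteq> B" by fact+
  show "w i \<odot>\<^bsub>M\<^esub> y i = \<zero>\<^bsub>M\<^esub>" if "i \<in> B - {i \<in> A. w i \<noteq> \<zero>}" for i
    using that assms(2,5) by auto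
  show "(\<lambda>i. w i \<odot>\<^bsub>M\<^esub> y i) \<in> B \<rightarrow> carrier M"
    using assms(2,4,5) by auto
qed simp

lemma finsum_in_submodule:
  assumes K: "submodule K R M" and "finite A" "f \<in> A \<rightarrow> K"
  shows "finsum M f A \<in> K"
  using assms(2,3)
proof (induction A)
  case empty
  then show ?case using submoduleD(2)[OF K] by simp
next
  case (insert a A)
  then have "f \<in> A \<rightarrow> carrier M" "f a \<in> carrier M" using submoduleD(1)[OF K] by auto
  then show ?case using insert submoduleD(3)[OF K] by simp
qed

lemma lincomb_cong:
  assumes "\<And>i. i \<in> A \<Longrightarrow> v i = w i" "\<And>i. i \<in> A \<Longrightarrow> y i = z i"
    and "\<And>i. i \<in> A \<Longrightarrow> w i \<in> carrier R" "\<And>i. i \<in> A \<Longrightarrow> z i \<in> carrier M"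
  shows "lincomb R M A v y = lincomb R M A w z"
  unfolding lincomb_def using assms by (intro M.finsum_cong') auto

lemma lincomb_closed:
  assumes "\<And>i. i \<in> A \<Longrightarrow> w i \<in> carrier R" "\<And>i. i \<in> A \<Longrightarrow> y i \<in> carrier M"
  shows "lincomb R M A w y \<in> carrier M"
  unfolding lincomb_def using assms by (intro M.finsum_closed) auto

lemma lincomb_add:
  assumes "finite {i \<in> A. v i \<noteq> \<zero>}" "finite {i \<in> A. w i \<noteq> \<zero>}"
    and v: "\<And>i. i \<in> A \<Longrightarrow> v i \<in> carrier R" and w: "\<And>i. i \<in> A \<Longrightarrow> w i \<in> carrier R"
    and y: "\<And>i. i \<in> A \<Longrightarrow> y i \<in> carrier M"
  shows "lincomb R M A (\<lambda>i. v i \<oplus> w i) y = lincomb R M A v y \<oplus>\<^bsub>M\<^esub> lincomb R M A w y"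
proof -
  let ?B = "{i \<in> A. v i \<noteq> \<zero>\<^bsub>R\<^esub>} \<union> {i \<in> A. w i \<noteq> \<zero>\<^bsub>R\<^esub>}"
  have B: "finite ?B" "?B \<subseteq> A" using assms(1,2) by auto
  have 1: "lincomb R M A v y = finsum M (\<lambda>i. v i \<odot>\<^bsub>M\<^esub> y i) ?B"
    using B v y by (intro lincomb_eq) auto
  have 2: "lincomb R M A w y = finsum M (\<lambda>i. w i \<odot>\<^bsub>M\<^esub> y i) ?B"
    using B w y by (intro lincomb_eq) auto
  have "lincomb R M A (\<lambda>i. v i \<oplus> w i) y = finsum M (\<lambda>i. (v i \<oplus> w i) \<odot>\<^bsub>M\<^esub> y i) ?B"
    using B v w y by (intro lincomb_eq) auto
  also have "\<dots> = finsum M (\<lambda>i. v i \<odot>\<^bsub>M\<^esub> y i \<oplus>\<^bsub>M\<^esub> w i \<odot>\<^bsub>M\<^esub> y i) ?B"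
    using B v w y by (intro M.finsum_cong') (auto simp: smult_l_distr)
  also have "\<dots> = lincomb R M A v y \<oplus>\<^bsub>M\<^esub> lincomb R M A w y"
    unfolding 1 2 using B v w y by (intro M.finsum_addf) auto
  finally show ?thesis .
qed

lemma lincomb_smult:
  assumes "finite {i \<in> A. w i \<noteq> \<zero>}" and w: "\<And>i. i \<in> A \<Longrightarrow> w i \<in> carrier R"
    and y: "\<And>i. i \<in> A \<Longrightarrow> y i \<in> carrier M" and a: "a \<in> carrier R"
  shows "lincomb R M A (\<lambda>i. a \<otimes> w i) y = a \<odot>\<^bsub>M\<^esub> lincomb R M A w y"
proof -
  let ?B = "{i \<in> A. w i \<noteq> \<zero>\<^bsub>R\<^esub>}"
  have "lincomb R M A (\<lambda>i. a \<otimes> w i) y = finsum M (\<lambda>i. (a \<otimes> w i) \<odot>\<^bsub>M\<^esub> y i) ?B"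
    using assms by (intro lincomb_eq) auto
  also have "\<dots> = finsum M (\<lambda>i. a \<odot>\<^bsub>M\<^esub> (w i \<odot>\<^bsub>M\<^esub> y i)) ?B"
    using w y a by (intro M.finsum_cong') (auto simp: smult_assoc1)
  also have "\<dots> = a \<odot>\<^bsub>M\<^esub> lincomb R M A w y"
    unfolding lincomb_def using assms by (intro finsum_smult_ldistr[symmetric]) auto
  finally show ?thesis .
qed

end

lemma module_hom_lincomb:
  assumes "module R N" "module R P" "h \<in> module_hom R N P" "finite {i \<in> A. w i \<noteq> \<zero>\<^bsub>R\<^esub>}"
    and "\<And>i. i \<in> A \<Longrightarrow> w i \<in> carrier R" "\<And>i. i \<in> A \<Longrightarrow> y i \<in> carrier N"
  shows "h (lincomb R N A w y) = lincomb R P A w (\<lambda>i. h (y i))"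
proof -
  interpret N: plain_module R N using assms(1) by (rule plain_module.intro)
  interpret P: plain_module R P using assms(2) by (rule plain_module.intro)
  have "h (lincomb R N A w y) = finsum P (\<lambda>i. h (w i \<odot>\<^bsub>N\<^esub> y i)) {i \<in> A. w i \<noteq> \<zero>\<^bsub>R\<^esub>}"
    unfolding lincomb_def using assms(5,6) by (intro module_hom_finsum[OF assms(1-4)]) auto
  also have "\<dots> = lincomb R P A w (\<lambda>i. h (y i))"
    unfolding lincomb_def using assms(5,6) module_homD[OF assms(3)] by (intro P.finsum_cong') auto
  finally show ?thesis .
qed

text \<open>The dual basis criterion for projectivity. It gives lifts against modules in every type,
  which the splitting condition over one fixed type does not do directly.\<close>

definition dual_basis ::
    "('a, 'm) ring_scheme \<Rightarrow> ('a, 'b) module \<Rightarrow> 'i set \<Rightarrow> ('i \<Rightarrow> 'b) \<Rightarrow> ('i \<Rightarrow> 'b \<Rightarrow> 'a) \<Rightarrow> bool" where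
  "dual_basis R N A e c \<longleftrightarrow>
     (\<forall>i\<in>A. e i \<in> carrier N \<and> c i \<in> module_hom R N (reg_module R)) \<and>
     (\<forall>x\<in>carrier N. finite {i \<in> A. c i x \<noteq> \<zero>\<^bsub>R\<^esub>} \<and> x = lincomb R N A (\<lambda>i. c i x) e)"

text \<open>The index type has to be a parameter: it is \<open>nat\<close> for free modules of
  finite rank and the element type for projective modules.\<close>

definition has_dual_basis :: "'i itself \<Rightarrow> ('a, 'm) ring_scheme \<Rightarrow> ('a, 'b) module \<Rightarrow> bool" where
  "has_dual_basis _ R N \<longleftrightarrow> (\<exists>A (e :: 'i \<Rightarrow> 'b) c. dual_basis R N A e c)"

lemma module_hom_of_dual_basis:
  assumes N: "module R N" and U: "module R U" and db: "dual_basis R N A e c"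
    and y: "\<And>i. i \<in> A \<Longrightarrow> y i \<in> carrier U"
  shows "(\<lambda>x. lincomb R U A (\<lambda>i. c i x) y) \<in> module_hom R N U"
proof -
  interpret N: plain_module R N using N by (rule plain_module.intro)
  interpret U: plain_module R U using U by (rule plain_module.intro)
  have c: "c i \<in> module_hom R N (reg_module R)" if "i \<in> A" for i
    using db that by (auto simp: dual_basis_def)
  have cc: "c i x \<in> carrier R" if "i \<in> A" "x \<in> carrier N" for i x
    using module_homD(1)[OF c[OF that(1)] that(2)] by simp
  have fin: "finite {i \<in> A. c i x \<noteq> \<zero>\<^bsub>R\<^esub>}" if "x \<in> carrier N" for x
    using db that by (auto simp: dual_basis_def)
  show ?thesis
  proof (intro module_homI)
    fix x assume x: "x \<in> carrier N"
    show "lincomb R U A (\<lambda>i. c i x) y \<in> carrier U"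
      using cc x y by (intro U.lincomb_closed) auto
    {
      fix x' assume x': "x' \<in> carrier N"
      have "lincomb R U A (\<lambda>i. c i (x \<oplus>\<^bsub>N\<^esub> x')) y = lincomb R U A (\<lambda>i. c i x \<oplus>\<^bsub>R\<^esub> c i x') y"
        using cc x x' y module_homD(2)[OF c _ _] by (intro U.lincomb_cong) auto
      also have "\<dots> = lincomb R U A (\<lambda>i. c i x) y \<oplus>\<^bsub>U\<^esub> lincomb R U A (\<lambda>i. c i x') y"
        using cc fin x x' y by (intro U.lincomb_add) auto
      finally show "lincomb R U A (\<lambda>i. c i (x \<oplus>\<^bsub>N\<^esub> x')) y = \<dots>" .
    }
    fix a assume a: "a \<in> carrier R"
    have "lincomb R U A (\<lambda>i. c i (a \<odot>\<^bsub>N\<^esub> x)) y = lincomb R U A (\<lambda>i. a \<otimes>\<^bsub>R\<^esub> c i x) y"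
      using cc x a y module_homD(3)[OF c _ _] by (intro U.lincomb_cong) auto
    also have "\<dots> = a \<odot>\<^bsub>U\<^esub> lincomb R U A (\<lambda>i. c i x) y"
      using cc fin x y a by (intro U.lincomb_smult) auto
    finally show "lincomb R U A (\<lambda>i. c i (a \<odot>\<^bsub>N\<^esub> x)) y = \<dots>" .
  qed
qed

text \<open>Only the images of the dual basis vectors have to be lifted; the coordinates extend the
  choice linearly. Asking that the image of \<open>f\<close> lie in that of \<open>g\<close> covers
  surjections and exact sequences alike.\<close>

lemma lift_through:
  assumes N: "module R N" and U: "module R U" and Y: "module R Y"
    and db: "has_dual_basis TYPE('i) R N"
    and f: "f \<in> module_hom R N Y" and g: "g \<in> module_hom R U Y"
    and sub: "\<And>x. x \<in> carrier N \<Longrightarrow> f x \<in> g ` carrier U"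
  shows "\<exists>h\<in>module_hom R N U. \<forall>x\<in>carrier N. g (h x) = f x"
proof -
  obtain A and e :: "'i \<Rightarrow> _" and c where db: "dual_basis R N A e c"
    using db by (auto simp: has_dual_basis_def)
  interpret N: plain_module R N using N by (rule plain_module.intro)
  interpret U: plain_module R U using U by (rule plain_module.intro)
  interpret Y: plain_module R Y using Y by (rule plain_module.intro)
  have e: "e i \<in> carrier N" and c: "c i \<in> module_hom R N (reg_module R)" if "i \<in> A" for i
    using db that by (auto simp: dual_basis_def)
  have cc: "c i x \<in> carrier R" if "i \<in> A" "x \<in> carrier N" for i x
    using module_homD(1)[OF c[OF that(1)] that(2)] by simp
  have fin: "finite {i \<in> A. c i x \<noteq> \<zero>\<^bsub>R\<^esub>}" and eq: "x = lincomb R N A (\<lambda>i. c i x) e"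
    if "x \<in> carrier N" for x
    using db that by (auto simp: dual_basis_def)
  have "\<forall>i\<in>A. \<exists>y\<in>carrier U. g y = f (e i)" using sub e by (metis imageE)
  then obtain y where y: "\<And>i. i \<in> A \<Longrightarrow> y i \<in> carrier U" "\<And>i. i \<in> A \<Longrightarrow> g (y i) = f (e i)" by metis
  have "g (lincomb R U A (\<lambda>i. c i x) y) = f x" if x: "x \<in> carrier N" for x
  proof -
    have "g (lincomb R U A (\<lambda>i. c i x) y) = lincomb R Y A (\<lambda>i. c i x) (\<lambda>i. g (y i))"
      using fin[OF x] cc x y by (intro module_hom_lincomb[OF U Y g]) auto
    also have "\<dots> = lincomb R Y A (\<lambda>i. c i x) (\<lambda>i. f (e i))"
      using cc x y module_homD(1)[OF f] e by (intro Y.lincomb_cong) auto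
    also have "\<dots> = f (lincomb R N A (\<lambda>i. c i x) e)"
      using fin[OF x] cc x e by (intro module_hom_lincomb[OF N Y f, symmetric]) auto
    also have "\<dots> = f x" using eq[OF x] by simp
    finally show ?thesis .
  qed
  moreover have "(\<lambda>x. lincomb R U A (\<lambda>i. c i x) y) \<in> module_hom R N U"
    using y(1) by (rule module_hom_of_dual_basis[OF N U db])
  ultimately show ?thesis by (intro bexI) auto
qed

section \<open>Dual bases of free and projective modules\<close>

lemma std_free_simps:
  "carrier (std_free_module R n) = {..<n} \<rightarrow>\<^sub>E carrier R"
  "u \<oplus>\<^bsub>std_free_module R n\<^esub> v = (\<lambda>i\<in>{..<n}. u i \<oplus>\<^bsub>R\<^esub> v i)"
  "a \<odot>\<^bsub>std_free_module R n\<^esub> v = (\<lambda>i\<in>{..<n}. a \<otimes>\<^bsub>R\<^esub> v i)"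
  "\<zero>\<^bsub>std_free_module R n\<^esub> = (\<lambda>i\<in>{..<n}. \<zero>\<^bsub>R\<^esub>)"
  by (simp_all add: std_free_module_def)

definition unit_vector :: "('a, 'm) ring_scheme \<Rightarrow> nat \<Rightarrow> nat \<Rightarrow> nat \<Rightarrow> 'a" where
  "unit_vector R n i = (\<lambda>j\<in>{..<n}. if j = i then \<one>\<^bsub>R\<^esub> else \<zero>\<^bsub>R\<^esub>)"

context cring
begin

lemma std_free_module_module: "module R (std_free_module R n)"
proof (intro moduleI abelian_groupI)
  show "cring R" by (rule is_cring)
  show "\<exists>y\<in>carrier (std_free_module R n). y \<oplus>\<^bsub>std_free_module R n\<^esub> x = \<zero>\<^bsub>std_free_module R n\<^esub>"
    if "x \<in> carrier (std_free_module R n)" for x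
    using that
    by (intro bexI[of _ "\<lambda>i\<in>{..<n}. \<ominus> x i"]) (auto simp: std_free_simps PiE_iff l_neg fun_eq_iff)
qed (auto simp: std_free_simps PiE_iff fun_eq_iff a_ac l_distr r_distr m_assoc extensional_def)

lemma std_free_expand:
  assumes v: "v \<in> carrier (std_free_module R n)"
  shows "v = finsum (std_free_module R n) (\<lambda>i. v i \<odot>\<^bsub>std_free_module R n\<^esub> unit_vector R n i) {..<n}"
    (is "v = ?s")
proof -
  let ?F = "std_free_module R n"
  interpret F: plain_module R ?F by (rule plain_module.intro[OF std_free_module_module])
  interpret S: plain_module R "reg_module R" by (rule plain_module.intro[OF reg_module_module])
  have vi: "v i \<in> carrier R" if "i < n" for i using v that by (auto simp: std_free_simps)
  have u: "unit_vector R n i \<in> carrier ?F" for i by (auto simp: std_free_simps unit_vector_def)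
  have cl: "(\<lambda>i. v i \<odot>\<^bsub>?F\<^esub> unit_vector R n i) \<in> {..<n} \<rightarrow> carrier ?F" using vi u by auto
  have s: "?s \<in> carrier ?F" by (rule F.finsum_closed[OF cl])
  have "v j = ?s j" if j: "j < n" for j
  proof -
    have hom: "(\<lambda>v. v j) \<in> module_hom R ?F (reg_module R)"
      using j by (intro module_homI) (auto simp: std_free_simps)
    have "?s j = finsum (reg_module R) (\<lambda>i. (v i \<odot>\<^bsub>?F\<^esub> unit_vector R n i) j) {..<n}"
      by (rule module_hom_finsum[OF F.module_axioms S.module_axioms hom _ cl]) simp
    also have "\<dots> = finsum (reg_module R) (\<lambda>i. if j = i then v i else \<zero>\<^bsub>reg_module R\<^esub>) {..<n}"
      using j vi by (intro S.finsum_cong') (auto simp: std_free_simps unit_vector_def)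
    also have "\<dots> = v j" using j vi by (intro S.finsum_singleton) auto
    finally show ?thesis ..
  qed
  then show ?thesis
    using v s unfolding std_free_simps by (intro PiE_ext[of v "{..<n}" "\<lambda>_. carrier R"]) auto
qed

end

lemma free_of_rank_basis:
  assumes "cring R" "free_of_rank R N n"
  shows "\<exists>e c. (\<forall>i<n. e i \<in> carrier N \<and> c i \<in> module_hom R N (reg_module R)) \<and>
    (\<forall>i<n. \<forall>j<n. c i (e j) = (if i = j then \<one>\<^bsub>R\<^esub> else \<zero>\<^bsub>R\<^esub>)) \<and>
    (\<forall>x\<in>carrier N. x = finsum N (\<lambda>i. c i x \<odot>\<^bsub>N\<^esub> e i) {..<n})"
proof -
  interpret cring R by fact
  let ?F = "std_free_module R n"
  interpret F: plain_module R ?F by (rule plain_module.intro[OF std_free_module_module])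
  interpret N: plain_module R N using assms(2) by (simp add: free_of_rank_def plain_module_def)
  obtain h where h: "h \<in> module_hom R ?F N" "bij_betw h (carrier ?F) (carrier N)"
    using assms(2) by (auto simp: free_of_rank_def module_iso_def)
  define k where "k = inv_into (carrier ?F) h"
  have kh: "k (h v) = v" if "v \<in> carrier ?F" for v
    using that h(2) by (simp add: k_def bij_betw_def)
  have k: "k x \<in> carrier ?F" "h (k x) = x" if "x \<in> carrier N" for x
    using that h(2) by (auto simp: k_def bij_betw_def inv_into_into f_inv_into_f)
  have khom: "k \<in> module_hom R N ?F"
  proof (intro module_homI)
    show "k (x \<oplus>\<^bsub>N\<^esub> y) = k x \<oplus>\<^bsub>?F\<^esub> k y" if "x \<in> carrier N" "y \<in> carrier N" for x y
      using module_homD(2)[OF h(1) k(1)[OF that(1)] k(1)[OF that(2)]] k that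
        kh[OF F.a_closed[OF k(1)[OF that(1)] k(1)[OF that(2)]]] by simp
    show "k (a \<odot>\<^bsub>N\<^esub> x) = a \<odot>\<^bsub>?F\<^esub> k x" if "a \<in> carrier R" "x \<in> carrier N" for a x
      using module_homD(3)[OF h(1) that(1) k(1)[OF that(2)]] k that
        kh[OF F.smult_closed[OF that(1) k(1)[OF that(2)]]] by simp
  qed (rule k(1))
  have u: "unit_vector R n i \<in> carrier ?F" for i by (auto simp: std_free_simps unit_vector_def)
  define e where "e i = h (unit_vector R n i)" for i
  define c where "c i x = k x i" for i x
  have proj: "(\<lambda>v. v i) \<in> module_hom R ?F (reg_module R)" if "i < n" for i
    using that by (intro module_homI) (auto simp: std_free_simps)
  have "x = finsum N (\<lambda>i. c i x \<odot>\<^bsub>N\<^esub> e i) {..<n}" if x: "x \<in> carrier N" for x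
  proof -
    have ki: "k x i \<in> carrier R" if "i < n" for i using k(1)[OF x] that by (auto simp: std_free_simps)
    have "x = h (finsum ?F (\<lambda>i. k x i \<odot>\<^bsub>?F\<^esub> unit_vector R n i) {..<n})"
      using std_free_expand[OF k(1)[OF x]] k(2)[OF x] by simp
    also have "\<dots> = finsum N (\<lambda>i. h (k x i \<odot>\<^bsub>?F\<^esub> unit_vector R n i)) {..<n}"
      using ki u by (intro module_hom_finsum[OF F.module_axioms N.module_axioms h(1)]) auto
    also have "\<dots> = finsum N (\<lambda>i. c i x \<odot>\<^bsub>N\<^esub> e i) {..<n}"
      using ki u module_homD[OF h(1)] by (intro N.finsum_cong') (auto simp: c_def e_def)
    finally show ?thesis .
  qed
  moreover have "e i \<in> carrier N" for i using module_homD(1)[OF h(1) u] by (simp add: e_def)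
  moreover have "c i \<in> module_hom R N (reg_module R)" if "i < n" for i
    using module_hom_comp[OF khom proj[OF that]] by (simp add: c_def[abs_def])
  moreover have "c i (e j) = (if i = j then \<one>\<^bsub>R\<^esub> else \<zero>\<^bsub>R\<^esub>)" if "i < n" "j < n" for i j
    using kh[OF u] that by (simp add: c_def e_def unit_vector_def)
  ultimately show ?thesis by blast
qed

lemma free_has_dual_basis:
  assumes "cring R" "free_of_rank R N n"
  shows "has_dual_basis TYPE(nat) R N"
proof -
  interpret N: plain_module R N using assms(2) by (simp add: free_of_rank_def plain_module_def)
  obtain e c where ec: "\<And>i. i < n \<Longrightarrow> e i \<in> carrier N" "\<And>i. i < n \<Longrightarrow> c i \<in> module_hom R N (reg_module R)"
    "\<And>x. x \<in> carrier N \<Longrightarrow> x = finsum N (\<lambda>i. c i x \<odot>\<^bsub>N\<^esub> e i) {..<n}"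
    using free_of_rank_basis[OF assms] by blast
  have "x = lincomb R N {..<n} (\<lambda>i. c i x) e" if x: "x \<in> carrier N" for x
    using ec(1) ec(3)[OF x] module_homD(1)[OF ec(2) x]
    by (subst N.lincomb_eq[of "{..<n}"]) auto
  then have "dual_basis R N {..<n} e c" using ec(1,2) by (auto simp: dual_basis_def)
  then show ?thesis by (auto simp: has_dual_basis_def)
qed

text \<open>The free module on the elements of \<open>P\<close> maps onto \<open>P\<close>; the coordinates of a splitting
  form a dual basis together with the elements of \<open>P\<close> themselves.\<close>

definition fin_supp_module :: "('a, 'm) ring_scheme \<Rightarrow> 'b set \<Rightarrow> ('a, 'b \<Rightarrow> 'a) module" where
  "fin_supp_module R U = \<lparr>carrier = {f. (\<forall>x. f x \<in> carrier R) \<and> (\<forall>x. x \<notin> U \<longrightarrow> f x = \<zero>\<^bsub>R\<^esub>) \<and>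
       finite {x. f x \<noteq> \<zero>\<^bsub>R\<^esub>}}, monoid.mult = undefined, one = undefined,
     ring.zero = (\<lambda>x. \<zero>\<^bsub>R\<^esub>), add = (\<lambda>f g x. f x \<oplus>\<^bsub>R\<^esub> g x), smult = (\<lambda>a f x. a \<otimes>\<^bsub>R\<^esub> f x)\<rparr>"

lemma (in cring) fin_supp_module_module: "module R (fin_supp_module R U)"
proof -
  let ?F = "fin_supp_module R U"
  have add: "f \<oplus>\<^bsub>?F\<^esub> g \<in> carrier ?F" if "f \<in> carrier ?F" "g \<in> carrier ?F" for f g
  proof -
    have "{x. f x \<oplus> g x \<noteq> \<zero>} \<subseteq> {x. f x \<noteq> \<zero>} \<union> {x. g x \<noteq> \<zero>}" by auto
    then show ?thesis
      using that by (auto simp: fin_supp_module_def dest: finite_subset)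
  qed
  have smult: "a \<odot>\<^bsub>?F\<^esub> f \<in> carrier ?F" if "a \<in> carrier R" "f \<in> carrier ?F" for a f
  proof -
    have "{x. a \<otimes> f x \<noteq> \<zero>} \<subseteq> {x. f x \<noteq> \<zero>}" using that(1) by auto
    then show ?thesis
      using that by (auto simp: fin_supp_module_def dest: finite_subset)
  qed
  show ?thesis
  proof (intro moduleI abelian_groupI)
    show "cring R" by (rule is_cring)
    show "\<zero>\<^bsub>?F\<^esub> \<in> carrier ?F" by (simp add: fin_supp_module_def)
    show "f \<oplus>\<^bsub>?F\<^esub> g \<in> carrier ?F" if "f \<in> carrier ?F" "g \<in> carrier ?F" for f g using that by (rule add)
    show "a \<odot>\<^bsub>?F\<^esub> f \<in> carrier ?F" if "a \<in> carrier R" "f \<in> carrier ?F" for a f using that by (rule smult)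
    show "\<exists>g\<in>carrier ?F. g \<oplus>\<^bsub>?F\<^esub> f = \<zero>\<^bsub>?F\<^esub>" if "f \<in> carrier ?F" for f
    proof
      show "(\<ominus> \<one>) \<odot>\<^bsub>?F\<^esub> f \<in> carrier ?F" using that by (intro smult) auto
      show "(\<ominus> \<one>) \<odot>\<^bsub>?F\<^esub> f \<oplus>\<^bsub>?F\<^esub> f = \<zero>\<^bsub>?F\<^esub>"
        using that by (simp add: fin_supp_module_def l_minus l_neg)
    qed
  qed (simp_all add: fin_supp_module_def a_ac l_distr r_distr m_assoc)
qed

lemma projective_has_dual_basis:
  fixes R :: "('a, 'm) ring_scheme" (structure) and P :: "('a, 'b) module"
  assumes "projective_module R P"
  shows "has_dual_basis TYPE('b) R P"
proof -
  interpret P: plain_module R P using assms by (simp add: projective_module_def plain_module_def)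
  let ?F = "fin_supp_module R (carrier P)"
  define g where "g f = lincomb R P (carrier P) f (\<lambda>x. x)" for f
  have F: "module R ?F" by (rule cring.fin_supp_module_module[OF P.R.is_cring])
  have FD: "\<And>x. f x \<in> carrier R" "finite {x \<in> carrier P. f x \<noteq> \<zero>}" if "f \<in> carrier ?F" for f
    using that by (auto simp: fin_supp_module_def)
  have g: "g \<in> module_hom R ?F P"
  proof (intro module_homI)
    fix f assume f: "f \<in> carrier ?F"
    show "g f \<in> carrier P" unfolding g_def using FD[OF f] by (intro P.lincomb_closed) auto
    {
      fix f' assume f': "f' \<in> carrier ?F"
      have "f \<oplus>\<^bsub>?F\<^esub> f' = (\<lambda>x. f x \<oplus> f' x)" by (simp add: fin_supp_module_def)
      then show "g (f \<oplus>\<^bsub>?F\<^esub> f') = g f \<oplus>\<^bsub>P\<^esub> g f'"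
        unfolding g_def using FD[OF f] FD[OF f'] P.lincomb_add[of "carrier P" f f' "\<lambda>x. x"] by simp
    }
    fix a assume a: "a \<in> carrier R"
    have "a \<odot>\<^bsub>?F\<^esub> f = (\<lambda>x. a \<otimes> f x)" by (simp add: fin_supp_module_def)
    then show "g (a \<odot>\<^bsub>?F\<^esub> f) = a \<odot>\<^bsub>P\<^esub> g f"
      unfolding g_def using FD[OF f] a P.lincomb_smult[of "carrier P" f "\<lambda>x. x" a] by simp
  qed
  have "x \<in> g ` carrier ?F" if x: "x \<in> carrier P" for x
  proof
    let ?f = "\<lambda>y. if y = x then \<one>\<^bsub>R\<^esub> else \<zero>\<^bsub>R\<^esub>"
    \<comment> \<open>The support of \<open>?f\<close> in the form that simplification gives it; it
      is empty if 1 = 0.\<close>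
    have "{y. y = x \<and> \<one> \<noteq> \<zero>} \<subseteq> {x}" by auto
    then have "finite {y. y = x \<and> \<one> \<noteq> \<zero>}" by (rule finite_subset) simp
    then show "?f \<in> carrier ?F" using x by (auto simp: fin_supp_module_def)
    have "g ?f = finsum P (\<lambda>y. ?f y \<odot>\<^bsub>P\<^esub> y) {x}"
      unfolding g_def using x by (intro P.lincomb_eq) auto
    then show "x = g ?f" using x by simp
  qed
  then have "g ` carrier ?F = carrier P" using module_homD(1)[OF g] by blast
  then obtain s where s: "s \<in> module_hom R P ?F" "\<And>x. x \<in> carrier P \<Longrightarrow> g (s x) = x"
    using assms F g unfolding projective_module_def by blast
  have "(\<lambda>x. s x b) \<in> module_hom R P (reg_module R)" for b
    using module_homD[OF s(1)] by (intro module_homI) (auto simp: fin_supp_module_def)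
  moreover have "finite {b \<in> carrier P. s x b \<noteq> \<zero>}" if "x \<in> carrier P" for x
    using FD(2)[OF module_homD(1)[OF s(1) that]] .
  ultimately have "dual_basis R P (carrier P) (\<lambda>b. b) (\<lambda>b x. s x b)"
    using s(2) by (auto simp: dual_basis_def g_def)
  then show ?thesis by (auto simp: has_dual_basis_def)
qed

section \<open>Comparison of resolutions\<close>

lemma left_resolutionD:
  assumes "left_resolution R F d \<epsilon> N"
  shows "module R (F i)" "d i \<in> module_hom R (F (Suc i)) (F i)" "\<epsilon> \<in> module_hom R (F 0) N"
    "\<epsilon> ` carrier (F 0) = carrier N"
    "d 0 ` carrier (F 1) = {x \<in> carrier (F 0). \<epsilon> x = \<zero>\<^bsub>N\<^esub>}"
    "d (Suc i) ` carrier (F (Suc (Suc i))) = {x \<in> carrier (F (Suc i)). d i x = \<zero>\<^bsub>F i\<^esub>}"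
    "x \<in> carrier (F 1) \<Longrightarrow> \<epsilon> (d 0 x) = \<zero>\<^bsub>N\<^esub>"
    "x \<in> carrier (F (Suc (Suc i))) \<Longrightarrow> d i (d (Suc i) x) = \<zero>\<^bsub>F i\<^esub>"
  using assms unfolding left_resolution_def by blast+

text \<open>Lifts are chosen degree by degree. \<open>P\<close> records that the composite with
  \<open>dF\<close> falls into the image of \<open>dG\<close>, which is what the next lift requires,
  and \<open>Q\<close> is the commutation of neighbouring maps.\<close>

lemma chain_map_exists:
  assumes F: "left_resolution R F dF \<epsilon>F N" and G: "left_resolution R G dG \<epsilon>G N"
    and N: "module R N" and db: "\<And>i. has_dual_basis TYPE('i) R (F i)"
  shows "\<exists>\<alpha>. \<forall>i. \<alpha> i \<in> module_hom R (F i) (G i) \<and>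
    (\<forall>x\<in>carrier (F 0). \<epsilon>G (\<alpha> 0 x) = \<epsilon>F x) \<and>
    (\<forall>x\<in>carrier (F (Suc i)). dG i (\<alpha> (Suc i) x) = \<alpha> i (dF i x))"
proof -
  note F' = left_resolutionD[OF F] and G' = left_resolutionD[OF G]
  define P where "P n a \<longleftrightarrow> a \<in> module_hom R (F n) (G n) \<and> (n = 0 \<longrightarrow> (\<forall>x\<in>carrier (F 0). \<epsilon>G (a x) = \<epsilon>F x)) \<and>
      (\<forall>x\<in>carrier (F (Suc n)). a (dF n x) \<in> dG n ` carrier (G (Suc n)))" for n a
  define Q where "Q n a b \<longleftrightarrow> (\<forall>x\<in>carrier (F (Suc n)). dG n (b x) = a (dF n x))" for n a b
  have "\<exists>\<alpha>. \<forall>n. P n (\<alpha> n) \<and> Q n (\<alpha> n) (\<alpha> (Suc n))"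
  proof (rule dependent_nat_choice)
    obtain a where a: "a \<in> module_hom R (F 0) (G 0)" "\<forall>x\<in>carrier (F 0). \<epsilon>G (a x) = \<epsilon>F x"
      using lift_through[OF F'(1) G'(1) N db F'(3) G'(3)] G'(4) module_homD(1)[OF F'(3)] by auto
    have "a (dF 0 x) \<in> dG 0 ` carrier (G 1)" if "x \<in> carrier (F 1)" for x
      using that a module_homD(1)[OF F'(2)[of 0]] module_homD(1)[OF a(1)] F'(7) unfolding G'(5) by auto
    then show "\<exists>x. P 0 x" using a by (auto simp: P_def)
  next
    fix a n assume a: "P n a"
    have "\<exists>b\<in>module_hom R (F (Suc n)) (G (Suc n)). \<forall>x\<in>carrier (F (Suc n)). dG n (b x) = a (dF n x)"
      using a by (intro lift_through[OF F'(1) G'(1) G'(1) db _ G'(2)]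
          module_hom_comp[OF F'(2)]) (auto simp: P_def)
    then obtain b where b: "b \<in> module_hom R (F (Suc n)) (G (Suc n))"
      "\<forall>x\<in>carrier (F (Suc n)). dG n (b x) = a (dF n x)" by blast
    have "b (dF (Suc n) x) \<in> dG (Suc n) ` carrier (G (Suc (Suc n)))" if "x \<in> carrier (F (Suc (Suc n)))" for x
    proof -
      have c: "dF (Suc n) x \<in> carrier (F (Suc n))" using module_homD(1)[OF F'(2) that] .
      have "dG n (b (dF (Suc n) x)) = a \<zero>\<^bsub>F n\<^esub>" using b(2) c F'(8)[OF that] by simp
      also have "\<dots> = \<zero>\<^bsub>G n\<^esub>" using a by (intro module_hom_zero[OF F'(1) G'(1)]) (auto simp: P_def)
      finally show ?thesis unfolding G'(6) using module_homD(1)[OF b(1) c] by simp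
    qed
    then show "\<exists>b. P (Suc n) b \<and> Q n a b" using b by (auto simp: P_def Q_def)
  qed
  then obtain \<alpha> where "\<And>n. P n (\<alpha> n)" "\<And>n. Q n (\<alpha> n) (\<alpha> (Suc n))" by blast
  then show ?thesis by (intro exI[of _ \<alpha>]) (auto simp: P_def Q_def)
qed

text \<open>The condition d s d = \<chi> d kept in \<open>P\<close> makes \<chi> - s d, one degree
  higher, a map into the cycles, which exactness lifts to the next \<open>s\<close>.\<close>

lemma null_homotopy_exists:
  assumes F: "left_resolution R F d \<epsilon> N" and db: "\<And>i. has_dual_basis TYPE('i) R (F i)"
    and chi: "\<And>i. \<chi> i \<in> module_hom R (F i) (F i)"
    and comm: "\<And>i x. x \<in> carrier (F (Suc i)) \<Longrightarrow> d i (\<chi> (Suc i) x) = \<chi> i (d i x)"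
    and aug: "\<And>x. x \<in> carrier (F 0) \<Longrightarrow> \<epsilon> (\<chi> 0 x) = \<zero>\<^bsub>N\<^esub>"
  shows "\<exists>s. (\<forall>i. s i \<in> module_hom R (F i) (F (Suc i))) \<and>
    (\<forall>x\<in>carrier (F 0). \<chi> 0 x = d 0 (s 0 x)) \<and>
    (\<forall>i. \<forall>x\<in>carrier (F (Suc i)). \<chi> (Suc i) x = d (Suc i) (s (Suc i) x) \<oplus>\<^bsub>F (Suc i)\<^esub> s i (d i x))"
proof -
  note F' = left_resolutionD[OF F]
  define P where "P n s \<longleftrightarrow> s \<in> module_hom R (F n) (F (Suc n)) \<and> (n = 0 \<longrightarrow> (\<forall>x\<in>carrier (F 0). \<chi> 0 x = d 0 (s x))) \<and>
      (\<forall>x\<in>carrier (F (Suc n)). d n (s (d n x)) = \<chi> n (d n x))" for n s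
  define Q where "Q n s t \<longleftrightarrow> (\<forall>x\<in>carrier (F (Suc n)). \<chi> (Suc n) x = d (Suc n) (t x) \<oplus>\<^bsub>F (Suc n)\<^esub> s (d n x))" for n s t
  have "\<exists>s. \<forall>n. P n (s n) \<and> Q n (s n) (s (Suc n))"
  proof (rule dependent_nat_choice)
    have "\<exists>s\<in>module_hom R (F 0) (F 1). \<forall>x\<in>carrier (F 0). d 0 (s x) = \<chi> 0 x"
      using aug module_homD(1)[OF chi] F'(2)[of 0] unfolding One_nat_def
      by (intro lift_through[OF F'(1) F'(1) F'(1) db chi]) (auto simp: F'(5)[unfolded One_nat_def])
    then obtain s where s: "s \<in> module_hom R (F 0) (F 1)" "\<forall>x\<in>carrier (F 0). d 0 (s x) = \<chi> 0 x" by blast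
    then show "\<exists>s. P 0 s" using module_homD(1)[OF F'(2)[of 0]] by (auto simp: P_def)
  next
    fix s n assume s: "P n s"
    interpret Fn: plain_module R "F n" by (rule plain_module.intro[OF F'(1)])
    interpret Fs: plain_module R "F (Suc n)" by (rule plain_module.intro[OF F'(1)])
    have sh: "s \<in> module_hom R (F n) (F (Suc n))" using s by (simp add: P_def)
    define u where "u x = \<chi> (Suc n) x \<ominus>\<^bsub>F (Suc n)\<^esub> s (d n x)" for x
    have u: "u \<in> module_hom R (F (Suc n)) (F (Suc n))"
      unfolding u_def using module_hom_diff[OF F'(1) F'(1) chi module_hom_comp[OF F'(2) sh]] .
    have ux: "u x \<in> d (Suc n) ` carrier (F (Suc (Suc n)))" if x: "x \<in> carrier (F (Suc n))" for x
    proof -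
      have c: "d n x \<in> carrier (F n)" "s (d n x) \<in> carrier (F (Suc n))" "\<chi> (Suc n) x \<in> carrier (F (Suc n))"
        using x module_homD(1)[OF F'(2)] module_homD(1)[OF sh] module_homD(1)[OF chi] by auto
      have "d n (u x) = d n (\<chi> (Suc n) x) \<ominus>\<^bsub>F n\<^esub> d n (s (d n x))"
        unfolding u_def by (rule module_hom_minus[OF F'(1) F'(1) F'(2) c(3,2)])
      also have "\<dots> = \<zero>\<^bsub>F n\<^esub>"
        using s x comm[OF x] module_homD(1)[OF chi c(1)] by (simp add: P_def a_minus_def Fn.M.r_neg)
      finally show ?thesis unfolding F'(6) using module_homD(1)[OF u x] by simp
    qed
    obtain t where t: "t \<in> module_hom R (F (Suc n)) (F (Suc (Suc n)))"
      "\<forall>x\<in>carrier (F (Suc n)). d (Suc n) (t x) = u x"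
      using lift_through[OF F'(1) F'(1) F'(1) db u F'(2) ux] by blast
    have Q: "Q n s t"
      unfolding Q_def
    proof
      fix x assume x: "x \<in> carrier (F (Suc n))"
      have c: "s (d n x) \<in> carrier (F (Suc n))" "\<chi> (Suc n) x \<in> carrier (F (Suc n))"
        using x module_homD(1)[OF F'(2)] module_homD(1)[OF sh] module_homD(1)[OF chi] by auto
      show "\<chi> (Suc n) x = d (Suc n) (t x) \<oplus>\<^bsub>F (Suc n)\<^esub> s (d n x)"
        using t(2) x Fs.minus_add_cancel[OF c(2,1)] by (simp add: u_def)
    qed
    have "d (Suc n) (t (d (Suc n) x)) = \<chi> (Suc n) (d (Suc n) x)" if x: "x \<in> carrier (F (Suc (Suc n)))" for x
    proof -
      have c: "d (Suc n) x \<in> carrier (F (Suc n))" using module_homD(1)[OF F'(2) x] .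
      have "s (d n (d (Suc n) x)) = \<zero>\<^bsub>F (Suc n)\<^esub>"
        using F'(8)[OF x] module_hom_zero[OF F'(1) F'(1) sh] by simp
      then show ?thesis
        using Q c module_homD(1)[OF F'(2) module_homD(1)[OF t(1) c]] by (simp add: Q_def)
    qed
    then show "\<exists>t. P (Suc n) t \<and> Q n s t" using Q t(1) by (auto simp: P_def)
  qed
  then obtain s where "\<And>n. P n (s n)" "\<And>n. Q n (s n) (s (Suc n))" by blast
  then show ?thesis by (intro exI[of _ s]) (auto simp: P_def Q_def)
qed

section \<open>Quotient modules\<close>

context plain_module
begin

lemma coset_eq: "K +>\<^bsub>M\<^esub> x = {k \<oplus>\<^bsub>M\<^esub> x | k. k \<in> K}"
  by (auto simp: a_r_coset_def')

lemma coset_eq_iff: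
  assumes K: "submodule K R M" and x: "x \<in> carrier M" and y: "y \<in> carrier M"
  shows "K +>\<^bsub>M\<^esub> x = K +>\<^bsub>M\<^esub> y \<longleftrightarrow> x \<ominus>\<^bsub>M\<^esub> y \<in> K"
proof
  note K' = submoduleD[OF K]
  assume eq: "K +>\<^bsub>M\<^esub> x = K +>\<^bsub>M\<^esub> y"
  have "x = \<zero>\<^bsub>M\<^esub> \<oplus>\<^bsub>M\<^esub> x" using x by simp
  then have "x \<in> K +>\<^bsub>M\<^esub> x" unfolding coset_eq using K'(2) by blast
  then obtain k where k: "k \<in> K" "x = k \<oplus>\<^bsub>M\<^esub> y" unfolding eq unfolding coset_eq by blast
  have "k \<in> carrier M" using k(1) K'(1) by blast
  then have "x \<ominus>\<^bsub>M\<^esub> y = k" unfolding k(2) using y by (simp add: a_minus_def M.a_assoc M.r_neg)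
  then show "x \<ominus>\<^bsub>M\<^esub> y \<in> K" using k(1) by simp
next
  note K' = submoduleD[OF K]
  assume d: "x \<ominus>\<^bsub>M\<^esub> y \<in> K"
  have sub: "K +>\<^bsub>M\<^esub> u \<subseteq> K +>\<^bsub>M\<^esub> v" if "u \<ominus>\<^bsub>M\<^esub> v \<in> K" "u \<in> carrier M" "v \<in> carrier M" for u v
  proof
    fix w assume "w \<in> K +>\<^bsub>M\<^esub> u"
    then obtain k where k: "k \<in> K" "w = k \<oplus>\<^bsub>M\<^esub> u" unfolding coset_eq by blast
    have kc: "k \<in> carrier M" using k(1) K'(1) by blast
    have "w = (k \<oplus>\<^bsub>M\<^esub> (u \<ominus>\<^bsub>M\<^esub> v)) \<oplus>\<^bsub>M\<^esub> v"
      using minus_add_cancel[OF that(2,3)] kc that(2,3) k(2) by (simp add: M.a_assoc)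
    moreover have "k \<oplus>\<^bsub>M\<^esub> (u \<ominus>\<^bsub>M\<^esub> v) \<in> K" using K'(3) k(1) that(1) by blast
    ultimately show "w \<in> K +>\<^bsub>M\<^esub> v" unfolding coset_eq by blast
  qed
  have "y \<ominus>\<^bsub>M\<^esub> x = (\<ominus> \<one>) \<odot>\<^bsub>M\<^esub> (x \<ominus>\<^bsub>M\<^esub> y)"
    using x y by (simp add: a_minus_def uminus_eq_smult[symmetric] M.minus_add M.a_comm)
  then have "y \<ominus>\<^bsub>M\<^esub> x \<in> K" using d K'(5) by simp
  then show "K +>\<^bsub>M\<^esub> x = K +>\<^bsub>M\<^esub> y" using sub d x y by blast
qed

lemma quot_module_carrier: "carrier (quot_module M K) = (\<lambda>x. K +>\<^bsub>M\<^esub> x) ` carrier M"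
  by (auto simp: quot_module_def A_RCOSETS_def')

lemma quot_module_zero: "K \<subseteq> carrier M \<Longrightarrow> \<zero>\<^bsub>quot_module M K\<^esub> = K +>\<^bsub>M\<^esub> \<zero>\<^bsub>M\<^esub>"
  by (auto simp: quot_module_def)

lemma quot_module_add:
  assumes K: "submodule K R M" and x: "x \<in> carrier M" and y: "y \<in> carrier M"
  shows "(K +>\<^bsub>M\<^esub> x) \<oplus>\<^bsub>quot_module M K\<^esub> (K +>\<^bsub>M\<^esub> y) = K +>\<^bsub>M\<^esub> (x \<oplus>\<^bsub>M\<^esub> y)"
proof -
  note K' = submoduleD[OF K]
  have 1: "(k \<oplus>\<^bsub>M\<^esub> x) \<oplus>\<^bsub>M\<^esub> (k' \<oplus>\<^bsub>M\<^esub> y) = (k \<oplus>\<^bsub>M\<^esub> k') \<oplus>\<^bsub>M\<^esub> (x \<oplus>\<^bsub>M\<^esub> y)"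
    if "k \<in> K" "k' \<in> K" for k k'
    using that K'(1) x y by (auto simp: subset_iff M.a_ac)
  have 2: "k \<oplus>\<^bsub>M\<^esub> (x \<oplus>\<^bsub>M\<^esub> y) = (k \<oplus>\<^bsub>M\<^esub> x) \<oplus>\<^bsub>M\<^esub> (\<zero>\<^bsub>M\<^esub> \<oplus>\<^bsub>M\<^esub> y)" if "k \<in> K" for k
    using that K'(1) x y by (auto simp: subset_iff M.a_ac)
  have "set_add M {k \<oplus>\<^bsub>M\<^esub> x |k. k \<in> K} {k \<oplus>\<^bsub>M\<^esub> y |k. k \<in> K} = {k \<oplus>\<^bsub>M\<^esub> (x \<oplus>\<^bsub>M\<^esub> y) |k. k \<in> K}"
  proof (intro equalityI subsetI)
    fix z assume "z \<in> set_add M {k \<oplus>\<^bsub>M\<^esub> x |k. k \<in> K} {k \<oplus>\<^bsub>M\<^esub> y |k. k \<in> K}"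
    then obtain k k' where k: "k \<in> K" "k' \<in> K" "z = (k \<oplus>\<^bsub>M\<^esub> x) \<oplus>\<^bsub>M\<^esub> (k' \<oplus>\<^bsub>M\<^esub> y)"
      unfolding set_add_def' by blast
    then show "z \<in> {k \<oplus>\<^bsub>M\<^esub> (x \<oplus>\<^bsub>M\<^esub> y) |k. k \<in> K}"
      unfolding 1[OF k(1,2)] using K'(3) by blast
  next
    fix z assume "z \<in> {k \<oplus>\<^bsub>M\<^esub> (x \<oplus>\<^bsub>M\<^esub> y) |k. k \<in> K}"
    then obtain k where k: "k \<in> K" "z = k \<oplus>\<^bsub>M\<^esub> (x \<oplus>\<^bsub>M\<^esub> y)" by blast
    then show "z \<in> set_add M {k \<oplus>\<^bsub>M\<^esub> x |k. k \<in> K} {k \<oplus>\<^bsub>M\<^esub> y |k. k \<in> K}"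
      unfolding set_add_def' using 2[OF k(1)] K'(2) by blast
  qed
  then show ?thesis by (simp add: quot_module_def coset_eq)
qed

lemma quot_module_smult:
  assumes K: "submodule K R M" and x: "x \<in> carrier M" and a: "a \<in> carrier R"
  shows "a \<odot>\<^bsub>quot_module M K\<^esub> (K +>\<^bsub>M\<^esub> x) = K +>\<^bsub>M\<^esub> (a \<odot>\<^bsub>M\<^esub> x)"
proof -
  note K' = submoduleD[OF K]
  have "K +>\<^bsub>M\<^esub> (a \<odot>\<^bsub>M\<^esub> (k \<oplus>\<^bsub>M\<^esub> x)) = K +>\<^bsub>M\<^esub> (a \<odot>\<^bsub>M\<^esub> x)" if k: "k \<in> K" for k
  proof -
    have kc: "k \<in> carrier M" using k K'(1) by blast
    have "a \<odot>\<^bsub>M\<^esub> (k \<oplus>\<^bsub>M\<^esub> x) \<ominus>\<^bsub>M\<^esub> a \<odot>\<^bsub>M\<^esub> x = a \<odot>\<^bsub>M\<^esub> k"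
      using kc x a by (simp add: smult_r_distr a_minus_def M.a_assoc M.r_neg)
    then show ?thesis using kc x a k K'(5) by (subst coset_eq_iff[OF K]) auto
  qed
  then show ?thesis
    using K'(2) by (auto simp: quot_module_def coset_eq[of K x])
qed

lemma quot_module_module:
  assumes K: "submodule K R M"
  shows "module R (quot_module M K)"
  by (rule module_surj_image[OF module_axioms, where h = "\<lambda>x. K +>\<^bsub>M\<^esub> x"])
    (use submoduleD(1)[OF K] in \<open>simp_all add: quot_module_carrier quot_module_zero
      quot_module_add[OF K] quot_module_smult[OF K]\<close>)

lemma quot_module_proj_hom:
  assumes K: "submodule K R M"
  shows "(\<lambda>x. K +>\<^bsub>M\<^esub> x) \<in> module_hom R M (quot_module M K)"
  by (intro module_homI) (auto simp: quot_module_carrier quot_module_add[OF K] quot_module_smult[OF K])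

lemma coset_zero_iff:
  assumes K: "submodule K R M" and x: "x \<in> carrier M"
  shows "K +>\<^bsub>M\<^esub> x = \<zero>\<^bsub>quot_module M K\<^esub> \<longleftrightarrow> x \<in> K"
  using coset_eq_iff[OF K x M.zero_closed] quot_module_zero[OF submoduleD(1)[OF K]]
    minus_add_cancel[OF x M.zero_closed] x by simp

end

lemma (in cring) submodule_ideal:
  assumes "ideal K R"
  shows "submodule K R (reg_module R)"
proof -
  interpret S: plain_module R "reg_module R" by (rule plain_module.intro[OF reg_module_module])
  show ?thesis using idealD[OF assms] by (intro S.submoduleI_smult) auto
qed

section \<open>Minimal resolutions over local rings\<close>

lemma local_ring_Units:
  assumes loc: "noetherian_local_ring R" and m: "maximalideal m R" and s: "s \<in> carrier R - m"
  shows "s \<in> Units R"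
proof -
  interpret noetherian_ring R using loc by (simp add: noetherian_local_ring_def)
  interpret cring R using loc by (simp add: noetherian_local_ring_def)
  have sc: "{s} \<subseteq> carrier R" using s by blast
  have one: "\<one>\<^bsub>R\<^esub> \<in> Idl\<^bsub>R\<^esub> {s}"
  proof (rule ccontr)
    assume "\<one>\<^bsub>R\<^esub> \<notin> Idl\<^bsub>R\<^esub> {s}"
    then obtain N where N: "ideal N R" "\<one>\<^bsub>R\<^esub> \<notin> N" "Idl\<^bsub>R\<^esub> {s} \<subseteq> N"
      "\<And>N'. ideal N' R \<Longrightarrow> \<one>\<^bsub>R\<^esub> \<notin> N' \<Longrightarrow> N \<subseteq> N' \<Longrightarrow> N' = N"
      using ideal_maximal_element[OF genideal_ideal[OF sc], of "\<lambda>N. \<one>\<^bsub>R\<^esub> \<notin> N"] by metis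
    have "maximalideal N R"
    proof (rule maximalidealI[OF N(1)])
      show "carrier R \<noteq> N" using N(2) by blast
      show "N' = N \<or> N' = carrier R" if "ideal N' R" "N \<subseteq> N'" for N'
        using N(4)[OF that(1) _ that(2)] ideal.one_imp_carrier[OF that(1)] by blast
    qed
    then have "N = m" using loc m unfolding noetherian_local_ring_def by blast
    then show False using genideal_self[OF sc] N(3) s by blast
  qed
  then obtain a where a: "a \<in> carrier R" "\<one>\<^bsub>R\<^esub> = a \<otimes>\<^bsub>R\<^esub> s"
    using s cgenideal_eq_genideal[of s] by (auto simp: cgenideal_def)
  then show ?thesis using s m_comm[of a s] unfolding Units_def by auto
qed

lemma free_finitely_generated:
  assumes cr: "cring R" and free: "free_of_rank R N n"
  shows "\<exists>A\<subseteq>carrier N. finite A \<and> gen_submodule R N A = carrier N"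
proof -
  interpret N: plain_module R N using free by (simp add: free_of_rank_def plain_module_def)
  obtain e c where ec: "\<And>i. i < n \<Longrightarrow> e i \<in> carrier N" "\<And>i. i < n \<Longrightarrow> c i \<in> module_hom R N (reg_module R)"
    "\<And>x. x \<in> carrier N \<Longrightarrow> x = finsum N (\<lambda>i. c i x \<odot>\<^bsub>N\<^esub> e i) {..<n}"
    using free_of_rank_basis[OF cr free] by blast
  let ?A = "e ` {..<n}"
  have Ac: "?A \<subseteq> carrier N" using ec(1) by auto
  note G = N.submodule_gen_submodule[OF Ac]
  note G' = N.submoduleD[OF G(1)]
  have "y \<in> gen_submodule R N ?A" if y: "y \<in> carrier N" for y
  proof -
    have "finsum N (\<lambda>i. c i y \<odot>\<^bsub>N\<^esub> e i) {..<n} \<in> gen_submodule R N ?A"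
    proof (rule N.finsum_in_submodule[OF G(1)])
      show "(\<lambda>i. c i y \<odot>\<^bsub>N\<^esub> e i) \<in> {..<n} \<rightarrow> gen_submodule R N ?A"
        using G(2) module_homD(1)[OF ec(2) y] by (auto intro!: G'(5))
    qed simp
    then show ?thesis using ec(3)[OF y] by simp
  qed
  then show ?thesis using Ac G'(1) by (intro exI[of _ ?A]) auto
qed

lemma (in plain_module) gen_submodule_Un_carrier:
  assumes "A \<subseteq> carrier M" "gen_submodule R M A = carrier M" "K \<subseteq> carrier M"
  shows "gen_submodule R M (K \<union> A) = carrier M"
proof -
  have c: "K \<union> A \<subseteq> carrier M" using assms by blast
  note L = submodule_gen_submodule[OF c]
  have "gen_submodule R M A \<subseteq> gen_submodule R M (K \<union> A)"
    using L(2) by (intro gen_submodule_minimal[OF L(1)]) blast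
  then show ?thesis using assms(2) submoduleD(1)[OF L(1)] by blast
qed

text \<open>This is \<open>nakayama_local\<close> at the maximal ideal, where the multipliers are
  units and cancel.\<close>

lemma nakayama_free:
  assumes loc: "noetherian_local_ring R" and m: "maximalideal m R"
    and free: "free_of_rank R N n" and K: "submodule K R N"
    and gen: "carrier N \<subseteq> gen_submodule R N (K \<union> {a \<odot>\<^bsub>N\<^esub> x | a x. a \<in> m \<and> x \<in> carrier N})"
  shows "carrier N \<subseteq> K"
proof
  fix x assume x: "x \<in> carrier N"
  have cr: "cring R" using loc by (simp add: noetherian_local_ring_def)
  interpret N: plain_module R N using free by (simp add: free_of_rank_def plain_module_def)
  obtain A where A: "A \<subseteq> carrier N" "finite A" "gen_submodule R N A = carrier N"
    using free_finitely_generated[OF cr free] by blast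
  have W: "carrier N = gen_submodule R N (K \<union> A)"
    using N.gen_submodule_Un_carrier[OF A(1,3) N.submoduleD(1)[OF K]] by simp
  have "\<exists>s\<in>carrier R - m. s \<odot>\<^bsub>N\<^esub> x \<in> K"
  proof (rule N.nakayama_local[OF cring.maximalideal_prime[OF cr m] A(2,1) K W _ x])
    have "\<one>\<^bsub>R\<^esub> \<notin> m" using maximalideal.I_notcarr[OF m] ideal.one_imp_carrier[OF maximalideal.axioms(1)[OF m]] by blast
    then show "\<exists>s\<in>carrier R - m. s \<odot>\<^bsub>N\<^esub> w \<in>
        gen_submodule R N (K \<union> {q \<odot>\<^bsub>N\<^esub> v |q v. q \<in> m \<and> v \<in> carrier N})" if "w \<in> carrier N" for w
      using gen that by (intro bexI[of _ "\<one>\<^bsub>R\<^esub>"]) auto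
  qed
  then obtain s where s: "s \<in> carrier R - m" "s \<odot>\<^bsub>N\<^esub> x \<in> K" by blast
  have u: "s \<in> Units R" by (rule local_ring_Units[OF loc m s(1)])
  then obtain t where t: "t \<in> carrier R" "t \<otimes>\<^bsub>R\<^esub> s = \<one>\<^bsub>R\<^esub>" by (auto simp: Units_def)
  have "x = t \<odot>\<^bsub>N\<^esub> (s \<odot>\<^bsub>N\<^esub> x)" using t s x by (simp add: N.smult_assoc1[symmetric])
  then show "x \<in> K" using N.submoduleD(5)[OF K t(1) s(2)] by simp
qed

lemma noetherian_local_ring_maximal:
  assumes "noetherian_local_ring R"
  obtains m where "maximalideal m R"
  using assms by (auto simp: noetherian_local_ring_def)

lemma minimal_free_resolutionD:
  assumes "minimal_free_resolution R F d \<epsilon> N"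
  shows "left_resolution R F d \<epsilon> N" "\<exists>n. free_of_rank R (F i) n"
    "maximalideal m R \<Longrightarrow> d i ` carrier (F (Suc i)) \<subseteq>
        gen_submodule R (F i) {a \<odot>\<^bsub>F i\<^esub> x | a x. a \<in> m \<and> x \<in> carrier (F i)}"
  using assms by (auto simp: minimal_free_resolution_def)

lemma minimal_free_resolution_dual_basis:
  assumes "cring R" "minimal_free_resolution R F d \<epsilon> N"
  shows "has_dual_basis TYPE(nat) R (F i)"
  using minimal_free_resolutionD(2)[OF assms(2)] free_has_dual_basis[OF assms(1)] by blast

text \<open>Composing comparison maps \<open>F \<rightarrow> P \<rightarrow> F\<close> gives an endomorphism of \<open>F\<close> homotopic to the identity
  and zero beyond the length of \<open>P\<close>, so there \<open>F i\<close> equals its multiple by the maximal ideal.\<close>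

lemma minimal_free_resolution_length:
  fixes P :: "nat \<Rightarrow> ('a, 'p) module"
  assumes loc: "noetherian_local_ring R" and N: "module R N"
    and F: "minimal_free_resolution R F d \<epsilon> N"
    and P: "left_resolution R P dP \<epsilon>P N" "\<And>i. projective_module R (P i)"
    and len: "\<And>i. i > n \<Longrightarrow> carrier (P i) = {\<zero>\<^bsub>P i\<^esub>}" and i: "i > n"
  shows "carrier (F i) = {\<zero>\<^bsub>F i\<^esub>}"
proof -
  have cr: "cring R" using loc by (simp add: noetherian_local_ring_def)
  obtain m where m: "maximalideal m R" using noetherian_local_ring_maximal[OF loc] .
  note res = minimal_free_resolutionD(1)[OF F]
  note F' = left_resolutionD[OF res] and P' = left_resolutionD[OF P(1)]
  note db = minimal_free_resolution_dual_basis[OF cr F]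
  obtain \<alpha> where \<alpha>: "\<And>i. \<alpha> i \<in> module_hom R (F i) (P i)"
    "\<And>x. x \<in> carrier (F 0) \<Longrightarrow> \<epsilon>P (\<alpha> 0 x) = \<epsilon> x"
    "\<And>i x. x \<in> carrier (F (Suc i)) \<Longrightarrow> dP i (\<alpha> (Suc i) x) = \<alpha> i (d i x)"
    using chain_map_exists[OF res P(1) N db] by blast
  have dbP: "has_dual_basis TYPE('p) R (P i)" for i by (rule projective_has_dual_basis[OF P(2)])
  obtain \<beta> where \<beta>: "\<And>i. \<beta> i \<in> module_hom R (P i) (F i)"
    "\<And>x. x \<in> carrier (P 0) \<Longrightarrow> \<epsilon> (\<beta> 0 x) = \<epsilon>P x"
    "\<And>i x. x \<in> carrier (P (Suc i)) \<Longrightarrow> d i (\<beta> (Suc i) x) = \<beta> i (dP i x)"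
    using chain_map_exists[OF P(1) res N dbP] by blast
  \<comment> \<open>The difference of the identity and the composite \<beta> \<alpha> induces zero
    on \<open>N\<close>, hence is null-homotopic.\<close>
  define \<chi> where "\<chi> i x = x \<ominus>\<^bsub>F i\<^esub> \<beta> i (\<alpha> i x)" for i x
  have \<chi>: "\<chi> i \<in> module_hom R (F i) (F i)" for i
    unfolding \<chi>_def[abs_def]
    by (rule module_hom_diff[OF F'(1) F'(1) module_hom_id module_hom_comp[OF \<alpha>(1) \<beta>(1)]])
  have cl: "\<alpha> i x \<in> carrier (P i)" "\<beta> i (\<alpha> i x) \<in> carrier (F i)" if "x \<in> carrier (F i)" for i x
    using module_homD(1)[OF \<alpha>(1) that] module_homD(1)[OF \<beta>(1)] by auto
  have comm: "d i (\<chi> (Suc i) x) = \<chi> i (d i x)" if x: "x \<in> carrier (F (Suc i))" for i x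
  proof -
    have "d i (\<chi> (Suc i) x) = d i x \<ominus>\<^bsub>F i\<^esub> d i (\<beta> (Suc i) (\<alpha> (Suc i) x))"
      unfolding \<chi>_def by (rule module_hom_minus[OF F'(1) F'(1) F'(2) x cl(2)[OF x]])
    also have "d i (\<beta> (Suc i) (\<alpha> (Suc i) x)) = \<beta> i (\<alpha> i (d i x))"
      using \<beta>(3)[OF cl(1)[OF x]] \<alpha>(3)[OF x] by simp
    finally show ?thesis by (simp add: \<chi>_def)
  qed
  have aug: "\<epsilon> (\<chi> 0 x) = \<zero>\<^bsub>N\<^esub>" if x: "x \<in> carrier (F 0)" for x
  proof -
    interpret N: plain_module R N using N by (rule plain_module.intro)
    have "\<epsilon> (\<chi> 0 x) = \<epsilon> x \<ominus>\<^bsub>N\<^esub> \<epsilon> (\<beta> 0 (\<alpha> 0 x))"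
      unfolding \<chi>_def by (rule module_hom_minus[OF F'(1) N F'(3) x cl(2)[OF x]])
    also have "\<epsilon> (\<beta> 0 (\<alpha> 0 x)) = \<epsilon> x" using \<beta>(2)[OF cl(1)[OF x]] \<alpha>(2)[OF x] by simp
    finally show ?thesis using module_homD(1)[OF F'(3) x] by (simp add: a_minus_def N.M.r_neg)
  qed
  obtain s where s: "\<And>i. s i \<in> module_hom R (F i) (F (Suc i))"
    "\<And>i x. x \<in> carrier (F (Suc i)) \<Longrightarrow> \<chi> (Suc i) x = d (Suc i) (s (Suc i) x) \<oplus>\<^bsub>F (Suc i)\<^esub> s i (d i x)"
    using null_homotopy_exists[OF res db \<chi> comm aug] by blast
  obtain j where j: "i = Suc j" using i by (cases i) auto
  let ?m = "\<lambda>k. {a \<odot>\<^bsub>F k\<^esub> x | a x. a \<in> m \<and> x \<in> carrier (F k)}"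
  interpret Fi: plain_module R "F i" by (rule plain_module.intro[OF F'(1)])
  interpret Fj: plain_module R "F j" by (rule plain_module.intro[OF F'(1)])
  have mc: "m \<subseteq> carrier R" using idealD(1)[OF maximalideal.axioms(1)[OF m]] .
  have mi: "?m i \<subseteq> carrier (F i)" using mc by auto
  have mj: "?m j \<subseteq> carrier (F j)" using mc by auto
  note G = Fi.submodule_gen_submodule[OF mi]
  note G' = Fi.submoduleD[OF G(1)]
  have sj: "s j y \<in> gen_submodule R (F i) (?m i)" if "y \<in> gen_submodule R (F j) (?m j)" for y
  proof -
    have "s j y \<in> s j ` gen_submodule R (F j) (?m j)" using that by blast
    also have "\<dots> = gen_submodule R (F i) (s j ` ?m j)"
      unfolding j by (rule gen_submodule_hom_image[OF F'(1) F'(1) s(1) mj, symmetric])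
    also have "\<dots> \<subseteq> gen_submodule R (F i) (?m i)"
    proof (rule Fi.gen_submodule_minimal[OF G(1)])
      have "s j ` ?m j \<subseteq> ?m i"
        using module_homD(1,3)[OF s(1)[of j]] mc unfolding j by (auto simp: subset_iff) blast
      then show "s j ` ?m j \<subseteq> gen_submodule R (F i) (?m i)" using G(2) by blast
    qed
    finally show ?thesis .
  qed
  \<comment> \<open>In this degree \<alpha> vanishes, so x = d s x + s d x. The first term lies in m
    F_i by minimality, the second because d x lies in m F_j and \<open>s\<close> is linear.\<close>
  have "x \<in> gen_submodule R (F i) (?m i)" if x: "x \<in> carrier (F i)" for x
  proof -
    have "\<alpha> i x = \<zero>\<^bsub>P i\<^esub>" using cl(1)[OF x] len[OF i] by simp
    then have "\<beta> i (\<alpha> i x) = \<zero>\<^bsub>F i\<^esub>" using module_hom_zero[OF P'(1) F'(1) \<beta>(1)] by simp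
    then have "\<chi> i x = x" using x by (simp add: \<chi>_def a_minus_def)
    then have "x = d i (s i x) \<oplus>\<^bsub>F i\<^esub> s j (d j x)" using s(2)[of x j] x j by simp
    moreover have "d i (s i x) \<in> gen_submodule R (F i) (?m i)"
      using minimal_free_resolutionD(3)[OF F m, of i] module_homD(1)[OF s(1) x] by blast
    moreover have "d j x \<in> gen_submodule R (F j) (?m j)"
      using minimal_free_resolutionD(3)[OF F m, of j] x j by blast
    ultimately show ?thesis using sj[of "d j x"] G'(3)[of "d i (s i x)" "s j (d j x)"] by simp
  qed
  then have gen: "carrier (F i) \<subseteq> gen_submodule R (F i) ({\<zero>\<^bsub>F i\<^esub>} \<union> ?m i)"
  proof -
    have c: "{\<zero>\<^bsub>F i\<^esub>} \<union> ?m i \<subseteq> carrier (F i)" using mi by auto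
    note L = Fi.submodule_gen_submodule[OF c]
    have "gen_submodule R (F i) (?m i) \<subseteq> gen_submodule R (F i) ({\<zero>\<^bsub>F i\<^esub>} \<union> ?m i)"
      using L(2) by (intro Fi.gen_submodule_minimal[OF L(1)]) blast
    then show ?thesis using \<open>\<And>x. x \<in> carrier (F i) \<Longrightarrow> x \<in> gen_submodule R (F i) (?m i)\<close> by blast
  qed
  have "submodule {\<zero>\<^bsub>F i\<^esub>} R (F i)" by (rule Fi.submoduleI_smult) auto
  then show ?thesis
    using nakayama_free[OF loc m _ _ gen] minimal_free_resolutionD(2)[OF F, of i] by auto
qed

text \<open>R/K is cyclic and the kernel of \<epsilon> is contained in m F_0, so Nakayama's lemma
  makes a preimage \<open>v\<close> of 1 generate F_0. For the second claim, F_0 is nonzero since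
  \<open>K\<close> is proper, so it has a basis vector e_0 = b v; a v = 0 gives a e_0 = 0, and the
  coordinate of e_0 gives a = 0.\<close>

lemma minimal_free_resolution_generator:
  fixes R (structure)
  assumes loc: "noetherian_local_ring R" and K: "ideal K R" "K \<noteq> carrier R"
    and F: "minimal_free_resolution R F d \<epsilon> (quot_module (reg_module R) K)"
    and v: "v \<in> carrier (F 0)" "\<epsilon> v = K +>\<^bsub>reg_module R\<^esub> \<one>"
  shows "x \<in> carrier (F 0) \<Longrightarrow> \<exists>a\<in>carrier R. x = a \<odot>\<^bsub>F 0\<^esub> v"
    and "a \<in> carrier R \<Longrightarrow> a \<odot>\<^bsub>F 0\<^esub> v = \<zero>\<^bsub>F 0\<^esub> \<Longrightarrow> a = \<zero>"
proof -
  have cr: "cring R" using loc by (simp add: noetherian_local_ring_def)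
  interpret cring R by fact
  interpret S: plain_module R "reg_module R" by (rule plain_module.intro[OF reg_module_module])
  obtain m where m: "maximalideal m R" using noetherian_local_ring_maximal[OF loc] .
  note F' = left_resolutionD[OF minimal_free_resolutionD(1)[OF F]]
  interpret F0: plain_module R "F 0" by (rule plain_module.intro[OF F'(1)])
  obtain n where n: "free_of_rank R (F 0) n" using minimal_free_resolutionD(2)[OF F] by blast
  have Ks: "submodule K R (reg_module R)" by (rule submodule_ideal[OF K(1)])
  interpret Q: plain_module R "quot_module (reg_module R) K"
    by (rule plain_module.intro[OF S.quot_module_module[OF Ks]])
  define V where "V = (\<lambda>a. a \<odot>\<^bsub>F 0\<^esub> v) ` carrier R"
  have "(\<lambda>a. a \<odot>\<^bsub>F 0\<^esub> v) \<in> module_hom R (reg_module R) (F 0)"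
    using v(1) by (intro module_homI) (auto simp: F0.smult_l_distr F0.smult_assoc1)
  then have V: "submodule V R (F 0)"
    using submodule_hom_image[OF S.module_axioms F'(1) _ S.carrier_is_submodule] by (simp add: V_def)
  have Veq: "V = {a \<odot>\<^bsub>F 0\<^esub> v | a. a \<in> carrier R}" by (auto simp: V_def)
  let ?m = "{a \<odot>\<^bsub>F 0\<^esub> x | a x. a \<in> m \<and> x \<in> carrier (F 0)}"
  have mc: "?m \<subseteq> carrier (F 0)" using idealD(1)[OF maximalideal.axioms(1)[OF m]] by auto
  have c: "V \<union> ?m \<subseteq> carrier (F 0)" using F0.submoduleD(1)[OF V] mc by blast
  note L = F0.submodule_gen_submodule[OF c]
  have all: "carrier (F 0) \<subseteq> V"
  proof (rule nakayama_free[OF loc m n V])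
    show "carrier (F 0) \<subseteq> gen_submodule R (F 0) (V \<union> ?m)"
    proof
      fix x assume x: "x \<in> carrier (F 0)"
      have "\<epsilon> x \<in> carrier (quot_module (reg_module R) K)" using module_homD(1)[OF F'(3) x] .
      then obtain b where b: "b \<in> carrier R" "\<epsilon> x = K +>\<^bsub>reg_module R\<^esub> b"
        by (auto simp: S.quot_module_carrier)
      have bv: "b \<odot>\<^bsub>F 0\<^esub> v \<in> carrier (F 0)" using b v by simp
      have "\<epsilon> (b \<odot>\<^bsub>F 0\<^esub> v) = \<epsilon> x"
        using module_homD(3)[OF F'(3) b(1) v(1)] b v(2) S.quot_module_smult[OF Ks, of \<one> b] by simp
      then have "\<epsilon> (x \<ominus>\<^bsub>F 0\<^esub> b \<odot>\<^bsub>F 0\<^esub> v) = \<zero>\<^bsub>quot_module (reg_module R) K\<^esub>"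
        using module_hom_minus[OF F'(1) Q.module_axioms F'(3) x bv] module_homD(1)[OF F'(3) x]
        by (simp add: a_minus_def Q.M.r_neg)
      then have "x \<ominus>\<^bsub>F 0\<^esub> b \<odot>\<^bsub>F 0\<^esub> v \<in> d 0 ` carrier (F 1)" unfolding F'(5) using x bv by simp
      then have "x \<ominus>\<^bsub>F 0\<^esub> b \<odot>\<^bsub>F 0\<^esub> v \<in> gen_submodule R (F 0) ?m"
        using minimal_free_resolutionD(3)[OF F m, of 0] by auto
      moreover have "gen_submodule R (F 0) ?m \<subseteq> gen_submodule R (F 0) (V \<union> ?m)"
        using L(2) by (intro F0.gen_submodule_minimal[OF L(1)]) blast
      moreover have "b \<odot>\<^bsub>F 0\<^esub> v \<in> gen_submodule R (F 0) (V \<union> ?m)" using L(2) b unfolding Veq by blast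
      ultimately have "(x \<ominus>\<^bsub>F 0\<^esub> b \<odot>\<^bsub>F 0\<^esub> v) \<oplus>\<^bsub>F 0\<^esub> b \<odot>\<^bsub>F 0\<^esub> v \<in> gen_submodule R (F 0) (V \<union> ?m)"
        using F0.submoduleD(3)[OF L(1)] by blast
      then show "x \<in> gen_submodule R (F 0) (V \<union> ?m)" using F0.minus_add_cancel[OF x bv] by simp
    qed
  qed
  then show "\<exists>a\<in>carrier R. x = a \<odot>\<^bsub>F 0\<^esub> v" if "x \<in> carrier (F 0)" for x
    using that unfolding Veq by blast
  assume a: "a \<in> carrier R" "a \<odot>\<^bsub>F 0\<^esub> v = \<zero>\<^bsub>F 0\<^esub>"
  obtain e c where ec: "\<And>i. i < n \<Longrightarrow> e i \<in> carrier (F 0)"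
    "\<And>i. i < n \<Longrightarrow> c i \<in> module_hom R (F 0) (reg_module R)"
    "\<And>i j. i < n \<Longrightarrow> j < n \<Longrightarrow> c i (e j) = (if i = j then \<one> else \<zero>)"
    "\<And>x. x \<in> carrier (F 0) \<Longrightarrow> x = finsum (F 0) (\<lambda>i. c i x \<odot>\<^bsub>F 0\<^esub> e i) {..<n}"
    using free_of_rank_basis[OF cr n] by blast
  have "n \<noteq> 0"
  proof
    assume "n = 0"
    then have "v = \<zero>\<^bsub>F 0\<^esub>" using ec(4)[OF v(1)] by simp
    then have "K +>\<^bsub>reg_module R\<^esub> \<one> = \<zero>\<^bsub>quot_module (reg_module R) K\<^esub>"
      using module_hom_zero[OF F'(1) Q.module_axioms F'(3)] v(2) by simp
    then have "\<one> \<in> K" using S.coset_zero_iff[OF Ks, of \<one>] by simp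
    then show False using K ideal.one_imp_carrier by blast
  qed
  then have e0: "e 0 \<in> carrier (F 0)" "c 0 \<in> module_hom R (F 0) (reg_module R)" "c 0 (e 0) = \<one>"
    using ec(1,2)[of 0] ec(3)[of 0 0] by auto
  then obtain b where b: "b \<in> carrier R" "e 0 = b \<odot>\<^bsub>F 0\<^esub> v" using all unfolding Veq by blast
  have "a \<odot>\<^bsub>F 0\<^esub> e 0 = \<zero>\<^bsub>F 0\<^esub>" unfolding b(2) using a b(1) v(1) F0.smult_lcomm[OF a(1) b(1) v(1)] by simp
  then have "c 0 \<zero>\<^bsub>F 0\<^esub> = a \<otimes> \<one>" using module_homD(3)[OF e0(2) a(1) e0(1)] e0(3) by simp
  then show "a = \<zero>" using module_hom_zero[OF F'(1) S.module_axioms e0(2)] a(1) by simp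
qed

section \<open>Vanishing below the grade\<close>

lemma (in ring) Idl_insert_Idl:
  assumes "A \<subseteq> carrier R" "x \<in> carrier R"
  shows "Idl (insert x (Idl A)) = Idl (insert x A)"
proof
  have c: "insert x A \<subseteq> carrier R" using assms by blast
  have I: "ideal (Idl A) R" by (rule genideal_ideal[OF assms(1)])
  have c': "insert x (Idl A) \<subseteq> carrier R" using idealD(1)[OF I] assms(2) by blast
  note J = genideal_ideal[OF c] genideal_self[OF c]
  note J' = genideal_ideal[OF c'] genideal_self[OF c']
  have "Idl A \<subseteq> Idl (insert x A)" using J(2) by (intro genideal_minimal[OF J(1)]) blast
  then show "Idl (insert x (Idl A)) \<subseteq> Idl (insert x A)"
    using J(2) by (intro genideal_minimal[OF J(1)]) blast
  show "Idl (insert x A) \<subseteq> Idl (insert x (Idl A))"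
    using J'(2) genideal_self[OF assms(1)] by (intro genideal_minimal[OF J'(1)]) blast
qed

text \<open>Multiplication by an element of \<open>K\<close> is zero on R/K, hence null-homotopic on
  a projective resolution. This drives Rees' argument and, for the ideal J, the annihilation of the
  cokernel of the last dual map.\<close>

lemma ideal_homotopy:
  fixes R (structure)
  assumes cr: "cring R" and K: "ideal K R"
    and F: "left_resolution R F d \<epsilon> (quot_module (reg_module R) K)"
    and db: "\<And>i. has_dual_basis TYPE('i) R (F i)" and x: "x \<in> K"
  shows "\<exists>s. (\<forall>i. s i \<in> module_hom R (F i) (F (Suc i))) \<and>
    (\<forall>y\<in>carrier (F 0). x \<odot>\<^bsub>F 0\<^esub> y = d 0 (s 0 y)) \<and>
    (\<forall>i. \<forall>y\<in>carrier (F (Suc i)). x \<odot>\<^bsub>F (Suc i)\<^esub> y = d (Suc i) (s (Suc i) y) \<oplus>\<^bsub>F (Suc i)\<^esub> s i (d i y))"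
proof (rule null_homotopy_exists[OF F db, where \<chi> = "\<lambda>i y. x \<odot>\<^bsub>F i\<^esub> y"])
  interpret cring R by fact
  interpret S: plain_module R "reg_module R" by (rule plain_module.intro[OF reg_module_module])
  note F' = left_resolutionD[OF F]
  have Ks: "submodule K R (reg_module R)" by (rule submodule_ideal[OF K])
  have xc: "x \<in> carrier R" using x idealD(1)[OF K] by blast
  show "(\<lambda>y. x \<odot>\<^bsub>F i\<^esub> y) \<in> module_hom R (F i) (F i)" for i
    by (rule plain_module.smult_hom[OF plain_module.intro[OF F'(1)] xc])
  show "d i (x \<odot>\<^bsub>F (Suc i)\<^esub> y) = x \<odot>\<^bsub>F i\<^esub> d i y" if "y \<in> carrier (F (Suc i))" for i y
    by (rule module_homD(3)[OF F'(2) xc that])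
  show "\<epsilon> (x \<odot>\<^bsub>F 0\<^esub> y) = \<zero>\<^bsub>quot_module (reg_module R) K\<^esub>" if y: "y \<in> carrier (F 0)" for y
  proof -
    obtain b where b: "b \<in> carrier R" "\<epsilon> y = K +>\<^bsub>reg_module R\<^esub> b"
      using module_homD(1)[OF F'(3) y] by (auto simp: S.quot_module_carrier)
    have "\<epsilon> (x \<odot>\<^bsub>F 0\<^esub> y) = K +>\<^bsub>reg_module R\<^esub> (x \<otimes> b)"
      using module_homD(3)[OF F'(3) xc y] b S.quot_module_smult[OF Ks, of b x] xc by simp
    then show ?thesis using S.coset_zero_iff[OF Ks, of "x \<otimes> b"] idealD(7)[OF K x b(1)] xc b(1) by simp
  qed
qed

text \<open>Over a projective complex this is exactness of Hom(F, R/U) in degree i: maps to R/U are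
  represented by maps to R, and equations hold modulo \<open>U\<close>.\<close>

definition dual_exact_at ::
    "('a, 'm) ring_scheme \<Rightarrow> (nat \<Rightarrow> ('a, 'b) module) \<Rightarrow> (nat \<Rightarrow> 'b \<Rightarrow> 'b) \<Rightarrow> 'a set \<Rightarrow> nat \<Rightarrow> bool" where
  "dual_exact_at R F d U i \<longleftrightarrow> (\<forall>f\<in>module_hom R (F i) (reg_module R).
     (\<forall>x\<in>carrier (F (Suc i)). f (d i x) \<in> U) \<longrightarrow>
     (case i of 0 \<Rightarrow> \<forall>x\<in>carrier (F 0). f x \<in> U
      | Suc j \<Rightarrow> \<exists>h\<in>module_hom R (F j) (reg_module R). \<forall>x\<in>carrier (F (Suc j)). f x \<ominus>\<^bsub>R\<^esub> h (d j x) \<in> U))"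

text \<open>Rees' argument: the classes of \<open>Ext\<^sup>i(R/K, R/(x\<^sub>1,\<dots>,x\<^sub>k))\<close> are killed by \<open>x\<^sub>k\<^sub>+\<^sub>1 \<in> K\<close>, and
  modulo \<open>x\<^sub>k\<^sub>+\<^sub>1\<close> they come from \<open>Ext\<^sup>i\<^sup>-\<^sup>1(R/K, R/(x\<^sub>1,\<dots>,x\<^sub>k\<^sub>+\<^sub>1))\<close>.\<close>

lemma rees:
  fixes R (structure)
  assumes cr: "cring R" and K: "ideal K R"
    and F: "left_resolution R F d \<epsilon> (quot_module (reg_module R) K)"
    and db: "\<And>i. has_dual_basis TYPE('i) R (F i)"
    and xs: "set xs \<subseteq> K"
    and reg: "\<And>i a. i < length xs \<Longrightarrow> a \<in> carrier R \<Longrightarrow>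
        xs ! i \<otimes> a \<in> Idl (set (take i xs)) \<Longrightarrow> a \<in> Idl (set (take i xs))"
    and "i + k < length xs"
  shows "dual_exact_at R F d (Idl (set (take k xs))) i"
  using assms(7)
proof (induction i arbitrary: k)
  interpret cring R by fact
  interpret S: plain_module R "reg_module R" by (rule plain_module.intro[OF reg_module_module])
  note F' = left_resolutionD[OF F]
  have Kc: "K \<subseteq> carrier R" by (rule idealD(1)[OF K])
  note htpy = ideal_homotopy[OF cr K F db]
  {
    case (0 k)
    have k: "k < length xs" using 0 by simp
    let ?x = "xs ! k" and ?I = "Idl\<^bsub>R\<^esub> (set (take k xs))"
    have x: "?x \<in> K" using k xs by auto
    have xc: "?x \<in> carrier R" using x Kc by blast
    obtain s where s: "\<And>i. s i \<in> module_hom R (F i) (F (Suc i))"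
      "\<And>y. y \<in> carrier (F 0) \<Longrightarrow> ?x \<odot>\<^bsub>F 0\<^esub> y = d 0 (s 0 y)"
      using htpy[OF x] by blast
    show ?case
      unfolding dual_exact_at_def
    proof (simp, intro ballI impI)
      fix f y assume f: "f \<in> module_hom R (F 0) (reg_module R)"
        "\<forall>x\<in>carrier (F (Suc 0)). f (d 0 x) \<in> ?I" and y: "y \<in> carrier (F 0)"
      have "?x \<otimes> f y = f (d 0 (s 0 y))"
        using module_homD(3)[OF f(1) xc y] s(2)[OF y] by simp
      also have "\<dots> \<in> ?I" using f(2) module_homD(1)[OF s(1) y] by blast
      finally show "f y \<in> ?I" using reg[OF k] module_homD(1)[OF f(1) y] by simp
    qed
  next
    case (Suc j k)
    have k: "k < length xs" using Suc.prems by simp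
    let ?x = "xs ! k" and ?I = "Idl\<^bsub>R\<^esub> (set (take k xs))" and ?J = "Idl\<^bsub>R\<^esub> (set (take (Suc k) xs))"
    have x: "?x \<in> K" using k xs by auto
    have xc: "?x \<in> carrier R" using x Kc by blast
    have tc: "set (take k xs) \<subseteq> carrier R" using xs Kc set_take_subset[of k xs] by blast
    have I: "ideal ?I R" by (rule genideal_ideal[OF tc])
    have J: "?J = Idl\<^bsub>R\<^esub> (insert ?x ?I)"
      using Idl_insert_Idl[OF tc xc] k by (simp add: take_Suc_conv_app_nth)
    have Jeq: "?J = {u \<oplus> a \<otimes> ?x | u a. u \<in> ?I \<and> a \<in> carrier R}"
      unfolding J by (rule Idl_insert_ideal[OF I xc])
    have Is: "submodule ?I R (reg_module R)" by (rule submodule_ideal[OF I])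
    note Ii = idealD[OF I]
    obtain s where s: "\<And>i. s i \<in> module_hom R (F i) (F (Suc i))"
      "\<And>i y. y \<in> carrier (F (Suc i)) \<Longrightarrow>
         ?x \<odot>\<^bsub>F (Suc i)\<^esub> y = d (Suc i) (s (Suc i) y) \<oplus>\<^bsub>F (Suc i)\<^esub> s i (d i y)"
      using htpy[OF x] by blast
    show ?case
      unfolding dual_exact_at_def nat.case
    proof (intro ballI impI)
      fix f assume f: "f \<in> module_hom R (F (Suc j)) (reg_module R)"
        "\<forall>x\<in>carrier (F (Suc (Suc j))). f (d (Suc j) x) \<in> ?I"
      note fc = module_homD(1)[OF f(1), simplified]
      \<comment> \<open>The homotopy gives x f = h d modulo I, so h d takes values in I + Rx, and
        \<open>h\<close> is a cocycle one degree lower with coefficients modulo one more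
        element.\<close>
      define h where "h y = f (s j y)" for y
      have h: "h \<in> module_hom R (F j) (reg_module R)"
        unfolding h_def by (rule module_hom_comp[OF s(1) f(1)])
      note hc = module_homD(1)[OF h, simplified]
      have dc: "d j y \<in> carrier (F j)" if "y \<in> carrier (F (Suc j))" for y
        using module_homD(1)[OF F'(2) that] .
      have xf: "?x \<otimes> f y \<ominus> h (d j y) \<in> ?I" if y: "y \<in> carrier (F (Suc j))" for y
      proof -
        have c: "s (Suc j) y \<in> carrier (F (Suc (Suc j)))" "s j (d j y) \<in> carrier (F (Suc j))"
          using module_homD(1)[OF s(1)] y dc[OF y] by auto
        have c': "d (Suc j) (s (Suc j) y) \<in> carrier (F (Suc j))" using module_homD(1)[OF F'(2) c(1)] .
        have "?x \<otimes> f y = f (d (Suc j) (s (Suc j) y)) \<oplus> h (d j y)"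
          using module_homD(3)[OF f(1) xc y] s(2)[OF y] module_homD(2)[OF f(1) c' c(2)] by (simp add: h_def)
        then have "?x \<otimes> f y \<ominus> h (d j y) = f (d (Suc j) (s (Suc j) y))"
          using fc[OF c'] hc[OF dc[OF y]] by (simp add: a_minus_def a_assoc r_neg)
        then show ?thesis using f(2) c(1) by simp
      qed
      have hd: "h (d j y) \<in> ?J" if y: "y \<in> carrier (F (Suc j))" for y
      proof -
        have "h (d j y) = (\<ominus> (?x \<otimes> f y \<ominus> h (d j y))) \<oplus> f y \<otimes> ?x"
          using fc[OF y] hc[OF dc[OF y]] xc by algebra
        then show ?thesis unfolding Jeq using Ii(5)[OF xf[OF y]] fc[OF y] by blast
      qed
      \<comment> \<open>The induction hypothesis makes \<open>h\<close> a coboundary modulo I + Rx;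
        removing it leaves h d unchanged and yields values in I + Rx.\<close>
      have "\<exists>u\<in>module_hom R (F j) (reg_module R). (\<forall>y\<in>carrier (F j). u y \<in> ?J) \<and>
          (\<forall>y\<in>carrier (F (Suc j)). u (d j y) = h (d j y))"
      proof (cases j)
        case 0
        then show ?thesis
          using Suc.IH[of "Suc k"] Suc.prems h hd unfolding dual_exact_at_def by auto
      next
        case (Suc l)
        obtain h' where h': "h' \<in> module_hom R (F l) (reg_module R)"
          "\<forall>y\<in>carrier (F (Suc l)). h y \<ominus> h' (d l y) \<in> ?J"
          using Suc.IH[of "Suc k"] Suc.prems h hd unfolding dual_exact_at_def Suc by auto
        have hom: "(\<lambda>y. h' (d l y)) \<in> module_hom R (F j) (reg_module R)"
          unfolding Suc by (rule module_hom_comp[OF F'(2) h'(1)])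
        have "h (d j y) \<ominus> h' (d l (d j y)) = h (d j y)" if y: "y \<in> carrier (F (Suc j))" for y
        proof -
          have "h' (d l (d j y)) = \<zero>"
            using F'(8)[of y l] y module_hom_zero[OF F'(1) S.module_axioms h'(1)] Suc by simp
          then show ?thesis using hc[OF dc[OF y]] by (simp add: a_minus_def)
        qed
        moreover have "(\<lambda>y. h y \<ominus> h' (d l y)) \<in> module_hom R (F j) (reg_module R)"
          by (rule module_hom_cong[OF F'(1) module_hom_diff[OF F'(1) S.module_axioms h hom]])
            (use hc module_homD(1)[OF hom] in simp)
        ultimately show ?thesis using h'(2) Suc by (intro bexI[of _ "\<lambda>y. h y \<ominus> h' (d l y)"]) auto
      qed
      then obtain u where u: "u \<in> module_hom R (F j) (reg_module R)"
        "\<And>y. y \<in> carrier (F j) \<Longrightarrow> u y \<in> ?J"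
        "\<And>y. y \<in> carrier (F (Suc j)) \<Longrightarrow> u (d j y) = h (d j y)" by blast
      note uc = module_homD(1)[OF u(1), simplified]
      let ?Q = "quot_module (reg_module R) ?I"
      have Q: "module R ?Q" by (rule S.quot_module_module[OF Is])
      note pr = S.quot_module_proj_hom[OF Is]
      have mx: "(\<lambda>a. ?x \<otimes> a) \<in> module_hom R (reg_module R) (reg_module R)"
        using S.smult_hom[OF xc] by simp
      \<comment> \<open>Divides \<open>u\<close> by \<open>x\<close> modulo I, linearly because
        \<open>F j\<close> has a dual basis. Then x f = x w d modulo I, and regularity cancels
        \<open>x\<close>.\<close>
      have "\<exists>w\<in>module_hom R (F j) (reg_module R). \<forall>y\<in>carrier (F j).
          ?I +>\<^bsub>reg_module R\<^esub> (?x \<otimes> w y) = ?I +>\<^bsub>reg_module R\<^esub> u y"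
      proof (rule lift_through[OF F'(1) S.module_axioms Q db module_hom_comp[OF u(1) pr]
            module_hom_comp[OF mx pr]])
        fix y assume y: "y \<in> carrier (F j)"
        obtain w a where wa: "w \<in> ?I" "a \<in> carrier R" "u y = w \<oplus> a \<otimes> ?x"
          using u(2)[OF y] unfolding Jeq by blast
        have wc: "w \<in> carrier R" using wa(1) Ii(1) by blast
        have "u y \<ominus> ?x \<otimes> a = w" unfolding wa(3) using wc wa(2) xc by algebra
        then have "?I +>\<^bsub>reg_module R\<^esub> u y = ?I +>\<^bsub>reg_module R\<^esub> (?x \<otimes> a)"
          using S.coset_eq_iff[OF Is, of "u y" "?x \<otimes> a"] uc[OF y] wa(1,2) xc by simp
        then show "?I +>\<^bsub>reg_module R\<^esub> u y \<in> (\<lambda>a. ?I +>\<^bsub>reg_module R\<^esub> (?x \<otimes> a)) ` carrier (reg_module R)"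
          using wa(2) by simp
      qed
      then obtain w where w: "w \<in> module_hom R (F j) (reg_module R)"
        "\<And>y. y \<in> carrier (F j) \<Longrightarrow> ?I +>\<^bsub>reg_module R\<^esub> (?x \<otimes> w y) = ?I +>\<^bsub>reg_module R\<^esub> u y" by blast
      note wc = module_homD(1)[OF w(1), simplified]
      have "f y \<ominus> w (d j y) \<in> ?I" if y: "y \<in> carrier (F (Suc j))" for y
      proof -
        have "?x \<otimes> w (d j y) \<ominus> u (d j y) \<in> ?I"
          using S.coset_eq_iff[OF Is, of "?x \<otimes> w (d j y)" "u (d j y)"] w(2)[OF dc[OF y]]
            wc[OF dc[OF y]] uc[OF dc[OF y]] xc by simp
        then have "(?x \<otimes> f y \<ominus> h (d j y)) \<ominus> (?x \<otimes> w (d j y) \<ominus> h (d j y)) \<in> ?I"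
          using xf[OF y] u(3)[OF y] Ii(4) by simp
        also have "(?x \<otimes> f y \<ominus> h (d j y)) \<ominus> (?x \<otimes> w (d j y) \<ominus> h (d j y)) = ?x \<otimes> (f y \<ominus> w (d j y))"
          using fc[OF y] hc[OF dc[OF y]] wc[OF dc[OF y]] xc by algebra
        finally show ?thesis using reg[OF k] fc[OF y] wc[OF dc[OF y]] by simp
      qed
      then show "\<exists>h\<in>module_hom R (F j) (reg_module R). \<forall>x\<in>carrier (F (Suc j)). f x \<ominus> h (d j x) \<in> ?I"
        using w(1) by blast
    qed
  }
qed

section \<open>Vanishing above the projective dimension\<close>

lemma (in plain_module) add_minus_cancel:
  "x \<in> carrier M \<Longrightarrow> y \<in> carrier M \<Longrightarrow> (x \<oplus>\<^bsub>M\<^esub> y) \<ominus>\<^bsub>M\<^esub> y = x"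
  by (simp add: a_minus_def M.a_assoc M.r_neg)

lemma (in plain_module) minus_eq_imp:
  assumes "x \<ominus>\<^bsub>M\<^esub> y = u \<ominus>\<^bsub>M\<^esub> v" "x \<in> carrier M" "y \<in> carrier M" "u \<in> carrier M" "v \<in> carrier M"
  shows "v \<oplus>\<^bsub>M\<^esub> x = u \<oplus>\<^bsub>M\<^esub> y"
proof -
  have uv: "u \<ominus>\<^bsub>M\<^esub> v \<in> carrier M" using assms(4,5) by simp
  have "v \<oplus>\<^bsub>M\<^esub> x = v \<oplus>\<^bsub>M\<^esub> ((u \<ominus>\<^bsub>M\<^esub> v) \<oplus>\<^bsub>M\<^esub> y)"
    using minus_add_cancel[OF assms(2,3)] assms(1) by simp
  also have "\<dots> = ((u \<ominus>\<^bsub>M\<^esub> v) \<oplus>\<^bsub>M\<^esub> v) \<oplus>\<^bsub>M\<^esub> y"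
    using uv assms(3,5) by (simp only: M.a_ac M.a_closed)
  also have "\<dots> = u \<oplus>\<^bsub>M\<^esub> y" by (simp only: minus_add_cancel[OF assms(4,5)])
  finally show ?thesis .
qed

text \<open>Injectivity is stated for test modules in the type of the ring, while \<open>N\<close>
  may have any type, so Baer's argument is carried out: on the ideal of all a with a z in
  \<open>K\<close>, the map sending a to h (a z) is multiplication into some \<open>e\<close>, and
  \<open>z\<close> may be sent to \<open>e\<close>.\<close>

lemma injective_extend_insert:
  assumes N: "module R N" and E: "injective_module R E" and K: "submodule K R N"
    and z: "z \<in> carrier N" and h: "h \<in> module_hom R (N\<lparr>carrier := K\<rparr>) E"
  shows "\<exists>h'\<in>module_hom R (N\<lparr>carrier := {k \<oplus>\<^bsub>N\<^esub> a \<odot>\<^bsub>N\<^esub> z | k a. k \<in> K \<and> a \<in> carrier R}\<rparr>) E. \<forall>k\<in>K. h' k = h k"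
proof -
  interpret N: plain_module R N using N by (rule plain_module.intro)
  interpret E: plain_module R E using E by (simp add: injective_module_def plain_module_def)
  note K' = N.submoduleD[OF K]
  have hc: "h k \<in> carrier E" if "k \<in> K" for k using module_homD(1)[OF h] that by simp
  have hadd: "h (k \<oplus>\<^bsub>N\<^esub> k') = h k \<oplus>\<^bsub>E\<^esub> h k'" if "k \<in> K" "k' \<in> K" for k k'
    using module_homD(2)[OF h] that by simp
  have hsm: "h (a \<odot>\<^bsub>N\<^esub> k) = a \<odot>\<^bsub>E\<^esub> h k" if "a \<in> carrier R" "k \<in> K" for a k
    using module_homD(3)[OF h] that by simp
  have hmin: "h (k \<ominus>\<^bsub>N\<^esub> k') = h k \<ominus>\<^bsub>E\<^esub> h k'" if "k \<in> K" "k' \<in> K" for k k'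
  proof -
    have c: "k' \<in> carrier N" using that(2) K'(1) by blast
    have "(\<ominus>\<^bsub>R\<^esub> \<one>\<^bsub>R\<^esub>) \<odot>\<^bsub>N\<^esub> k' \<in> K" using K'(5)[OF _ that(2)] by simp
    then show ?thesis
      unfolding a_minus_def N.uminus_eq_smult[OF c] E.uminus_eq_smult[OF hc[OF that(2)]]
      using hadd[OF that(1)] hsm[OF _ that(2)] by simp
  qed
  define U where "U = {a \<in> carrier R. a \<odot>\<^bsub>N\<^esub> z \<in> K}"
  have U: "ideal U R"
    unfolding U_def using z K' by (intro N.R.idealI_simple) (auto simp: N.smult_l_distr N.smult_assoc1)
  have "\<exists>e\<in>carrier E. \<forall>u\<in>U. h (u \<odot>\<^bsub>N\<^esub> z) = u \<odot>\<^bsub>E\<^esub> e"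
    using z by (intro N.R.injective_extend_ideal[OF E U])
      (auto simp: U_def hc N.smult_l_distr N.smult_assoc1 hadd hsm)
  then obtain e where e: "e \<in> carrier E" "\<And>u. u \<in> U \<Longrightarrow> h (u \<odot>\<^bsub>N\<^esub> z) = u \<odot>\<^bsub>E\<^esub> e" by blast
  let ?U = "{k \<oplus>\<^bsub>N\<^esub> a \<odot>\<^bsub>N\<^esub> z | k a. k \<in> K \<and> a \<in> carrier R}"
  define h' where "h' u = (SOME w. \<exists>k a. k \<in> K \<and> a \<in> carrier R \<and> u = k \<oplus>\<^bsub>N\<^esub> a \<odot>\<^bsub>N\<^esub> z \<and> w = h k \<oplus>\<^bsub>E\<^esub> a \<odot>\<^bsub>E\<^esub> e)" for u
  have wd: "h k \<oplus>\<^bsub>E\<^esub> a \<odot>\<^bsub>E\<^esub> e = h k' \<oplus>\<^bsub>E\<^esub> b \<odot>\<^bsub>E\<^esub> e"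
    if k: "k \<in> K" and a: "a \<in> carrier R" and k': "k' \<in> K" and b: "b \<in> carrier R"
      and eq: "k \<oplus>\<^bsub>N\<^esub> a \<odot>\<^bsub>N\<^esub> z = k' \<oplus>\<^bsub>N\<^esub> b \<odot>\<^bsub>N\<^esub> z" for k a k' b
  proof -
    have c: "k \<in> carrier N" "k' \<in> carrier N" using k k' K'(1) by auto
    have "(a \<ominus>\<^bsub>R\<^esub> b) \<odot>\<^bsub>N\<^esub> z = a \<odot>\<^bsub>N\<^esub> z \<ominus>\<^bsub>N\<^esub> b \<odot>\<^bsub>N\<^esub> z"
      using a b z by (simp add: a_minus_def N.smult_l_distr N.smult_l_minus)
    also have "a \<odot>\<^bsub>N\<^esub> z = \<ominus>\<^bsub>N\<^esub> k \<oplus>\<^bsub>N\<^esub> (k \<oplus>\<^bsub>N\<^esub> a \<odot>\<^bsub>N\<^esub> z)"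
      using c a z by (simp add: N.M.a_assoc[symmetric] N.M.l_neg)
    also have "\<dots> = \<ominus>\<^bsub>N\<^esub> k \<oplus>\<^bsub>N\<^esub> (k' \<oplus>\<^bsub>N\<^esub> b \<odot>\<^bsub>N\<^esub> z)" by (simp only: eq)
    also have "\<dots> = (k' \<ominus>\<^bsub>N\<^esub> k) \<oplus>\<^bsub>N\<^esub> b \<odot>\<^bsub>N\<^esub> z"
      using c b z by (simp add: a_minus_def N.M.a_ac)
    also have "\<dots> \<ominus>\<^bsub>N\<^esub> b \<odot>\<^bsub>N\<^esub> z = k' \<ominus>\<^bsub>N\<^esub> k"
      using c b z by (intro N.add_minus_cancel) auto
    finally have d: "(a \<ominus>\<^bsub>R\<^esub> b) \<odot>\<^bsub>N\<^esub> z = k' \<ominus>\<^bsub>N\<^esub> k" .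
    then have "a \<ominus>\<^bsub>R\<^esub> b \<in> U" using K'(4)[OF k' k] a b by (simp add: U_def)
    then have "(a \<ominus>\<^bsub>R\<^esub> b) \<odot>\<^bsub>E\<^esub> e = h ((a \<ominus>\<^bsub>R\<^esub> b) \<odot>\<^bsub>N\<^esub> z)" using e(2) by simp
    also have "\<dots> = h k' \<ominus>\<^bsub>E\<^esub> h k" unfolding d by (rule hmin[OF k' k])
    finally have "a \<odot>\<^bsub>E\<^esub> e \<ominus>\<^bsub>E\<^esub> b \<odot>\<^bsub>E\<^esub> e = h k' \<ominus>\<^bsub>E\<^esub> h k"
      using a b e(1) by (simp add: a_minus_def E.smult_l_distr E.smult_l_minus)
    then show ?thesis
      using hc[OF k] hc[OF k'] a b e(1) by (intro E.minus_eq_imp) auto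
  qed
  have h'_eq: "h' (k \<oplus>\<^bsub>N\<^esub> a \<odot>\<^bsub>N\<^esub> z) = h k \<oplus>\<^bsub>E\<^esub> a \<odot>\<^bsub>E\<^esub> e" if k: "k \<in> K" and a: "a \<in> carrier R" for k a
    unfolding h'_def
  proof (rule someI2)
    show "\<exists>k' a'. k' \<in> K \<and> a' \<in> carrier R \<and> k \<oplus>\<^bsub>N\<^esub> a \<odot>\<^bsub>N\<^esub> z = k' \<oplus>\<^bsub>N\<^esub> a' \<odot>\<^bsub>N\<^esub> z \<and>
        h k \<oplus>\<^bsub>E\<^esub> a \<odot>\<^bsub>E\<^esub> e = h k' \<oplus>\<^bsub>E\<^esub> a' \<odot>\<^bsub>E\<^esub> e"
      using k a by blast
  next
    fix w assume "\<exists>k' a'. k' \<in> K \<and> a' \<in> carrier R \<and> k \<oplus>\<^bsub>N\<^esub> a \<odot>\<^bsub>N\<^esub> z = k' \<oplus>\<^bsub>N\<^esub> a' \<odot>\<^bsub>N\<^esub> z \<and> w = h k' \<oplus>\<^bsub>E\<^esub> a' \<odot>\<^bsub>E\<^esub> e"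
    then obtain k' a' where *: "k' \<in> K" "a' \<in> carrier R" "k \<oplus>\<^bsub>N\<^esub> a \<odot>\<^bsub>N\<^esub> z = k' \<oplus>\<^bsub>N\<^esub> a' \<odot>\<^bsub>N\<^esub> z"
      "w = h k' \<oplus>\<^bsub>E\<^esub> a' \<odot>\<^bsub>E\<^esub> e" by blast
    show "w = h k \<oplus>\<^bsub>E\<^esub> a \<odot>\<^bsub>E\<^esub> e" using wd[OF k a *(1,2,3)] *(4) by simp
  qed
  have "h' \<in> module_hom R (N\<lparr>carrier := ?U\<rparr>) E"
  proof (rule module_homI)
    fix u assume "u \<in> carrier (N\<lparr>carrier := ?U\<rparr>)"
    then obtain k a where u: "k \<in> K" "a \<in> carrier R" "u = k \<oplus>\<^bsub>N\<^esub> a \<odot>\<^bsub>N\<^esub> z" by auto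
    have kc: "k \<in> carrier N" using u(1) K'(1) by blast
    show "h' u \<in> carrier E" using u h'_eq hc e(1) by simp
    {
      fix b assume b: "b \<in> carrier R"
      have "b \<odot>\<^bsub>N\<^esub> u = b \<odot>\<^bsub>N\<^esub> k \<oplus>\<^bsub>N\<^esub> (b \<otimes>\<^bsub>R\<^esub> a) \<odot>\<^bsub>N\<^esub> z"
        using u(2,3) b z kc by (simp add: N.smult_r_distr N.smult_assoc1)
      then show "h' (b \<odot>\<^bsub>N\<lparr>carrier := ?U\<rparr>\<^esub> u) = b \<odot>\<^bsub>E\<^esub> h' u"
        using u b h'_eq K'(5) hsm hc e(1) by (simp add: E.smult_r_distr E.smult_assoc1)
    }
    fix v assume "v \<in> carrier (N\<lparr>carrier := ?U\<rparr>)"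
    then obtain k' a' where v: "k' \<in> K" "a' \<in> carrier R" "v = k' \<oplus>\<^bsub>N\<^esub> a' \<odot>\<^bsub>N\<^esub> z" by auto
    have k'c: "k' \<in> carrier N" using v(1) K'(1) by blast
    have "u \<oplus>\<^bsub>N\<^esub> v = (k \<oplus>\<^bsub>N\<^esub> k') \<oplus>\<^bsub>N\<^esub> (a \<oplus>\<^bsub>R\<^esub> a') \<odot>\<^bsub>N\<^esub> z"
      using u(2,3) v(2,3) z kc k'c by (simp add: N.smult_l_distr N.M.a_ac)
    then show "h' (u \<oplus>\<^bsub>N\<lparr>carrier := ?U\<rparr>\<^esub> v) = h' u \<oplus>\<^bsub>E\<^esub> h' v"
      using u v h'_eq K'(3) hadd hc e(1) by (simp add: E.smult_l_distr E.M.a_ac)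
  qed
  moreover have "h' k = h k" if k: "k \<in> K" for k
  proof -
    have kc: "k \<in> carrier N" using k K'(1) by blast
    show ?thesis using h'_eq[OF k, of "\<zero>\<^bsub>R\<^esub>"] kc z hc[OF k] e(1) by simp
  qed
  ultimately show ?thesis by blast
qed

text \<open>Iterates the one-generator step. For finitely many generators this induction takes the
  place of Zorn's lemma in Baer's argument.\<close>

lemma injective_extend_finite:
  assumes N: "module R N" and E: "injective_module R E"
    and "finite A" "A \<subseteq> carrier N" "submodule K R N" "h \<in> module_hom R (N\<lparr>carrier := K\<rparr>) E"
  shows "\<exists>h'\<in>module_hom R (N\<lparr>carrier := gen_submodule R N (K \<union> A)\<rparr>) E. \<forall>k\<in>K. h' k = h k"
  using assms(3-)
proof (induction A arbitrary: K h rule: finite_induct)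
  interpret N: plain_module R N using N by (rule plain_module.intro)
  {
    case (empty K h)
    then show ?case using N.gen_submodule_of_submodule by auto
  next
    case (insert z A K h)
    have z: "z \<in> carrier N" and A: "A \<subseteq> carrier N" using insert.prems(1) by auto
    have Kc: "K \<subseteq> carrier N" by (rule N.submoduleD(1)[OF insert.prems(2)])
    have zK: "insert z K \<subseteq> carrier N" using z Kc by blast
    let ?L = "gen_submodule R N (insert z K)"
    note L = N.submodule_gen_submodule[OF zK]
    have Leq: "?L = {k \<oplus>\<^bsub>N\<^esub> a \<odot>\<^bsub>N\<^esub> z | k a. k \<in> K \<and> a \<in> carrier R}"
      using N.gen_submodule_insert[OF Kc z] N.gen_submodule_of_submodule[OF insert.prems(2)] by simp
    obtain h1 where h1: "h1 \<in> module_hom R (N\<lparr>carrier := ?L\<rparr>) E" "\<forall>k\<in>K. h1 k = h k"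
      using injective_extend_insert[OF N E insert.prems(2) z insert.prems(3)] unfolding Leq by blast
    obtain h2 where h2: "h2 \<in> module_hom R (N\<lparr>carrier := gen_submodule R N (?L \<union> A)\<rparr>) E" "\<forall>k\<in>?L. h2 k = h1 k"
      using insert.IH[OF A L(1) h1(1)] by blast
    have "gen_submodule R N (?L \<union> A) = gen_submodule R N (K \<union> insert z A)"
    proof
      have c: "K \<union> insert z A \<subseteq> carrier N" "?L \<union> A \<subseteq> carrier N"
        using Kc z A N.submoduleD(1)[OF L(1)] by auto
      note G = N.submodule_gen_submodule[OF c(1)] and G' = N.submodule_gen_submodule[OF c(2)]
      have "?L \<subseteq> gen_submodule R N (K \<union> insert z A)"
        using G(2) by (intro N.gen_submodule_minimal[OF G(1)]) blast
      then show "gen_submodule R N (?L \<union> A) \<subseteq> gen_submodule R N (K \<union> insert z A)"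
        using G(2) by (intro N.gen_submodule_minimal[OF G(1)]) blast
      show "gen_submodule R N (K \<union> insert z A) \<subseteq> gen_submodule R N (?L \<union> A)"
        using G'(2) L(2) by (intro N.gen_submodule_minimal[OF G'(1)]) blast
    qed
    then show ?case using h2 h1(2) L(2) by (intro bexI[of _ h2]) auto
  }
qed

text \<open>The dual of \<open>lift_through\<close>: the kernel condition defines a map on the image
  of \<open>g\<close>, and injectivity extends it to the finitely generated module
  \<open>P\<close>.\<close>

lemma injective_extend_through:
  assumes N: "module R N" and free: "free_of_rank R P n" and E: "injective_module R E"
    and g: "g \<in> module_hom R N P" and f: "f \<in> module_hom R N E"
    and ker: "\<And>x. x \<in> carrier N \<Longrightarrow> g x = \<zero>\<^bsub>P\<^esub> \<Longrightarrow> f x = \<zero>\<^bsub>E\<^esub>"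
  shows "\<exists>h\<in>module_hom R P E. \<forall>x\<in>carrier N. h (g x) = f x"
proof -
  interpret N: plain_module R N using N by (rule plain_module.intro)
  interpret P: plain_module R P using free by (simp add: free_of_rank_def plain_module_def)
  interpret E: plain_module R E using E by (simp add: injective_module_def plain_module_def)
  define K where "K = g ` carrier N"
  have K: "submodule K R P"
    unfolding K_def by (rule submodule_hom_image[OF N P.module_axioms g N.carrier_is_submodule])
  define h0 where "h0 u = f (SOME x. x \<in> carrier N \<and> g x = u)" for u
  have h0: "h0 (g x) = f x" if x: "x \<in> carrier N" for x
    unfolding h0_def
  proof (rule someI2[of _ x])
    show "x \<in> carrier N \<and> g x = g x" using x by simp
    fix y assume y: "y \<in> carrier N \<and> g y = g x"
    have "g (y \<ominus>\<^bsub>N\<^esub> x) = \<zero>\<^bsub>P\<^esub>"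
      using module_hom_minus[OF N P.module_axioms g, of y x] y x module_homD(1)[OF g x]
      by (simp add: a_minus_def P.M.r_neg)
    then have "f y \<ominus>\<^bsub>E\<^esub> f x = \<zero>\<^bsub>E\<^esub>"
      using module_hom_minus[OF N E.module_axioms f, of y x] ker[of "y \<ominus>\<^bsub>N\<^esub> x"] y x by simp
    then show "f y = f x"
      by (rule module_hom_eqI_diff[OF E.module_axioms, rotated 2]) (use y x module_homD(1)[OF f] in auto)
  qed
  have "h0 \<in> module_hom R (P\<lparr>carrier := K\<rparr>) E"
  proof (rule module_homI)
    fix u assume "u \<in> carrier (P\<lparr>carrier := K\<rparr>)"
    then obtain x where x: "x \<in> carrier N" "u = g x" by (auto simp: K_def)
    show "h0 u \<in> carrier E" using x h0 module_homD(1)[OF f] by simp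
    show "h0 (a \<odot>\<^bsub>P\<lparr>carrier := K\<rparr>\<^esub> u) = a \<odot>\<^bsub>E\<^esub> h0 u" if "a \<in> carrier R" for a
      using x h0[OF x(1)] h0[of "a \<odot>\<^bsub>N\<^esub> x"] module_homD(3)[OF f that x(1)] module_homD(3)[OF g that x(1)] that by simp
    fix v assume "v \<in> carrier (P\<lparr>carrier := K\<rparr>)"
    then obtain y where y: "y \<in> carrier N" "v = g y" by (auto simp: K_def)
    show "h0 (u \<oplus>\<^bsub>P\<lparr>carrier := K\<rparr>\<^esub> v) = h0 u \<oplus>\<^bsub>E\<^esub> h0 v"
      using x y h0[OF x(1)] h0[OF y(1)] h0[of "x \<oplus>\<^bsub>N\<^esub> y"] module_homD(2)[OF f x(1) y(1)]
        module_homD(2)[OF g x(1) y(1)] by simp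
  qed
  moreover obtain A where A: "A \<subseteq> carrier P" "finite A" "gen_submodule R P A = carrier P"
    using free_finitely_generated[OF N.R.is_cring free] by blast
  ultimately obtain h where h: "h \<in> module_hom R (P\<lparr>carrier := gen_submodule R P (K \<union> A)\<rparr>) E" "\<forall>k\<in>K. h k = h0 k"
    using injective_extend_finite[OF P.module_axioms E A(2,1) K] by blast
  have "P\<lparr>carrier := gen_submodule R P (K \<union> A)\<rparr> = P"
    using P.gen_submodule_Un_carrier[OF A(1,3) P.submoduleD(1)[OF K]] by simp
  then show ?thesis using h h0 by (intro bexI[of _ h]) (auto simp: K_def)
qed

section \<open>The double complex of a free and an injective resolution\<close>

context injective_resolution
begin

text \<open>Diagram chase in the double complex \<open>Hom(F\<^sub>i, E\<^sub>j)\<close>, in antidiagonals beyond the length of \<open>F\<close>.\<close>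

lemma double_complex_exact:
  assumes F: "left_resolution R F dF \<epsilon> N" and free: "\<And>i. \<exists>n. free_of_rank R (F i) n"
    and len: "\<And>i. i > g \<Longrightarrow> carrier (F i) = {\<zero>\<^bsub>F i\<^esub>}"
    and "f \<in> module_hom R (F i) (E j)" "\<And>x. x \<in> carrier (F i) \<Longrightarrow> d j (f x) = \<zero>\<^bsub>E (Suc j)\<^esub>"
    and "\<And>x. x \<in> carrier (F (Suc i)) \<Longrightarrow> f (dF i x) = \<zero>\<^bsub>E j\<^esub>" and "i + j > g"
  shows "case j of 0 \<Rightarrow> \<forall>x\<in>carrier (F i). f x = \<zero>\<^bsub>E j\<^esub>
    | Suc k \<Rightarrow> \<exists>h\<in>module_hom R (F i) (E k). (\<forall>x\<in>carrier (F (Suc i)). h (dF i x) = \<zero>\<^bsub>E k\<^esub>) \<and>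
        (\<forall>x\<in>carrier (F i). d k (h x) = f x)"
  using assms(4-)
proof (induction j arbitrary: i f)
  case (0 i f)
  note F' = left_resolutionD[OF F]
  have "carrier (F i) = {\<zero>\<^bsub>F i\<^esub>}" using 0 by (intro len) simp
  then show ?case using module_hom_zero[OF F'(1) E_module "0.prems"(1)] by simp
next
  case (Suc j i f)
  note F' = left_resolutionD[OF F]
  note f = Suc.prems(1)
  have db: "has_dual_basis TYPE(nat) R (F i)" for i
    using free free_has_dual_basis[OF is_cring] by blast
  have im: "f x \<in> d j ` carrier (E j)" if x: "x \<in> carrier (F i)" for x
    unfolding d_exact using Suc.prems(2)[OF x] module_homD(1)[OF f x] by simp
  obtain f' where f': "f' \<in> module_hom R (F i) (E j)" "\<And>x. x \<in> carrier (F i) \<Longrightarrow> d j (f' x) = f x"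
    using lift_through[OF F'(1) E_module E_module db f d_hom im] by blast
  \<comment> \<open>\<open>f'\<close> lifts \<open>f\<close> but need not kill the image of
    \<open>dF i\<close>. The failure \<open>u\<close> sits at position (i + 1, j), of the same total
    degree as (i, j + 1), so the induction hypothesis applies to it.\<close>
  define u where "u x = f' (dF i x)" for x
  have u: "u \<in> module_hom R (F (Suc i)) (E j)"
    unfolding u_def by (rule module_hom_comp[OF F'(2) f'(1)])
  have dFc: "dF i x \<in> carrier (F i)" if "x \<in> carrier (F (Suc i))" for i x
    using module_homD(1)[OF F'(2) that] .
  have u1: "d j (u x) = \<zero>\<^bsub>E (Suc j)\<^esub>" if "x \<in> carrier (F (Suc i))" for x
    using f'(2)[OF dFc[OF that]] Suc.prems(3)[OF that] by (simp add: u_def)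
  have u2: "u (dF (Suc i) x) = \<zero>\<^bsub>E j\<^esub>" if "x \<in> carrier (F (Suc (Suc i)))" for x
    using F'(8)[OF that] module_hom_zero[OF F'(1) E_module f'(1)] by (simp add: u_def)
  note IH = Suc.IH[OF u u1 u2]
  show ?case
    unfolding nat.case
  proof (cases j)
    case 0
    have "\<forall>x\<in>carrier (F (Suc i)). u x = \<zero>\<^bsub>E j\<^esub>" using IH Suc.prems(4) 0 by simp
    then show "\<exists>h\<in>module_hom R (F i) (E j). (\<forall>x\<in>carrier (F (Suc i)). h (dF i x) = \<zero>\<^bsub>E j\<^esub>) \<and>
        (\<forall>x\<in>carrier (F i). d j (h x) = f x)"
      using f' by (intro bexI[of _ f']) (auto simp: u_def)
  next
    case (Suc k)
    obtain h' where h': "h' \<in> module_hom R (F (Suc i)) (E k)"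
      "\<And>x. x \<in> carrier (F (Suc (Suc i))) \<Longrightarrow> h' (dF (Suc i) x) = \<zero>\<^bsub>E k\<^esub>"
      "\<And>x. x \<in> carrier (F (Suc i)) \<Longrightarrow> d k (h' x) = u x"
      using IH Suc.prems(4) Suc by auto
    have ker: "h' x = \<zero>\<^bsub>E k\<^esub>" if "x \<in> carrier (F (Suc i))" "dF i x = \<zero>\<^bsub>F i\<^esub>" for x
    proof -
      have "x \<in> dF (Suc i) ` carrier (F (Suc (Suc i)))" unfolding F'(6) using that by simp
      then show ?thesis using h'(2) by auto
    qed
    obtain n where n: "free_of_rank R (F i) n" using free by blast
    \<comment> \<open>\<open>h'\<close> kills the kernel of \<open>dF i\<close>, so injectivity
      extends it along \<open>dF i\<close>. Subtracting d w from \<open>f'\<close> then removes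
      \<open>u\<close> without changing the image under \<open>d\<close>.\<close>
    obtain w where w: "w \<in> module_hom R (F i) (E k)" "\<And>x. x \<in> carrier (F (Suc i)) \<Longrightarrow> w (dF i x) = h' x"
      using injective_extend_through[OF F'(1) n injective F'(2) h'(1) ker] by blast
    have dw: "(\<lambda>x. d k (w x)) \<in> module_hom R (F i) (E j)"
      unfolding Suc by (rule module_hom_comp[OF w(1) d_hom])
    define h where "h x = f' x \<ominus>\<^bsub>E j\<^esub> d k (w x)" for x
    have h: "h \<in> module_hom R (F i) (E j)"
      unfolding h_def by (rule module_hom_diff[OF F'(1) E_module f'(1) dw])
    have "h (dF i x) = \<zero>\<^bsub>E j\<^esub>" if x: "x \<in> carrier (F (Suc i))" for x
      using w(2)[OF x] h'(3)[OF x] module_homD(1)[OF u x]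
      by (simp add: h_def u_def a_minus_def E.M.r_neg)
    moreover have "d j (h x) = f x" if x: "x \<in> carrier (F i)" for x
    proof -
      have c: "w x \<in> carrier (E k)" "f' x \<in> carrier (E j)" "d k (w x) \<in> carrier (E j)"
        using module_homD(1)[OF w(1) x] module_homD(1)[OF f'(1) x] module_homD(1)[OF dw x] by auto
      have "d j (h x) = f x \<ominus>\<^bsub>E (Suc j)\<^esub> d j (d k (w x))"
        unfolding h_def using d_minus[OF c(2,3)] f'(2)[OF x] by simp
      also have "d j (d k (w x)) = \<zero>\<^bsub>E (Suc j)\<^esub>" using d_d[OF c(1)] Suc by simp
      finally show ?thesis using module_homD(1)[OF f x] E.minus_add_cancel[of "f x" "Suc j" "\<zero>\<^bsub>E (Suc j)\<^esub>"]
        by simp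
    qed
    ultimately show "\<exists>h\<in>module_hom R (F i) (E j). (\<forall>x\<in>carrier (F (Suc i)). h (dF i x) = \<zero>\<^bsub>E j\<^esub>) \<and>
        (\<forall>x\<in>carrier (F i). d j (h x) = f x)"
      using h by blast
  qed
qed

text \<open>F_0 is free on a preimage \<open>v\<close> of 1, so \<open>e\<close> defines the map
  sending a v to a e, which kills the image of F_1 because \<open>K\<close> kills \<open>e\<close>.
  It is a cocycle at position (0, m) of the double complex, where m > g. The map \<open>h\<close>
  found there gives d (h v) = e, and \<open>K\<close> kills h v because \<open>h\<close> kills the
  image of F_1.\<close>

lemma cocycles_subset_coboundaries:
  assumes loc: "noetherian_local_ring R" and K: "ideal K R" "K \<noteq> carrier R"
    and F: "minimal_free_resolution R F dF \<epsilon> (quot_module (reg_module R) K)"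
    and len: "\<And>i. i > g \<Longrightarrow> carrier (F i) = {\<zero>\<^bsub>F i\<^esub>}" and m: "m > g"
  shows "cocycles m K \<subseteq> coboundaries m K"
proof
  fix e assume e: "e \<in> cocycles m K"
  have ec: "e \<in> carrier (E m)" using e annihilated_carrier by (auto simp: cocycles_def annihilated_def)
  interpret S: plain_module R "reg_module R" by (rule plain_module.intro[OF reg_module_module])
  have Ks: "submodule K R (reg_module R)" by (rule submodule_ideal[OF K(1)])
  have Kc: "K \<subseteq> carrier R" by (rule idealD(1)[OF K(1)])
  note res = minimal_free_resolutionD(1)[OF F]
  note F' = left_resolutionD[OF res]
  interpret F0: plain_module R "F 0" by (rule plain_module.intro[OF F'(1)])
  note db = minimal_free_resolution_dual_basis[OF is_cring F]
  have "K +>\<^bsub>reg_module R\<^esub> \<one> \<in> \<epsilon> ` carrier (F 0)" unfolding F'(4) by (simp add: S.quot_module_carrier)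
  then obtain v where v: "v \<in> carrier (F 0)" "\<epsilon> v = K +>\<^bsub>reg_module R\<^esub> \<one>" by auto
  note gen = minimal_free_resolution_generator[OF loc K F v]
  have \<epsilon>v: "\<epsilon> (a \<odot>\<^bsub>F 0\<^esub> v) = K +>\<^bsub>reg_module R\<^esub> a" if "a \<in> carrier R" for a
    using module_homD(3)[OF F'(3) that v(1)] v(2) S.quot_module_smult[OF Ks, of \<one> a] that by simp
  have \<epsilon>0: "\<epsilon> (a \<odot>\<^bsub>F 0\<^esub> v) = \<zero>\<^bsub>quot_module (reg_module R) K\<^esub> \<longleftrightarrow> a \<in> K" if "a \<in> carrier R" for a
    using \<epsilon>v[OF that] S.coset_zero_iff[OF Ks, of a] that by simp
  have mv: "(\<lambda>a. a \<odot>\<^bsub>F 0\<^esub> v) \<in> module_hom R (reg_module R) (F 0)"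
    using v(1) by (intro module_homI) (auto simp: F0.smult_l_distr F0.smult_assoc1)
  have "\<exists>c\<in>module_hom R (F 0) (reg_module R). \<forall>x\<in>carrier (F 0). c x \<odot>\<^bsub>F 0\<^esub> v = x"
    by (rule lift_through[OF F'(1) S.module_axioms F'(1) db module_hom_id mv]) (use gen(1) in auto)
  then obtain c where c: "c \<in> module_hom R (F 0) (reg_module R)"
    "\<And>x. x \<in> carrier (F 0) \<Longrightarrow> c x \<odot>\<^bsub>F 0\<^esub> v = x" by blast
  have cc: "c x \<in> carrier R" if "x \<in> carrier (F 0)" for x using module_homD(1)[OF c(1) that] by simp
  have me: "(\<lambda>a. a \<odot>\<^bsub>E m\<^esub> e) \<in> module_hom R (reg_module R) (E m)"
    using ec by (intro module_homI) (auto simp: E.smult_l_distr E.smult_assoc1)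
  define f where "f x = c x \<odot>\<^bsub>E m\<^esub> e" for x
  have f: "f \<in> module_hom R (F 0) (E m)" unfolding f_def by (rule module_hom_comp[OF c(1) me])
  have f1: "d m (f x) = \<zero>\<^bsub>E (Suc m)\<^esub>" if "x \<in> carrier (F 0)" for x
    using d_smult[OF cc[OF that] ec] e cc[OF that] by (simp add: f_def cocycles_def)
  have f2: "f (dF 0 x) = \<zero>\<^bsub>E m\<^esub>" if x: "x \<in> carrier (F (Suc 0))" for x
  proof -
    have y: "dF 0 x \<in> carrier (F 0)" using module_homD(1)[OF F'(2) x] .
    have "c (dF 0 x) \<in> K" using \<epsilon>0[OF cc[OF y]] c(2)[OF y] F'(7)[of x] x by simp
    then show ?thesis using e by (simp add: f_def cocycles_def annihilated_def)
  qed
  obtain k where k: "m = Suc k" using m by (cases m) auto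
  obtain h where h: "h \<in> module_hom R (F 0) (E k)" "\<forall>x\<in>carrier (F (Suc 0)). h (dF 0 x) = \<zero>\<^bsub>E k\<^esub>"
    "\<forall>x\<in>carrier (F 0). d k (h x) = f x"
    using double_complex_exact[where g = g, OF res minimal_free_resolutionD(2)[OF F] len f f1 f2] m k by auto
  have hv: "h v \<in> carrier (E k)" using module_homD(1)[OF h(1) v(1)] .
  have "(c v \<ominus> \<one>) \<odot>\<^bsub>F 0\<^esub> v = \<zero>\<^bsub>F 0\<^esub>"
    using c(2)[OF v(1)] cc[OF v(1)] v(1)
    by (simp add: a_minus_def F0.smult_l_distr F0.smult_l_minus F0.M.r_neg)
  then have "c v \<ominus> \<one> = \<zero>" using gen(2) cc[OF v(1)] by simp
  then have "c v = \<one>"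
    using module_hom_eqI_diff[OF S.module_axioms, of "c v" \<one>] cc[OF v(1)] by simp
  then have "d k (h v) = e" using h(3) v(1) ec by (simp add: f_def)
  moreover have "a \<odot>\<^bsub>E k\<^esub> h v = \<zero>\<^bsub>E k\<^esub>" if a: "a \<in> K" for a
  proof -
    have ac: "a \<in> carrier R" using a Kc by blast
    have "a \<odot>\<^bsub>F 0\<^esub> v \<in> dF 0 ` carrier (F 1)" unfolding F'(5) using \<epsilon>0[OF ac] a ac v(1) by simp
    then obtain y where "y \<in> carrier (F (Suc 0))" "a \<odot>\<^bsub>F 0\<^esub> v = dF 0 y" by auto
    then show ?thesis using h(2) module_homD(3)[OF h(1) ac v(1)] by simp
  qed
  then have "h v \<in> annihilated (E k) K" using hv by (simp add: annihilated_def)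
  ultimately show "e \<in> coboundaries m K" unfolding k coboundaries_def by auto
qed

end

text \<open>With g the grade, g <= r holds, and perfection together with minimality bounds the
  length of \<open>F\<close> by g. Ext^m(R/K, R) is nonzero for some m >= r but zero for m > g, so r
  <= g. Thus the resolution has length at most r, and a regular sequence of length r in
  \<open>K\<close> feeds Rees' argument.\<close>

lemma perfect_resolution:
  fixes R (structure)
  assumes gor: "gorenstein_local_ring TYPE('e) R" and perf: "perfect_ideal R K"
    and codim: "codim R K = enat r"
    and F: "minimal_free_resolution R F d \<epsilon> (quot_module (reg_module R) K)"
  shows "i < r \<Longrightarrow> dual_exact_at R F d {\<zero>} i"
    and "i > r \<Longrightarrow> carrier (F i) = {\<zero>\<^bsub>F i\<^esub>}"
proof -
  have loc: "noetherian_local_ring R" using gor by (simp add: gorenstein_local_ring_def)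
  have cr: "cring R" using loc by (simp add: noetherian_local_ring_def)
  interpret noetherian_ring R using loc by (simp add: noetherian_local_ring_def)
  interpret cring R by fact
  interpret S: plain_module R "reg_module R" by (rule plain_module.intro[OF reg_module_module])
  have K: "ideal K R" "K \<noteq> carrier R" and pd: "proj_dim R (quot_module (reg_module R) K) = grade R K"
    using perf by (auto simp: perfect_ideal_def)
  have Q: "module R (quot_module (reg_module R) K)" by (rule S.quot_module_module[OF submodule_ideal[OF K(1)]])
  have "grade R K \<le> enat r" using grade_le_codim[OF cr, of K] codim by simp
  then obtain g where g: "grade R K = enat g" "g \<le> r" by (cases "grade R K") auto
  \<comment> \<open>The strict comparison with g + 1 turns the infimum into an actual resolution of
    length at most g.\<close>
  have "Inf {enat n | n. \<exists>(P :: nat \<Rightarrow> ('a, nat \<Rightarrow> 'a) module) d \<epsilon>.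
     left_resolution R P d \<epsilon> (quot_module (reg_module R) K) \<and> (\<forall>i. projective_module R (P i)) \<and>
     (\<forall>i>n. carrier (P i) = {\<zero>\<^bsub>P i\<^esub>})} < enat (Suc g)"
    using pd g by (simp add: proj_dim_def)
  then obtain n and P :: "nat \<Rightarrow> ('a, nat \<Rightarrow> 'a) module" and dP \<epsilon>P where P: "n \<le> g"
     "left_resolution R P dP \<epsilon>P (quot_module (reg_module R) K)" "\<And>i. projective_module R (P i)"
     "\<And>i. i > n \<Longrightarrow> carrier (P i) = {\<zero>\<^bsub>P i\<^esub>}"
    unfolding Inf_less_iff by (auto simp: less_Suc_eq_le)
  have len: "carrier (F i) = {\<zero>\<^bsub>F i\<^esub>}" if "i > g" for i
    using minimal_free_resolution_length[OF loc Q F P(2,3,4)] that P(1) by simp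
  obtain E :: "nat \<Rightarrow> ('a, 'e) module" and dE \<iota> N where E: "right_resolution R (reg_module R) \<iota> E dE"
    "\<And>i. injective_module R (E i)" "\<And>i. i > N \<Longrightarrow> carrier (E i) = {\<zero>\<^bsub>E i\<^esub>}"
    using gor unfolding gorenstein_local_ring_def by blast
  interpret E: injective_resolution R E dE \<iota>
    using E(1,2) by unfold_locales
  have "\<exists>m\<ge>r. \<not> E.cocycles m K \<subseteq> E.coboundaries m K"
  proof (rule E.ext_nonzero_above_codim[OF K E(3)])
    fix P assume P: "primeideal P R" "K \<subseteq> P"
    have "codim R K \<le> prime_height R P" unfolding codim_def using P by (intro Inf_lower) blast
    then show "\<exists>h\<ge>r. \<exists>C. (\<forall>i\<le>h. primeideal (C i) R) \<and> (\<forall>i<h. C i \<subset> C (Suc i)) \<and> C h = P"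
      using prime_height_chain[OF P(1)] codim by simp
  qed
  then obtain m where "m \<ge> r" "\<not> E.cocycles m K \<subseteq> E.coboundaries m K" by blast
  then have "r \<le> g"
    using E.cocycles_subset_coboundaries[where g = g and m = m, OF loc K F len] by fastforce
  then have gr: "g = r" using g(2) by simp
  show "carrier (F i) = {\<zero>\<^bsub>F i\<^esub>}" if "i > r" for i using len that gr by simp
  \<comment> \<open>A finite supremum of lengths is attained. The strict comparison with g - 1 that
    shows it leaves g = 0 to the empty sequence.\<close>
  have "\<exists>xs. length xs = g \<and> set xs \<subseteq> K \<and> regular_sequence R xs"
  proof (cases g)
    case 0
    have "Idl {} \<subseteq> K" by (rule genideal_minimal[OF K(1)]) simp
    then have "regular_sequence R []" using K idealD(1)[OF K(1)] by (auto simp: regular_sequence_def)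
    then show ?thesis using 0 by (intro exI[of _ "[]"]) simp
  next
    case (Suc g')
    then have "enat g' < Sup {enat (length xs) | xs. set xs \<subseteq> K \<and> regular_sequence R xs}"
      using g(1) by (simp add: grade_def)
    then obtain xs where xs: "g' < length xs" "set xs \<subseteq> K" "regular_sequence R xs"
      unfolding less_Sup_iff by auto
    then have "enat (length xs) \<le> enat g" unfolding g(1)[symmetric] grade_def by (intro Sup_upper) blast
    then show ?thesis using xs Suc by (intro exI[of _ xs]) simp
  qed
  then obtain xs where xs: "length xs = g" "set xs \<subseteq> K" "regular_sequence R xs" by blast
  show "dual_exact_at R F d {\<zero>} i" if "i < r" for i
  proof -
    have "Idl {} = {\<zero>}"
      using genideal_minimal[OF zeroideal, of "{}"] idealD(2)[OF genideal_ideal[of "{}"]] by auto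
    moreover have "dual_exact_at R F d (Idl (set (take 0 xs))) i"
      using that gr xs by (intro rees[OF cr K(1) minimal_free_resolutionD(1)[OF F]
          minimal_free_resolution_dual_basis[OF cr F] xs(2)]) (auto simp: regular_sequence_def)
    ultimately show ?thesis by simp
  qed
qed

section \<open>Bilinear forms\<close>

text \<open>Stands for a map from \<open>N\<close> to the dual of \<open>P\<close>, or equally from
  \<open>P\<close> to the dual of \<open>N\<close>. Liftings take place in both arguments, and in
  this form exchanging them is immediate.\<close>

definition bilinear_form ::
    "('a, 'm) ring_scheme \<Rightarrow> ('a, 'b) module \<Rightarrow> ('a, 'c) module \<Rightarrow> ('b \<Rightarrow> 'c \<Rightarrow> 'a) \<Rightarrow> bool" where
  "bilinear_form R N P B \<longleftrightarrow> (\<forall>x\<in>carrier N. B x \<in> module_hom R P (reg_module R)) \<and>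
     (\<forall>y\<in>carrier P. (\<lambda>x. B x y) \<in> module_hom R N (reg_module R))"

lemma bilinear_formD:
  assumes "bilinear_form R N P B"
  shows "x \<in> carrier N \<Longrightarrow> B x \<in> module_hom R P (reg_module R)"
    "y \<in> carrier P \<Longrightarrow> (\<lambda>x. B x y) \<in> module_hom R N (reg_module R)"
    "x \<in> carrier N \<Longrightarrow> y \<in> carrier P \<Longrightarrow> B x y \<in> carrier R"
proof -
  show 1: "x \<in> carrier N \<Longrightarrow> B x \<in> module_hom R P (reg_module R)" for x
    using assms by (simp add: bilinear_form_def)
  show "y \<in> carrier P \<Longrightarrow> (\<lambda>x. B x y) \<in> module_hom R N (reg_module R)"
    using assms by (simp add: bilinear_form_def)
  show "x \<in> carrier N \<Longrightarrow> y \<in> carrier P \<Longrightarrow> B x y \<in> carrier R"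
    using module_homD(1)[OF 1] by simp
qed

lemma bilinear_form_swap: "bilinear_form R N P B \<Longrightarrow> bilinear_form R P N (\<lambda>y x. B x y)"
  by (simp add: bilinear_form_def)

lemma bilinear_form_comp:
  assumes B: "bilinear_form R N P B" and f: "f \<in> module_hom R N' N" and g: "g \<in> module_hom R P' P"
  shows "bilinear_form R N' P' (\<lambda>x y. B (f x) (g y))"
  using module_hom_comp[OF g bilinear_formD(1)[OF B]] module_hom_comp[OF f bilinear_formD(2)[OF B]]
    module_homD(1)[OF f] module_homD(1)[OF g]
  by (auto simp: bilinear_form_def)

lemma bilinear_form_zero:
  assumes "cring R" "module R N" "module R P" "bilinear_form R N P B"
  shows "x \<in> carrier N \<Longrightarrow> B x \<zero>\<^bsub>P\<^esub> = \<zero>\<^bsub>R\<^esub>" "y \<in> carrier P \<Longrightarrow> B \<zero>\<^bsub>N\<^esub> y = \<zero>\<^bsub>R\<^esub>"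
  using module_hom_zero[OF assms(3) cring.reg_module_module[OF assms(1)] bilinear_formD(1)[OF assms(4)]]
    module_hom_zero[OF assms(2) cring.reg_module_module[OF assms(1)] bilinear_formD(2)[OF assms(4)]]
  by auto

lemma bilinear_form_minus:
  assumes cr: "cring R" and N: "module R N" and P: "module R P"
    and B: "bilinear_form R N P B" and C: "bilinear_form R N P C"
  shows "bilinear_form R N P (\<lambda>x y. B x y \<ominus>\<^bsub>R\<^esub> C x y)"
proof -
  interpret cring R by fact
  note S = reg_module_module
  have 1: "(\<lambda>y. B x y \<ominus>\<^bsub>R\<^esub> C x y) \<in> module_hom R P (reg_module R)" if x: "x \<in> carrier N" for x
    using bilinear_formD(3)[OF B x] bilinear_formD(3)[OF C x]
    by (intro module_hom_cong[OF P module_hom_diff[OF P S bilinear_formD(1)[OF B x] bilinear_formD(1)[OF C x]]]) simp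
  have 2: "(\<lambda>x. B x y \<ominus>\<^bsub>R\<^esub> C x y) \<in> module_hom R N (reg_module R)" if y: "y \<in> carrier P" for y
    using bilinear_formD(3)[OF B _ y] bilinear_formD(3)[OF C _ y]
    by (intro module_hom_cong[OF N module_hom_diff[OF N S bilinear_formD(2)[OF B y] bilinear_formD(2)[OF C y]]]) simp
  show ?thesis using 1 2 by (simp add: bilinear_form_def)
qed

lemma bilinear_form_of_hom:
  assumes "h \<in> module_hom R N (dual R P)"
  shows "bilinear_form R N P h"
proof -
  have h: "h x \<in> module_hom R P (reg_module R)" if "x \<in> carrier N" for x
    using module_homD(1)[OF assms that] by (simp add: dual_simps)
  moreover have "(\<lambda>x. h x y) \<in> module_hom R N (reg_module R)" if "y \<in> carrier P" for y
    using that module_homD[OF assms] module_homD(1)[OF h _]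
    by (intro module_homI) (auto simp: dual_simps)
  ultimately show ?thesis by (simp add: bilinear_form_def)
qed

lemma hom_of_bilinear_form:
  assumes P: "module R P" and B: "bilinear_form R N P B"
  shows "(\<lambda>x. restrict (B x) (carrier P)) \<in> module_hom R N (dual R P)"
proof (rule module_homI)
  fix x assume x: "x \<in> carrier N"
  show "restrict (B x) (carrier P) \<in> carrier (dual R P)"
    by (rule dual_restrict[OF P bilinear_formD(1)[OF B x]])
  show "restrict (B (a \<odot>\<^bsub>N\<^esub> x)) (carrier P) = a \<odot>\<^bsub>dual R P\<^esub> restrict (B x) (carrier P)"
    if "a \<in> carrier R" for a
    using module_homD(3)[OF bilinear_formD(2)[OF B] that x] by (auto simp: dual_simps fun_eq_iff)
  show "restrict (B (x \<oplus>\<^bsub>N\<^esub> x')) (carrier P) =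
      restrict (B x) (carrier P) \<oplus>\<^bsub>dual R P\<^esub> restrict (B x') (carrier P)"
    if "x' \<in> carrier N" for x'
    using module_homD(2)[OF bilinear_formD(2)[OF B] x that] by (auto simp: dual_simps fun_eq_iff)
qed

text \<open>Each \<open>B x\<close> factors through \<open>g\<close> by itself; lifting along the
  transpose of \<open>g\<close> with a dual basis of \<open>N\<close> makes the factorization linear
  in x.\<close>

lemma bilinear_form_lift:
  assumes cr: "cring R" and N: "module R N" and P: "module R P" and P': "module R P'"
    and db: "has_dual_basis TYPE('i) R N" and g: "g \<in> module_hom R P P'"
    and B: "bilinear_form R N P B"
    and lift: "\<And>x. x \<in> carrier N \<Longrightarrow> \<exists>f\<in>module_hom R P' (reg_module R). \<forall>y\<in>carrier P. B x y = f (g y)"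
  shows "\<exists>B'. bilinear_form R N P' B' \<and> (\<forall>x\<in>carrier N. \<forall>y\<in>carrier P. B x y = B' x (g y))"
proof -
  have "\<exists>h\<in>module_hom R N (dual R P'). \<forall>x\<in>carrier N. dual_map P g (h x) = restrict (B x) (carrier P)"
  proof (rule lift_through[OF N dual_module[OF cr P'] dual_module[OF cr P] db
        hom_of_bilinear_form[OF P B] dual_map_hom[OF P g]])
    fix x assume x: "x \<in> carrier N"
    then obtain f where f: "f \<in> module_hom R P' (reg_module R)" "\<forall>y\<in>carrier P. B x y = f (g y)"
      using lift by blast
    have "restrict (B x) (carrier P) = dual_map P g (restrict f (carrier P'))"
      using f(2) module_homD(1)[OF g] by (auto simp: dual_map_def)
    then show "restrict (B x) (carrier P) \<in> dual_map P g ` carrier (dual R P')"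
      using dual_restrict[OF P' f(1)] by blast
  qed
  then obtain h where h: "h \<in> module_hom R N (dual R P')"
    "\<And>x. x \<in> carrier N \<Longrightarrow> dual_map P g (h x) = restrict (B x) (carrier P)" by blast
  have "B x y = h x (g y)" if "x \<in> carrier N" "y \<in> carrier P" for x y
    using fun_cong[OF h(2)[OF that(1)], of y] that(2) by (simp add: dual_map_def)
  then show ?thesis using bilinear_form_of_hom[OF h(1)] by blast
qed

text \<open>The map from \<open>N\<close> to the dual of F_i lifts through the dual of F_(i-1), with
  F_(-1) = 0. The lift \<open>B'\<close> is what later becomes the next component of a chain map or
  of a homotopy.\<close>

definition form_boundary ::
    "('a, 'm) ring_scheme \<Rightarrow> ('a, 'b) module \<Rightarrow> (nat \<Rightarrow> ('a, 'c) module) \<Rightarrow> (nat \<Rightarrow> 'c \<Rightarrow> 'c) \<Rightarrow> nat \<Rightarrow>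
     ('b \<Rightarrow> 'c \<Rightarrow> 'a) \<Rightarrow> bool" where
  "form_boundary R N F d i B \<longleftrightarrow> (case i of
      0 \<Rightarrow> \<forall>x\<in>carrier N. \<forall>y\<in>carrier (F 0). B x y = \<zero>\<^bsub>R\<^esub>
    | Suc j \<Rightarrow> \<exists>B'. bilinear_form R N (F j) B' \<and>
        (\<forall>x\<in>carrier N. \<forall>y\<in>carrier (F (Suc j)). B x y = B' x (d j y)))"

text \<open>Exactness provides a lift for each x separately; the dual basis of \<open>N\<close>
  makes these lifts bilinear.\<close>

lemma form_boundary_exact:
  assumes cr: "cring R" and N: "module R N" and F: "\<And>i. module R (F i)"
    and d: "\<And>i. d i \<in> module_hom R (F (Suc i)) (F i)"
    and db: "has_dual_basis TYPE('i) R N" and ex: "dual_exact_at R F d {\<zero>\<^bsub>R\<^esub>} i"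
    and B: "bilinear_form R N (F i) B"
    and coc: "\<And>x y. x \<in> carrier N \<Longrightarrow> y \<in> carrier (F (Suc i)) \<Longrightarrow> B x (d i y) = \<zero>\<^bsub>R\<^esub>"
  shows "form_boundary R N F d i B"
proof (cases i)
  case 0
  then show ?thesis
    using ex coc bilinear_formD(1)[OF B] by (auto simp: form_boundary_def dual_exact_at_def)
next
  case (Suc j)
  interpret cring R by fact
  have "\<exists>B'. bilinear_form R N (F j) B' \<and> (\<forall>x\<in>carrier N. \<forall>y\<in>carrier (F (Suc j)). B x y = B' x (d j y))"
  proof (rule bilinear_form_lift[OF cr N F F db d])
    show "bilinear_form R N (F (Suc j)) B" using B Suc by simp
    fix x assume x: "x \<in> carrier N"
    have Bx: "B x \<in> module_hom R (F (Suc j)) (reg_module R)" using bilinear_formD(1)[OF B x] Suc by simp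
    obtain h where h: "h \<in> module_hom R (F j) (reg_module R)"
      "\<forall>y\<in>carrier (F (Suc j)). B x y \<ominus>\<^bsub>R\<^esub> h (d j y) = \<zero>\<^bsub>R\<^esub>"
      using ex Bx coc[OF x] Suc by (auto simp: dual_exact_at_def)
    have "B x y = h (d j y)" if y: "y \<in> carrier (F (Suc j))" for y
      using module_hom_eqI_diff[OF reg_module_module, of "B x y" "h (d j y)"] h(2) y
        module_homD(1)[OF Bx y] module_homD(1)[OF h(1) module_homD(1)[OF d y]] by simp
    then show "\<exists>f\<in>module_hom R (F j) (reg_module R). \<forall>y\<in>carrier (F (Suc j)). B x y = f (d j y)"
      using h(1) by blast
  qed
  then show ?thesis using Suc by (simp add: form_boundary_def)
qed

section \<open>Lifting homomorphisms to the resolutions\<close>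

text \<open>The facts about the two resolutions on which the lifting rests. In the application
  \<open>v\<close> lies over 1 in S/I, so \<open>\<psi> 0 v\<close> lies over 1 in S/J and is a
  basis of M_0, and \<open>J\<close> appears as the image of M_1. The ranges of exactness differ by
  one because the codimensions do.\<close>

locale linked_resolutions = cring R for R :: "('a, 'm) ring_scheme" (structure) +
  fixes J :: "'a set"
    and L :: "nat \<Rightarrow> ('a, 'b) module" and dL :: "nat \<Rightarrow> 'b \<Rightarrow> 'b"
    and M :: "nat \<Rightarrow> ('a, 'c) module" and dM :: "nat \<Rightarrow> 'c \<Rightarrow> 'c"
    and \<psi> :: "nat \<Rightarrow> 'b \<Rightarrow> 'c" and r :: nat and v :: 'b
  assumes J: "ideal J R"
    and L_module: "module R (L i)" and M_module: "module R (M i)"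
    and dL_hom: "dL i \<in> module_hom R (L (Suc i)) (L i)"
    and dM_hom: "dM i \<in> module_hom R (M (Suc i)) (M i)"
    and dL_dL: "y \<in> carrier (L (Suc (Suc i))) \<Longrightarrow> dL i (dL (Suc i) y) = \<zero>\<^bsub>L i\<^esub>"
    and dM_dM: "x \<in> carrier (M (Suc (Suc i))) \<Longrightarrow> dM i (dM (Suc i) x) = \<zero>\<^bsub>M i\<^esub>"
    and L_basis: "has_dual_basis TYPE(nat) R (L i)" and M_basis: "has_dual_basis TYPE(nat) R (M i)"
    and \<psi>_hom: "\<psi> i \<in> module_hom R (L i) (M i)"
    and \<psi>_comm: "y \<in> carrier (L (Suc i)) \<Longrightarrow> \<psi> i (dL i y) = dM i (\<psi> (Suc i) y)"
    and L_exact: "i < r \<Longrightarrow> dual_exact_at R L dL {\<zero>} i"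
    and M_exact: "i \<le> r \<Longrightarrow> dual_exact_at R M dM {\<zero>} i"
    and M_length: "carrier (M (Suc (Suc r))) = {\<zero>\<^bsub>M (Suc (Suc r))\<^esub>}"
    and v: "v \<in> carrier (L 0)"
    and L_generated: "y \<in> carrier (L 0) \<Longrightarrow> \<exists>a\<in>carrier R. y = a \<odot>\<^bsub>L 0\<^esub> v"
    and M_generated: "x \<in> carrier (M 0) \<Longrightarrow> \<exists>a\<in>carrier R. x = a \<odot>\<^bsub>M 0\<^esub> \<psi> 0 v"
    and M_free: "a \<in> carrier R \<Longrightarrow> a \<odot>\<^bsub>M 0\<^esub> \<psi> 0 v = \<zero>\<^bsub>M 0\<^esub> \<Longrightarrow> a = \<zero>"
    and dM_image: "dM 0 ` carrier (M (Suc 0)) = (\<lambda>t. t \<odot>\<^bsub>M 0\<^esub> \<psi> 0 v) ` J"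
    and M_homotopy: "t \<in> J \<Longrightarrow> \<exists>s\<in>module_hom R (M r) (M (Suc r)).
      \<forall>x\<in>carrier (M (Suc r)). t \<odot>\<^bsub>M (Suc r)\<^esub> x = s (dM r x)"
begin

sublocale S: plain_module R "reg_module R"
  by (rule plain_module.intro[OF reg_module_module])

sublocale L: plain_module R "L i" for i
  by (rule plain_module.intro[OF L_module])

sublocale M: plain_module R "M i" for i
  by (rule plain_module.intro[OF M_module])

lemma J_carrier: "J \<subseteq> carrier R"
  by (rule idealD(1)[OF J])

lemma dL_closed: "y \<in> carrier (L (Suc i)) \<Longrightarrow> dL i y \<in> carrier (L i)"
  using module_homD(1)[OF dL_hom] .

lemma dM_closed: "x \<in> carrier (M (Suc i)) \<Longrightarrow> dM i x \<in> carrier (M i)"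
  using module_homD(1)[OF dM_hom] .

lemma \<psi>_closed: "y \<in> carrier (L i) \<Longrightarrow> \<psi> i y \<in> carrier (M i)"
  using module_homD(1)[OF \<psi>_hom] .

text \<open>Identifies M_0 with the ring along the basis vector \<open>\<psi> 0 v\<close>:
  projectivity provides a coordinate, and \<open>M_free\<close> makes it the inverse.\<close>

lemma coordinate:
  obtains c where "c \<in> module_hom R (M 0) (reg_module R)"
    "\<And>x. x \<in> carrier (M 0) \<Longrightarrow> c x \<odot>\<^bsub>M 0\<^esub> \<psi> 0 v = x"
    "\<And>a. a \<in> carrier R \<Longrightarrow> c (a \<odot>\<^bsub>M 0\<^esub> \<psi> 0 v) = a"
proof -
  have u: "\<psi> 0 v \<in> carrier (M 0)" by (rule \<psi>_closed[OF v])
  have mu: "(\<lambda>a. a \<odot>\<^bsub>M 0\<^esub> \<psi> 0 v) \<in> module_hom R (reg_module R) (M 0)"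
    using u by (intro module_homI) (auto simp: M.smult_l_distr M.smult_assoc1)
  have "\<exists>c\<in>module_hom R (M 0) (reg_module R). \<forall>x\<in>carrier (M 0). c x \<odot>\<^bsub>M 0\<^esub> \<psi> 0 v = x"
    by (rule lift_through[OF M_module S.module_axioms M_module M_basis module_hom_id mu])
      (use M_generated in auto)
  then obtain c where c: "c \<in> module_hom R (M 0) (reg_module R)"
    "\<And>x. x \<in> carrier (M 0) \<Longrightarrow> c x \<odot>\<^bsub>M 0\<^esub> \<psi> 0 v = x" by blast
  have "c (a \<odot>\<^bsub>M 0\<^esub> \<psi> 0 v) = a" if a: "a \<in> carrier R" for a
  proof -
    let ?b = "c (a \<odot>\<^bsub>M 0\<^esub> \<psi> 0 v)"
    have b: "?b \<in> carrier R" using module_homD(1)[OF c(1)] a u by simp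
    have "(?b \<ominus> a) \<odot>\<^bsub>M 0\<^esub> \<psi> 0 v = \<zero>\<^bsub>M 0\<^esub>"
      using c(2)[of "a \<odot>\<^bsub>M 0\<^esub> \<psi> 0 v"] a b u
      by (simp add: a_minus_def M.smult_l_distr M.smult_l_minus M.M.r_neg)
    then have "?b \<ominus> a = \<zero>" using M_free a b by simp
    then show ?thesis using module_hom_eqI_diff[OF S.module_axioms, of ?b a] a b by simp
  qed
  then show ?thesis using that c by blast
qed

text \<open>A chain map between the shifted resolution \<open>M\<close> and \<open>L\<^sup>*\<close>, given as bilinear forms on
  \<open>M\<^sub>i\<^sub>+\<^sub>1 \<times> L\<^sub>k\<close> with \<open>i + k = r\<close>, is homotopic to one that factors through \<open>M\<^sup>* \<rightarrow> L\<^sup>*\<close>. At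
  \<open>k = 0\<close> this holds because \<open>\<psi>\<^sub>0\<close> is an isomorphism, and the extension \<open>B'\<close> exists there because
  \<open>J\<close> annihilates the cokernel of \<open>M\<^sub>r\<^sup>* \<rightarrow> M\<^sub>r\<^sub>+\<^sub>1\<^sup>*\<close>.\<close>

lemma factor_through_dual:
  assumes "i + k = r" "bilinear_form R (M (Suc i)) (L k) \<beta>"
    and "form_boundary R (M (Suc (Suc i))) L dL k (\<lambda>x. \<beta> (dM (Suc i) x))"
  shows "\<exists>B B' \<Lambda>. bilinear_form R (M (Suc i)) (M k) B \<and>
    form_boundary R (M (Suc (Suc i))) M dM k (\<lambda>x. B (dM (Suc i) x)) \<and>
    bilinear_form R (M i) (M (Suc k)) B' \<and>
    (\<forall>x\<in>carrier (M (Suc i)). \<forall>z\<in>carrier (M (Suc k)). B x (dM k z) = B' (dM i x) z) \<and>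
    bilinear_form R (M i) (L k) \<Lambda> \<and>
    form_boundary R (M (Suc i)) L dL k (\<lambda>x y. \<beta> x y \<ominus> B x (\<psi> k y) \<ominus> \<Lambda> (dM i x) y)"
  using assms
proof (induction k arbitrary: i \<beta>)
  case (0 i \<beta>)
  have i: "i = r" using 0 by simp
  note \<beta> = "0.prems"(2)[unfolded i]
  obtain c where c: "c \<in> module_hom R (M 0) (reg_module R)"
    "\<And>x. x \<in> carrier (M 0) \<Longrightarrow> c x \<odot>\<^bsub>M 0\<^esub> \<psi> 0 v = x"
    "\<And>a. a \<in> carrier R \<Longrightarrow> c (a \<odot>\<^bsub>M 0\<^esub> \<psi> 0 v) = a" using coordinate by blast
  have cc: "c x \<in> carrier R" if "x \<in> carrier (M 0)" for x using module_homD(1)[OF c(1) that] by simp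
  \<comment> \<open>The form on M_0 that agrees with \<beta> along \<open>\<psi> 0\<close>; it is
    determined by its value \<beta>(x, v) at the basis vector.\<close>
  define B where "B x y = c y \<otimes> \<beta> x v" for x y
  have \<beta>v: "(\<lambda>x. \<beta> x v) \<in> module_hom R (M (Suc r)) (reg_module R)" by (rule bilinear_formD(2)[OF \<beta> v])
  have \<beta>vc: "\<beta> x v \<in> carrier R" if "x \<in> carrier (M (Suc r))" for x using bilinear_formD(3)[OF \<beta> that v] .
  have B: "bilinear_form R (M (Suc r)) (M 0) B"
    unfolding bilinear_form_def
  proof (intro conjI ballI)
    fix x assume x: "x \<in> carrier (M (Suc r))"
    have "(\<lambda>a. a \<otimes> \<beta> x v) \<in> module_hom R (reg_module R) (reg_module R)"
      using \<beta>vc[OF x] by (intro module_homI) (auto simp: l_distr m_assoc)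
    then show "B x \<in> module_hom R (M 0) (reg_module R)"
      unfolding B_def[abs_def] by (rule module_hom_comp[OF c(1)])
  next
    fix y assume y: "y \<in> carrier (M 0)"
    show "(\<lambda>x. B x y) \<in> module_hom R (M (Suc r)) (reg_module R)"
      using module_hom_comp[OF \<beta>v S.smult_hom[OF cc[OF y]]] by (simp add: B_def)
  qed
  have B\<psi>: "B x (\<psi> 0 y) = \<beta> x y" if x: "x \<in> carrier (M (Suc r))" and y: "y \<in> carrier (L 0)" for x y
  proof -
    obtain a where a: "a \<in> carrier R" "y = a \<odot>\<^bsub>L 0\<^esub> v" using L_generated[OF y] by blast
    have "c (\<psi> 0 y) = a" using module_homD(3)[OF \<psi>_hom a(1) v] c(3)[OF a(1)] a(2) by simp
    then show ?thesis
      using module_homD(3)[OF bilinear_formD(1)[OF \<beta> x] a(1) v] a by (simp add: B_def)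
  qed
  have bd: "form_boundary R (M (Suc (Suc r))) M dM 0 (\<lambda>x. B (dM (Suc r) x))"
  proof -
    have "dM (Suc r) x = \<zero>\<^bsub>M (Suc r)\<^esub>" if "x \<in> carrier (M (Suc (Suc r)))" for x
      using that M_length module_hom_zero[OF M_module M_module dM_hom] by simp
    then show ?thesis
      using bilinear_form_zero(2)[OF is_cring M_module M_module B] by (simp add: form_boundary_def)
  qed
  have "\<exists>B'. bilinear_form R (M 1) (M r) B' \<and>
      (\<forall>z\<in>carrier (M 1). \<forall>x\<in>carrier (M (Suc r)). B x (dM 0 z) = B' z (dM r x))"
  proof (rule bilinear_form_lift[OF is_cring M_module M_module M_module M_basis dM_hom])
    show "bilinear_form R (M 1) (M (Suc r)) (\<lambda>z x. B x (dM 0 z))"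
      using bilinear_form_comp[OF bilinear_form_swap[OF B] dM_hom module_hom_id] by simp
    fix z assume z: "z \<in> carrier (M 1)"
    then obtain t where t: "t \<in> J" "dM 0 z = t \<odot>\<^bsub>M 0\<^esub> \<psi> 0 v" using dM_image by auto
    have tc: "t \<in> carrier R" using t(1) J_carrier by blast
    obtain s where s: "s \<in> module_hom R (M r) (M (Suc r))"
      "\<And>x. x \<in> carrier (M (Suc r)) \<Longrightarrow> t \<odot>\<^bsub>M (Suc r)\<^esub> x = s (dM r x)" using M_homotopy[OF t(1)] by blast
    \<comment> \<open>Since t x = s (d x), moving the factor t inside \<beta> gives an expression
      that depends on x through d x only.\<close>
    have "B x (dM 0 z) = \<beta> (s (dM r x)) v" if x: "x \<in> carrier (M (Suc r))" for x
      using c(3)[OF tc] t(2) module_homD(3)[OF \<beta>v tc x] s(2)[OF x] by (simp add: B_def)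
    then show "\<exists>f\<in>module_hom R (M r) (reg_module R). \<forall>x\<in>carrier (M (Suc r)). B x (dM 0 z) = f (dM r x)"
      by (intro bexI[OF _ module_hom_comp[OF s(1) \<beta>v]]) simp
  qed
  then obtain B' where B': "bilinear_form R (M 1) (M r) B'"
    "\<And>z x. z \<in> carrier (M 1) \<Longrightarrow> x \<in> carrier (M (Suc r)) \<Longrightarrow> B x (dM 0 z) = B' z (dM r x)" by blast
  have zero: "bilinear_form R (M r) (L 0) (\<lambda>x y. \<zero>)"
    using module_hom_const_zero[OF M_module S.module_axioms] module_hom_const_zero[OF L_module S.module_axioms]
    by (simp add: bilinear_form_def)
  have "form_boundary R (M (Suc r)) L dL 0 (\<lambda>x y. \<beta> x y \<ominus> B x (\<psi> 0 y) \<ominus> \<zero>)"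
    using B\<psi> bilinear_formD(3)[OF \<beta>] by (simp add: form_boundary_def a_minus_def r_neg)
  then show ?case
    unfolding i using B bd bilinear_form_swap[OF B'(1)] B'(2) zero
    by (intro exI[of _ B] exI[of _ "\<lambda>x z. B' z x"] exI[of _ "\<lambda>x y. \<zero>"]) simp
next
  case (Suc k i \<beta>)
  note \<beta> = Suc.prems(2)
  \<comment> \<open>The next component of the given chain map, one step closer to k = 0; the
    induction hypothesis is applied to it.\<close>
  obtain \<gamma> where \<gamma>: "bilinear_form R (M (Suc (Suc i))) (L k) \<gamma>"
    "\<And>x y. x \<in> carrier (M (Suc (Suc i))) \<Longrightarrow> y \<in> carrier (L (Suc k)) \<Longrightarrow> \<beta> (dM (Suc i) x) y = \<gamma> x (dL k y)"
    using Suc.prems(3) by (auto simp: form_boundary_def)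
  have \<gamma>': "form_boundary R (M (Suc (Suc (Suc i)))) L dL k (\<lambda>x. \<gamma> (dM (Suc (Suc i)) x))"
  proof (rule form_boundary_exact[where F = L and d = dL, OF is_cring M_module L_module dL_hom M_basis])
    show "dual_exact_at R L dL {\<zero>} k" using Suc.prems(1) by (intro L_exact) simp
    show "bilinear_form R (M (Suc (Suc (Suc i)))) (L k) (\<lambda>x. \<gamma> (dM (Suc (Suc i)) x))"
      using bilinear_form_comp[OF \<gamma>(1) dM_hom module_hom_id] by simp
    show "\<gamma> (dM (Suc (Suc i)) x) (dL k y) = \<zero>"
      if "x \<in> carrier (M (Suc (Suc (Suc i))))" "y \<in> carrier (L (Suc k))" for x y
      using \<gamma>(2)[OF dM_closed[OF that(1)] that(2)] dM_dM[OF that(1)]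
        bilinear_form_zero(2)[OF is_cring M_module L_module \<beta> that(2)] by simp
  qed
  \<comment> \<open>The extension obtained for \<gamma>, called \<open>B'\<close> in the statement,
    is the \<open>B\<close> of the present degree; its own extension is found below from exactness
    of the dual of M.\<close>
  obtain C B \<Lambda> where C: "bilinear_form R (M (Suc (Suc i))) (M k) C"
    and B: "bilinear_form R (M (Suc i)) (M (Suc k)) B"
    and CB: "\<And>x z. x \<in> carrier (M (Suc (Suc i))) \<Longrightarrow> z \<in> carrier (M (Suc k)) \<Longrightarrow>
        C x (dM k z) = B (dM (Suc i) x) z"
    and \<Lambda>: "bilinear_form R (M (Suc i)) (L k) \<Lambda>"
    and bd: "form_boundary R (M (Suc (Suc i))) L dL k
        (\<lambda>x y. \<gamma> x y \<ominus> C x (\<psi> k y) \<ominus> \<Lambda> (dM (Suc i) x) y)"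
    using Suc.IH[OF _ \<gamma>(1) \<gamma>'] Suc.prems(1) by auto
  have ex: "dual_exact_at R M dM {\<zero>} (Suc i)" using Suc.prems(1) by (intro M_exact) simp
  have 1: "form_boundary R (M (Suc (Suc i))) M dM (Suc k) (\<lambda>x. B (dM (Suc i) x))"
    using C CB by (auto simp: form_boundary_def)
  \<comment> \<open>The arguments are exchanged: for fixed z, the form sending x to B(x, d z) is a
    cocycle of the dual of M in degree i + 1 <= r.\<close>
  have "form_boundary R (M (Suc (Suc k))) M dM (Suc i) (\<lambda>z x. B x (dM (Suc k) z))"
  proof (rule form_boundary_exact[where F = M and d = dM, OF is_cring M_module M_module dM_hom M_basis ex])
    show "bilinear_form R (M (Suc (Suc k))) (M (Suc i)) (\<lambda>z x. B x (dM (Suc k) z))"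
      using bilinear_form_comp[OF bilinear_form_swap[OF B] dM_hom module_hom_id] by simp
    show "B (dM (Suc i) x) (dM (Suc k) z) = \<zero>"
      if "z \<in> carrier (M (Suc (Suc k)))" "x \<in> carrier (M (Suc (Suc i)))" for z x
      using CB[OF that(2) dM_closed[OF that(1)]] dM_dM[OF that(1)]
        bilinear_form_zero(1)[OF is_cring M_module M_module C that(2)] by simp
  qed
  then obtain B' where B': "bilinear_form R (M (Suc (Suc k))) (M i) B'"
    "\<And>z x. z \<in> carrier (M (Suc (Suc k))) \<Longrightarrow> x \<in> carrier (M (Suc i)) \<Longrightarrow> B x (dM (Suc k) z) = B' z (dM i x)"
    by (auto simp: form_boundary_def)
  \<comment> \<open>The homotopy relation of this degree up to the term still missing. By the
    relation for \<gamma> it is a cocycle in x, so exactness of the dual of M writes it as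
    \<Lambda>'(y, d x), the missing term.\<close>
  define D where "D x y = \<beta> x y \<ominus> B x (\<psi> (Suc k) y) \<ominus> \<Lambda> x (dL k y)" for x y
  have D: "bilinear_form R (M (Suc i)) (L (Suc k)) D"
    unfolding D_def
    by (intro bilinear_form_minus is_cring M_module L_module \<beta> bilinear_form_comp[OF B module_hom_id \<psi>_hom]
        bilinear_form_comp[OF \<Lambda> module_hom_id dL_hom])
  have "form_boundary R (L (Suc k)) M dM (Suc i) (\<lambda>y x. D x y)"
  proof (rule form_boundary_exact[where F = M and d = dM, OF is_cring L_module M_module dM_hom L_basis ex
        bilinear_form_swap[OF D]])
    fix y x assume y: "y \<in> carrier (L (Suc k))" and x: "x \<in> carrier (M (Suc (Suc i)))"
    have "D (dM (Suc i) x) y = \<gamma> x (dL k y) \<ominus> C x (\<psi> k (dL k y)) \<ominus> \<Lambda> (dM (Suc i) x) (dL k y)"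
      using \<gamma>(2)[OF x y] CB[OF x \<psi>_closed[OF y]] \<psi>_comm[OF y] by (simp add: D_def)
    also have "\<dots> = \<zero>"
    proof (cases k)
      case 0
      then show ?thesis using bd x dL_closed[OF y] by (simp add: form_boundary_def)
    next
      case (Suc l)
      then obtain G where G: "bilinear_form R (M (Suc (Suc i))) (L l) G"
        "\<And>x y. x \<in> carrier (M (Suc (Suc i))) \<Longrightarrow> y \<in> carrier (L k) \<Longrightarrow>
            \<gamma> x y \<ominus> C x (\<psi> k y) \<ominus> \<Lambda> (dM (Suc i) x) y = G x (dL l y)"
        using bd by (auto simp: form_boundary_def)
      show ?thesis
        using G(2)[OF x dL_closed[OF y]] dL_dL[of y l] y Suc
          bilinear_form_zero(1)[OF is_cring M_module L_module G(1) x] by simp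
    qed
    finally show "D (dM (Suc i) x) y = \<zero>" .
  qed
  then obtain \<Lambda>' where \<Lambda>': "bilinear_form R (L (Suc k)) (M i) \<Lambda>'"
    "\<And>y x. y \<in> carrier (L (Suc k)) \<Longrightarrow> x \<in> carrier (M (Suc i)) \<Longrightarrow> D x y = \<Lambda>' y (dM i x)"
    by (auto simp: form_boundary_def)
  have "\<beta> x y \<ominus> B x (\<psi> (Suc k) y) \<ominus> \<Lambda>' y (dM i x) = \<Lambda> x (dL k y)"
    if x: "x \<in> carrier (M (Suc i))" and y: "y \<in> carrier (L (Suc k))" for x y
  proof -
    have c: "\<beta> x y \<in> carrier R" "B x (\<psi> (Suc k) y) \<in> carrier R" "\<Lambda> x (dL k y) \<in> carrier R"
      using bilinear_formD(3)[OF \<beta> x y] bilinear_formD(3)[OF B x \<psi>_closed[OF y]]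
        bilinear_formD(3)[OF \<Lambda> x dL_closed[OF y]] by auto
    have "\<beta> x y \<ominus> B x (\<psi> (Suc k) y) \<ominus> D x y = \<Lambda> x (dL k y)"
      unfolding D_def using c by algebra
    then show ?thesis using \<Lambda>'(2)[OF y x] by simp
  qed
  then have "form_boundary R (M (Suc i)) L dL (Suc k)
      (\<lambda>x y. \<beta> x y \<ominus> B x (\<psi> (Suc k) y) \<ominus> \<Lambda>' y (dM i x))"
    using \<Lambda> by (auto simp: form_boundary_def)
  then show ?case
    using B 1 bilinear_form_swap[OF B'(1)] B'(2) bilinear_form_swap[OF \<Lambda>'(1)]
    by (intro exI[of _ B] exI[of _ "\<lambda>x z. B' z x"] exI[of _ "\<lambda>x y. \<Lambda>' y x"]) simp
qed

end

section \<open>The generators\<close>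

lemma dual_boundaries_0: "dual_boundaries R F d 0 = {\<zero>\<^bsub>dual R (F 0)\<^esub>}"
  by (simp add: dual_boundaries_def)

lemma dual_boundaries_Suc:
  "dual_boundaries R F d (Suc j) = dual_map (F (Suc j)) (d j) ` carrier (dual R (F j))"
  by (simp add: dual_boundaries_def)

lemma submodule_dual_boundaries:
  assumes cr: "cring R" and F: "\<And>i. module R (F i)" and d: "\<And>i. d i \<in> module_hom R (F (Suc i)) (F i)"
  shows "submodule (dual_boundaries R F d i) R (dual R (F i))"
proof -
  interpret D: plain_module R "dual R (F k)" for k
    by (rule plain_module.intro[OF dual_module[OF cr F]])
  show ?thesis
  proof (induction i)
    case 0
    have "submodule {\<zero>\<^bsub>dual R (F 0)\<^esub>} R (dual R (F 0))" by (rule D.submoduleI_smult) auto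
    then show ?case unfolding dual_boundaries_0 .
  next
    case (Suc j)
    show ?case
      unfolding dual_boundaries_Suc
      by (rule submodule_hom_image[OF D.module_axioms D.module_axioms dual_map_hom[OF F d] D.carrier_is_submodule])
  qed
qed

text \<open>Membership in the boundaries is a condition on each x alone; the dual basis of
  \<open>N\<close> assembles the chosen preimages into one form.\<close>

lemma form_boundary_iff:
  fixes B :: "'b \<Rightarrow> 'c \<Rightarrow> 'a"
  assumes cr: "cring R" and N: "module R N" and F: "\<And>i. module R (F i)"
    and d: "\<And>i. d i \<in> module_hom R (F (Suc i)) (F i)"
    and db: "has_dual_basis TYPE('i) R N" and B: "bilinear_form R N (F i) B"
  shows "form_boundary R N F d i B \<longleftrightarrow>
    (\<forall>x\<in>carrier N. restrict (B x) (carrier (F i)) \<in> dual_boundaries R F d i)"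
proof (cases i)
  case 0
  have "(\<lambda>y\<in>carrier (F 0). B x y) = (\<lambda>y\<in>carrier (F 0). \<zero>\<^bsub>R\<^esub>) \<longleftrightarrow> (\<forall>y\<in>carrier (F 0). B x y = \<zero>\<^bsub>R\<^esub>)" for x
    by (auto simp: fun_eq_iff restrict_def)
  then show ?thesis by (simp add: 0 form_boundary_def dual_boundaries_0 dual_simps)
next
  case (Suc j)
  show ?thesis
  proof
    assume "form_boundary R N F d i B"
    then obtain B' where B': "bilinear_form R N (F j) B'"
      "\<And>x y. x \<in> carrier N \<Longrightarrow> y \<in> carrier (F (Suc j)) \<Longrightarrow> B x y = B' x (d j y)"
      using Suc by (auto simp: form_boundary_def)
    show "\<forall>x\<in>carrier N. restrict (B x) (carrier (F i)) \<in> dual_boundaries R F d i"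
    proof
      fix x assume x: "x \<in> carrier N"
      have "restrict (B x) (carrier (F i)) = dual_map (F (Suc j)) (d j) (restrict (B' x) (carrier (F j)))"
        using B'(2)[OF x] module_homD(1)[OF d] Suc by (auto simp: dual_map_def)
      then show "restrict (B x) (carrier (F i)) \<in> dual_boundaries R F d i"
        unfolding Suc dual_boundaries_Suc using dual_restrict[OF F bilinear_formD(1)[OF B'(1) x]] by blast
    qed
  next
    assume *: "\<forall>x\<in>carrier N. restrict (B x) (carrier (F i)) \<in> dual_boundaries R F d i"
    have "\<exists>B'. bilinear_form R N (F j) B' \<and> (\<forall>x\<in>carrier N. \<forall>y\<in>carrier (F (Suc j)). B x y = B' x (d j y))"
    proof (rule bilinear_form_lift[OF cr N F F db d])
      show "bilinear_form R N (F (Suc j)) B" using B Suc by simp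
      fix x assume "x \<in> carrier N"
      then obtain h where h: "h \<in> carrier (dual R (F j))"
        "restrict (B x) (carrier (F (Suc j))) = dual_map (F (Suc j)) (d j) h"
        using * unfolding Suc dual_boundaries_Suc by blast
      have "B x y = h (d j y)" if "y \<in> carrier (F (Suc j))" for y
        using fun_cong[OF h(2), of y] that by (simp add: dual_map_def)
      then show "\<exists>f\<in>module_hom R (F j) (reg_module R). \<forall>y\<in>carrier (F (Suc j)). B x y = f (d j y)"
        using h(1) by (auto simp: dual_simps)
    qed
    then show "form_boundary R N F d i B" by (simp add: Suc form_boundary_def)
  qed
qed

lemma ideal_module_simps [simp]:
  "carrier (ideal_module R J) = J"
  "add (ideal_module R J) = add R"
  "smult (ideal_module R J) = monoid.mult R"
  "ring.zero (ideal_module R J) = \<zero>\<^bsub>R\<^esub>"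
  by (simp_all add: ideal_module_def)

lemma (in cring) ideal_module_module: "ideal J R \<Longrightarrow> module R (ideal_module R J)"
  unfolding ideal_module_def
  by (rule submodule.submodule_is_module[OF submodule_ideal reg_module_module])

section \<open>The canonical module of S/I and the map induced on T\<close>

locale linked_resolutions_dual = linked_resolutions R J L dL M dM \<psi> r v
  for R :: "('a, 'm) ring_scheme" (structure) and J :: "'a set"
    and L :: "nat \<Rightarrow> ('a, 'b) module" and dL :: "nat \<Rightarrow> 'b \<Rightarrow> 'b"
    and M :: "nat \<Rightarrow> ('a, 'c) module" and dM :: "nat \<Rightarrow> 'c \<Rightarrow> 'c"
    and \<psi> :: "nat \<Rightarrow> 'b \<Rightarrow> 'c" and r :: nat and v :: 'b +
  fixes l :: nat and \<tau> :: "('c \<Rightarrow> 'a) \<Rightarrow> (nat \<Rightarrow> 'a)"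
  assumes \<tau>: "\<tau> \<in> module_iso R (dual R (M (Suc r))) (std_free_module R l)"
begin

sublocale DL: plain_module R "dual R (L i)" for i
  by (rule plain_module.intro[OF dual_module[OF is_cring L_module]])

sublocale DM: plain_module R "dual R (M i)" for i
  by (rule plain_module.intro[OF dual_module[OF is_cring M_module]])

sublocale SF: plain_module R "std_free_module R l"
  by (rule plain_module.intro[OF std_free_module_module])

lemma submodule_boundaries_L: "submodule (dual_boundaries R L dL i) R (dual R (L i))"
  by (rule submodule_dual_boundaries[where F = L and d = dL, OF is_cring L_module dL_hom])

lemma submodule_boundaries_M: "submodule (dual_boundaries R M dM i) R (dual R (M i))"
  by (rule submodule_dual_boundaries[where F = M and d = dM, OF is_cring M_module dM_hom])

definition \<omega> :: "('a, ('b \<Rightarrow> 'a) set) module" where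
  "\<omega> = omega R L dL r"

abbreviation \<pi> :: "('b \<Rightarrow> 'a) \<Rightarrow> ('b \<Rightarrow> 'a) set" where
  "\<pi> \<equiv> omega_proj R L dL r"

sublocale \<omega>: plain_module R \<omega>
  unfolding \<omega>_def omega_def by (rule plain_module.intro[OF DL.quot_module_module[OF submodule_boundaries_L]])

lemma \<pi>_hom: "\<pi> \<in> module_hom R (dual R (L r)) \<omega>"
  unfolding \<omega>_def omega_def omega_proj_def[abs_def]
  by (rule DL.quot_module_proj_hom[OF submodule_boundaries_L])

lemma \<pi>_surj: "\<pi> ` carrier (dual R (L r)) = carrier \<omega>"
  unfolding \<omega>_def omega_def omega_proj_def[abs_def] DL.quot_module_carrier ..

lemma \<pi>_zero_iff: "f \<in> carrier (dual R (L r)) \<Longrightarrow> \<pi> f = \<zero>\<^bsub>\<omega>\<^esub> \<longleftrightarrow> f \<in> dual_boundaries R L dL r"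
  unfolding \<omega>_def omega_def omega_proj_def by (rule DL.coset_zero_iff[OF submodule_boundaries_L])

abbreviation transposed :: "('c \<Rightarrow> 'a) \<Rightarrow> ('c \<Rightarrow> 'a)" where
  "transposed \<equiv> dual_map (M (Suc r)) (dM r)"

abbreviation \<Psi> :: "(nat \<Rightarrow> 'a) \<Rightarrow> ('b \<Rightarrow> 'a) set" where
  "\<Psi> \<equiv> psi_star R L dL M dM \<psi> r \<tau>"

abbreviation T :: "(nat \<Rightarrow> 'a) set" where
  "T \<equiv> T_module R M dM r \<tau>"

lemma transposed_hom: "transposed \<in> module_hom R (dual R (M r)) (dual R (M (Suc r)))"
  by (rule dual_map_hom[OF M_module dM_hom])

lemma \<psi>_dual_hom: "dual_map (L r) (\<psi> r) \<in> module_hom R (dual R (M r)) (dual R (L r))"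
  by (rule dual_map_hom[OF L_module \<psi>_hom])

lemma \<tau>_hom: "\<tau> \<in> module_hom R (dual R (M (Suc r))) (std_free_module R l)"
  using \<tau> by (simp add: module_iso_def)

lemma \<tau>_transposed_hom: "(\<lambda>g. \<tau> (transposed g)) \<in> module_hom R (dual R (M r)) (std_free_module R l)"
  by (rule module_hom_comp[OF transposed_hom \<tau>_hom])

lemma T_eq: "T = (\<lambda>g. \<tau> (transposed g)) ` carrier (dual R (M r))"
proof -
  have "{f \<in> carrier (dual R (M (Suc r))). omega_proj R M dM (Suc r) f = \<zero>\<^bsub>omega R M dM (Suc r)\<^esub>} =
      dual_boundaries R M dM (Suc r)"
    unfolding omega_def omega_proj_def
    using DM.coset_zero_iff[OF submodule_boundaries_M, of _ "Suc r"]
      DM.submoduleD(1)[OF submodule_boundaries_M[of "Suc r"]] by auto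
  then show ?thesis unfolding T_module_def dual_boundaries_Suc by (simp add: image_image)
qed

text \<open>\<open>g\<close> is a cocycle in degree r, where the dual of M is exact, so it is a
  boundary; the transpose of \<psi> carries boundaries to boundaries.\<close>

lemma transposed_kernel:
  assumes g: "g \<in> carrier (dual R (M r))" and 0: "transposed g = \<zero>\<^bsub>dual R (M (Suc r))\<^esub>"
  shows "dual_map (L r) (\<psi> r) g \<in> dual_boundaries R L dL r"
proof -
  have g': "g \<in> module_hom R (M r) (reg_module R)" using g by (simp add: dual_simps)
  have coc: "g (dM r x) = \<zero>" if "x \<in> carrier (M (Suc r))" for x
    using fun_cong[OF 0, of x] that by (simp add: dual_map_def dual_simps)
  show ?thesis
  proof (cases r)
    case 0
    have "g x = \<zero>" if "x \<in> carrier (M 0)" for x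
      using M_exact[of 0] g' coc that 0 by (auto simp: dual_exact_at_def)
    then show ?thesis
      using \<psi>_closed[of _ 0] unfolding 0 dual_boundaries_0 by (auto simp: dual_map_def dual_simps)
  next
    case (Suc j)
    obtain h where h: "h \<in> module_hom R (M j) (reg_module R)"
      "\<And>x. x \<in> carrier (M (Suc j)) \<Longrightarrow> g x \<ominus> h (dM j x) = \<zero>"
      using M_exact[of r] g' coc unfolding Suc by (auto simp: dual_exact_at_def)
    have gh: "g x = h (dM j x)" if x: "x \<in> carrier (M (Suc j))" for x
      using module_hom_eqI_diff[OF S.module_axioms, of "g x" "h (dM j x)"] h(2)[OF x]
        module_homD(1)[OF g'[unfolded Suc] x] module_homD(1)[OF h(1) dM_closed[OF x]] x by simp
    have h': "restrict (\<lambda>y. h (\<psi> j y)) (carrier (L j)) \<in> carrier (dual R (L j))"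
      by (rule dual_restrict[OF L_module module_hom_comp[OF \<psi>_hom h(1)]])
    have "dual_map (L r) (\<psi> r) g = dual_map (L (Suc j)) (dL j) (restrict (\<lambda>y. h (\<psi> j y)) (carrier (L j)))"
      using gh \<psi>_closed[of _ "Suc j"] \<psi>_comm[of _ j] dL_closed[of _ j]
      unfolding Suc by (auto simp: dual_map_def)
    then show ?thesis unfolding Suc dual_boundaries_Suc using h' by blast
  qed
qed

text \<open>Resolves the definite description: \<tau> is injective, so two choices of
  \<open>g\<close> differ by an element of the kernel of the transpose, whose class in \<omega> is
  zero.\<close>

lemma \<Psi>_eq:
  assumes g: "g \<in> carrier (dual R (M r))"
  shows "\<Psi> (\<tau> (transposed g)) = \<pi> (dual_map (L r) (\<psi> r) g)"
proof -
  have T: "\<tau> (transposed g) \<in> T" unfolding T_eq using g by blast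
  have wd: "\<pi> (dual_map (L r) (\<psi> r) g') = \<pi> (dual_map (L r) (\<psi> r) g)"
    if g': "g' \<in> carrier (dual R (M r))" and eq: "\<tau> (transposed g) = \<tau> (transposed g')" for g'
  proof -
    have "transposed g' = transposed g"
      using \<tau> eq module_homD(1)[OF transposed_hom] g g'
      by (auto simp: module_iso_def bij_betw_def dest: inj_onD)
    then have "transposed (g' \<ominus>\<^bsub>dual R (M r)\<^esub> g) = \<zero>\<^bsub>dual R (M (Suc r))\<^esub>"
      using module_hom_minus[OF DM.module_axioms DM.module_axioms transposed_hom g' g]
        module_homD(1)[OF transposed_hom g] by (simp add: a_minus_def DM.M.r_neg)
    then have "\<pi> (dual_map (L r) (\<psi> r) (g' \<ominus>\<^bsub>dual R (M r)\<^esub> g)) = \<zero>\<^bsub>\<omega>\<^esub>"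
      using \<pi>_zero_iff module_homD(1)[OF \<psi>_dual_hom] transposed_kernel g g' by simp
    then have "\<pi> (dual_map (L r) (\<psi> r) g') \<ominus>\<^bsub>\<omega>\<^esub> \<pi> (dual_map (L r) (\<psi> r) g) = \<zero>\<^bsub>\<omega>\<^esub>"
      using module_hom_minus[OF DM.module_axioms \<omega>.module_axioms module_hom_comp[OF \<psi>_dual_hom \<pi>_hom] g' g]
      by simp
    then show ?thesis
      by (rule module_hom_eqI_diff[OF \<omega>.module_axioms, rotated 2])
        (use g g' module_homD(1)[OF module_hom_comp[OF \<psi>_dual_hom \<pi>_hom]] in auto)
  qed
  have "(THE w. \<exists>g'\<in>carrier (dual R (M r)). \<tau> (transposed g) = \<tau> (transposed g') \<and>
      w = \<pi> (dual_map (L r) (\<psi> r) g')) = \<pi> (dual_map (L r) (\<psi> r) g)"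
  proof (rule the_equality)
    fix w assume "\<exists>g'\<in>carrier (dual R (M r)). \<tau> (transposed g) = \<tau> (transposed g') \<and>
      w = \<pi> (dual_map (L r) (\<psi> r) g')"
    then obtain g' where "g' \<in> carrier (dual R (M r))" "\<tau> (transposed g) = \<tau> (transposed g')"
      "w = \<pi> (dual_map (L r) (\<psi> r) g')" by blast
    then show "w = \<pi> (dual_map (L r) (\<psi> r) g)" using wd by simp
  qed (use g in blast)
  then show ?thesis using T by (simp add: psi_star_def)
qed

lemma \<Psi>_hom: "\<Psi> \<in> module_hom R ((std_free_module R l)\<lparr>carrier := T\<rparr>) \<omega>"
proof (rule module_homI)
  note comp = module_hom_comp[OF \<psi>_dual_hom \<pi>_hom]
  fix u assume "u \<in> carrier ((std_free_module R l)\<lparr>carrier := T\<rparr>)"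
  then obtain g where g: "g \<in> carrier (dual R (M r))" "u = \<tau> (transposed g)" by (auto simp: T_eq)
  show "\<Psi> u \<in> carrier \<omega>" unfolding g(2) \<Psi>_eq[OF g(1)] using module_homD(1)[OF comp g(1)] .
  show "\<Psi> (a \<odot>\<^bsub>(std_free_module R l)\<lparr>carrier := T\<rparr>\<^esub> u) = a \<odot>\<^bsub>\<omega>\<^esub> \<Psi> u" if a: "a \<in> carrier R" for a
    using \<Psi>_eq[of "a \<odot>\<^bsub>dual R (M r)\<^esub> g"] \<Psi>_eq[OF g(1)] module_homD(3)[OF \<tau>_transposed_hom a g(1)]
      module_homD(3)[OF comp a g(1)] a g by simp
  fix u' assume "u' \<in> carrier ((std_free_module R l)\<lparr>carrier := T\<rparr>)"
  then obtain g' where g': "g' \<in> carrier (dual R (M r))" "u' = \<tau> (transposed g')" by (auto simp: T_eq)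
  show "\<Psi> (u \<oplus>\<^bsub>(std_free_module R l)\<lparr>carrier := T\<rparr>\<^esub> u') = \<Psi> u \<oplus>\<^bsub>\<omega>\<^esub> \<Psi> u'"
    using \<Psi>_eq[of "g \<oplus>\<^bsub>dual R (M r)\<^esub> g'"] \<Psi>_eq[OF g(1)] \<Psi>_eq[OF g'(1)]
      module_homD(2)[OF \<tau>_transposed_hom g(1) g'(1)] module_homD(2)[OF comp g(1) g'(1)] g g' by simp
qed

text \<open>J annihilates S^l / T: for f in the dual of M_(r+1) the homotopy \<open>s\<close> gives
  t f = (f s) d, an element of the image of the transpose. In particular the maps s_i take values in
  T.\<close>

lemma smult_in_T:
  assumes t: "t \<in> J" and w: "w \<in> carrier (std_free_module R l)"
  shows "t \<odot>\<^bsub>std_free_module R l\<^esub> w \<in> T"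
proof -
  have tc: "t \<in> carrier R" using t J_carrier by blast
  have "w \<in> \<tau> ` carrier (dual R (M (Suc r)))" using \<tau> w by (simp add: module_iso_def bij_betw_def)
  then obtain f where f: "f \<in> carrier (dual R (M (Suc r)))" "w = \<tau> f" by blast
  have f': "f \<in> module_hom R (M (Suc r)) (reg_module R)" using f(1) by (simp add: dual_simps)
  obtain s where s: "s \<in> module_hom R (M r) (M (Suc r))"
    "\<And>x. x \<in> carrier (M (Suc r)) \<Longrightarrow> t \<odot>\<^bsub>M (Suc r)\<^esub> x = s (dM r x)" using M_homotopy[OF t] by blast
  define g where "g = restrict (\<lambda>x. f (s x)) (carrier (M r))"
  have g: "g \<in> carrier (dual R (M r))"
    unfolding g_def by (rule dual_restrict[OF M_module module_hom_comp[OF s(1) f']])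
  have "transposed g = t \<odot>\<^bsub>dual R (M (Suc r))\<^esub> f"
    using s(2) dM_closed[of _ r] module_homD(3)[OF f' tc]
    by (auto simp: g_def dual_map_def dual_simps fun_eq_iff)
  then have "t \<odot>\<^bsub>std_free_module R l\<^esub> w = \<tau> (transposed g)"
    using module_homD(3)[OF \<tau>_hom tc f(1)] f(2) by simp
  then show ?thesis unfolding T_eq using g by blast
qed

section \<open>The module Hom(J, \<omega>) and its generators\<close>

definition H :: "('a, 'a \<Rightarrow> ('b \<Rightarrow> 'a) set) module" where
  "H = hom_module R (ideal_module R J) \<omega>"

sublocale H: plain_module R H
  unfolding H_def
  by (rule plain_module.intro[OF hom_module_module[OF ideal_module_module[OF J] \<omega>.module_axioms]])

lemma H_simps:
  "carrier H = module_hom R (ideal_module R J) \<omega> \<inter> extensional J"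
  "f \<oplus>\<^bsub>H\<^esub> g = (\<lambda>t\<in>J. f t \<oplus>\<^bsub>\<omega>\<^esub> g t)"
  "a \<odot>\<^bsub>H\<^esub> f = (\<lambda>t\<in>J. a \<odot>\<^bsub>\<omega>\<^esub> f t)"
  by (simp_all add: H_def hom_module_simps)

text \<open>The linear extension of \<open>e\<^sub>i \<mapsto> k\<^sub>i\<close>.\<close>

definition \<kappa> :: "(nat \<Rightarrow> 'a) \<Rightarrow> 'a \<Rightarrow> ('b \<Rightarrow> 'a) set" where
  "\<kappa> w = (\<lambda>t\<in>J. \<Psi> (t \<odot>\<^bsub>std_free_module R l\<^esub> w))"

lemma \<kappa>_hom: "\<kappa> \<in> module_hom R (std_free_module R l) H"
proof (rule module_homI)
  let ?S = "std_free_module R l"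
  note \<Psi> = module_homD[OF \<Psi>_hom, simplified]
  fix w assume w: "w \<in> carrier ?S"
  have mult: "\<Psi> (a \<odot>\<^bsub>?S\<^esub> (t \<odot>\<^bsub>?S\<^esub> w)) = a \<odot>\<^bsub>\<omega>\<^esub> \<Psi> (t \<odot>\<^bsub>?S\<^esub> w)" if "a \<in> carrier R" "t \<in> J" for a t
    by (rule \<Psi>(3)[OF that(1) smult_in_T[OF that(2) w]])
  have Jc: "t \<in> carrier R" if "t \<in> J" for t using that J_carrier by blast
  have "\<kappa> w \<in> module_hom R (ideal_module R J) \<omega>"
  proof (rule module_homI, unfold ideal_module_simps)
    fix t assume t: "t \<in> J"
    show "\<kappa> w t \<in> carrier \<omega>" using \<Psi>(1)[OF smult_in_T[OF t w]] t by (simp add: \<kappa>_def)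
    show "\<kappa> w (a \<otimes> t) = a \<odot>\<^bsub>\<omega>\<^esub> \<kappa> w t" if a: "a \<in> carrier R" for a
      using mult[OF a t] idealD(6)[OF J t a] t SF.smult_assoc1[OF a Jc[OF t] w] by (simp add: \<kappa>_def)
    show "\<kappa> w (t \<oplus> t') = \<kappa> w t \<oplus>\<^bsub>\<omega>\<^esub> \<kappa> w t'" if t': "t' \<in> J" for t'
      using \<Psi>(2)[OF smult_in_T[OF t w] smult_in_T[OF t' w]] idealD(3)[OF J t t'] t t'
        SF.smult_l_distr[OF Jc[OF t] Jc[OF t'] w] by (simp add: \<kappa>_def)
  qed
  then show "\<kappa> w \<in> carrier H" by (simp add: H_simps \<kappa>_def)
  show "\<kappa> (a \<odot>\<^bsub>?S\<^esub> w) = a \<odot>\<^bsub>H\<^esub> \<kappa> w" if a: "a \<in> carrier R" for a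
    using mult[OF a] SF.smult_lcomm[OF a Jc w] by (auto simp: H_simps \<kappa>_def intro!: restrict_ext)
  show "\<kappa> (w \<oplus>\<^bsub>?S\<^esub> w') = \<kappa> w \<oplus>\<^bsub>H\<^esub> \<kappa> w'" if w': "w' \<in> carrier ?S" for w'
    using \<Psi>(2)[OF smult_in_T[OF _ w] smult_in_T[OF _ w']] SF.smult_r_distr[OF Jc w w']
    by (auto simp: H_simps \<kappa>_def intro!: restrict_ext)
qed

lemma unit_vector_closed: "unit_vector R l i \<in> carrier (std_free_module R l)"
  by (auto simp: std_free_simps unit_vector_def)

lemma k_map_eq: "i < l \<Longrightarrow> k_map R J L dL M dM \<psi> r \<tau> l i = \<kappa> (unit_vector R l i)"
proof -
  assume i: "i < l"
  have "s_map R l i t = t \<odot>\<^bsub>std_free_module R l\<^esub> unit_vector R l i" if "t \<in> J" for t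
    using that J_carrier by (auto simp: s_map_def std_free_simps unit_vector_def fun_eq_iff)
  then show ?thesis unfolding k_map_def \<kappa>_def by (intro restrict_ext) simp
qed

lemma a_map_closed: "x \<in> carrier \<omega> \<Longrightarrow> a_map J \<omega> x \<in> carrier H"
proof -
  assume x: "x \<in> carrier \<omega>"
  have "a_map J \<omega> x \<in> module_hom R (ideal_module R J) \<omega>"
    using x J_carrier idealD(3,6)[OF J]
    by (intro module_homI) (auto simp: a_map_def \<omega>.smult_l_distr \<omega>.smult_assoc1 subset_iff)
  then show ?thesis by (simp add: H_simps a_map_def)
qed

lemma decomposition:
  assumes \<phi>: "\<phi> \<in> carrier H"
  shows "\<exists>w\<in>carrier (std_free_module R l). \<exists>x\<in>carrier \<omega>. \<phi> = \<kappa> w \<oplus>\<^bsub>H\<^esub> a_map J \<omega> x"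
proof -
  let ?u = "\<psi> 0 v"
  have u: "?u \<in> carrier (M 0)" by (rule \<psi>_closed[OF v])
  have \<phi>': "\<phi> \<in> module_hom R (ideal_module R J) \<omega>" "\<phi> \<in> extensional J" using \<phi> by (auto simp: H_simps)
  note \<phi>D = module_homD[OF \<phi>'(1), simplified]
  obtain c where c: "c \<in> module_hom R (M 0) (reg_module R)"
    "\<And>x. x \<in> carrier (M 0) \<Longrightarrow> c x \<odot>\<^bsub>M 0\<^esub> ?u = x"
    "\<And>a. a \<in> carrier R \<Longrightarrow> c (a \<odot>\<^bsub>M 0\<^esub> ?u) = a" using coordinate by blast
  have Jc: "t \<in> carrier R" if "t \<in> J" for t using that J_carrier by blast
  \<comment> \<open>The surjection of M_1 onto \<open>J\<close> that the differential becomes once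
    M_0 is identified with the ring.\<close>
  define p where "p x = c (dM 0 x)" for x
  have p: "p \<in> module_hom R (M (Suc 0)) (reg_module R)"
    unfolding p_def by (rule module_hom_comp[OF dM_hom c(1)])
  have pJ: "p x \<in> J" if "x \<in> carrier (M (Suc 0))" for x
  proof -
    have "dM 0 x \<in> (\<lambda>t. t \<odot>\<^bsub>M 0\<^esub> ?u) ` J" unfolding dM_image[symmetric] using that by blast
    then show ?thesis using c(3) Jc by (auto simp: p_def)
  qed
  have f: "(\<lambda>x. \<phi> (p x)) \<in> module_hom R (M (Suc 0)) \<omega>"
    using \<phi>D pJ module_homD[OF p] by (intro module_homI) auto
  have "\<phi> (p x) \<in> \<pi> ` carrier (dual R (L r))" if "x \<in> carrier (M (Suc 0))" for x
    unfolding \<pi>_surj using module_homD(1)[OF f that] .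
  \<comment> \<open>The first component of the chain map over \<phi>. The boundary condition
    \<open>bd\<close> shown next expresses that \<phi> p d is zero.\<close>
  then obtain \<beta> where \<beta>: "\<beta> \<in> module_hom R (M (Suc 0)) (dual R (L r))"
    "\<And>x. x \<in> carrier (M (Suc 0)) \<Longrightarrow> \<pi> (\<beta> x) = \<phi> (p x)"
    using lift_through[OF M_module DL.module_axioms \<omega>.module_axioms M_basis f \<pi>_hom] by blast
  have bil: "bilinear_form R (M (Suc 0)) (L r) \<beta>" by (rule bilinear_form_of_hom[OF \<beta>(1)])
  have \<beta>c: "\<beta> x \<in> carrier (dual R (L r))" if "x \<in> carrier (M (Suc 0))" for x
    using module_homD(1)[OF \<beta>(1) that] .
  have \<beta>r: "restrict (\<beta> x) (carrier (L r)) = \<beta> x" if "x \<in> carrier (M (Suc 0))" for x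
    using \<beta>c[OF that] by (auto simp: dual_simps extensional_restrict)
  have bd: "form_boundary R (M (Suc (Suc 0))) L dL r (\<lambda>x. \<beta> (dM (Suc 0) x))"
  proof (subst form_boundary_iff[where F = L and d = dL, OF is_cring M_module L_module dL_hom M_basis])
    show "bilinear_form R (M (Suc (Suc 0))) (L r) (\<lambda>x. \<beta> (dM (Suc 0) x))"
      using bilinear_form_comp[OF bil dM_hom module_hom_id] by simp
    show "\<forall>x\<in>carrier (M (Suc (Suc 0))). restrict (\<beta> (dM (Suc 0) x)) (carrier (L r)) \<in> dual_boundaries R L dL r"
    proof
      fix x assume x: "x \<in> carrier (M (Suc (Suc 0)))"
      have "p (dM (Suc 0) x) = \<zero>"
        unfolding p_def dM_dM[OF x] using module_hom_zero[OF M_module S.module_axioms c(1)] by simp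
      then have "\<phi> (p (dM (Suc 0) x)) = \<zero>\<^bsub>\<omega>\<^esub>"
        using module_hom_zero[OF ideal_module_module[OF J] \<omega>.module_axioms \<phi>'(1)] by simp
      then show "restrict (\<beta> (dM (Suc 0) x)) (carrier (L r)) \<in> dual_boundaries R L dL r"
        using \<beta>(2)[OF dM_closed[OF x]] \<pi>_zero_iff[OF \<beta>c[OF dM_closed[OF x]]] \<beta>r[OF dM_closed[OF x]] by simp
    qed
  qed
  obtain B B' \<Lambda> where B: "bilinear_form R (M (Suc 0)) (M r) B" and B': "bilinear_form R (M 0) (M (Suc r)) B'"
    and BB': "\<And>x z. x \<in> carrier (M (Suc 0)) \<Longrightarrow> z \<in> carrier (M (Suc r)) \<Longrightarrow> B x (dM r z) = B' (dM 0 x) z"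
    and \<Lambda>: "bilinear_form R (M 0) (L r) \<Lambda>"
    and diff: "form_boundary R (M (Suc 0)) L dL r (\<lambda>x y. \<beta> x y \<ominus> B x (\<psi> r y) \<ominus> \<Lambda> (dM 0 x) y)"
    using factor_through_dual[of 0 r \<beta>] bil bd by auto
  \<comment> \<open>Values at the basis vector of M_0: if d x is t times that vector, then B'(d x,
    -) = t C and \<Lambda>(d x, -) = t W. So \<open>C\<close> yields the combination of the k_i and
    \<open>W\<close> the element of \<omega>.\<close>
  define C where "C = restrict (B' ?u) (carrier (M (Suc r)))"
  define W where "W = restrict (\<Lambda> ?u) (carrier (L r))"
  have C: "C \<in> carrier (dual R (M (Suc r)))"
    unfolding C_def by (rule dual_restrict[OF M_module bilinear_formD(1)[OF B' u]])
  have W: "W \<in> carrier (dual R (L r))"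
    unfolding W_def by (rule dual_restrict[OF L_module bilinear_formD(1)[OF \<Lambda> u]])
  define D where "D x = restrict (\<lambda>y. \<beta> x y \<ominus> B x (\<psi> r y) \<ominus> \<Lambda> (dM 0 x) y) (carrier (L r))" for x
  have Dbil: "bilinear_form R (M (Suc 0)) (L r) (\<lambda>x y. \<beta> x y \<ominus> B x (\<psi> r y) \<ominus> \<Lambda> (dM 0 x) y)"
    by (intro bilinear_form_minus is_cring M_module L_module bil bilinear_form_comp[OF B module_hom_id \<psi>_hom]
        bilinear_form_comp[OF \<Lambda> dM_hom module_hom_id])
  have D: "D x \<in> dual_boundaries R L dL r" if "x \<in> carrier (M (Suc 0))" for x
    using diff that unfolding D_def form_boundary_iff[where F = L and d = dL, OF is_cring M_module L_module dL_hom M_basis Dbil] by blast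
  have eq: "\<phi> t = \<kappa> (\<tau> C) t \<oplus>\<^bsub>\<omega>\<^esub> a_map J \<omega> (\<pi> W) t" if t: "t \<in> J" for t
  proof -
    have tc: "t \<in> carrier R" by (rule Jc[OF t])
    have "t \<odot>\<^bsub>M 0\<^esub> ?u \<in> dM 0 ` carrier (M (Suc 0))" unfolding dM_image using t by blast
    then obtain x where x: "x \<in> carrier (M (Suc 0))" "dM 0 x = t \<odot>\<^bsub>M 0\<^esub> ?u" by auto
    have px: "p x = t" unfolding p_def x(2) by (rule c(3)[OF tc])
    define G where "G = restrict (B x) (carrier (M r))"
    have G: "G \<in> carrier (dual R (M r))"
      unfolding G_def by (rule dual_restrict[OF M_module bilinear_formD(1)[OF B x(1)]])
    define G' where "G' = dual_map (L r) (\<psi> r) G"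
    have G': "G' \<in> carrier (dual R (L r))" unfolding G'_def by (rule module_homD(1)[OF \<psi>_dual_hom G])
    have Dx: "D x \<in> carrier (dual R (L r))" using D[OF x(1)] DL.submoduleD(1)[OF submodule_boundaries_L] by blast
    have "\<beta> x = D x \<oplus>\<^bsub>dual R (L r)\<^esub> (G' \<oplus>\<^bsub>dual R (L r)\<^esub> t \<odot>\<^bsub>dual R (L r)\<^esub> W)"
    proof (rule hom_module_eqI[where R = R and N = "L r" and P = "reg_module R", folded dual_def])
      show "\<beta> x \<in> carrier (dual R (L r))" by (rule \<beta>c[OF x(1)])
      show "D x \<oplus>\<^bsub>dual R (L r)\<^esub> (G' \<oplus>\<^bsub>dual R (L r)\<^esub> t \<odot>\<^bsub>dual R (L r)\<^esub> W) \<in> carrier (dual R (L r))"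
        using Dx G' W tc by simp
      fix y assume y: "y \<in> carrier (L r)"
      have cl: "\<beta> x y \<in> carrier R" "B x (\<psi> r y) \<in> carrier R" "\<Lambda> ?u y \<in> carrier R"
        using bilinear_formD(3)[OF bil x(1) y] bilinear_formD(3)[OF B x(1) \<psi>_closed[OF y]]
          bilinear_formD(3)[OF \<Lambda> u y] by auto
      have "\<Lambda> (dM 0 x) y = t \<otimes> \<Lambda> ?u y"
        unfolding x(2) using module_homD(3)[OF bilinear_formD(2)[OF \<Lambda> y] tc u] by simp
      then have "(D x \<oplus>\<^bsub>dual R (L r)\<^esub> (G' \<oplus>\<^bsub>dual R (L r)\<^esub> t \<odot>\<^bsub>dual R (L r)\<^esub> W)) y =
          (\<beta> x y \<ominus> B x (\<psi> r y) \<ominus> t \<otimes> \<Lambda> ?u y) \<oplus> (B x (\<psi> r y) \<oplus> t \<otimes> \<Lambda> ?u y)"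
        using y \<psi>_closed[OF y] by (simp add: dual_simps D_def G'_def G_def W_def dual_map_def)
      also have "\<dots> = \<beta> x y" using cl tc by algebra
      finally show "\<beta> x y = (D x \<oplus>\<^bsub>dual R (L r)\<^esub> (G' \<oplus>\<^bsub>dual R (L r)\<^esub> t \<odot>\<^bsub>dual R (L r)\<^esub> W)) y" ..
    qed
    then have "\<pi> (\<beta> x) = \<pi> (D x) \<oplus>\<^bsub>\<omega>\<^esub> (\<pi> G' \<oplus>\<^bsub>\<omega>\<^esub> t \<odot>\<^bsub>\<omega>\<^esub> \<pi> W)"
      using Dx G' W tc by (simp add: module_homD(2,3)[OF \<pi>_hom])
    also have "\<pi> (D x) = \<zero>\<^bsub>\<omega>\<^esub>" using \<pi>_zero_iff[OF Dx] D[OF x(1)] by simp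
    finally have \<phi>t: "\<phi> t = \<pi> G' \<oplus>\<^bsub>\<omega>\<^esub> t \<odot>\<^bsub>\<omega>\<^esub> \<pi> W"
      using \<beta>(2)[OF x(1)] px module_homD(1)[OF \<pi>_hom] G' W tc by simp
    have "transposed G = t \<odot>\<^bsub>dual R (M (Suc r))\<^esub> C"
    proof -
      have "B x (dM r z) = t \<otimes> B' ?u z" if z: "z \<in> carrier (M (Suc r))" for z
        using BB'[OF x(1) z] module_homD(3)[OF bilinear_formD(2)[OF B' z] tc u] x(2) by simp
      then show ?thesis
        using dM_closed[of _ r] by (auto simp: dual_map_def dual_simps G_def C_def fun_eq_iff)
    qed
    then have "t \<odot>\<^bsub>std_free_module R l\<^esub> \<tau> C = \<tau> (transposed G)"
      using module_homD(3)[OF \<tau>_hom tc C] by simp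
    then have "\<kappa> (\<tau> C) t = \<pi> G'" using \<Psi>_eq[OF G] t by (simp add: \<kappa>_def G'_def)
    then show ?thesis using \<phi>t t by (simp add: a_map_def)
  qed
  have "\<phi> = \<kappa> (\<tau> C) \<oplus>\<^bsub>H\<^esub> a_map J \<omega> (\<pi> W)"
    unfolding H_simps
  proof
    fix t
    show "\<phi> t = (\<lambda>t\<in>J. \<kappa> (\<tau> C) t \<oplus>\<^bsub>\<omega>\<^esub> a_map J \<omega> (\<pi> W) t) t"
      using eq \<phi>'(2) by (cases "t \<in> J") (auto simp: extensional_def)
  qed
  then show ?thesis using module_homD(1)[OF \<tau>_hom C] module_homD(1)[OF \<pi>_hom W] by blast
qed

lemma generators:
  assumes A_def: "A = a_map J \<omega> ` carrier \<omega> \<union> k_map R J L dL M dM \<psi> r \<tau> l ` {..<l}"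
  shows "A \<subseteq> carrier H" "gen_submodule R H A = carrier H"
proof -
  show A: "A \<subseteq> carrier H"
    using a_map_closed k_map_eq module_homD(1)[OF \<kappa>_hom unit_vector_closed] by (auto simp: A_def)
  note G = H.submodule_gen_submodule[OF A]
  note G' = H.submoduleD[OF G(1)]
  show "gen_submodule R H A = carrier H"
  proof
    show "gen_submodule R H A \<subseteq> carrier H" by (rule G'(1))
    show "carrier H \<subseteq> gen_submodule R H A"
    proof
      fix \<phi> assume "\<phi> \<in> carrier H"
      then obtain w x where w: "w \<in> carrier (std_free_module R l)" and x: "x \<in> carrier \<omega>"
        and \<phi>: "\<phi> = \<kappa> w \<oplus>\<^bsub>H\<^esub> a_map J \<omega> x" using decomposition by blast
      have wi: "w i \<in> carrier R" if "i < l" for i using w that by (auto simp: std_free_simps)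
      have "\<kappa> w = \<kappa> (finsum (std_free_module R l) (\<lambda>i. w i \<odot>\<^bsub>std_free_module R l\<^esub> unit_vector R l i) {..<l})"
        using std_free_expand[OF w] by simp
      also have "\<dots> = finsum H (\<lambda>i. \<kappa> (w i \<odot>\<^bsub>std_free_module R l\<^esub> unit_vector R l i)) {..<l}"
        using wi unit_vector_closed
        by (intro module_hom_finsum[OF SF.module_axioms H.module_axioms \<kappa>_hom]) auto
      also have "\<dots> \<in> gen_submodule R H A"
      proof (rule H.finsum_in_submodule[OF G(1)])
        have "\<kappa> (w i \<odot>\<^bsub>std_free_module R l\<^esub> unit_vector R l i) \<in> gen_submodule R H A" if i: "i < l" for i
        proof -
          have "\<kappa> (unit_vector R l i) \<in> A" unfolding A_def k_map_eq[OF i, symmetric] using i by blast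
          then show ?thesis
            using module_homD(3)[OF \<kappa>_hom wi[OF i] unit_vector_closed] G(2) G'(5)[OF wi[OF i]] by auto
        qed
        then show "(\<lambda>i. \<kappa> (w i \<odot>\<^bsub>std_free_module R l\<^esub> unit_vector R l i)) \<in> {..<l} \<rightarrow> gen_submodule R H A"
          by auto
      qed simp
      finally have "\<kappa> w \<in> gen_submodule R H A" .
      moreover have "a_map J \<omega> x \<in> gen_submodule R H A" using x G(2) by (auto simp: A_def)
      ultimately show "\<phi> \<in> gen_submodule R H A" unfolding \<phi> by (rule G'(3))
    qed
  qed
qed

end

theorem theorem3p2:
  fixes S :: "('a, 'm) ring_scheme"
    and I J :: "'a set"
    and r l :: nat
    and L :: "nat \<Rightarrow> ('a, 'b) module" and dL :: "nat \<Rightarrow> 'b \<Rightarrow> 'b" and \<epsilon>L :: "'b \<Rightarrow> 'a set"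
    and M :: "nat \<Rightarrow> ('a, 'c) module" and dM :: "nat \<Rightarrow> 'c \<Rightarrow> 'c" and \<epsilon>M :: "'c \<Rightarrow> 'a set"
    and \<psi> :: "nat \<Rightarrow> 'b \<Rightarrow> 'c"
    and \<tau> :: "('c \<Rightarrow> 'a) \<Rightarrow> (nat \<Rightarrow> 'a)"
  assumes "gorenstein_local_ring TYPE('e) S"
    and "perfect_ideal S I" and "perfect_ideal S J" and "I \<subseteq> J"
    and "codim S I = enat r" and "codim S J = enat (r + 1)"
    and "minimal_free_resolution S L dL \<epsilon>L (quot_module (reg_module S) I)"
    and "minimal_free_resolution S M dM \<epsilon>M (quot_module (reg_module S) J)"
    and "chain_map_over S L dL \<epsilon>L M dM \<epsilon>M (quot_proj S J) \<psi>"
    and "free_of_rank S (M (r + 1)) l"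
    and "\<tau> \<in> module_iso S (dual S (M (r + 1))) (std_free_module S l)"
  shows "let \<omega> = omega S L dL r;
             H = hom_module S (ideal_module S J) \<omega>;
             k = k_map S J L dL M dM \<psi> r \<tau> l;
             A = a_map J \<omega> ` carrier \<omega> \<union> k ` {..<l}
         in A \<subseteq> carrier H \<and> gen_submodule S H A = carrier H"
proof -
  have loc: "noetherian_local_ring S" using assms(1) by (simp add: gorenstein_local_ring_def)
  then have cr: "cring S" by (simp add: noetherian_local_ring_def)
  interpret cring S by fact
  interpret Sm: plain_module S "reg_module S" by (rule plain_module.intro[OF reg_module_module])
  have I: "ideal I S" "I \<noteq> carrier S" and J: "ideal J S" "J \<noteq> carrier S"
    using assms(2,3) by (auto simp: perfect_ideal_def)
  note Ji = idealD[OF J(1)]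
  have Js: "submodule J S (reg_module S)" by (rule submodule_ideal[OF J(1)])
  note L = left_resolutionD[OF minimal_free_resolutionD(1)[OF assms(7)]]
  note M = left_resolutionD[OF minimal_free_resolutionD(1)[OF assms(8)]]
  note Mb = minimal_free_resolution_dual_basis[OF cr assms(8)]
  have \<psi>: "\<psi> i \<in> module_hom S (L i) (M i)" "x \<in> carrier (L (Suc i)) \<Longrightarrow> \<psi> i (dL i x) = dM i (\<psi> (Suc i) x)"
    "y \<in> carrier (L 0) \<Longrightarrow> \<epsilon>M (\<psi> 0 y) = quot_proj S J (\<epsilon>L y)" for i x y
    using assms(9) by (auto simp: chain_map_over_def)
  \<comment> \<open>A preimage of 1 under \<epsilon>L; its image under \<open>\<psi> 0\<close> lies
    over 1 in S/J and is a basis of M_0 by minimality.\<close>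
  have "I +>\<^bsub>reg_module S\<^esub> \<one>\<^bsub>S\<^esub> \<in> \<epsilon>L ` carrier (L 0)" unfolding L(4) by (simp add: Sm.quot_module_carrier)
  then obtain v where v: "v \<in> carrier (L 0)" "\<epsilon>L v = I +>\<^bsub>reg_module S\<^esub> \<one>\<^bsub>S\<^esub>" by auto
  have u: "\<psi> 0 v \<in> carrier (M 0)" by (rule module_homD(1)[OF \<psi>(1) v(1)])
  have reg: "J +>\<^bsub>S\<^esub> x = J +>\<^bsub>reg_module S\<^esub> x" for x by (simp add: a_r_coset_def')
  have \<epsilon>u: "\<epsilon>M (\<psi> 0 v) = J +>\<^bsub>reg_module S\<^esub> \<one>\<^bsub>S\<^esub>"
  proof -
    have "J +>\<^bsub>S\<^esub> (k \<oplus>\<^bsub>S\<^esub> \<one>\<^bsub>S\<^esub>) = J +>\<^bsub>reg_module S\<^esub> \<one>\<^bsub>S\<^esub>" if k: "k \<in> I" for k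
    proof -
      have kc: "k \<in> carrier S" "k \<in> J" using k assms(4) Ji(1) by auto
      have "(k \<oplus>\<^bsub>S\<^esub> \<one>\<^bsub>S\<^esub>) \<ominus>\<^bsub>S\<^esub> \<one>\<^bsub>S\<^esub> = k" using kc by (simp add: a_minus_def a_assoc r_neg)
      then show ?thesis using Sm.coset_eq_iff[OF Js, of "k \<oplus>\<^bsub>S\<^esub> \<one>\<^bsub>S\<^esub>" "\<one>\<^bsub>S\<^esub>"] kc by (simp add: reg)
    qed
    then show ?thesis
      using \<psi>(3)[OF v(1)] v(2) idealD(2)[OF I(1)] by (auto simp: quot_proj_def Sm.coset_eq[of I])
  qed
  note gen = minimal_free_resolution_generator[OF loc J assms(8) u \<epsilon>u]
  have \<epsilon>J: "\<epsilon>M (t \<odot>\<^bsub>M 0\<^esub> \<psi> 0 v) = \<zero>\<^bsub>quot_module (reg_module S) J\<^esub> \<longleftrightarrow> t \<in> J" if "t \<in> carrier S" for t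
    using module_homD(3)[OF M(3) that u] \<epsilon>u Sm.quot_module_smult[OF Js, of "\<one>\<^bsub>S\<^esub>" t]
      Sm.coset_zero_iff[OF Js, of t] that by simp
  interpret M0: plain_module S "M 0" by (rule plain_module.intro[OF M(1)])
  have image: "dM 0 ` carrier (M (Suc 0)) = (\<lambda>t. t \<odot>\<^bsub>M 0\<^esub> \<psi> 0 v) ` J"
  proof -
    have "{x \<in> carrier (M 0). \<epsilon>M x = \<zero>\<^bsub>quot_module (reg_module S) J\<^esub>} = (\<lambda>t. t \<odot>\<^bsub>M 0\<^esub> \<psi> 0 v) ` J"
    proof (intro equalityI subsetI)
      fix x assume x: "x \<in> {x \<in> carrier (M 0). \<epsilon>M x = \<zero>\<^bsub>quot_module (reg_module S) J\<^esub>}"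
      then obtain t where "t \<in> carrier S" "x = t \<odot>\<^bsub>M 0\<^esub> \<psi> 0 v" using gen(1) by blast
      then show "x \<in> (\<lambda>t. t \<odot>\<^bsub>M 0\<^esub> \<psi> 0 v) ` J" using x \<epsilon>J by auto
    next
      fix x assume "x \<in> (\<lambda>t. t \<odot>\<^bsub>M 0\<^esub> \<psi> 0 v) ` J"
      then obtain t where t: "t \<in> J" "x = t \<odot>\<^bsub>M 0\<^esub> \<psi> 0 v" by blast
      have "t \<in> carrier S" using t(1) Ji(1) by blast
      then show "x \<in> {x \<in> carrier (M 0). \<epsilon>M x = \<zero>\<^bsub>quot_module (reg_module S) J\<^esub>}"
        using \<epsilon>J t u by simp
    qed
    then show ?thesis using M(5) by simp
  qed
  note exact_L = perfect_resolution(1)[OF assms(1,2,5,7)]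
  note exact_M = perfect_resolution(1)[OF assms(1,3,6,8)]
  have len: "carrier (M (Suc (Suc r))) = {\<zero>\<^bsub>M (Suc (Suc r))\<^esub>}"
    by (rule perfect_resolution(2)[OF assms(1,3,6,8)]) simp
  have homotopy: "\<exists>s\<in>module_hom S (M r) (M (Suc r)). \<forall>x\<in>carrier (M (Suc r)). t \<odot>\<^bsub>M (Suc r)\<^esub> x = s (dM r x)"
    if t: "t \<in> J" for t
  proof -
    interpret Mr: plain_module S "M (Suc r)" by (rule plain_module.intro[OF M(1)])
    have tc: "t \<in> carrier S" using t Ji(1) by blast
    obtain s where s: "\<And>i. s i \<in> module_hom S (M i) (M (Suc i))"
      "\<And>i x. x \<in> carrier (M (Suc i)) \<Longrightarrow>
         t \<odot>\<^bsub>M (Suc i)\<^esub> x = dM (Suc i) (s (Suc i) x) \<oplus>\<^bsub>M (Suc i)\<^esub> s i (dM i x)"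
      using ideal_homotopy[OF cr J(1) minimal_free_resolutionD(1)[OF assms(8)] Mb t] by blast
    have "t \<odot>\<^bsub>M (Suc r)\<^esub> x = s r (dM r x)" if x: "x \<in> carrier (M (Suc r))" for x
    proof -
      \<comment> \<open>M_(r+2) is zero, so of the two terms of the homotopy in degree r + 1 only
        the one factoring through \<open>dM r\<close> remains.\<close>
      have "s (Suc r) x = \<zero>\<^bsub>M (Suc (Suc r))\<^esub>" using module_homD(1)[OF s(1) x] len by simp
      then have "dM (Suc r) (s (Suc r) x) = \<zero>\<^bsub>M (Suc r)\<^esub>" using module_hom_zero[OF M(1) M(1) M(2)] by simp
      then show ?thesis
        using s(2)[OF x] module_homD(1)[OF s(1) module_homD(1)[OF M(2) x]] by simp
    qed
    then show ?thesis using s(1) by blast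
  qed
  note Lb = minimal_free_resolution_dual_basis[OF cr assms(7)]
  note L_gen = minimal_free_resolution_generator(1)[OF loc I assms(7) v]
  \<comment> \<open>The codimension of \<open>J\<close> is r + 1, so exactness of the dual of M
    reaches degree r.\<close>
  have exact_M': "dual_exact_at S M dM {\<zero>\<^bsub>S\<^esub>} i" if "i \<le> r" for i
    using exact_M that by simp
  have \<tau>: "\<tau> \<in> module_iso S (dual S (M (Suc r))) (std_free_module S l)" using assms(11) by simp
  interpret link: linked_resolutions_dual S J L dL M dM \<psi> r v l \<tau>
    by (intro linked_resolutions_dual.intro linked_resolutions.intro linked_resolutions_axioms.intro
        linked_resolutions_dual_axioms.intro)
      (rule cr J(1) L(1) M(1) L(2) M(2) L(8) M(8) Lb Mb \<psi>(1,2) exact_L exact_M' len v(1) L_gen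
        gen(1) image homotopy \<tau> gen(2); assumption)+
  show ?thesis
    unfolding Let_def using link.generators[OF refl] by (simp add: link.\<omega>_def link.H_def)
qed

end
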